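(* Let $x_t$ be a $K$-invariant Markov process in a smooth manifold $X$ under the smooth action of a Lie group $K$, let $Y$ be a submanifold of $X$ transversal to $K$ such that the isotropy subgroup of $K$ at every $y\in Y^\circ$ is the same compact subgroup $M$ of $K$, and $X^\circ=Y^\circ\times(K/M)$ as a product manifold. Let $x_t=z_ty_t$, $t<\zeta$, be the decomposition into radial part $y_t$ in $Y^\circ$ and angular part $z_t$ in $K/M$, where $\zeta$ is the exit time from $X^\circ$. Fix $T>0$. Then, almost surely on $[\zeta>T]$, given a radial path $y_t$ for $0\le t\le T$, the conditioned angular process $z_t$ is a nonhomogeneous Lévy process in $K/M$. More precisely: for every $y\in Y^\circ$ and $z\in K/M$, and for $JP_y$-almost all $y(\cdot)$ in $[\zeta>T]\subset D_T(Y^\circ)$, the angular process $z_t$, $0\le t\le T$, is a nonhomogeneous Lévy process in $K/M$ under the conditional distribution $R_z^{y(\cdot)}$.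
   Context: Markov processes. A Markov process $x_t$ in $X$ with transition semigroup $P_t$ is a process with rcll paths (right continuous with left limits), possibly with finite life time $\xi$, such that $E[f(x_{t+s})\mid\mathcal F_t]=P_sf(x_t)$ a.s. for $s,t\ge0$, $f\in C_b(X)$ ($f$ taken to be $0$ after the life time), where $\mathcal F_t$ is its natural filtration and the $P_t$ are sub-probability kernels from $X$ to $X$ with $P_0(x,\cdot)=\delta_x$, $P_{t+s}(x,\cdot)=\int P_t(x,dy)P_s(y,\cdot)$. It is $K$-invariant if $P_t(f\circ k)=(P_tf)\circ k$ for all $f\in C_b(X)$, $k\in K$. Transversality. $Y$ is a submanifold of $X$, possibly with boundary, with $(Ky)\cap Y=\{y\}$ for $y\in Y$ and $X=\bigcup_{y\in Y}Ky$. $Y^\circ$ is $Y$ minus its boundary, and $X^\circ$ is the union of the $K$-orbits meeting $Y^\circ$, an open dense subset of $X$. $J:X\to Y$ is $J(x)=y$ for $x\in Ky$. Under $X^\circ=Y^\circ\times(K/M)$, the pair $(y,z)$ corresponds to $x=zy:=S(z)y$, where $S:K/M\to K$ is any section map (measurable with $\pi\circ S=\mathrm{id}_{K/M}$, $\pi:K\to K/M$ the natural projection); this does not depend on $S$. $J_2:X^\circ\to K/M$ is $J_2(zy)=z$. Exit time. $\zeta=\inf\{t>0:\ x_t\notin X^\circ,\ x_{t-}\notin X^\circ\text{ or }t\ge\xi\}$, $\inf\emptyset=\infty$. For $t<\zeta$ and $x_0\in X^\circ$, $y_t=J(x_t)$ and $z_t=J_2(x_t)$. The exit time of $y_t$ from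 $Y^\circ$ is also denoted $\zeta$. Path spaces. $D_T(E)$ is the space of rcll maps $[0,T]\to E$ with the Skorohod topology. $P_x$ is the distribution on $D_T(X)$ of the process started at $x$ (a sub-probability measure, due to the possibly finite life time). $J$ and $J_2$ also denote the induced maps $x(\cdot)\mapsto y(\cdot)$ and $x(\cdot)\mapsto z(\cdot)$ on paths, with $x(\cdot)=z(\cdot)y(\cdot)$. $JP_y$ is the image of $P_y$ under $J$. Conditional distribution. $\mathcal F^Y_{0,T}=\sigma\{y_t:0\le t\le T\}$. $R_z^{y(\cdot)}$ is a probability kernel from $D_T(Y^\circ)\times(K/M)$ to $D_T(K/M)$ (a regular conditional distribution) such that for all $x\in X^\circ$ and measurable $F\subset D_T(K/M)$, $$R_{J_2(x)}^{J[x(\cdot)]}(F)=P_x[J_2^{-1}(F)\mid J^{-1}(\mathcal F^Y_{0,T})]\quad\text{for }P_x\text{-almost all }x(\cdot)\text{ in }[\zeta>T]\subset D_T(X^\circ).$$ So $R_z^{y(\cdot)}$ is the conditional law of the angular process given the radial path $y(\cdot)$ and $z_0=z$. Nonhomogeneous Lévy processes in $K/M$. Let $o=eM$. For $M$-invariant finite measures on $K/M$, $\mu*\nu(f)=\int f(S(x)y)\mu(dx)\nu(dy)$ (independent of $S$). A continuous two-parameter convolution semigroup is a family $\mu_{s,t}$, $s\le t$, of $M$-invariant probability measures on $K/M$ with $\mu_{s,t}*\mu_{t,u}=\mu_{s,u}$ for $s<t<u$, $\mu_{t,t}=\delta_o$, and $\mu_{s,t}\to\mu_{s,s}$ weakly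 as $t\downarrow s$. A rcll process $z_t$ in $K/M$ (here on the time interval $[0,T]$) is a nonhomogeneous Lévy process if for such a family, for all $0<t_1<\cdots<t_n\,(\le T)$ and $f\in C_b((K/M)^{n+1})$, $$E[f(z_0,z_{t_1},\ldots,z_{t_n})]=\int f(w_0,w_0w_1,\ldots,w_0w_1\cdots w_n)\mu_0(dw_0)\mu_{0,t_1}(dw_1)\cdots\mu_{t_{n-1},t_n}(dw_n),$$ where $\mu_0$ is the law of $z_0$ and $w_0w_1\cdots w_i:=S(w_0)\cdots S(w_{i-1})w_i$ (the integral does not depend on $S$). *)

theory Defs
  imports
    "HOL-Probability.Probability"
    "HOL-Algebra.Group_Action"
    "HOL-Algebra.Left_Coset"
begin

section \<open>Smooth manifolds\<close>

text \<open>Euclidean $n$-space is \<^term>\<open>Euclidean_space n\<close>, i.e. the functions \<^typ>\<open>nat \<Rightarrow> real\<close>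
  vanishing at all indices \<open>\<ge> n\<close>; dimensions are ordinary natural numbers, \<open>0\<close> included.\<close>

primrec Ck_on :: "nat \<Rightarrow> nat \<Rightarrow> (nat \<Rightarrow> real) set \<Rightarrow> ((nat \<Rightarrow> real) \<Rightarrow> real) \<Rightarrow> bool" where
  "Ck_on n 0 U f \<longleftrightarrow> continuous_map (subtopology (Euclidean_space n) U) euclideanreal f"
| "Ck_on n (Suc k) U f \<longleftrightarrow>
     continuous_map (subtopology (Euclidean_space n) U) euclideanreal f \<and>
     (\<forall>i<n. \<exists>g. (\<forall>x\<in>U. ((\<lambda>s. f (x(i := s))) has_real_derivative g x) (at (x i))) \<and> Ck_on n k U g)"

text \<open>Only used for sets \<open>U\<close> that are open in \<^term>\<open>Euclidean_space n\<close>.\<close>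

definition smooth_on :: "nat \<Rightarrow> nat \<Rightarrow> (nat \<Rightarrow> real) set \<Rightarrow> ((nat \<Rightarrow> real) \<Rightarrow> nat \<Rightarrow> real) \<Rightarrow> bool" where
  "smooth_on n m U F \<longleftrightarrow>
     F ` U \<subseteq> topspace (Euclidean_space m) \<and> (\<forall>j<m. \<forall>k. Ck_on n k U (\<lambda>x. F x j))"

type_synonym 'a chart = "'a set \<times> ('a \<Rightarrow> nat \<Rightarrow> real)"

record 'a manifold =
  top_of :: "'a topology"
  dim_of :: nat
  charts_of :: "'a chart set"

definition is_chart :: "'a topology \<Rightarrow> nat \<Rightarrow> 'a chart \<Rightarrow> bool" where
  "is_chart T n c \<longleftrightarrow> (case c of (U, \<phi>) \<Rightarrow>
     openin T U \<and> openin (Euclidean_space n) (\<phi> ` U) \<and>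
     homeomorphic_map (subtopology T U) (subtopology (Euclidean_space n) (\<phi> ` U)) \<phi>)"

definition compatible_charts :: "nat \<Rightarrow> 'a chart \<Rightarrow> 'a chart \<Rightarrow> bool" where
  "compatible_charts n c d \<longleftrightarrow> (case (c, d) of ((U, \<phi>), (V, \<psi>)) \<Rightarrow>
     smooth_on n n (\<phi> ` (U \<inter> V)) (\<psi> \<circ> inv_into U \<phi>) \<and>
     smooth_on n n (\<psi> ` (U \<inter> V)) (\<phi> \<circ> inv_into V \<psi>))"

definition smooth_manifold :: "'a manifold \<Rightarrow> bool" where
  "smooth_manifold X \<longleftrightarrow>
     Hausdorff_space (top_of X) \<and> second_countable (top_of X) \<and>
     (\<forall>c\<in>charts_of X. is_chart (top_of X) (dim_of X) c) \<and>
     (\<Union>(U, \<phi>)\<in>charts_of X. U) = topspace (top_of X) \<and>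
     (\<forall>c\<in>charts_of X. \<forall>d\<in>charts_of X. compatible_charts (dim_of X) c d)"

text \<open>The charts of the maximal atlas.\<close>

definition smooth_chart :: "'a manifold \<Rightarrow> 'a chart \<Rightarrow> bool" where
  "smooth_chart X c \<longleftrightarrow>
     is_chart (top_of X) (dim_of X) c \<and> (\<forall>d\<in>charts_of X. compatible_charts (dim_of X) c d)"

definition smooth_map :: "'a manifold \<Rightarrow> 'b manifold \<Rightarrow> ('a \<Rightarrow> 'b) \<Rightarrow> bool" where
  "smooth_map X Y f \<longleftrightarrow>
     continuous_map (top_of X) (top_of Y) f \<and>
     (\<forall>(U, \<phi>)\<in>charts_of X. \<forall>(V, \<psi>)\<in>charts_of Y.
        smooth_on (dim_of X) (dim_of Y) (\<phi> ` (U \<inter> f -` V)) (\<psi> \<circ> f \<circ> inv_into U \<phi>))"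

definition diffeomorphism :: "'a manifold \<Rightarrow> 'b manifold \<Rightarrow> ('a \<Rightarrow> 'b) \<Rightarrow> bool" where
  "diffeomorphism X Y f \<longleftrightarrow>
     bij_betw f (topspace (top_of X)) (topspace (top_of Y)) \<and>
     smooth_map X Y f \<and> smooth_map Y X (inv_into (topspace (top_of X)) f)"

definition prod_manifold :: "'a manifold \<Rightarrow> 'b manifold \<Rightarrow> ('a \<times> 'b) manifold" where
  "prod_manifold X Y =
     \<lparr> top_of = prod_topology (top_of X) (top_of Y),
       dim_of = dim_of X + dim_of Y,
       charts_of = {(U \<times> V, \<lambda>(x, y) i. if i < dim_of X then \<phi> x i else \<psi> y (i - dim_of X)) | U \<phi> V \<psi>.
                      (U, \<phi>) \<in> charts_of X \<and> (V, \<psi>) \<in> charts_of Y} \<rparr>"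

definition open_submanifold :: "'a manifold \<Rightarrow> 'a set \<Rightarrow> 'a manifold" where
  "open_submanifold X W =
     \<lparr> top_of = subtopology (top_of X) W,
       dim_of = dim_of X,
       charts_of = {(U \<inter> W, \<phi>) | U \<phi>. (U, \<phi>) \<in> charts_of X} \<rparr>"

text \<open>Embedded submanifolds of dimension \<open>m\<close>, possibly with boundary, of a manifold (without
  boundary), through slice charts and half-slice charts. A boundary point is a point lying on the
  face of some half-slice chart.\<close>

definition slice_chart :: "'a manifold \<Rightarrow> 'a set \<Rightarrow> nat \<Rightarrow> 'a chart \<Rightarrow> bool" where
  "slice_chart X Y m c \<longleftrightarrow> smooth_chart X c \<and> (case c of (U, \<phi>) \<Rightarrow>
     \<phi> ` (U \<inter> Y) = {x \<in> \<phi> ` U. \<forall>i\<ge>m. x i = 0})"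

definition half_slice_chart :: "'a manifold \<Rightarrow> 'a set \<Rightarrow> nat \<Rightarrow> 'a chart \<Rightarrow> bool" where
  "half_slice_chart X Y m c \<longleftrightarrow> 1 \<le> m \<and> smooth_chart X c \<and> (case c of (U, \<phi>) \<Rightarrow>
     \<phi> ` (U \<inter> Y) = {x \<in> \<phi> ` U. (\<forall>i\<ge>m. x i = 0) \<and> 0 \<le> x 0})"

definition submanifold_with_boundary :: "'a manifold \<Rightarrow> 'a set \<Rightarrow> nat \<Rightarrow> bool" where
  "submanifold_with_boundary X Y m \<longleftrightarrow>
     m \<le> dim_of X \<and> Y \<subseteq> topspace (top_of X) \<and>
     (\<forall>y\<in>Y. \<exists>U \<phi>. y \<in> U \<and> (slice_chart X Y m (U, \<phi>) \<or> half_slice_chart X Y m (U, \<phi>)))"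

definition submanifold_boundary :: "'a manifold \<Rightarrow> 'a set \<Rightarrow> nat \<Rightarrow> 'a set" where
  "submanifold_boundary X Y m =
     {y \<in> Y. \<exists>U \<phi>. half_slice_chart X Y m (U, \<phi>) \<and> y \<in> U \<and> \<phi> y 0 = 0}"

definition submanifold_interior :: "'a manifold \<Rightarrow> 'a set \<Rightarrow> nat \<Rightarrow> 'a set" where
  "submanifold_interior X Y m = Y - submanifold_boundary X Y m"

definition interior_manifold :: "'a manifold \<Rightarrow> 'a set \<Rightarrow> nat \<Rightarrow> 'a manifold" where
  "interior_manifold X Y m =
     \<lparr> top_of = subtopology (top_of X) (submanifold_interior X Y m),
       dim_of = m,
       charts_of = {(U \<inter> submanifold_interior X Y m, \<phi>) | U \<phi>. slice_chart X Y m (U, \<phi>)} \<rparr>"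


section \<open>Lie groups, actions and homogeneous spaces\<close>

text \<open>Throughout, \<open>K\<close> is the group and \<open>L\<close> its manifold structure.\<close>

definition lie_group :: "('k, 'b) monoid_scheme \<Rightarrow> 'k manifold \<Rightarrow> bool" where
  "lie_group K L \<longleftrightarrow>
     group K \<and> smooth_manifold L \<and> topspace (top_of L) = carrier K \<and>
     smooth_map (prod_manifold L L) L (\<lambda>(a, b). a \<otimes>\<^bsub>K\<^esub> b) \<and>
     smooth_map L L (\<lambda>a. inv\<^bsub>K\<^esub> a)"

definition smooth_action ::
  "('k, 'b) monoid_scheme \<Rightarrow> 'k manifold \<Rightarrow> 'x manifold \<Rightarrow> ('k \<Rightarrow> 'x \<Rightarrow> 'x) \<Rightarrow> bool" where
  "smooth_action K L X \<alpha> \<longleftrightarrow>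
     group_action K (topspace (top_of X)) \<alpha> \<and>
     smooth_map (prod_manifold L X) X (\<lambda>(k, x). \<alpha> k x)"

definition transversal ::
  "('k, 'b) monoid_scheme \<Rightarrow> ('k \<Rightarrow> 'x \<Rightarrow> 'x) \<Rightarrow> 'x manifold \<Rightarrow> 'x set \<Rightarrow> bool" where
  "transversal K \<alpha> X Y \<longleftrightarrow>
     (\<forall>y\<in>Y. orbit K \<alpha> y \<inter> Y = {y}) \<and> topspace (top_of X) = (\<Union>y\<in>Y. orbit K \<alpha> y)"

definition coset_topology :: "('k, 'b) monoid_scheme \<Rightarrow> 'k topology \<Rightarrow> 'k set \<Rightarrow> 'k set topology" where
  "coset_topology K T M =
     topology (\<lambda>W. W \<subseteq> lcosets\<^bsub>K\<^esub> M \<and> openin T {k \<in> topspace T. k <#\<^bsub>K\<^esub> M \<in> W})"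

lemma openin_coset_topology:
  "openin (coset_topology K T M) W \<longleftrightarrow>
     W \<subseteq> lcosets\<^bsub>K\<^esub> M \<and> openin T {k \<in> topspace T. k <#\<^bsub>K\<^esub> M \<in> W}"
proof -
  let ?pre = "\<lambda>W. {k \<in> topspace T. k <#\<^bsub>K\<^esub> M \<in> W}"
  have "istopology (\<lambda>W. W \<subseteq> lcosets\<^bsub>K\<^esub> M \<and> openin T (?pre W))"
    unfolding istopology_def
  proof (intro conjI allI impI)
    fix V W
    assume "V \<subseteq> lcosets\<^bsub>K\<^esub> M \<and> openin T (?pre V)" "W \<subseteq> lcosets\<^bsub>K\<^esub> M \<and> openin T (?pre W)"
    moreover have "?pre (V \<inter> W) = ?pre V \<inter> ?pre W" by auto
    ultimately show "V \<inter> W \<subseteq> lcosets\<^bsub>K\<^esub> M" "openin T (?pre (V \<inter> W))" by auto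
  next
    fix \<W> :: "'a set set set"
    assume *: "\<forall>W\<in>\<W>. W \<subseteq> lcosets\<^bsub>K\<^esub> M \<and> openin T (?pre W)"
    have "?pre (\<Union>\<W>) = (\<Union>W\<in>\<W>. ?pre W)" by auto
    with * show "\<Union>\<W> \<subseteq> lcosets\<^bsub>K\<^esub> M" "openin T (?pre (\<Union>\<W>))" by auto
  qed
  then show ?thesis
    unfolding coset_topology_def by (simp add: topology_inverse')
qed

text \<open>\<open>Q\<close> is the manifold \<open>K/M\<close>: the smooth structure on the coset space for which the projection
  is smooth and admits smooth local sections. It is uniquely determined, as a maximal atlas, by
  these properties.\<close>

definition homogeneous_manifold ::
  "('k, 'b) monoid_scheme \<Rightarrow> 'k manifold \<Rightarrow> 'k set \<Rightarrow> 'k set manifold \<Rightarrow> bool" where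
  "homogeneous_manifold K L M Q \<longleftrightarrow>
     smooth_manifold Q \<and> top_of Q = coset_topology K (top_of L) M \<and>
     smooth_map L Q (\<lambda>k. k <#\<^bsub>K\<^esub> M) \<and>
     (\<forall>z\<in>lcosets\<^bsub>K\<^esub> M. \<exists>W \<sigma>. openin (top_of Q) W \<and> z \<in> W \<and>
        smooth_map (open_submanifold Q W) L \<sigma> \<and> (\<forall>w\<in>W. \<sigma> w <#\<^bsub>K\<^esub> M = w))"

definition borel_of :: "'a topology \<Rightarrow> 'a measure" where
  "borel_of T = sigma (topspace T) {U. openin T U}"

definition coset_section ::
  "('k, 'b) monoid_scheme \<Rightarrow> 'k manifold \<Rightarrow> 'k set \<Rightarrow> 'k set manifold \<Rightarrow> ('k set \<Rightarrow> 'k) \<Rightarrow> bool" where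
  "coset_section K L M Q S \<longleftrightarrow>
     S \<in> borel_of (top_of Q) \<rightarrow>\<^sub>M borel_of (top_of L) \<and> (\<forall>z\<in>lcosets\<^bsub>K\<^esub> M. S z <#\<^bsub>K\<^esub> M = z)"

definition radial_part :: "('k, 'b) monoid_scheme \<Rightarrow> ('k \<Rightarrow> 'x \<Rightarrow> 'x) \<Rightarrow> 'x set \<Rightarrow> 'x \<Rightarrow> 'x" where
  "radial_part K \<alpha> Y x = (THE y. y \<in> Y \<and> x \<in> orbit K \<alpha> y)"

text \<open>To be used with the interior \<open>Yo\<close> of the transversal and \<open>x\<close> in \<open>K Yo\<close>.\<close>

definition angular_part ::
  "('k, 'b) monoid_scheme \<Rightarrow> ('k \<Rightarrow> 'x \<Rightarrow> 'x) \<Rightarrow> 'x set \<Rightarrow> 'k set \<Rightarrow> ('k set \<Rightarrow> 'k) \<Rightarrow> 'x \<Rightarrow> 'k set" where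
  "angular_part K \<alpha> Yo M S x = (THE z. z \<in> lcosets\<^bsub>K\<^esub> M \<and> (\<exists>y\<in>Yo. x = \<alpha> (S z) y))"


section \<open>Path spaces\<close>

definition Cb :: "'a topology \<Rightarrow> ('a \<Rightarrow> real) set" where
  "Cb E = {f. continuous_map E euclideanreal f \<and> bounded (f ` topspace E)}"

definition rcll_paths :: "real \<Rightarrow> 'a topology \<Rightarrow> (real \<Rightarrow> 'a) set" where
  "rcll_paths T E = {w \<in> {0..T} \<rightarrow>\<^sub>E topspace E.
     (\<forall>t\<in>{0..<T}. limitin E w (w t) (at_right t)) \<and>
     (\<forall>t\<in>{0<..T}. \<exists>l. limitin E w l (at_left t))}"

definition compatible_metric :: "'a topology \<Rightarrow> 'a \<Rightarrow> 'a \<Rightarrow> real" where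
  "compatible_metric E =
     (SOME d. Metric_space (topspace E) d \<and> Metric_space.mtopology (topspace E) d = E)"

text \<open>The Skorohod (J1) metric on paths in a metrizable \<open>E\<close>. Since an rcll path on a compact interval
  has relatively compact range, the induced topology does not depend on which metric of \<open>E\<close> is
  used. The value \<open>0\<close> off the path space only serves to make this a total nonnegative function.\<close>

definition skorohod_dist :: "real \<Rightarrow> 'a topology \<Rightarrow> (real \<Rightarrow> 'a) \<Rightarrow> (real \<Rightarrow> 'a) \<Rightarrow> real" where
  "skorohod_dist T E v w = (if v \<in> rcll_paths T E \<and> w \<in> rcll_paths T E then
     Inf {r. 0 \<le> r \<and>
       (\<exists>\<tau>. strict_mono_on {0..T} \<tau> \<and> \<tau> ` {0..T} = {0..T} \<and>
          (\<forall>t\<in>{0..T}. \<bar>\<tau> t - t\<bar> \<le> r \<and> compatible_metric E (v t) (w (\<tau> t)) \<le> r))}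
     else 0)"

definition skorohod_topology :: "real \<Rightarrow> 'a topology \<Rightarrow> (real \<Rightarrow> 'a) topology" where
  "skorohod_topology T E = Metric_space.mtopology (rcll_paths T E) (skorohod_dist T E)"

definition path_borel :: "real \<Rightarrow> 'a topology \<Rightarrow> (real \<Rightarrow> 'a) measure" where
  "path_borel T E = borel_of (skorohod_topology T E)"

definition path_map :: "real \<Rightarrow> ('a \<Rightarrow> 'b) \<Rightarrow> (real \<Rightarrow> 'a) \<Rightarrow> real \<Rightarrow> 'b" where
  "path_map T f w = (\<lambda>t\<in>{0..T}. f (w t))"

definition coordinate_algebra :: "real \<Rightarrow> 'a topology \<Rightarrow> (real \<Rightarrow> 'a) measure" where
  "coordinate_algebra T E = sigma (rcll_paths T E)
     {{w \<in> rcll_paths T E. w t \<in> B} | t B. t \<in> {0..T} \<and> B \<in> sets (borel_of E)}"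


section \<open>Markov processes\<close>

definition transition_semigroup :: "'x topology \<Rightarrow> (real \<Rightarrow> 'x \<Rightarrow> 'x measure) \<Rightarrow> bool" where
  "transition_semigroup E P \<longleftrightarrow>
     (\<forall>t\<ge>0. P t \<in> borel_of E \<rightarrow>\<^sub>M subprob_algebra (borel_of E)) \<and>
     (\<forall>x\<in>topspace E. P 0 x = return (borel_of E) x) \<and>
     (\<forall>t\<ge>0. \<forall>s\<ge>0. \<forall>x\<in>topspace E. P (t + s) x = P t x \<bind> P s)"

text \<open>A process \<open>p\<close> with life time \<open>\<xi>\<close>: the value \<open>p t \<omega>\<close> is meaningful only for \<open>t < \<xi> \<omega>\<close>. The
  event \<open>t < \<xi>\<close> itself belongs to the natural filtration at time \<open>t\<close>. No left limit is required at
  the life time.\<close>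

definition natural_filtration ::
  "'x topology \<Rightarrow> 'w measure \<Rightarrow> (real \<Rightarrow> 'w \<Rightarrow> 'x) \<Rightarrow> ('w \<Rightarrow> ereal) \<Rightarrow> real \<Rightarrow> 'w measure" where
  "natural_filtration E N p \<xi> t = sigma (space N)
     {{\<omega> \<in> space N. ereal u < \<xi> \<omega> \<and> p u \<omega> \<in> B} | u B. u \<in> {0..t} \<and> B \<in> sets (borel_of E)}"

definition rcll_process ::
  "'x topology \<Rightarrow> 'w measure \<Rightarrow> (real \<Rightarrow> 'w \<Rightarrow> 'x) \<Rightarrow> ('w \<Rightarrow> ereal) \<Rightarrow> bool" where
  "rcll_process E N p \<xi> \<longleftrightarrow>
     prob_space N \<and> \<xi> \<in> borel_measurable N \<and>
     (\<forall>t\<ge>0. \<forall>B\<in>sets (borel_of E). {\<omega> \<in> space N. ereal t < \<xi> \<omega> \<and> p t \<omega> \<in> B} \<in> sets N) \<and>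
     (\<forall>\<omega>\<in>space N. \<forall>t\<ge>0. ereal t < \<xi> \<omega> \<longrightarrow>
        limitin E (\<lambda>s. p s \<omega>) (p t \<omega>) (at_right t) \<and>
        (0 < t \<longrightarrow> (\<exists>l. limitin E (\<lambda>s. p s \<omega>) l (at_left t))))"

definition markov_process ::
  "'x topology \<Rightarrow> (real \<Rightarrow> 'x \<Rightarrow> 'x measure) \<Rightarrow> 'w measure \<Rightarrow> (real \<Rightarrow> 'w \<Rightarrow> 'x) \<Rightarrow> ('w \<Rightarrow> ereal) \<Rightarrow> bool" where
  "markov_process E P N p \<xi> \<longleftrightarrow>
     rcll_process E N p \<xi> \<and>
     (\<forall>t\<ge>0. \<forall>s\<ge>0. \<forall>f\<in>Cb E. AE \<omega> in N.
        real_cond_exp N (natural_filtration E N p \<xi> t)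
          (\<lambda>\<omega>. if ereal (t + s) < \<xi> \<omega> then f (p (t + s) \<omega>) else 0) \<omega> =
        (if ereal t < \<xi> \<omega> then (\<integral>x. f x \<partial>P s (p t \<omega>)) else 0))"

definition invariant_semigroup ::
  "('k, 'b) monoid_scheme \<Rightarrow> ('k \<Rightarrow> 'x \<Rightarrow> 'x) \<Rightarrow> 'x topology \<Rightarrow> (real \<Rightarrow> 'x \<Rightarrow> 'x measure) \<Rightarrow> bool" where
  "invariant_semigroup K \<alpha> E P \<longleftrightarrow>
     (\<forall>t\<ge>0. \<forall>f\<in>Cb E. \<forall>k\<in>carrier K. \<forall>x\<in>topspace E.
        (\<integral>x'. f (\<alpha> k x') \<partial>P t x) = (\<integral>x'. f x' \<partial>P t (\<alpha> k x)))"

definition exit_time :: "'x topology \<Rightarrow> 'x set \<Rightarrow> ereal \<Rightarrow> (real \<Rightarrow> 'x) \<Rightarrow> ereal" where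
  "exit_time E W \<xi> w = Inf {ereal t | t. 0 < t \<and>
     (w t \<notin> W \<or> \<not> (\<exists>l\<in>W. limitin E w l (at_left t)) \<or> \<xi> \<le> ereal t)}"

text \<open>The distribution of the process on \<open>[0,T]\<close>, restricted to the event \<open>\<zeta> > T\<close>: a sub-probability
  measure on the path space of \<open>E\<close>. For \<open>\<zeta>\<close> the exit time from an open set \<open>E\<close>, the path
  lies in \<open>rcll_paths T E\<close> on this event as soon as it starts in \<open>E\<close>; the explicit condition
  discards the null set where the initial value is wrong.\<close>

definition path_law ::
  "real \<Rightarrow> 'x topology \<Rightarrow> 'w measure \<Rightarrow> (real \<Rightarrow> 'w \<Rightarrow> 'x) \<Rightarrow> ('w \<Rightarrow> ereal) \<Rightarrow> (real \<Rightarrow> 'x) measure" where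
  "path_law T E N p \<zeta> =
     distr (restrict_space N {\<omega> \<in> space N. ereal T < \<zeta> \<omega> \<and> (\<lambda>t\<in>{0..T}. p t \<omega>) \<in> rcll_paths T E}) (path_borel T E)
       (\<lambda>\<omega>. \<lambda>t\<in>{0..T}. p t \<omega>)"


section \<open>Nonhomogeneous Levy processes in homogeneous spaces\<close>

definition invariant_measure ::
  "('k, 'b) monoid_scheme \<Rightarrow> 'k set \<Rightarrow> 'k set topology \<Rightarrow> 'k set measure \<Rightarrow> bool" where
  "invariant_measure K M Q \<nu> \<longleftrightarrow>
     sets \<nu> = sets (borel_of Q) \<and> (\<forall>h\<in>M. distr \<nu> (borel_of Q) (\<lambda>z. h <#\<^bsub>K\<^esub> z) = \<nu>)"

definition coset_convolution ::
  "('k, 'b) monoid_scheme \<Rightarrow> ('k set \<Rightarrow> 'k) \<Rightarrow> 'k set topology \<Rightarrow>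
   'k set measure \<Rightarrow> 'k set measure \<Rightarrow> 'k set measure" where
  "coset_convolution K S Q \<mu> \<nu> =
     distr (\<mu> \<Otimes>\<^sub>M \<nu>) (borel_of Q) (\<lambda>(x, y). S x <#\<^bsub>K\<^esub> y)"

definition convolution_semigroup ::
  "('k, 'b) monoid_scheme \<Rightarrow> 'k set \<Rightarrow> ('k set \<Rightarrow> 'k) \<Rightarrow> 'k set topology \<Rightarrow>
   (real \<Rightarrow> real \<Rightarrow> 'k set measure) \<Rightarrow> bool" where
  "convolution_semigroup K M S Q \<mu> \<longleftrightarrow>
     (\<forall>s t. 0 \<le> s \<and> s \<le> t \<longrightarrow> prob_space (\<mu> s t) \<and> invariant_measure K M Q (\<mu> s t)) \<and>
     (\<forall>s t u. 0 \<le> s \<and> s < t \<and> t < u \<longrightarrow> coset_convolution K S Q (\<mu> s t) (\<mu> t u) = \<mu> s u) \<and>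
     (\<forall>t\<ge>0. \<mu> t t = return (borel_of Q) M) \<and>
     (\<forall>s\<ge>0. \<forall>f\<in>Cb Q. ((\<lambda>t. \<integral>z. f z \<partial>\<mu> s t) \<longlongrightarrow> (\<integral>z. f z \<partial>\<mu> s s)) (at_right s))"

text \<open>\<open>section_prod K S w i = S (w 0) \<dots> S (w (i - 1))\<close>, so that
  \<open>coset_word K S w i = w 0 w 1 \<dots> w i\<close>.\<close>

primrec section_prod :: "('k, 'b) monoid_scheme \<Rightarrow> ('k set \<Rightarrow> 'k) \<Rightarrow> (nat \<Rightarrow> 'k set) \<Rightarrow> nat \<Rightarrow> 'k" where
  "section_prod K S w 0 = \<one>\<^bsub>K\<^esub>"
| "section_prod K S w (Suc i) = section_prod K S w i \<otimes>\<^bsub>K\<^esub> S (w i)"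

definition coset_word ::
  "('k, 'b) monoid_scheme \<Rightarrow> ('k set \<Rightarrow> 'k) \<Rightarrow> (nat \<Rightarrow> 'k set) \<Rightarrow> nat \<Rightarrow> 'k set" where
  "coset_word K S w i = section_prod K S w i <#\<^bsub>K\<^esub> w i"

text \<open>The iterated integral over \<open>w 0, \<dots>, w n\<close> is an integral with respect to the product
  measure of the law of \<open>z 0\<close> and the measures \<open>\<mu> (t (i - 1)) (t i)\<close>.\<close>

definition nonhomogeneous_levy_process ::
  "('k, 'b) monoid_scheme \<Rightarrow> 'k set \<Rightarrow> ('k set \<Rightarrow> 'k) \<Rightarrow> 'k set topology \<Rightarrow> real \<Rightarrow>
   'w measure \<Rightarrow> (real \<Rightarrow> 'w \<Rightarrow> 'k set) \<Rightarrow> bool" where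
  "nonhomogeneous_levy_process K M S Q T N z \<longleftrightarrow>
     prob_space N \<and> (\<forall>t\<in>{0..T}. z t \<in> N \<rightarrow>\<^sub>M borel_of Q) \<and>
     (\<forall>\<omega>\<in>space N. (\<lambda>t\<in>{0..T}. z t \<omega>) \<in> rcll_paths T Q) \<and>
     (\<exists>\<mu>. convolution_semigroup K M S Q \<mu> \<and>
       (\<forall>n t f. t 0 = 0 \<and> (\<forall>i<n. t i < t (Suc i)) \<and> t n \<le> T \<and>
            f \<in> Cb (product_topology (\<lambda>_. Q) {..n}) \<longrightarrow>
          (\<integral>\<omega>. f (\<lambda>i\<in>{..n}. z (t i) \<omega>) \<partial>N) =
          (\<integral>w. f (\<lambda>i\<in>{..n}. coset_word K S w i)
             \<partial>PiM {..n} (\<lambda>i. case i of 0 \<Rightarrow> distr N (borel_of Q) (z 0)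
                                     | Suc j \<Rightarrow> \<mu> (t j) (t i)))))"


section \<open>The conditional distribution of the angular process\<close>

text \<open>\<open>Px x\<close> stands for the distribution of the process started at \<open>x\<close>, restricted to the event
  \<open>[\<zeta> > T]\<close>, as a finite measure on the path space of \<open>XT\<close> (the space \<open>K Yo\<close>). Because it is finite,
  \<^const>\<open>real_cond_exp\<close> applies without normalisation. \<open>J\<close> and \<open>J2\<close> are the radial and angular
  projections.\<close>

definition angular_conditional_distribution ::
  "real \<Rightarrow> 'x topology \<Rightarrow> 'x topology \<Rightarrow> 'z topology \<Rightarrow> ('x \<Rightarrow> 'x) \<Rightarrow> ('x \<Rightarrow> 'z) \<Rightarrow>
   ('x \<Rightarrow> (real \<Rightarrow> 'x) measure) \<Rightarrow> ('z \<Rightarrow> (real \<Rightarrow> 'x) \<Rightarrow> (real \<Rightarrow> 'z) measure) \<Rightarrow> bool" where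
  "angular_conditional_distribution T XT YT Q J J2 Px R \<longleftrightarrow>
     (\<lambda>(v, z). R z v) \<in> path_borel T YT \<Otimes>\<^sub>M borel_of Q \<rightarrow>\<^sub>M prob_algebra (path_borel T Q) \<and>
     (\<forall>x\<in>topspace XT. \<forall>F\<in>sets (path_borel T Q). AE w in Px x.
        measure (R (J2 x) (path_map T J w)) F =
        real_cond_exp (Px x)
          (vimage_algebra (rcll_paths T XT) (path_map T J) (coordinate_algebra T YT))
          (indicator {w \<in> rcll_paths T XT. path_map T J2 w \<in> F}) w)"

end

theory Submission imports Defs begin

text \<open>
  Apply the Markov property at a time \<open>s\<close> and move the future back by the angular position
  \<open>S z\<^sub>s\<close>: by \<open>K\<close>-invariance the moved future is a path of the process started at the radial position
  \<open>y\<^sub>s\<close>, and an additional factor from \<open>M\<close> is invisible because \<open>M\<close> fixes the transversal. Hence, given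
  the radial path, the increment \<open>S(z\<^sub>s)\<inverse> z\<^sub>t\<close> is independent of the past up to time \<open>s\<close>, and its
  conditional law is \<open>M\<close>-invariant. Disintegrating over countably many rational times and over countable
  generators, almost every conditional law has independent \<open>M\<close>-invariant increments at rational times.

  For a single such law on the path space, right continuity extends this to all times. A measurable
  section \<open>S\<close> is not continuous, so increments between approximating times are formed with continuous
  local sections, which changes neither the law nor the independence since the increments are
  \<open>M\<close>-invariant. The laws of the increments then form the required convolution semigroup.
\<close>

section \<open>Borel sets of topological spaces\<close>

text \<open>The conditioning is on the whole radial path, while the Markov property at
  \<open>s\<close> speaks of the past of \<open>s\<close> only. The bridge is that the Skorohod
  Borel sets are generated by the coordinates, hence by rectangles of a past and a future event. On
  such a rectangle the radial past is absorbed into the full past, and the radial future is a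
  functional of the moved future because \<open>K\<close> does not change radial parts. Thus the
  conditional law of an increment is a function of the radial future alone.

  The event that the path stays in \<open>Xo\<close> up to \<open>T\<close> must split in the same
  way. It does, because \<open>Xo\<close> is \<open>K\<close>-invariant and because openness of
  \<open>Xo\<close> lets countably many coordinates of an rcll path decide it. Paths that die or
  leave are dropped: all laws are finite measures and are never normalised.

  A null set has to be transferred: \<open>R z\<close> is controlled by the process started at a
  point with angular part \<open>z\<close>, while the claim concerns the radial law from
  \<open>y\<close>. The point \<open>\<alpha> (S z) y\<close> serves both purposes, since by
  invariance the radial law depends only on the radial part of the starting point.\<close>

lemma space_borel_of [simp]: "space (borel_of T) = topspace T"
  unfolding borel_of_def by (rule space_measure_of) (auto dest: openin_subset)

lemma sets_borel_of: "sets (borel_of T) = sigma_sets (topspace T) {U. openin T U}"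
  unfolding borel_of_def by (rule sets_measure_of) (auto dest: openin_subset)

lemma borel_of_open: "openin T U \<Longrightarrow> U \<in> sets (borel_of T)"
  by (auto simp: sets_borel_of)

lemma borel_of_closed: "closedin T C \<Longrightarrow> C \<in> sets (borel_of T)"
  using sets.compl_sets[OF borel_of_open[of T "topspace T - C"]]
  by (auto simp: closedin_def double_diff)

lemma borel_of_euclidean [simp]: "borel_of euclidean = borel"
  by (simp add: borel_of_def borel_def)

lemma measurable_borel_ofI:
  assumes "\<And>x. x \<in> space M \<Longrightarrow> f x \<in> topspace T"
    and "\<And>U. openin T U \<Longrightarrow> f -` U \<inter> space M \<in> sets M"
  shows "f \<in> M \<rightarrow>\<^sub>M borel_of T"
  unfolding borel_of_def by (rule measurable_measure_of) (use assms in \<open>auto dest: openin_subset\<close>)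

lemma continuous_map_measurable:
  assumes "continuous_map X Y f" shows "f \<in> borel_of X \<rightarrow>\<^sub>M borel_of Y"
proof (rule measurable_borel_ofI)
  show "f x \<in> topspace Y" if "x \<in> space (borel_of X)" for x
    using that assms by (auto simp: continuous_map_def)
  show "f -` U \<inter> space (borel_of X) \<in> sets (borel_of X)" if "openin Y U" for U
  proof -
    have "f -` U \<inter> space (borel_of X) = {x \<in> topspace X. f x \<in> U}" by auto
    then show ?thesis using openin_continuous_map_preimage[OF assms that] by (simp add: borel_of_open)
  qed
qed

lemma Cb_measurable: "f \<in> Cb X \<Longrightarrow> f \<in> borel_measurable (borel_of X)"
  using continuous_map_measurable[of X euclideanreal f] by (simp add: Cb_def)

lemma Cb_bounded:
  assumes "f \<in> Cb X" obtains B where "\<And>x. x \<in> topspace X \<Longrightarrow> \<bar>f x\<bar> \<le> B"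
  using assms by (auto simp: Cb_def bounded_iff)

lemma measurable_borel_of_subtopology:
  assumes "f \<in> M \<rightarrow>\<^sub>M borel_of X" and "\<And>x. x \<in> space M \<Longrightarrow> f x \<in> S"
  shows "f \<in> M \<rightarrow>\<^sub>M borel_of (subtopology X S)"
proof (rule measurable_borel_ofI)
  show "f x \<in> topspace (subtopology X S)" if "x \<in> space M" for x
    using measurable_space[OF assms(1) that] assms(2)[OF that] by simp
  fix U assume "openin (subtopology X S) U"
  then obtain V where V: "openin X V" "U = V \<inter> S" by (auto simp: openin_subtopology)
  have "f -` U \<inter> space M = f -` V \<inter> space M" using V assms(2) by auto
  then show "f -` U \<inter> space M \<in> sets M" using measurable_sets[OF assms(1) borel_of_open[OF V(1)]] by simp
qed

lemma measurable_borel_of_subtopologyD: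
  assumes "f \<in> M \<rightarrow>\<^sub>M borel_of (subtopology X S)"
  shows "f \<in> M \<rightarrow>\<^sub>M borel_of X"
proof -
  have "id \<in> borel_of (subtopology X S) \<rightarrow>\<^sub>M borel_of X"
    by (rule continuous_map_measurable) (simp add: continuous_map_from_subtopology)
  from measurable_comp[OF assms this] show ?thesis by simp
qed

text \<open>Finite intersections, with the empty one supplying \<open>\<Omega>\<close>. A countable
  pi-system lets an identity that holds almost surely for each generator hold outside one common
  null set and still determine a measure.\<close>

lemma countable_Int_stable_generator:
  assumes "countable \<A>" and "\<A> \<subseteq> Pow \<Omega>"
  obtains \<B> where "countable \<B>" "\<B> \<subseteq> Pow \<Omega>" "Int_stable \<B>" "\<Omega> \<in> \<B>"
    "sigma_sets \<Omega> \<B> = sigma_sets \<Omega> \<A>" "\<B> \<subseteq> sigma_sets \<Omega> \<A>"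
proof -
  define \<B> where "\<B> = (\<lambda>F. \<Omega> \<inter> \<Inter>F) ` {F. finite F \<and> F \<subseteq> \<A>}"
  have sub: "\<B> \<subseteq> sigma_sets \<Omega> \<A>"
  proof -
    have "\<Omega> \<inter> \<Inter>F \<in> sigma_sets \<Omega> \<A>" if "finite F" "F \<subseteq> \<A>" for F
      using that
    proof (induction F)
      case empty then show ?case by (simp add: sigma_sets_top)
    next
      case (insert A F)
      then have "\<Omega> \<inter> \<Inter>F \<in> sigma_sets \<Omega> \<A>" "A \<in> sigma_sets \<Omega> \<A>" by auto
      then have "A \<inter> (\<Omega> \<inter> \<Inter>F) \<in> sigma_sets \<Omega> \<A>"
        using sets.Int[of _ "sigma \<Omega> \<A>"] assms(2) by (simp add: sets_measure_of)
      moreover have "\<Omega> \<inter> \<Inter>(insert A F) = A \<inter> (\<Omega> \<inter> \<Inter>F)" by auto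
      ultimately show ?case by simp
    qed
    then show ?thesis unfolding \<B>_def by auto
  qed
  show thesis
  proof
    show "countable \<B>" unfolding \<B>_def using assms(1) by (simp add: countable_Collect_finite_subset)
    show "\<B> \<subseteq> Pow \<Omega>" unfolding \<B>_def by auto
    show "Int_stable \<B>"
    proof (rule Int_stableI)
      fix a b assume "a \<in> \<B>" "b \<in> \<B>"
      then obtain F G where "finite F" "F \<subseteq> \<A>" "finite G" "G \<subseteq> \<A>" "a = \<Omega> \<inter> \<Inter>F" "b = \<Omega> \<inter> \<Inter>G"
        unfolding \<B>_def by auto
      then show "a \<inter> b \<in> \<B>" unfolding \<B>_def by (intro image_eqI[of _ _ "F \<union> G"]) auto
    qed
    show "\<Omega> \<in> \<B>" unfolding \<B>_def by (intro image_eqI[of _ _ "{}"]) auto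
    show "\<B> \<subseteq> sigma_sets \<Omega> \<A>" by (rule sub)
    have "\<A> \<subseteq> \<B>" unfolding \<B>_def
    proof
      fix A assume "A \<in> \<A>"
      then show "A \<in> (\<lambda>F. \<Omega> \<inter> \<Inter>F) ` {F. finite F \<and> F \<subseteq> \<A>}"
        using assms(2) by (intro image_eqI[of _ _ "{A}"]) auto
    qed
    then show "sigma_sets \<Omega> \<B> = sigma_sets \<Omega> \<A>"
      using sub by (auto intro!: equalityI sigma_sets_mono)
  qed
qed

section \<open>Second countable spaces: countable generators and finite products\<close>

lemma second_countable_base:
  assumes "second_countable X"
  obtains \<B> where "countable \<B>" "\<And>B. B \<in> \<B> \<Longrightarrow> openin X B"
    "\<And>U x. openin X U \<Longrightarrow> x \<in> U \<Longrightarrow> \<exists>B\<in>\<B>. x \<in> B \<and> B \<subseteq> U"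
  using assms unfolding second_countable_def by metis

lemma borel_of_countable_generator:
  assumes "second_countable X"
  obtains \<B> where "countable \<B>" "\<B> \<subseteq> Pow (topspace X)" "Int_stable \<B>" "topspace X \<in> \<B>"
    "sets (borel_of X) = sigma_sets (topspace X) \<B>"
proof -
  obtain \<A> where \<A>: "countable \<A>" "\<And>B. B \<in> \<A> \<Longrightarrow> openin X B"
    "\<And>U x. openin X U \<Longrightarrow> x \<in> U \<Longrightarrow> \<exists>B\<in>\<A>. x \<in> B \<and> B \<subseteq> U"
    using second_countable_base[OF assms] by blast
  have sub: "\<A> \<subseteq> Pow (topspace X)" using \<A>(2) openin_subset by blast
  have "U \<in> sigma_sets (topspace X) \<A>" if "openin X U" for U
  proof -
    have "U = \<Union>{B \<in> \<A>. B \<subseteq> U}" using \<A>(3)[OF that] by blast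
    moreover have "\<Union>{B \<in> \<A>. B \<subseteq> U} \<in> sigma_sets (topspace X) \<A>"
      by (rule sigma_sets_UNION) (use \<A>(1) in \<open>auto intro: countable_subset[of _ \<A>]\<close>)
    ultimately show ?thesis by simp
  qed
  then have eq: "sets (borel_of X) = sigma_sets (topspace X) \<A>"
    unfolding sets_borel_of using \<A>(2) by (intro sigma_sets_eqI) auto
  from countable_Int_stable_generator[OF \<A>(1) sub] that eq show thesis by metis
qed

text \<open>An open set of the product is a countable union of rectangles of basic open sets. This
  makes jointly continuous maps, such as the group operation and the actions, measurable for the
  product sigma-algebra.\<close>

lemma openin_prod_measurable:
  assumes X: "second_countable X" and Y: "second_countable Y" and U: "openin (prod_topology X Y) U"
  shows "U \<in> sets (borel_of X \<Otimes>\<^sub>M borel_of Y)"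
proof -
  obtain \<A> where \<A>: "countable \<A>" "\<And>B. B \<in> \<A> \<Longrightarrow> openin X B"
    "\<And>U x. openin X U \<Longrightarrow> x \<in> U \<Longrightarrow> \<exists>B\<in>\<A>. x \<in> B \<and> B \<subseteq> U"
    using second_countable_base[OF X] by blast
  obtain \<B> where \<B>: "countable \<B>" "\<And>B. B \<in> \<B> \<Longrightarrow> openin Y B"
    "\<And>U x. openin Y U \<Longrightarrow> x \<in> U \<Longrightarrow> \<exists>B\<in>\<B>. x \<in> B \<and> B \<subseteq> U"
    using second_countable_base[OF Y] by blast
  let ?I = "{p \<in> \<A> \<times> \<B>. fst p \<times> snd p \<subseteq> U}"
  have "U = (\<Union>p\<in>?I. fst p \<times> snd p)"
  proof (intro equalityI subsetI)
    fix u assume u: "u \<in> U"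
    then obtain V W where VW: "openin X V" "openin Y W" "fst u \<in> V" "snd u \<in> W" "V \<times> W \<subseteq> U"
      using U unfolding openin_prod_topology_alt by (metis prod.collapse)
    obtain A B where "A \<in> \<A>" "fst u \<in> A" "A \<subseteq> V" "B \<in> \<B>" "snd u \<in> B" "B \<subseteq> W"
      using \<A>(3)[OF VW(1,3)] \<B>(3)[OF VW(2,4)] by auto
    then have "(A, B) \<in> ?I" "u \<in> fst (A, B) \<times> snd (A, B)" using VW(5) by (auto simp: mem_Times_iff)
    then show "u \<in> (\<Union>p\<in>?I. fst p \<times> snd p)" by blast
  qed auto
  moreover have "(\<Union>p\<in>?I. fst p \<times> snd p) \<in> sets (borel_of X \<Otimes>\<^sub>M borel_of Y)"
  proof (rule sets.countable_UN'')
    show "countable ?I" by (rule countable_subset[of _ "\<A> \<times> \<B>"]) (use \<A>(1) \<B>(1) in auto)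
    fix p assume "p \<in> ?I"
    then show "fst p \<times> snd p \<in> sets (borel_of X \<Otimes>\<^sub>M borel_of Y)"
      using \<A>(2) \<B>(2) by (intro pair_measureI borel_of_open) auto
  qed
  ultimately show ?thesis by simp
qed

lemma continuous_map_measurable_prod:
  assumes "second_countable X" "second_countable Y" and f: "continuous_map (prod_topology X Y) Z f"
  shows "f \<in> borel_of X \<Otimes>\<^sub>M borel_of Y \<rightarrow>\<^sub>M borel_of Z"
proof (rule measurable_borel_ofI)
  show "f x \<in> topspace Z" if "x \<in> space (borel_of X \<Otimes>\<^sub>M borel_of Y)" for x
    using that f by (auto simp: continuous_map_def space_pair_measure)
  show "f -` U \<inter> space (borel_of X \<Otimes>\<^sub>M borel_of Y) \<in> sets (borel_of X \<Otimes>\<^sub>M borel_of Y)"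
    if "openin Z U" for U
  proof -
    have "f -` U \<inter> space (borel_of X \<Otimes>\<^sub>M borel_of Y) = {x \<in> topspace (prod_topology X Y). f x \<in> U}"
      by (auto simp: space_pair_measure)
    then show ?thesis
      using openin_prod_measurable[OF assms(1,2) openin_continuous_map_preimage[OF f that]] by simp
  qed
qed

text \<open>Finiteness of \<open>I\<close> enters twice: the boxes of basic sets are countably many,
  and each of them is measurable.\<close>

lemma openin_product_measurable:
  assumes X: "second_countable X" and I: "finite I" and U: "openin (product_topology (\<lambda>_. X) I) U"
  shows "U \<in> sets (PiM I (\<lambda>_. borel_of X))"
proof -
  obtain \<A> where \<A>: "countable \<A>" "\<And>B. B \<in> \<A> \<Longrightarrow> openin X B"
    "\<And>U x. openin X U \<Longrightarrow> x \<in> U \<Longrightarrow> \<exists>B\<in>\<A>. x \<in> B \<and> B \<subseteq> U"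
    using second_countable_base[OF X] by blast
  let ?I = "{p \<in> I \<rightarrow>\<^sub>E \<A>. PiE I p \<subseteq> U}"
  have "U = (\<Union>p\<in>?I. PiE I p)"
  proof (intro equalityI subsetI)
    fix u assume u: "u \<in> U"
    have "\<exists>V. finite {i \<in> I. V i \<noteq> topspace X} \<and> (\<forall>i\<in>I. openin X (V i)) \<and> u \<in> PiE I V \<and> PiE I V \<subseteq> U"
      using U u unfolding openin_product_topology_alt by simp
    then obtain V where V: "\<forall>i\<in>I. openin X (V i)" "u \<in> PiE I V" "PiE I V \<subseteq> U"
      by (elim exE conjE)
    have "\<exists>B\<in>\<A>. u i \<in> B \<and> B \<subseteq> V i" if "i \<in> I" for i
      using \<A>(3)[OF bspec[OF V(1) that]] V(2) that by (auto simp: PiE_iff)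
    then obtain B where B: "\<And>i. i \<in> I \<Longrightarrow> B i \<in> \<A> \<and> u i \<in> B i \<and> B i \<subseteq> V i" by metis
    let ?p = "restrict B I"
    have "PiE I ?p \<subseteq> PiE I V" using B by (intro PiE_mono) auto
    then have "?p \<in> ?I" using B V(3) by auto
    moreover have "u \<in> PiE I ?p" using B V(2) by (auto simp: PiE_iff)
    ultimately show "u \<in> (\<Union>p\<in>?I. PiE I p)" by blast
  qed auto
  moreover have "(\<Union>p\<in>?I. PiE I p) \<in> sets (PiM I (\<lambda>_. borel_of X))"
  proof (rule sets.countable_UN'')
    show "countable ?I"
      by (rule countable_subset[of _ "I \<rightarrow>\<^sub>E \<A>"]) (use \<A>(1) I in \<open>auto intro!: countable_PiE\<close>)
    fix p assume "p \<in> ?I"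
    then show "PiE I p \<in> sets (PiM I (\<lambda>_. borel_of X))"
      using \<A>(2) I by (intro sets_PiM_I_finite borel_of_open) (auto simp: PiE_iff)
  qed
  ultimately show ?thesis by simp
qed

lemma continuous_map_measurable_PiM:
  assumes X: "second_countable X" and I: "finite I"
    and f: "continuous_map (product_topology (\<lambda>_. X) I) Z f"
  shows "f \<in> PiM I (\<lambda>_. borel_of X) \<rightarrow>\<^sub>M borel_of Z"
proof (rule measurable_borel_ofI)
  show "f x \<in> topspace Z" if "x \<in> space (PiM I (\<lambda>_. borel_of X))" for x
    using that f by (auto simp: continuous_map_def space_PiM)
  show "f -` U \<inter> space (PiM I (\<lambda>_. borel_of X)) \<in> sets (PiM I (\<lambda>_. borel_of X))"
    if "openin Z U" for U
  proof -
    have "f -` U \<inter> space (PiM I (\<lambda>_. borel_of X))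
        = {x \<in> topspace (product_topology (\<lambda>_. X) I). f x \<in> U}"
      by (auto simp: space_PiM)
    then show ?thesis
      using openin_product_measurable[OF assms(1,2) openin_continuous_map_preimage[OF f that]] by simp
  qed
qed

text \<open>The interleaving of closed and open sets is used in both directions. A sequence
  converging to a point of \<open>U\<close> is eventually in some \<open>V n\<close>; a sequence
  that is eventually in \<open>C n\<close> has its limit in \<open>C n\<close>, hence in
  \<open>U\<close>. Membership of a limit in an open set thereby becomes a countable
  condition.\<close>

lemma open_exhaustion:
  assumes "metrizable_space X" "openin X U"
  obtains C V :: "nat \<Rightarrow> 'a set" where "\<And>n. closedin X (C n)" "\<And>n. openin X (V n)" "\<And>n. V n \<subseteq> C n"
    "\<And>n. C n \<subseteq> U" "incseq V" "incseq C" "(\<Union>n. V n) = U"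
proof -
  obtain M d where Md: "Metric_space M d" "X = Metric_space.mtopology M d"
    using assms(1) unfolding metrizable_space_def by auto
  interpret Metric_space M d by fact
  \<comment> \<open>A ball of radius strictly larger than 1/(n+1) leaves room to move the centre, so
    \<open>V n\<close> is open; the fixed radius in \<open>C n\<close> makes that set
    closed.\<close>
  define V where "V n = {x \<in> M. \<exists>r>1 / real (Suc n). mball x r \<subseteq> U}" for n
  define C where "C n = {x \<in> M. mball x (1 / real (Suc n)) \<subseteq> U}" for n
  have mono: "1 / real (Suc n) \<le> 1 / real (Suc m)" if "m \<le> n" for m n
    using that by (simp add: frac_le)
  show thesis
  proof
    fix n
    show "closedin X (C n)"
      unfolding Md(2) closedin_metric
    proof (intro conjI allI impI)
      show "C n \<subseteq> M" by (auto simp: C_def)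
      fix x assume x: "x \<in> M - C n"
      then have "\<not> mball x (1 / real (Suc n)) \<subseteq> U" by (simp add: C_def del: of_nat_Suc)
      then obtain y where y: "y \<in> mball x (1 / real (Suc n))" "y \<notin> U" by blast
      let ?r = "1 / real (Suc n) - d x y"
      have "disjnt (C n) (mball x ?r)"
        unfolding disjnt_iff
      proof (intro allI notI)
        fix z assume "z \<in> C n \<and> z \<in> mball x ?r"
        then have z: "z \<in> M" "mball z (1 / real (Suc n)) \<subseteq> U" "d x z < ?r" by (auto simp: C_def)
        have "d z y < 1 / real (Suc n)"
          using triangle[of z x y] z(1,3) y(1) x commute[of x z] by auto
        then show False using z y by auto
      qed
      then show "\<exists>r>0. disjnt (C n) (mball x r)" using y by (intro exI[of _ ?r]) auto
    qed
    show "openin X (V n)"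
      unfolding Md(2) openin_mtopology
    proof (intro conjI allI impI)
      show "V n \<subseteq> M" by (auto simp: V_def)
      fix x assume "x \<in> V n"
      then obtain r where r: "x \<in> M" "r > 1 / real (Suc n)" "mball x r \<subseteq> U" by (auto simp: V_def)
      define q where "q = 1 / real (Suc n)"
      let ?e = "(r - q) / 2"
      have qr: "q < r" using r(2) by (simp add: q_def)
      have "mball x ?e \<subseteq> V n"
      proof
        fix y assume y: "y \<in> mball x ?e"
        have "mball y (r - ?e) \<subseteq> mball x r"
          using y r(1) commute[of x y] by (intro mball_subset) auto
        moreover have "r - ?e > 1 / real (Suc n)" unfolding q_def[symmetric] using qr by (simp add: field_simps)
        ultimately show "y \<in> V n" using r(3) y unfolding V_def by auto
      qed
      then show "\<exists>r>0. mball x r \<subseteq> V n" using qr by (intro exI[of _ ?e]) auto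
    qed
    show "V n \<subseteq> C n"
      unfolding V_def C_def using mball_subset_concentric[OF less_imp_le] by blast
    show "C n \<subseteq> U"
    proof
      fix x assume "x \<in> C n"
      then have "x \<in> mball x (1 / real (Suc n))" "mball x (1 / real (Suc n)) \<subseteq> U" by (auto simp: C_def)
      then show "x \<in> U" by blast
    qed
  next
    show "incseq V"
    proof (intro incseq_SucI subsetI)
      fix n x assume "x \<in> V n"
      then obtain r where "x \<in> M" "1 / real (Suc n) < r" "mball x r \<subseteq> U" by (auto simp: V_def)
      moreover from this have "1 / real (Suc (Suc n)) < r" using mono[of n "Suc n"] by linarith
      ultimately show "x \<in> V (Suc n)" unfolding V_def by blast
    qed
    show "incseq C"
    proof (intro incseq_SucI subsetI)
      fix n x assume "x \<in> C n"
      then show "x \<in> C (Suc n)"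
        using mball_subset_concentric[OF mono[of n "Suc n"], of x] unfolding C_def by simp blast
    qed
    show "(\<Union>n. V n) = U"
    proof (intro equalityI subsetI)
      fix x assume x: "x \<in> U"
      then obtain r where r: "r > 0" "mball x r \<subseteq> U" "x \<in> M"
        using assms(2) unfolding Md(2) openin_mtopology by blast
      obtain n where "inverse (real (Suc n)) < r" using reals_Archimedean[OF r(1)] by blast
      then show "x \<in> (\<Union>n. V n)" using r unfolding V_def by (auto simp: inverse_eq_divide)
    next
      fix x assume "x \<in> (\<Union>n. V n)"
      then obtain n r where "x \<in> M" "r > 1 / real (Suc n)" "mball x r \<subseteq> U" by (auto simp: V_def)
      moreover have "1 / real (Suc n) > 0" by simp
      ultimately have "r > 0" by linarith
      then have "x \<in> mball x r" using \<open>x \<in> M\<close> by simp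
      then show "x \<in> U" using \<open>mball x r \<subseteq> U\<close> by blast
    qed
  qed
qed

text \<open>With an exhaustion of \<open>U\<close>, the limit lies in \<open>U\<close> exactly if
  for some \<open>m\<close> the sequence is in \<open>C m\<close> from some index on, a countable
  combination of measurable conditions.\<close>

lemma measurable_limit_metrizable:
  fixes f :: "nat \<Rightarrow> 'a \<Rightarrow> 'b"
  assumes Y: "metrizable_space Y" and f: "\<And>n. f n \<in> M \<rightarrow>\<^sub>M borel_of Y"
    and lim: "\<And>x. x \<in> space M \<Longrightarrow> limitin Y (\<lambda>n. f n x) (g x) sequentially"
  shows "g \<in> M \<rightarrow>\<^sub>M borel_of Y"
proof (rule measurable_borel_ofI)
  show "g x \<in> topspace Y" if "x \<in> space M" for x using lim[OF that] by (rule limitin_topspace)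
  fix U assume U: "openin Y U"
  obtain C V :: "nat \<Rightarrow> 'b set" where CV: "\<And>n. closedin Y (C n)" "\<And>n. openin Y (V n)" "\<And>n. V n \<subseteq> C n"
    "\<And>n. C n \<subseteq> U" "incseq V" "incseq C" "(\<Union>n. V n) = U" by (rule open_exhaustion[OF Y U]) (rule that; assumption)
  have "g -` U \<inter> space M = (\<Union>m. \<Union>N. \<Inter>n\<in>{N..}. f n -` C m \<inter> space M)"
  proof (intro equalityI subsetI)
    fix x assume x: "x \<in> g -` U \<inter> space M"
    then obtain m where "g x \<in> V m" using CV(7) by auto
    then have "\<forall>\<^sub>F n in sequentially. f n x \<in> V m"
      using lim[of x] x CV(2) by (auto simp: limitin_def)
    then obtain N where "\<And>n. n \<ge> N \<Longrightarrow> f n x \<in> V m" by (auto simp: eventually_sequentially)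
    then show "x \<in> (\<Union>m. \<Union>N. \<Inter>n\<in>{N..}. f n -` C m \<inter> space M)" using x CV(3)[of m] by auto
  next
    fix x assume "x \<in> (\<Union>m. \<Union>N. \<Inter>n\<in>{N..}. f n -` C m \<inter> space M)"
    then obtain m N where mN: "\<And>n. n \<ge> N \<Longrightarrow> f n x \<in> C m \<and> x \<in> space M" by auto
    then have "\<forall>\<^sub>F n in sequentially. f n x \<in> C m" unfolding eventually_sequentially by blast
    then have "g x \<in> C m"
      using limitin_closedin[OF lim CV(1)[of m]] mN by auto
    then show "x \<in> g -` U \<inter> space M" using CV(4) mN by auto
  qed
  also have "\<dots> \<in> sets M"
    using measurable_sets[OF f borel_of_closed[OF CV(1)]]
    by (intro sets.countable_UN'' sets.countable_INT') auto
  finally show "g -` U \<inter> space M \<in> sets M" .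
qed

text \<open>Open sets form a pi-system, and the indicator of an open set is a bounded pointwise
  limit of Urysohn functions that are 1 on the closed sets of an exhaustion and 0 off the open
  set.\<close>

lemma measure_eqI_Cb:
  assumes X: "metrizable_space X" and \<mu>: "finite_measure \<mu>" "sets \<mu> = sets (borel_of X)"
    and \<nu>: "finite_measure \<nu>" "sets \<nu> = sets (borel_of X)"
    and eq: "\<And>f. f \<in> Cb X \<Longrightarrow> (\<integral>x. f x \<partial>\<mu>) = (\<integral>x. f x \<partial>\<nu>)"
  shows "\<mu> = \<nu>"
proof (rule measure_eqI_generator_eq[where \<Omega>="topspace X" and E="{U. openin X U}" and A="\<lambda>_. topspace X"])
  show "Int_stable {U. openin X U}" by (auto intro!: Int_stableI)
  show "{U. openin X U} \<subseteq> Pow (topspace X)" by (auto dest: openin_subset)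
  show "sets \<mu> = sigma_sets (topspace X) {U. openin X U}" "sets \<nu> = sigma_sets (topspace X) {U. openin X U}"
    using \<mu> \<nu> by (auto simp: sets_borel_of)
  show "range (\<lambda>_. topspace X) \<subseteq> {U. openin X U}" "(\<Union>i. topspace X) = topspace X" by auto
  show "emeasure \<mu> (topspace X) \<noteq> \<infinity>" using finite_measure.emeasure_finite[OF \<mu>(1)] by simp
  fix U assume "U \<in> {U. openin X U}"
  then have U: "openin X U" by simp
  obtain C V :: "nat \<Rightarrow> 'a set" where CV: "\<And>n. closedin X (C n)" "\<And>n. openin X (V n)" "\<And>n. V n \<subseteq> C n"
    "\<And>n. C n \<subseteq> U" "incseq V" "incseq C" "(\<Union>n. V n) = U" by (rule open_exhaustion[OF X U]) (rule that; assumption)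
  have "\<exists>f. continuous_map X (top_of_set {0..1::real}) f \<and> f ` (topspace X - U) \<subseteq> {0} \<and> f ` C n \<subseteq> {1}" for n
  proof -
    have "closedin X (topspace X - U)" "disjnt (topspace X - U) (C n)"
      using U CV(4) by (auto simp: disjnt_iff)
    from Urysohn_lemma[OF metrizable_imp_normal_space[OF X] this(1) CV(1) this(2), of 0 1]
    show ?thesis by (metis zero_le_one)
  qed
  then obtain f where f: "\<And>n. continuous_map X (top_of_set {0..1::real}) (f n)"
    "\<And>n. f n ` (topspace X - U) \<subseteq> {0}" "\<And>n. f n ` C n \<subseteq> {1}" by metis
  have f01: "f n x \<in> {0..1}" if "x \<in> topspace X" for n x
    using f(1)[of n] that by (auto simp: continuous_map_def)
  have fCb: "f n \<in> Cb X" for n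
    using f(1)[of n] f01[of _ n] unfolding Cb_def
    by (auto simp: continuous_map_in_subtopology bounded_iff intro!: exI[of _ 1])
  have lim: "(\<lambda>n. f n x) \<longlonglongrightarrow> indicator U x" if "x \<in> topspace X" for x
  proof (cases "x \<in> U")
    case True
    then obtain m where "x \<in> V m" using CV(7) by auto
    then have "x \<in> C n" if "n \<ge> m" for n using CV(3)[of m] CV(6) that by (auto simp: incseq_def)
    then have "\<forall>\<^sub>F n in sequentially. f n x = indicator U x"
      using f(3) True by (auto simp: eventually_sequentially intro!: exI[of _ m])
    then show ?thesis by (rule tendsto_eventually)
  next
    case False
    then have "f n x = 0" for n using f(2)[of n] that by auto
    then show ?thesis using False by simp
  qed
  have main: "(\<lambda>n. \<integral>x. f n x \<partial>\<rho>) \<longlonglongrightarrow> measure \<rho> U"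
    if \<rho>: "finite_measure \<rho>" "sets \<rho> = sets (borel_of X)" for \<rho>
  proof -
    interpret finite_measure \<rho> by fact
    have sp: "space \<rho> = topspace X" using sets_eq_imp_space_eq[OF \<rho>(2)] by simp
    have "(\<lambda>n. \<integral>x. f n x \<partial>\<rho>) \<longlonglongrightarrow> (\<integral>x. indicator U x \<partial>\<rho>)"
    proof (rule integral_dominated_convergence[where w="\<lambda>_. 1"])
      show "f n \<in> borel_measurable \<rho>" for n
        using Cb_measurable[OF fCb] by (simp add: measurable_cong_sets[OF \<rho>(2) refl])
      show "indicator U \<in> borel_measurable \<rho>" using borel_of_open[OF U] \<rho>(2) by simp
    qed (use lim f01 sp in \<open>auto\<close>)
    then show ?thesis using borel_of_open[OF U] \<rho>(2) sp openin_subset[OF U] by (simp add: Int_absorb2)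
  qed
  have "measure \<mu> U = measure \<nu> U"
    by (rule LIMSEQ_unique[OF main[OF \<mu>]]) (use main[OF \<nu>] eq[OF fCb] in simp)
  then show "emeasure \<mu> U = emeasure \<nu> U"
    using \<mu> \<nu> by (simp add: finite_measure.emeasure_eq_measure)
qed

text \<open>Urysohn's metrization theorem. Regularity and the Lindelof property give normality; the
  Urysohn functions of countably many nested pairs of basic sets embed the space in a countable
  power of the reals.\<close>

lemma regular_second_countable_imp_metrizable:
  assumes "regular_space X" "Hausdorff_space X" "second_countable X"
  shows "metrizable_space X"
proof -
  obtain \<B> where \<B>: "countable \<B>" "\<And>B. B \<in> \<B> \<Longrightarrow> openin X B"
    "\<And>U x. openin X U \<Longrightarrow> x \<in> U \<Longrightarrow> \<exists>B\<in>\<B>. x \<in> B \<and> B \<subseteq> U"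
    using second_countable_base[OF assms(3)] by blast
  have normal: "normal_space X"
    using assms by (simp add: regular_Lindelof_imp_normal_space second_countable_imp_Lindelof_space)
  define I where "I = {p \<in> \<B> \<times> \<B>. X closure_of fst p \<subseteq> snd p}"
  have "\<exists>f. continuous_map X euclideanreal f \<and> f ` (X closure_of fst p) \<subseteq> {0} \<and> f ` (topspace X - snd p) \<subseteq> {1}"
    if "p \<in> I" for p
  proof -
    have "closedin X (topspace X - snd p)" "disjnt (X closure_of fst p) (topspace X - snd p)"
      using that \<B>(2) by (auto simp: I_def disjnt_iff)
    from Urysohn_lemma_alt[OF normal closedin_closure_of this] show ?thesis by metis
  qed
  then obtain F where F: "\<And>p. p \<in> I \<Longrightarrow> continuous_map X euclideanreal (F p)"
    "\<And>p. p \<in> I \<Longrightarrow> F p ` (X closure_of fst p) \<subseteq> {0}" "\<And>p. p \<in> I \<Longrightarrow> F p ` (topspace X - snd p) \<subseteq> {1::real}"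
    by metis
  define e where "e x = (\<lambda>p\<in>I. F p x)" for x
  define P where "P = powertop_real I"
  \<comment> \<open>Regularity supplies a neighbourhood of \<open>x\<close> whose closure lies in a
    basic set \<open>V\<close>. Shrinking it to a basic \<open>U\<close> gives a pair in
    \<open>I\<close> whose function is 0 at \<open>x\<close> and 1 off \<open>V\<close>.\<close>
  have sep: "\<exists>p\<in>I. F p x < 1 \<and> (\<forall>y\<in>topspace X. F p y < 1 \<longrightarrow> y \<in> W)" if W: "openin X W" "x \<in> W" for x W
  proof -
    obtain V where V: "V \<in> \<B>" "x \<in> V" "V \<subseteq> W" using \<B>(3)[OF W] by auto
    obtain U' where U': "openin X U'" "x \<in> U'" "X closure_of U' \<subseteq> V"
    proof -
      obtain U C where UC: "openin X U" "closedin X C" "x \<in> U" "U \<subseteq> C" "C \<subseteq> V"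
        using assms(1) \<B>(2)[OF V(1)] V(2) unfolding neighbourhood_base_of_closedin[symmetric] neighbourhood_base_of
        by metis
      then have "X closure_of U \<subseteq> V" using closure_of_minimal[of U C X] by auto
      then show thesis using that UC by blast
    qed
    obtain U where U: "U \<in> \<B>" "x \<in> U" "U \<subseteq> U'" using \<B>(3)[OF U'(1,2)] by auto
    have cl: "X closure_of U \<subseteq> V" using closure_of_mono[OF U(3)] U'(3) by blast
    have p: "(U, V) \<in> I" using U(1) V(1) cl by (simp add: I_def)
    have "x \<in> X closure_of U" using U(2) closure_of_subset[OF openin_subset[OF \<B>(2)[OF U(1)]]] by auto
    then have "F (U, V) x = 0" using F(2)[OF p] by auto
    moreover have "y \<in> W" if "y \<in> topspace X" "F (U, V) y < 1" for y
    proof (rule ccontr)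
      assume "y \<notin> W"
      then have "F (U, V) y \<in> F (U, V) ` (topspace X - snd (U, V))" using that V(3) by auto
      then show False using F(3)[OF p] that(2) by auto
    qed
    ultimately show ?thesis using p by (intro bexI[of _ "(U, V)"]) auto
  qed
  have cont: "continuous_map X P e"
    unfolding P_def continuous_map_componentwise e_def using F(1) by (auto simp: image_iff)
  have inj: "inj_on e (topspace X)"
  proof (rule inj_onI, rule ccontr)
    fix x y assume xy: "x \<in> topspace X" "y \<in> topspace X" "e x = e y" "x \<noteq> y"
    then obtain W where W: "openin X W" "x \<in> W" "y \<notin> W"
      using assms(2) unfolding Hausdorff_space_def by (metis disjnt_iff)
    obtain p where "p \<in> I" "F p x < 1" "F p y < 1 \<longrightarrow> y \<in> W" using sep[OF W(1,2)] xy(2) by auto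
    moreover have "F p x = F p y" if "p \<in> I" for p
      using fun_cong[OF xy(3), of p] that by (simp add: e_def)
    ultimately show False using W(3) by auto
  qed
  have "open_map X (subtopology P (e ` topspace X)) e"
    unfolding open_map_def
  proof (intro allI impI)
    fix W assume W: "openin X W"
    show "openin (subtopology P (e ` topspace X)) (e ` W)"
    proof (subst openin_subopen, intro ballI)
      fix y assume "y \<in> e ` W"
      then obtain x where x: "x \<in> W" "y = e x" by auto
      have xX: "x \<in> topspace X" using x W openin_subset by blast
      obtain p where p: "p \<in> I" "F p x < 1" "\<And>y. y \<in> topspace X \<Longrightarrow> F p y < 1 \<Longrightarrow> y \<in> W"
        using sep[OF W x(1)] by auto
      let ?G = "{g \<in> topspace P. g p \<in> {..<1}}"
      have "openin P ?G"
        by (rule openin_continuous_map_preimage[where Y=euclideanreal])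
          (use continuous_map_product_projection[OF p(1), of "\<lambda>_. euclideanreal"] in \<open>auto simp: P_def\<close>)
      then have "openin (subtopology P (e ` topspace X)) (?G \<inter> e ` topspace X)"
        by (auto simp: openin_subtopology)
      moreover have "y \<in> ?G \<inter> e ` topspace X"
        using x xX p cont by (auto simp: e_def continuous_map_def Pi_iff)
      moreover have "?G \<inter> e ` topspace X \<subseteq> e ` W" using p by (auto simp: e_def)
      ultimately show "\<exists>T. openin (subtopology P (e ` topspace X)) T \<and> y \<in> T \<and> T \<subseteq> e ` W" by blast
    qed
  qed
  then have "homeomorphic_map X (subtopology P (e ` topspace X)) e"
    using cont inj by (intro bijective_open_imp_homeomorphic_map)
      (auto simp: continuous_map_in_subtopology topspace_subtopology continuous_map_image_subset_topspace Int_absorb1)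
  then have hom: "X homeomorphic_space subtopology P (e ` topspace X)"
    using homeomorphic_map_imp_homeomorphic_space by blast
  have "countable I" by (rule countable_subset[of _ "\<B> \<times> \<B>"]) (use \<B>(1) in \<open>auto simp: I_def\<close>)
  then have "metrizable_space P"
    unfolding P_def metrizable_space_product_topology
    by (auto simp: metrizable_space_euclidean intro: countable_subset[of _ I])
  then show ?thesis
    using hom homeomorphic_metrizable_space metrizable_space_subtopology by blast
qed

text \<open>Charts carry local compactness over from Euclidean space; together with the Hausdorff
  property this gives regularity, and the second axiom of countability does the rest.\<close>

lemma smooth_manifold_metrizable:
  assumes "smooth_manifold X"
  shows "metrizable_space (top_of X)" "second_countable (top_of X)"
proof -
  have H: "Hausdorff_space (top_of X)" and S: "second_countable (top_of X)"
    using assms by (auto simp: smooth_manifold_def)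
  have "locally_compact_space (top_of X)"
    unfolding locally_compact_space_def
  proof
    fix x assume "x \<in> topspace (top_of X)"
    then obtain U \<phi> where c: "(U, \<phi>) \<in> charts_of X" "x \<in> U"
      using assms unfolding smooth_manifold_def by blast
    then have U: "openin (top_of X) U" "openin (Euclidean_space (dim_of X)) (\<phi> ` U)"
      "homeomorphic_map (subtopology (top_of X) U) (subtopology (Euclidean_space (dim_of X)) (\<phi> ` U)) \<phi>"
      using assms unfolding smooth_manifold_def is_chart_def by auto
    have "locally_compact_space (subtopology (Euclidean_space (dim_of X)) (\<phi> ` U))"
      by (rule locally_compact_space_open_subset)
        (use U(2) in \<open>auto simp: locally_compact_Euclidean_space Hausdorff_Euclidean_space\<close>)
    then have "locally_compact_space (subtopology (top_of X) U)"
      using U(3) homeomorphic_locally_compact_space homeomorphic_map_imp_homeomorphic_space by blast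
    moreover have "x \<in> topspace (subtopology (top_of X) U)" using c(2) openin_subset[OF U(1)] by auto
    ultimately obtain V C where "openin (subtopology (top_of X) U) V" "compactin (subtopology (top_of X) U) C" "x \<in> V" "V \<subseteq> C"
      unfolding locally_compact_space_def by blast
    then show "\<exists>U K. openin (top_of X) U \<and> compactin (top_of X) K \<and> x \<in> U \<and> U \<subseteq> K"
      using U(1) by (meson compactin_subtopology openin_trans_full)
  qed
  then have "regular_space (top_of X)"
    using H locally_compact_Hausdorff_imp_regular_space by blast
  then show "metrizable_space (top_of X)" "second_countable (top_of X)"
    using regular_second_countable_imp_metrizable H S by auto
qed

section \<open>Right-continuous paths with left limits\<close>

text \<open>The path condition freed from extensionality and from the interval starting at 0, so
  that paths can be cut, glued, moved by the group and compared in a subspace.\<close>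

definition rcll_on :: "real \<Rightarrow> real \<Rightarrow> 'a topology \<Rightarrow> (real \<Rightarrow> 'a) \<Rightarrow> bool" where
  "rcll_on a b E w \<longleftrightarrow> (\<forall>t\<in>{a..b}. w t \<in> topspace E) \<and>
     (\<forall>t\<in>{a..<b}. limitin E w (w t) (at_right t)) \<and> (\<forall>t\<in>{a<..b}. \<exists>l. limitin E w l (at_left t))"

lemma rcll_paths_iff: "w \<in> rcll_paths T E \<longleftrightarrow> w \<in> extensional {0..T} \<and> rcll_on 0 T E w"
  unfolding rcll_paths_def rcll_on_def by (auto simp: PiE_iff)

lemma limitin_at_right_cong:
  assumes "a < (b::real)" "\<And>s. a < s \<Longrightarrow> s < b \<Longrightarrow> f s = g s"
  shows "limitin E f l (at_right a) \<longleftrightarrow> limitin E g l (at_right a)"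
proof -
  have "\<forall>\<^sub>F s in at_right a. f s = g s" "\<forall>\<^sub>F s in at_right a. g s = f s"
    unfolding eventually_at_right_field using assms by metis+
  from this[THEN limitin_transform_eventually] show ?thesis by blast
qed

lemma limitin_at_left_cong:
  assumes "b < (a::real)" "\<And>s. b < s \<Longrightarrow> s < a \<Longrightarrow> f s = g s"
  shows "limitin E f l (at_left a) \<longleftrightarrow> limitin E g l (at_left a)"
proof -
  have "\<forall>\<^sub>F s in at_left a. f s = g s" "\<forall>\<^sub>F s in at_left a. g s = f s"
    unfolding eventually_at_left_field using assms by metis+
  from this[THEN limitin_transform_eventually] show ?thesis by blast
qed

lemma rcll_on_cong:
  assumes "\<And>t. t \<in> {a..b} \<Longrightarrow> v t = w t"
  shows "rcll_on a b E v \<longleftrightarrow> rcll_on a b E w"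
proof -
  have 1: "limitin E v (v t) (at_right t) = limitin E w (w t) (at_right t)" if "t \<in> {a..<b}" for t
    using limitin_at_right_cong[of t b v w E "w t"] assms that by auto
  have 2: "limitin E v l (at_left t) = limitin E w l (at_left t)" if "t \<in> {a<..b}" for t l
    using limitin_at_left_cong[of a t v w E l] assms that by auto
  show ?thesis unfolding rcll_on_def using 1 2 assms by auto
qed

lemma rcll_on_subinterval: "rcll_on a b E w \<Longrightarrow> a \<le> a' \<Longrightarrow> b' \<le> b \<Longrightarrow> rcll_on a' b' E w"
  unfolding rcll_on_def by auto

lemma rcll_on_compose:
  assumes "rcll_on a b E w" "continuous_map E E' f"
  shows "rcll_on a b E' (\<lambda>t. f (w t))"
  unfolding rcll_on_def
proof (intro conjI ballI)
  show "f (w t) \<in> topspace E'" if "t \<in> {a..b}" for t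
    using assms that unfolding rcll_on_def continuous_map_def by auto
  show "limitin E' (\<lambda>t. f (w t)) (f (w t)) (at_right t)" if "t \<in> {a..<b}" for t
  proof -
    have "limitin E w (w t) (at_right t)" using assms(1) that unfolding rcll_on_def by blast
    then have "limitin E' (f \<circ> w) (f (w t)) (at_right t)" by (rule continuous_map_limit[OF assms(2)])
    then show ?thesis by (auto simp: comp_def)
  qed
  show "\<exists>l. limitin E' (\<lambda>t. f (w t)) l (at_left t)" if t: "t \<in> {a<..b}" for t
  proof -
    obtain l where "limitin E w l (at_left t)" using assms(1) t unfolding rcll_on_def by blast
    then have "limitin E' (f \<circ> w) (f l) (at_left t)" by (rule continuous_map_limit[OF assms(2)])
    then show ?thesis by (auto simp: comp_def)
  qed
qed

text \<open>Stands in for relative compactness of the range of an rcll path. Bisection reduces the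
  claim to a neighbourhood of one time: on the left the left limit lies in some \<open>V n\<close>,
  on the right the value itself does, and the larger index serves for both sides.\<close>

lemma rcll_on_exhaustion:
  assumes w: "rcll_on a b E w" and V: "incseq V" "\<And>n::nat. openin E (V n)" "(\<Union>n. V n) = topspace E"
    and ab: "a \<le> b"
  shows "\<exists>n. \<forall>t\<in>{a..b}. w t \<in> V n"
proof -
  have "c \<in> {a..b} \<and> e \<in> {a..b} \<longrightarrow> (\<exists>n. \<forall>t\<in>{c..e}. w t \<in> V n)" if "c = a" "e = b" for c e
  proof -
    have "a \<le> b" by fact
    then have "a \<in> {a..b} \<and> b \<in> {a..b} \<longrightarrow> (\<exists>n. \<forall>t\<in>{a..b}. w t \<in> V n)"
    proof (induction rule: Bolzano[where P="\<lambda>c e. c \<in> {a..b} \<and> e \<in> {a..b} \<longrightarrow> (\<exists>n. \<forall>t\<in>{c..e}. w t \<in> V n)"])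
      case (trans c e g)
      show ?case
      proof
        assume *: "c \<in> {a..b} \<and> g \<in> {a..b}"
        then obtain m n where "\<forall>t\<in>{c..e}. w t \<in> V m" "\<forall>t\<in>{e..g}. w t \<in> V n"
          using trans by auto
        moreover have "V m \<subseteq> V (max m n)" "V n \<subseteq> V (max m n)" using V(1) by (auto simp: incseq_def)
        ultimately have "\<forall>t\<in>{c..g}. w t \<in> V (max m n)" by (metis atLeastAtMost_iff linear subsetD)
        then show "\<exists>n. \<forall>t\<in>{c..g}. w t \<in> V n" by blast
      qed
    next
      case (local x)
      have l: "\<exists>d>0. \<exists>n. \<forall>s\<in>{a..b}. x - d < s \<and> s < x \<longrightarrow> w s \<in> V n"
      proof (cases "a < x")
        case True
        then have "x \<in> {a<..b}" using local by simp
        then obtain l where l: "limitin E w l (at_left x)" using w unfolding rcll_on_def by blast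
        obtain n where n: "l \<in> V n" using V(3) limitin_topspace[OF l] by auto
        obtain e where "e < x" "\<forall>y>e. y < x \<longrightarrow> w y \<in> V n"
          using limitinD[OF l V(2) n] unfolding eventually_at_left_field by auto
        then show ?thesis by (intro exI[of _ "x - e"]) auto
      next
        case False then show ?thesis by (intro exI[of _ 1]) auto
      qed
      have r: "\<exists>d>0. \<exists>n. \<forall>s\<in>{a..b}. x \<le> s \<and> s < x + d \<longrightarrow> w s \<in> V n"
      proof (cases "x < b")
        case True
        then have lim: "limitin E w (w x) (at_right x)" using w local unfolding rcll_on_def by auto
        obtain n where n: "w x \<in> V n" using V(3) limitin_topspace[OF lim] by auto
        obtain e where e: "e > x" "\<forall>y>x. y < e \<longrightarrow> w y \<in> V n"
          using limitinD[OF lim V(2) n] unfolding eventually_at_right_field by auto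
        have "w s \<in> V n" if "x \<le> s" "s < e" for s using e n that by (cases "s = x") auto
        then show ?thesis using e(1) by (intro exI[of _ "e - x"]) auto
      next
        case False
        then have "x = b" using local by simp
        moreover obtain n where "w b \<in> V n" using w ab V(3) unfolding rcll_on_def by (metis UN_E atLeastAtMost_iff order_refl)
        ultimately show ?thesis by (intro exI[of _ 1] conjI exI[of _ n]) auto
      qed
      obtain d n where dn: "d > 0" "\<forall>s\<in>{a..b}. x - d < s \<and> s < x \<longrightarrow> w s \<in> V n" using l by blast
      obtain d' n' where dn': "d' > 0" "\<forall>s\<in>{a..b}. x \<le> s \<and> s < x + d' \<longrightarrow> w s \<in> V n'" using r by blast
      have mono: "V n \<subseteq> V (max n n')" "V n' \<subseteq> V (max n n')" using V(1) by (auto simp: incseq_def)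
      show ?case
      proof (intro exI[of _ "min d d'"] conjI allI impI)
        fix c e assume ce: "c \<le> x \<and> x \<le> e \<and> e - c < min d d'" "c \<in> {a..b} \<and> e \<in> {a..b}"
        have "w t \<in> V (max n n')" if "t \<in> {c..e}" for t
        proof (cases "t < x")
          case True then show ?thesis using dn(2)[rule_format, of t] ce that mono by auto
        next
          case False then show ?thesis using dn'(2)[rule_format, of t] ce that mono by auto
        qed
        then show "\<exists>n. \<forall>t\<in>{c..e}. w t \<in> V n" by blast
      qed (use dn dn' in auto)
    qed
    then show ?thesis using that by simp
  qed
  then show ?thesis using ab by auto
qed

lemma strict_mono_on_interval_endpoints:
  fixes f :: "real \<Rightarrow> real"
  assumes "strict_mono_on {a..b} f" "f ` {a..b} = {c..e}" "a \<le> b"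
  shows "f a = c" "f b = e"
proof -
  have m: "f x \<le> f y" if "x \<in> {a..b}" "y \<in> {a..b}" "x \<le> y" for x y
    using strict_mono_onD[OF assms(1), of x y] that by (cases "x = y") auto
  have "f a \<in> {c..e}" "f b \<in> {c..e}" using assms(2,3) by auto
  then have "c \<in> f ` {a..b}" "e \<in> f ` {a..b}" using assms(2) by auto
  then obtain x y where "x \<in> {a..b}" "c = f x" "y \<in> {a..b}" "e = f y" by auto
  then show "f a = c" "f b = e" using m[of a x] m[of y b] \<open>f a \<in> {c..e}\<close> \<open>f b \<in> {c..e}\<close> assms(3) by auto
qed

text \<open>Monotone surjections match endpoints, so both pieces take the value \<open>b'\<close> at
  \<open>b\<close>. This is how time changes of adjacent intervals are joined.\<close>

lemma strict_mono_on_glue: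
  fixes f g :: "real \<Rightarrow> real"
  assumes f: "strict_mono_on {a..b} f" "f ` {a..b} = {a'..b'}" and g: "strict_mono_on {b..c} g" "g ` {b..c} = {b'..c'}"
    and le: "a \<le> b" "b \<le> c"
  defines "h \<equiv> \<lambda>t. if t \<le> b then f t else g t"
  shows "strict_mono_on {a..c} h" "h ` {a..c} = {a'..c'}"
proof -
  note ef = strict_mono_on_interval_endpoints[OF f le(1)] and eg = strict_mono_on_interval_endpoints[OF g le(2)]
  have h1: "h t = f t" if "t \<in> {a..b}" for t using that by (simp add: h_def)
  have h2: "h t = g t" if "t \<in> {b..c}" for t using that ef eg by (auto simp: h_def)
  show "strict_mono_on {a..c} h"
  proof (rule strict_mono_onI)
    fix r s assume rs: "r \<in> {a..c}" "s \<in> {a..c}" "r < s"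
    consider "s \<le> b" | "r \<ge> b" | "r < b" "b < s" by linarith
    then show "h r < h s"
    proof cases
      case 1 then show ?thesis using strict_mono_onD[OF f(1)] rs h1 by auto
    next
      case 2 then show ?thesis using strict_mono_onD[OF g(1)] rs h2 by auto
    next
      case 3
      then have "h r < b'" "b' < h s"
        using strict_mono_onD[OF f(1), of r b] strict_mono_onD[OF g(1), of b s] rs h1 h2 ef eg le by auto
      then show ?thesis by simp
    qed
  qed
  have "a' \<le> b'" "b' \<le> c'" using f(2) g(2) le by (metis atLeastatMost_empty_iff image_is_empty)+
  moreover have "{a..c} = {a..b} \<union> {b..c}" using le by auto
  moreover have "h ` {a..b} = f ` {a..b}" "h ` {b..c} = g ` {b..c}" using h1 h2 by (auto intro!: image_cong)
  ultimately have "a' \<le> b'" "b' \<le> c'" "h ` {a..c} = f ` {a..b} \<union> g ` {b..c}" by (auto simp: image_Un)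
  then show "h ` {a..c} = {a'..c'}" using f(2) g(2) by auto
qed

section \<open>The Skorohod metric, some of its open sets, and the evaluation maps\<close>

definition skor_le :: "real \<Rightarrow> ('a \<Rightarrow> 'a \<Rightarrow> real) \<Rightarrow> (real \<Rightarrow> 'a) \<Rightarrow> (real \<Rightarrow> 'a) \<Rightarrow> real \<Rightarrow> bool" where
  "skor_le T d v w r \<longleftrightarrow> 0 \<le> r \<and> (\<exists>\<tau>. strict_mono_on {0..T} \<tau> \<and> \<tau> ` {0..T} = {0..T} \<and>
     (\<forall>t\<in>{0..T}. \<bar>\<tau> t - t\<bar> \<le> r \<and> d (v t) (w (\<tau> t)) \<le> r))"

locale path_space =
  fixes T :: real and E :: "'a topology"
  assumes T_pos: "0 < T" and metrizable: "metrizable_space E" and second_countable: "second_countable E"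
begin

abbreviation d where "d \<equiv> compatible_metric E"
abbreviation D where "D \<equiv> rcll_paths T E"
abbreviation sk where "sk \<equiv> skorohod_dist T E"

lemma Metric_d: "Metric_space (topspace E) d" and mtopology_d: "Metric_space.mtopology (topspace E) d = E"
proof -
  obtain M d' where "Metric_space M d'" "E = Metric_space.mtopology M d'"
    using metrizable unfolding metrizable_space_def by auto
  then have "\<exists>d'. Metric_space (topspace E) d' \<and> Metric_space.mtopology (topspace E) d' = E"
    by (metis Metric_space.topspace_mtopology)
  from someI_ex[OF this] show "Metric_space (topspace E) d" "Metric_space.mtopology (topspace E) d = E"
    unfolding compatible_metric_def by auto
qed

interpretation E: Metric_space "topspace E" d by (rule Metric_d)

lemma openin_ball: "x \<in> topspace E \<Longrightarrow> openin E (E.mball x r)"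
  using E.openin_mball[of x r] mtopology_d by simp

lemma open_ball_inside:
  assumes "openin E V" "x \<in> V" shows "\<exists>e>0. E.mball x e \<subseteq> V"
proof -
  have "openin E.mtopology V" using assms(1) mtopology_d by simp
  then show ?thesis unfolding E.openin_mtopology using assms(2) by blast
qed

lemma limit_right: "w \<in> D \<Longrightarrow> 0 \<le> t \<Longrightarrow> t < T \<Longrightarrow> limitin E w (w t) (at_right t)"
  by (auto simp: rcll_paths_def)

lemma in_space: "w \<in> D \<Longrightarrow> 0 \<le> t \<Longrightarrow> t \<le> T \<Longrightarrow> w t \<in> topspace E"
  by (auto simp: rcll_paths_def PiE_iff)

lemma right_ball:
  assumes "w \<in> D" "0 \<le> t" "t < T" "e > 0"
  shows "\<exists>u>t. u \<le> T \<and> (\<forall>s. t \<le> s \<and> s < u \<longrightarrow> d (w t) (w s) < e)"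
proof -
  have "\<forall>\<^sub>F s in at_right t. w s \<in> E.mball (w t) e"
    using limit_right[OF assms(1-3)] openin_ball in_space[OF assms(1,2)] assms(3,4)
    unfolding limitin_def by (metis E.centre_in_mball_iff less_imp_le)
  then obtain u where u: "u > t" "\<And>s. s > t \<Longrightarrow> s < u \<Longrightarrow> w s \<in> E.mball (w t) e"
    unfolding eventually_at_right_field by auto
  have "d (w t) (w s) < e" if "t \<le> s" "s < u" for s
    using u(2)[of s] that in_space[OF assms(1,2)] assms(3,4) by (cases "s = t") auto
  then show ?thesis using u(1) assms(3) by (intro exI[of _ "min u T"]) auto
qed

text \<open>The left limit in Cauchy form: what is used later is the small oscillation to the left
  of \<open>t\<close>, not the limit itself.\<close>

lemma left_ball:
  assumes "w \<in> D" "0 < t" "t \<le> T" "e > 0"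
  shows "\<exists>u<t. 0 \<le> u \<and> (\<forall>s s'. u < s \<and> s < t \<and> u < s' \<and> s' < t \<longrightarrow> d (w s) (w s') < e)"
proof -
  have "t \<in> {0<..T}" using assms by simp
  then obtain l where l: "limitin E w l (at_left t)" using assms(1) unfolding rcll_paths_def by blast
  then have lE: "l \<in> topspace E" by (rule limitin_topspace)
  have "\<forall>\<^sub>F s in at_left t. w s \<in> E.mball l (e/2)"
    using l openin_ball[OF lE] lE assms(4) unfolding limitin_def by (metis E.centre_in_mball_iff half_gt_zero)
  then obtain u where u: "u < t" "\<And>s. s > u \<Longrightarrow> s < t \<Longrightarrow> w s \<in> E.mball l (e/2)"
    unfolding eventually_at_left_field by auto
  have "d (w s) (w s') < e" if "u < s" "s < t" "u < s'" "s' < t" for s s'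
  proof -
    have "d l (w s) < e/2" "d l (w s') < e/2" "w s \<in> topspace E" "w s' \<in> topspace E"
      using u(2)[of s] u(2)[of s'] that by auto
    then show ?thesis using E.triangle''[of "w s" l "w s'"] lE by linarith
  qed
  then show ?thesis using u(1) assms(2) by (intro exI[of _ "max u 0"]) auto
qed

lemma skor_dist_eq: "v \<in> D \<Longrightarrow> w \<in> D \<Longrightarrow> sk v w = Inf {r. skor_le T d v w r}"
  by (simp add: skorohod_dist_def skor_le_def)

text \<open>Balls around one point exhaust \<open>E\<close>, so both paths are bounded. Hence the
  identity time change admits some radius, and the infimum defining the distance is taken over a
  nonempty set.\<close>

lemma bounded_pair:
  assumes "v \<in> D" "w \<in> D" shows "\<exists>r. \<forall>t\<in>{0..T}. d (v t) (w t) \<le> r"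
proof -
  obtain x where x: "x \<in> topspace E" using in_space[OF assms(1), of 0] T_pos by auto
  define V where "V n = E.mball x (real n)" for n
  have V: "incseq V" "\<And>n. openin E (V n)" "(\<Union>n. V n) = topspace E"
  proof -
    show "incseq V" unfolding V_def incseq_def by auto
    show "openin E (V n)" for n unfolding V_def by (rule openin_ball[OF x])
    show "(\<Union>n. V n) = topspace E" unfolding V_def using x reals_Archimedean2 by auto
  qed
  have "rcll_on 0 T E v" "rcll_on 0 T E w" using assms by (auto simp: rcll_paths_iff)
  from this[THEN rcll_on_exhaustion[OF _ V]] obtain m n where
    mn: "\<forall>t\<in>{0..T}. v t \<in> V m" "\<forall>t\<in>{0..T}. w t \<in> V n" using T_pos by (meson less_imp_le)
  have "d (v t) (w t) \<le> real m + real n" if "t \<in> {0..T}" for t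
  proof -
    have "d x (v t) < real m" "d x (w t) < real n" "v t \<in> topspace E" "w t \<in> topspace E"
      using mn that unfolding V_def by auto
    then show ?thesis using E.triangle''[of "v t" x "w t"] x by linarith
  qed
  then show ?thesis by blast
qed

lemma skor_leI_id:
  assumes "0 \<le> r" "\<And>t. t \<in> {0..T} \<Longrightarrow> d (v t) (w t) \<le> r"
  shows "skor_le T d v w r"
  unfolding skor_le_def using assms by (intro conjI exI[of _ "\<lambda>t. t"]) (auto intro: strict_mono_onI)

lemma skor_le_exists: assumes "v \<in> D" "w \<in> D" shows "\<exists>r. skor_le T d v w r"
proof -
  obtain r where "\<forall>t\<in>{0..T}. d (v t) (w t) \<le> r" using bounded_pair[OF assms] by auto
  moreover from this have "d (v 0) (w 0) \<le> r" using T_pos by simp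
  then have "0 \<le> r" using E.nonneg[of "v 0" "w 0"] by linarith
  ultimately show ?thesis using skor_leI_id by blast
qed

lemma skor_le_bdd: "bdd_below {r. skor_le T d v w r}"
  by (rule bdd_belowI[of _ 0]) (auto simp: skor_le_def)

lemma skor_le_mono: "skor_le T d v w r \<Longrightarrow> r \<le> r' \<Longrightarrow> skor_le T d v w r'"
  unfolding skor_le_def by (meson order_trans)

lemma skor_le_imp: "v \<in> D \<Longrightarrow> w \<in> D \<Longrightarrow> skor_le T d v w r \<Longrightarrow> sk v w \<le> r"
  using skor_le_bdd by (auto simp: skor_dist_eq intro: cInf_lower)

text \<open>The infimum need not be attained, hence the strict inequality.\<close>

lemma skor_less_imp: assumes "v \<in> D" "w \<in> D" "sk v w < r" shows "skor_le T d v w r"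
proof -
  have "{r. skor_le T d v w r} \<noteq> {}" using skor_le_exists[OF assms(1,2)] by auto
  from cInf_lessD[OF this] assms obtain r' where "skor_le T d v w r'" "r' < r" by (auto simp: skor_dist_eq)
  then show ?thesis using skor_le_mono by (meson less_imp_le)
qed

text \<open>The inverse time change works with the same radius.\<close>

lemma skor_le_sym: assumes "skor_le T d v w r" shows "skor_le T d w v r"
proof -
  obtain \<tau> where t: "0 \<le> r" "strict_mono_on {0..T} \<tau>" "\<tau> ` {0..T} = {0..T}"
    "\<And>t. t \<in> {0..T} \<Longrightarrow> \<bar>\<tau> t - t\<bar> \<le> r \<and> d (v t) (w (\<tau> t)) \<le> r"
    using assms unfolding skor_le_def by auto
  define \<sigma> where "\<sigma> = inv_into {0..T} \<tau>"
  have inj: "inj_on \<tau> {0..T}" using strict_mono_on_imp_inj_on[OF t(2)] .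
  have \<sigma>: "\<sigma> s \<in> {0..T}" "\<tau> (\<sigma> s) = s" if "s \<in> {0..T}" for s
    using that t(3) inv_into_into[of s \<tau> "{0..T}"] f_inv_into_f[of s \<tau> "{0..T}"] by (simp_all add: \<sigma>_def)
  have \<sigma>\<tau>: "\<sigma> (\<tau> s) = s" if "s \<in> {0..T}" for s
    using that inj by (simp add: \<sigma>_def)
  show ?thesis unfolding skor_le_def
  proof (intro conjI exI[of _ \<sigma>] ballI)
    show "0 \<le> r" by fact
    show "strict_mono_on {0..T} \<sigma>"
    proof (rule strict_mono_onI, rule ccontr)
      fix a b assume ab: "a \<in> {0..T}" "b \<in> {0..T}" "a < b" "\<not> \<sigma> a < \<sigma> b"
      then have "\<tau> (\<sigma> b) \<le> \<tau> (\<sigma> a)"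
        using strict_mono_onD[OF t(2) \<sigma>(1)[OF ab(2)] \<sigma>(1)[OF ab(1)]] by (cases "\<sigma> b = \<sigma> a") auto
      then show False using ab \<sigma> by auto
    qed
    show "\<sigma> ` {0..T} = {0..T}"
    proof
      show "\<sigma> ` {0..T} \<subseteq> {0..T}" using \<sigma>(1) by blast
      show "{0..T} \<subseteq> \<sigma> ` {0..T}"
      proof
        fix s assume s: "s \<in> {0..T}"
        then have "\<tau> s \<in> {0..T}" using t(3) by blast
        then show "s \<in> \<sigma> ` {0..T}" using \<sigma>\<tau>[OF s] by (metis image_eqI)
      qed
    qed
    fix s assume s: "s \<in> {0..T}"
    show "\<bar>\<sigma> s - s\<bar> \<le> r" using t(4)[OF \<sigma>(1)[OF s]] \<sigma>(2)[OF s] by (simp add: abs_minus_commute)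
    show "d (w s) (v (\<sigma> s)) \<le> r" using t(4)[OF \<sigma>(1)[OF s]] \<sigma>(2)[OF s] by (simp add: E.commute)
  qed
qed

text \<open>Compose the two time changes; displacements and distances add up.\<close>

lemma skor_le_trans:
  assumes D: "u \<in> D" "v \<in> D" "w \<in> D" and uv: "skor_le T d u v r" and vw: "skor_le T d v w r'"
  shows "skor_le T d u w (r + r')"
proof -
  obtain \<tau> where t: "0 \<le> r" "strict_mono_on {0..T} \<tau>" "\<tau> ` {0..T} = {0..T}"
    "\<And>t. t \<in> {0..T} \<Longrightarrow> \<bar>\<tau> t - t\<bar> \<le> r \<and> d (u t) (v (\<tau> t)) \<le> r"
    using uv unfolding skor_le_def by auto
  obtain \<sigma> where s: "0 \<le> r'" "strict_mono_on {0..T} \<sigma>" "\<sigma> ` {0..T} = {0..T}"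
    "\<And>t. t \<in> {0..T} \<Longrightarrow> \<bar>\<sigma> t - t\<bar> \<le> r' \<and> d (v t) (w (\<sigma> t)) \<le> r'"
    using vw unfolding skor_le_def by auto
  have \<tau>T: "\<tau> x \<in> {0..T}" if "x \<in> {0..T}" for x using t(3) that by blast
  have \<sigma>T: "\<sigma> x \<in> {0..T}" if "x \<in> {0..T}" for x using s(3) that by blast
  show ?thesis unfolding skor_le_def
  proof (intro conjI exI[of _ "\<lambda>x. \<sigma> (\<tau> x)"] ballI)
    show "0 \<le> r + r'" using t s by simp
    show "strict_mono_on {0..T} (\<lambda>x. \<sigma> (\<tau> x))"
      using \<tau>T by (intro strict_mono_onI strict_mono_onD[OF s(2)] strict_mono_onD[OF t(2)])
    show "(\<lambda>x. \<sigma> (\<tau> x)) ` {0..T} = {0..T}" using t(3) s(3) by (simp add: image_image[symmetric])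
    fix x assume x: "x \<in> {0..T}"
    show "\<bar>\<sigma> (\<tau> x) - x\<bar> \<le> r + r'" using t(4)[OF x] s(4)[OF \<tau>T[OF x]] by linarith
    have "u x \<in> topspace E" "v (\<tau> x) \<in> topspace E" "w (\<sigma> (\<tau> x)) \<in> topspace E"
      using D x \<tau>T[OF x] \<sigma>T[OF \<tau>T[OF x]] in_space by auto
    then show "d (u x) (w (\<sigma> (\<tau> x))) \<le> r + r'"
      using E.triangle[of "u x" "v (\<tau> x)" "w (\<sigma> (\<tau> x))"] t(4)[OF x] s(4)[OF \<tau>T[OF x]] by linarith
  qed
qed

text \<open>A time change may move \<open>t\<close> to the wrong side of a jump, so the values are
  compared at a time slightly to the right of \<open>t\<close>, where both paths are still close to
  their values at \<open>t\<close>. At \<open>T\<close> there is no such time, but every time change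
  fixes \<open>T\<close>.\<close>

lemma skor_zero_imp:
  assumes D: "v \<in> D" "w \<in> D" and 0: "sk v w = 0" shows "v = w"
proof
  fix t
  show "v t = w t"
  proof (cases "t \<in> {0..T}")
    case False
    then show ?thesis using D by (auto simp: rcll_paths_def PiE_iff extensional_def)
  next
    case True
    then have vw: "v t \<in> topspace E" "w t \<in> topspace E" using D in_space by auto
    have small: "skor_le T d v w r" if "r > 0" for r using skor_less_imp[OF D] 0 that by simp
    have "d (v t) (w t) \<le> e" if e: "e > 0" for e
    proof (cases "t = T")
      case T: True
      obtain \<tau> where \<tau>: "strict_mono_on {0..T} \<tau>" "\<tau> ` {0..T} = {0..T}"
        "\<And>t. t \<in> {0..T} \<Longrightarrow> d (v t) (w (\<tau> t)) \<le> e"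
        using small[OF e] unfolding skor_le_def by auto
      have "\<tau> T = T" using strict_mono_on_interval_endpoints[OF \<tau>(1,2)] T_pos by simp
      then show ?thesis using \<tau>(3)[of T] T T_pos by simp
    next
      case False
      then have t: "0 \<le> t" "t < T" using True by auto
      obtain a where a: "a > t" "a \<le> T" "\<And>s. t \<le> s \<Longrightarrow> s < a \<Longrightarrow> d (v t) (v s) < e/3"
        using right_ball[OF D(1) t, of "e/3"] e by auto
      obtain b where b: "b > t" "b \<le> T" "\<And>s. t \<le> s \<Longrightarrow> s < b \<Longrightarrow> d (w t) (w s) < e/3"
        using right_ball[OF D(2) t, of "e/3"] e by auto
      \<comment> \<open>\<open>s\<close> lies well inside the interval on which both paths are
        nearly constant, and the radius \<open>r\<close> chosen below is too small for the time
        change to carry \<open>s\<close> out of it.\<close>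
      define s where "s = (t + min a b) / 2"
      have s: "t < s" "s < a" "s < b" using a b by (auto simp: s_def)
      define r where "r = min (e/3) (min ((s - t) / 2) ((b - s) / 2))"
      have "r > 0" using e s by (simp add: r_def)
      moreover have "r \<le> e/3" unfolding r_def by (rule min.cobounded1)
      moreover have "r \<le> (s - t) / 2" unfolding r_def by (rule min.coboundedI2[OF min.cobounded1])
      moreover have "r \<le> (b - s) / 2" unfolding r_def by (rule min.coboundedI2[OF min.cobounded2])
      ultimately have r: "r > 0" "r \<le> e/3" "r < s - t" "r < b - s" using s by auto
      obtain \<tau> where \<tau>: "\<tau> ` {0..T} = {0..T}"
        "\<And>t. t \<in> {0..T} \<Longrightarrow> \<bar>\<tau> t - t\<bar> \<le> r \<and> d (v t) (w (\<tau> t)) \<le> r"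
        using small[OF r(1)] unfolding skor_le_def by auto
      have sT: "s \<in> {0..T}" using s t a by auto
      have \<tau>s: "t \<le> \<tau> s" "\<tau> s < b" "\<tau> s \<in> {0..T}" using \<tau>(2)[OF sT] r \<tau>(1) sT by auto
      have "d (v t) (v s) < e/3" "d (v s) (w (\<tau> s)) \<le> e/3" "d (w t) (w (\<tau> s)) < e/3"
        using a(3)[of s] b(3)[OF \<tau>s(1,2)] \<tau>(2)[OF sT] s r by auto
      moreover have "v s \<in> topspace E" "w (\<tau> s) \<in> topspace E" using D sT \<tau>s(3) in_space by auto
      ultimately show ?thesis
        using E.triangle[of "v t" "v s" "w t"] E.triangle'[of "v s" "w (\<tau> s)" "w t"] vw by linarith
    qed
    then have "d (v t) (w t) \<le> 0" by (rule dense_ge)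
    then show ?thesis using vw E.nonneg[of "v t" "w t"] E.zero[OF vw] by linarith
  qed
qed

lemma Metric_sk: "Metric_space D sk"
proof
  fix v w
  show nn: "0 \<le> sk v w"
  proof (cases "v \<in> D \<and> w \<in> D")
    case True
    then have "{r. skor_le T d v w r} \<noteq> {}" using skor_le_exists by auto
    then have "0 \<le> Inf {r. skor_le T d v w r}" by (rule cInf_greatest) (auto simp: skor_le_def)
    then show ?thesis using True by (simp add: skor_dist_eq)
  qed (auto simp: skorohod_dist_def)
  show "sk v w = sk w v"
  proof (cases "v \<in> D \<and> w \<in> D")
    case True
    have "skor_le T d v w r = skor_le T d w v r" for r by (rule iffI; erule skor_le_sym)
    then show ?thesis using True by (simp add: skor_dist_eq)
  qed (auto simp: skorohod_dist_def)
  show "sk v w = 0 \<longleftrightarrow> v = w" if vw: "v \<in> D" "w \<in> D"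
  proof
    show "v = w" if "sk v w = 0" using skor_zero_imp vw that by blast
    assume "v = w"
    then have "skor_le T d v w 0" using vw in_space by (intro skor_leI_id) auto
    then have "sk v w \<le> 0" using skor_le_imp vw by blast
    then show "sk v w = 0" using nn by simp
  qed
  show "sk v w \<le> sk v u + sk u w" if vw: "v \<in> D" "u \<in> D" "w \<in> D" for u
  proof (rule field_le_epsilon)
    fix e :: real assume "e > 0"
    then have "skor_le T d v u (sk v u + e/2)" "skor_le T d u w (sk u w + e/2)"
      using skor_less_imp vw by auto
    from skor_le_trans[OF vw this] have "sk v w \<le> (sk v u + e/2) + (sk u w + e/2)"
      using skor_le_imp vw by blast
    then show "sk v w \<le> sk v u + sk u w + e" by simp
  qed
qed

interpretation S: Metric_space D sk by (rule Metric_sk)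

lemma topspace_skorohod [simp]: "topspace (skorohod_topology T E) = D"
  by (simp add: skorohod_topology_def)

lemma space_path_borel [simp]: "space (path_borel T E) = D"
  by (simp add: path_borel_def)

lemma metrizable_skorohod: "metrizable_space (skorohod_topology T E)"
  unfolding skorohod_topology_def by (rule S.metrizable_space_mtopology)

lemma openin_skorohodI:
  assumes "O' \<subseteq> D" "\<And>v. v \<in> O' \<Longrightarrow> \<exists>r>0. \<forall>w\<in>D. skor_le T d v w r \<longrightarrow> w \<in> O'"
  shows "openin (skorohod_topology T E) O'"
  unfolding skorohod_topology_def S.openin_mtopology
proof (intro conjI allI impI)
  fix v assume v: "v \<in> O'"
  from assms(2)[OF v] obtain r where r: "r > 0" "\<forall>w\<in>D. skor_le T d v w r \<longrightarrow> w \<in> O'" by (elim exE conjE)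
  have "S.mball v r \<subseteq> O'"
  proof
    fix w assume "w \<in> S.mball v r"
    then have "v \<in> D" "w \<in> D" "sk v w < r" by auto
    from skor_less_imp[OF this] show "w \<in> O'" using r(2) \<open>w \<in> D\<close> by simp
  qed
  then show "\<exists>r>0. S.mball v r \<subseteq> O'" using r(1) by (intro exI[of _ r] conjI)
qed fact

text \<open>Evaluation at a fixed time need not be continuous for the Skorohod topology, but
  visiting an open set during an open time interval is a stable property: a small time change keeps
  the visiting time in the interval, and the position moves little.\<close>

lemma openin_visit:
  assumes V: "openin E V" and ab: "0 \<le> a" "b \<le> T"
  shows "openin (skorohod_topology T E) {w \<in> D. \<exists>s. a < s \<and> s < b \<and> w s \<in> V}"
proof (rule openin_skorohodI)
  fix v assume "v \<in> {w \<in> D. \<exists>s. a < s \<and> s < b \<and> w s \<in> V}"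
  then obtain s where s: "v \<in> D" "a < s" "s < b" "v s \<in> V" by auto
  obtain e where e: "e > 0" "E.mball (v s) e \<subseteq> V"
    using open_ball_inside[OF V s(4)] by blast
  define r where "r = min (e/2) (min ((s - a) / 2) ((b - s) / 2))"
  have "r > 0" using e s by (simp add: r_def)
  moreover have "r \<le> e/2" unfolding r_def by (rule min.cobounded1)
  moreover have "r \<le> (s - a) / 2" unfolding r_def by (rule min.coboundedI2[OF min.cobounded1])
  moreover have "r \<le> (b - s) / 2" unfolding r_def by (rule min.coboundedI2[OF min.cobounded2])
  ultimately have r: "r < e" "r < s - a" "r < b - s" "r > 0" using e s by auto
  have "w \<in> {w \<in> D. \<exists>s. a < s \<and> s < b \<and> w s \<in> V}" if w: "w \<in> D" "skor_le T d v w r" for w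
  proof -
    obtain \<tau> where \<tau>: "\<tau> ` {0..T} = {0..T}"
        "\<And>t. t \<in> {0..T} \<Longrightarrow> \<bar>\<tau> t - t\<bar> \<le> r \<and> d (v t) (w (\<tau> t)) \<le> r"
      using w(2) unfolding skor_le_def by auto
    have sT: "s \<in> {0..T}" using s ab by auto
    then have \<tau>T: "\<tau> s \<in> {0..T}" using \<tau>(1) by blast
    have "a < \<tau> s" "\<tau> s < b" using \<tau>(2)[OF sT] r by auto
    moreover have "w (\<tau> s) \<in> E.mball (v s) e"
      using \<tau>(2)[OF sT] r(1) in_space[OF s(1)] in_space[OF w(1)] sT \<tau>T by auto
    ultimately show ?thesis using e(2) w(1) by blast
  qed
  then show "\<exists>r>0. \<forall>w\<in>D. skor_le T d v w r \<longrightarrow> w \<in> {w \<in> D. \<exists>s. a < s \<and> s < b \<and> w s \<in> V}"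
    using r(4) by blast
qed auto

text \<open>Every time change fixes \<open>T\<close>, so the terminal position is a continuous
  function of the path.\<close>

lemma openin_final_value:
  assumes V: "openin E V"
  shows "openin (skorohod_topology T E) {w \<in> D. w T \<in> V}"
proof (rule openin_skorohodI)
  fix v assume v: "v \<in> {w \<in> D. w T \<in> V}"
  obtain e where e: "e > 0" "E.mball (v T) e \<subseteq> V"
    using open_ball_inside[OF V, of "v T"] v by blast
  have "w \<in> {w \<in> D. w T \<in> V}" if w: "w \<in> D" "skor_le T d v w (e/2)" for w
  proof -
    obtain \<tau> where \<tau>: "strict_mono_on {0..T} \<tau>" "\<tau> ` {0..T} = {0..T}"
        "\<And>t. t \<in> {0..T} \<Longrightarrow> d (v t) (w (\<tau> t)) \<le> e/2"
      using w(2) unfolding skor_le_def by auto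
    have "\<tau> T = T" using strict_mono_on_interval_endpoints[OF \<tau>(1,2)] T_pos by simp
    then have "w T \<in> E.mball (v T) e"
      using \<tau>(3)[of T] e(1) T_pos in_space[of v T] in_space[OF w(1), of T] v by auto
    then show ?thesis using e(2) w(1) by blast
  qed
  then show "\<exists>r>0. \<forall>w\<in>D. skor_le T d v w r \<longrightarrow> w \<in> {w \<in> D. w T \<in> V}"
    using e by (intro exI[of _ "e/2"]) auto
qed auto

text \<open>For \<open>t < T\<close>, right continuity turns \<open>w t\<close> in \<open>U\<close>
  into the statement that on some short interval to the right of \<open>t\<close> the path avoids
  the open complement of some \<open>C m\<close>. This is a countable combination of visit events;
  the time \<open>T\<close> is covered by the terminal position.\<close>

lemma measurable_evaluation:
  assumes t: "t \<in> {0..T}" shows "(\<lambda>w. w t) \<in> path_borel T E \<rightarrow>\<^sub>M borel_of E"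
proof (rule measurable_borel_ofI)
  show "w t \<in> topspace E" if "w \<in> space (path_borel T E)" for w using that in_space t by auto
  fix U assume U: "openin E U"
  show "(\<lambda>w. w t) -` U \<inter> space (path_borel T E) \<in> sets (path_borel T E)"
  proof (cases "t = T")
    case True
    have "(\<lambda>w. w t) -` U \<inter> space (path_borel T E) = {w \<in> D. w T \<in> U}" using True by auto
    then show ?thesis using borel_of_open[OF openin_final_value[OF U]] by (simp add: path_borel_def)
  next
    case False
    then have t: "0 \<le> t" "t < T" using t by auto
    obtain C V :: "nat \<Rightarrow> 'a set" where CV: "\<And>n. closedin E (C n)" "\<And>n. openin E (V n)" "\<And>n. V n \<subseteq> C n"
      "\<And>n. C n \<subseteq> U" "incseq V" "incseq C" "(\<Union>n. V n) = U"
      by (rule open_exhaustion[OF metrizable U]) (rule that; assumption)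
    define b where "b n = min T (t + 1 / real (Suc n))" for n
    have b: "t < b n" "b n \<le> T" for n using t by (auto simp: b_def)
    define A where "A m n = {w \<in> D. \<exists>s. t < s \<and> s < b n \<and> w s \<in> topspace E - C m}" for m n
    have A: "A m n \<in> sets (path_borel T E)" for m n
      unfolding A_def path_borel_def
      by (intro borel_of_open openin_visit) (use CV(1) t b in auto)
    have "(\<lambda>w. w t) -` U \<inter> space (path_borel T E) = (\<Union>m. \<Union>n. D - A m n)"
    proof (intro equalityI subsetI)
      fix w assume "w \<in> (\<lambda>w. w t) -` U \<inter> space (path_borel T E)"
      then have w: "w \<in> D" "w t \<in> U" by auto
      then obtain m where m: "w t \<in> V m" using CV(7) by auto
      then obtain u where u: "u > t" "\<And>s. t < s \<Longrightarrow> s < u \<Longrightarrow> w s \<in> V m"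
        using limitinD[OF limit_right[OF w(1) t] CV(2) m] unfolding eventually_at_right_field by auto
      obtain n where n: "inverse (real (Suc n)) < u - t" using reals_Archimedean[of "u - t"] u(1) by auto
      have "b n < u" using n unfolding b_def by (auto simp: inverse_eq_divide)
      then have "w \<notin> A m n" using u(2) CV(3)[of m] unfolding A_def by fastforce
      then show "w \<in> (\<Union>m. \<Union>n. D - A m n)" using w(1) by auto
    next
      fix w assume "w \<in> (\<Union>m. \<Union>n. D - A m n)"
      then obtain m n where w: "w \<in> D" "w \<notin> A m n" by auto
      have "w s \<in> C m" if "t < s" "s < b n" for s
        using w that t b[of n] in_space[OF w(1), of s] unfolding A_def by auto
      then have "\<forall>\<^sub>F s in at_right t. w s \<in> C m"
        unfolding eventually_at_right_field using b(1)[of n] by blast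
      then have "w t \<in> C m"
        using limitin_closedin[OF limit_right[OF w(1) t] CV(1)] by simp
      then show "w \<in> (\<lambda>w. w t) -` U \<inter> space (path_borel T E)" using CV(4) w(1) by auto
    qed
    moreover have "D - A m n \<in> sets (path_borel T E)" for m n
      using sets.compl_sets[OF A, of m n] by simp
    moreover have "(\<Union>m. \<Union>n. D - A m n) \<in> sets (path_borel T E)"
      using calculation(2) by (intro sets.countable_UN'') auto
    ultimately show ?thesis by simp
  qed
qed

end

section \<open>Borel sets of the Skorohod topology\<close>

context path_space begin

interpretation E: Metric_space "topspace E" d by (rule Metric_d)
interpretation S: Metric_space D sk by (rule Metric_sk)

lemma space_coordinate_algebra [simp]: "space (coordinate_algebra T E) = D"
  unfolding coordinate_algebra_def by (rule space_measure_of) auto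

lemma sets_coordinate_algebra:
  "sets (coordinate_algebra T E) = sigma_sets D {{w \<in> D. w t \<in> B} | t B. t \<in> {0..T} \<and> B \<in> sets (borel_of E)}"
  unfolding coordinate_algebra_def by (rule sets_measure_of) auto

lemma measurable_coordinate:
  assumes "t \<in> {0..T}" shows "(\<lambda>w. w t) \<in> coordinate_algebra T E \<rightarrow>\<^sub>M borel_of E"
proof (rule measurableI)
  show "w t \<in> space (borel_of E)" if "w \<in> space (coordinate_algebra T E)" for w
    using that in_space assms by auto
  fix B assume B: "B \<in> sets (borel_of E)"
  have "(\<lambda>w. w t) -` B \<inter> space (coordinate_algebra T E) = {w \<in> D. w t \<in> B}" by auto
  then show "(\<lambda>w. w t) -` B \<inter> space (coordinate_algebra T E) \<in> sets (coordinate_algebra T E)"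
    unfolding sets_coordinate_algebra using B assms by auto
qed

text \<open>The step paths obtained by sampling a path on a grid converge to it in the Skorohod metric.
  They factor through finitely many coordinates, so the Skorohod Borel sets lie in the coordinate algebra.\<close>

definition grid_index :: "nat \<Rightarrow> real \<Rightarrow> nat" where "grid_index n t = nat \<lfloor>real n / T * t\<rfloor>"

definition step_path :: "nat \<Rightarrow> (nat \<Rightarrow> 'a) \<Rightarrow> real \<Rightarrow> 'a" where
  "step_path n x = (\<lambda>t\<in>{0..T}. x (grid_index n t))"

definition discretize :: "nat \<Rightarrow> (real \<Rightarrow> 'a) \<Rightarrow> real \<Rightarrow> 'a" where
  "discretize n w = step_path n (\<lambda>i. w (real i * T / real n))"

text \<open>The index \<open>n\<close> is reached only at \<open>t = T\<close>, so a sampled path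
  keeps the exact terminal value; this matters because time changes cannot move
  \<open>T\<close>.\<close>

lemma grid_index_le:
  assumes "t \<in> {0..T}" "1 \<le> n" shows "grid_index n t \<le> n"
proof -
  have "real n / T * t \<le> real n" using assms T_pos by (simp add: field_simps)
  then have "\<lfloor>real n / T * t\<rfloor> \<le> int n" by linarith
  then show ?thesis unfolding grid_index_def by linarith
qed

lemma step_path_in_D:
  assumes n: "1 \<le> n" and x: "\<And>i. i \<le> n \<Longrightarrow> x i \<in> topspace E"
  shows "step_path n x \<in> D"
  unfolding rcll_paths_iff rcll_on_def
proof (intro conjI ballI)
  define c where "c = real n / T"
  have c: "c > 0" using n T_pos by (simp add: c_def)
  have gi: "grid_index n t = nat \<lfloor>c * t\<rfloor>" for t by (simp add: grid_index_def c_def)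
  show "step_path n x \<in> extensional {0..T}" by (simp add: step_path_def)
  show xE: "step_path n x t \<in> topspace E" if "t \<in> {0..T}" for t
    using x[OF grid_index_le[OF that n]] that by (simp add: step_path_def)
  fix t
  show "limitin E (step_path n x) (step_path n x t) (at_right t)" if t: "t \<in> {0..<T}"
  proof (rule limitin_eventually)
    show "step_path n x t \<in> topspace E" using xE t by auto
    have "step_path n x s = step_path n x t" if s: "t < s" "s < min T ((of_int \<lfloor>c * t\<rfloor> + 1) / c)" for s
    proof -
      have "c * s < of_int \<lfloor>c * t\<rfloor> + 1" using s c by (simp add: field_simps)
      moreover have "c * t \<le> c * s" using s c by simp
      then have "of_int \<lfloor>c * t\<rfloor> \<le> c * s" by linarith
      ultimately have "\<lfloor>c * s\<rfloor> = \<lfloor>c * t\<rfloor>" by (simp add: floor_unique)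
      then show ?thesis using s t by (simp add: step_path_def gi)
    qed
    moreover have "t < min T ((of_int \<lfloor>c * t\<rfloor> + 1) / c)"
    proof -
      have "c * t < of_int \<lfloor>c * t\<rfloor> + 1" by linarith
      then show ?thesis using t c by (simp add: field_simps)
    qed
    ultimately show "\<forall>\<^sub>F s in at_right t. step_path n x s = step_path n x t"
      unfolding eventually_at_right_field by blast
  qed
  show "\<exists>l. limitin E (step_path n x) l (at_left t)" if t: "t \<in> {0<..T}"
  proof
    \<comment> \<open>The cell immediately to the left of \<open>t\<close>. At a grid point it
      differs from the cell given by the floor, which belongs to the right of
      \<open>t\<close>.\<close>
    define k where "k = \<lceil>c * t\<rceil> - 1"
    have k: "of_int k < c * t" "c * t \<le> of_int k + 1" by (auto simp: k_def) linarith+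
    have "0 < c * t" using t c by simp
    then have k0: "0 \<le> k" unfolding k_def by linarith
    have kn: "nat k \<le> n"
    proof -
      have "c * t \<le> c * T" using t c by simp
      then have "c * t \<le> real n" using T_pos by (simp add: c_def)
      then have "of_int k < real n" using k by linarith
      then show ?thesis by linarith
    qed
    show "limitin E (step_path n x) (x (nat k)) (at_left t)"
    proof (rule limitin_eventually)
      show "x (nat k) \<in> topspace E" using x kn by auto
      have "step_path n x s = x (nat k)" if s: "of_int k / c < s" "s < t" for s
      proof -
        have "of_int k < c * s" using s c by (simp add: field_simps)
        moreover have "c * s < c * t" using s c by simp
        ultimately have "\<lfloor>c * s\<rfloor> = k" using k by (intro floor_unique) linarith+
        moreover have "0 \<le> of_int k / c" using k0 c by simp
        then have "0 \<le> s" using s by linarith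
        ultimately show ?thesis using s t by (simp add: step_path_def gi)
      qed
      moreover have "of_int k / c < t" using k c by (simp add: field_simps)
      ultimately show "\<forall>\<^sub>F s in at_left t. step_path n x s = x (nat k)"
        unfolding eventually_at_left_field by blast
    qed
  qed
qed

lemma discretize_in_D:
  assumes "1 \<le> n" "w \<in> D" shows "discretize n w \<in> D"
  unfolding discretize_def
proof (rule step_path_in_D[OF assms(1)])
  fix i assume "i \<le> n"
  then have "0 \<le> real i * T / real n" "real i * T / real n \<le> T" using T_pos assms(1) by (auto simp: field_simps)
  then show "w (real i * T / real n) \<in> topspace E" using in_space assms(2) by auto
qed

text \<open>Step paths depend uniformly on finitely many sampled values, so a preimage of an open
  set is a union of boxes of basic open sets, and there are only countably many such boxes.\<close>

lemma measurable_discretize: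
  assumes n: "1 \<le> n" shows "discretize n \<in> coordinate_algebra T E \<rightarrow>\<^sub>M path_borel T E"
  unfolding path_borel_def
proof (rule measurable_borel_ofI)
  show "discretize n w \<in> topspace (skorohod_topology T E)" if "w \<in> space (coordinate_algebra T E)" for w
    using that discretize_in_D[OF n] by simp
  fix U assume U: "openin (skorohod_topology T E) U"
  obtain \<B> where \<B>: "countable \<B>" "\<And>B. B \<in> \<B> \<Longrightarrow> openin E B"
    "\<And>U x. openin E U \<Longrightarrow> x \<in> U \<Longrightarrow> \<exists>B\<in>\<B>. x \<in> B \<and> B \<subseteq> U"
    using second_countable_base[OF second_countable] by blast
  define g where "g i = real i * T / real n" for i
  have g: "g i \<in> {0..T}" if "i \<le> n" for i using that T_pos n by (auto simp: g_def field_simps)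
  define P where "P = {p \<in> {..n} \<rightarrow>\<^sub>E \<B>. \<forall>x. (\<forall>i\<le>n. x i \<in> p i) \<longrightarrow> step_path n x \<in> U}"
  define F where "F p = (\<Inter>i\<in>{..n}. (\<lambda>w. w (g i)) -` p i \<inter> D)" for p
  have "discretize n -` U \<inter> D = (\<Union>p\<in>P. F p)"
  proof (intro equalityI subsetI)
    fix w assume "w \<in> discretize n -` U \<inter> D"
    then have w: "w \<in> D" "discretize n w \<in> U" by auto
    obtain r where r: "r > 0" "S.mball (discretize n w) r \<subseteq> U"
      using U w(2) unfolding skorohod_topology_def S.openin_mtopology by blast
    have "\<exists>B\<in>\<B>. w (g i) \<in> B \<and> B \<subseteq> E.mball (w (g i)) (r/2)" if "i \<le> n" for i
      using \<B>(3)[OF openin_ball, of "w (g i)" "w (g i)" "r/2"] g[OF that] in_space[OF w(1)] r(1) by auto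
    then obtain p where p: "\<And>i. i \<le> n \<Longrightarrow> p i \<in> \<B> \<and> w (g i) \<in> p i \<and> p i \<subseteq> E.mball (w (g i)) (r/2)" by metis
    have "step_path n x \<in> U" if x: "\<forall>i\<le>n. x i \<in> p i" for x
    proof -
      have xb: "x i \<in> E.mball (w (g i)) (r/2)" if "i \<le> n" for i using x p that by blast
      then have xD: "step_path n x \<in> D" by (intro step_path_in_D[OF n]) auto
      have "skor_le T d (discretize n w) (step_path n x) (r/2)"
      proof (rule skor_leI_id)
        fix t assume t: "t \<in> {0..T}"
        show "d (discretize n w t) (step_path n x t) \<le> r/2"
          using xb[OF grid_index_le[OF t n]] t unfolding discretize_def step_path_def g_def by auto
      qed (use r in auto)
      from skor_le_imp[OF discretize_in_D[OF n w(1)] xD this]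
      show ?thesis using r discretize_in_D[OF n w(1)] xD by auto
    qed
    then have "restrict p {..n} \<in> P" using p by (auto simp: P_def)
    moreover have "w \<in> F (restrict p {..n})" using w p by (auto simp: F_def)
    ultimately show "w \<in> (\<Union>p\<in>P. F p)" by blast
  next
    fix w assume "w \<in> (\<Union>p\<in>P. F p)"
    then obtain p where "p \<in> P" "w \<in> F p" by blast
    then show "w \<in> discretize n -` U \<inter> D" unfolding P_def F_def discretize_def g_def by auto
  qed
  moreover have "(\<Union>p\<in>P. F p) \<in> sets (coordinate_algebra T E)"
  proof (rule sets.countable_UN'')
    show "countable P"
      by (rule countable_subset[of _ "{..n} \<rightarrow>\<^sub>E \<B>"]) (use \<B>(1) in \<open>auto simp: P_def intro!: countable_PiE\<close>)
    fix p assume p: "p \<in> P"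
    show "F p \<in> sets (coordinate_algebra T E)"
      unfolding F_def
    proof (rule sets.finite_INT)
      fix i assume i: "i \<in> {..n}"
      then have "p i \<in> sets (borel_of E)" using p \<B>(2) borel_of_open by (auto simp: P_def PiE_iff)
      then show "(\<lambda>w. w (g i)) -` p i \<inter> D \<in> sets (coordinate_algebra T E)"
        using measurable_sets[OF measurable_coordinate[OF g]] i by simp
    qed auto
  qed
  ultimately show "discretize n -` U \<inter> space (coordinate_algebra T E) \<in> sets (coordinate_algebra T E)" by simp
qed

section \<open>Convergence of the sampled paths, with time changes built by bisection\<close>

definition ceil_grid :: "nat \<Rightarrow> real \<Rightarrow> real" where "ceil_grid n t = of_int \<lceil>real n / T * t\<rceil> / (real n / T)"

definition floor_grid :: "nat \<Rightarrow> real \<Rightarrow> real" where "floor_grid n t = of_int \<lfloor>real n / T * t\<rfloor> / (real n / T)"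

lemma ceil_grid:
  assumes "1 \<le> n" shows "t \<le> ceil_grid n t" "ceil_grid n t < t + T / real n"
proof -
  define c where "c = real n / T"
  have c: "c > 0" using assms T_pos by (simp add: c_def)
  have "c * t \<le> of_int \<lceil>c * t\<rceil>" "of_int \<lceil>c * t\<rceil> < c * t + 1" by linarith+
  then have "t \<le> of_int \<lceil>c * t\<rceil> / c" "of_int \<lceil>c * t\<rceil> / c < t + 1 / c" using c by (auto simp: field_simps)
  then show "t \<le> ceil_grid n t" "ceil_grid n t < t + T / real n" by (auto simp: ceil_grid_def c_def)
qed

text \<open>The sampled path at time \<open>t\<close> shows the value at
  \<open>floor_grid n t\<close>. On the interval between the rounded-up endpoints it therefore shows
  only values from \<open>[a, b)\<close>, which is why the time change should carry that interval
  onto \<open>[a, b]\<close>.\<close>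

lemma floor_grid_bounds:
  assumes "1 \<le> n" "ceil_grid n a \<le> t" "t < ceil_grid n b" shows "a \<le> floor_grid n t" "floor_grid n t < b"
proof -
  define c where "c = real n / T"
  have c: "c > 0" using assms T_pos by (simp add: c_def)
  have "of_int \<lceil>c * a\<rceil> \<le> c * t" "c * t < of_int \<lceil>c * b\<rceil>"
    using assms(2,3) c by (auto simp: ceil_grid_def c_def[symmetric] field_simps)
  then have "\<lceil>c * a\<rceil> \<le> \<lfloor>c * t\<rfloor>" "\<lfloor>c * t\<rfloor> < \<lceil>c * b\<rceil>" by linarith+
  then have "c * a \<le> of_int \<lfloor>c * t\<rfloor>" "of_int \<lfloor>c * t\<rfloor> < c * b" by linarith+
  then show "a \<le> floor_grid n t" "floor_grid n t < b"
    using c by (auto simp: floor_grid_def c_def[symmetric] field_simps)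
qed

text \<open>The property to which bisection is applied. Values are compared on the half-open
  interval only: the path may jump at \<open>b\<close>, and the sampled path shows this jump from
  the next interval on.\<close>

definition time_changeable :: "real \<Rightarrow> (real \<Rightarrow> 'a) \<Rightarrow> real \<Rightarrow> real \<Rightarrow> bool" where
  "time_changeable e w a b \<longleftrightarrow> (\<exists>N\<ge>1. \<forall>n\<ge>N. \<exists>\<tau>.
     strict_mono_on {ceil_grid n a..ceil_grid n b} \<tau> \<and> \<tau> ` {ceil_grid n a..ceil_grid n b} = {a..b} \<and>
     (\<forall>t\<in>{ceil_grid n a..ceil_grid n b}. \<bar>\<tau> t - t\<bar> \<le> e) \<and>
     (\<forall>t\<in>{ceil_grid n a..<ceil_grid n b}. d (w (floor_grid n t)) (w (\<tau> t)) \<le> e))"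

lemma eventually_mesh: assumes "r > 0" shows "\<exists>N\<ge>1. \<forall>n\<ge>N. T / real n < r"
proof -
  obtain N :: nat where N: "T / r < real N" using reals_Archimedean2 by blast
  have "T / real n < r" if "n \<ge> max 1 N" for n
  proof -
    have "T / r < real n" using N that by linarith
    then show ?thesis using assms that by (simp add: field_simps)
  qed
  then show ?thesis by (intro exI[of _ "max 1 N"]) auto
qed

lemma time_changeable_refl: assumes "e > 0" shows "time_changeable e w a a"
proof -
  obtain N where N: "N \<ge> 1" "\<And>n. n \<ge> N \<Longrightarrow> T / real n < e" using eventually_mesh[OF assms] by blast
  show ?thesis unfolding time_changeable_def
  proof (intro exI[of _ N] conjI allI impI exI[of _ "\<lambda>_. a"])
    fix n assume n: "N \<le> n"
    have "\<bar>a - ceil_grid n a\<bar> \<le> e" using ceil_grid[of n a] N n by (simp add: abs_le_iff) (smt (verit) N(2) n)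
    then show "\<forall>t\<in>{ceil_grid n a..ceil_grid n a}. \<bar>a - t\<bar> \<le> e" by simp
  qed (use N in \<open>auto intro: strict_mono_onI\<close>)
qed

text \<open>A linear time change suffices when the path hardly moves. A mesh below
  \<open>b - a\<close> keeps the rounded-up interval nondegenerate, and a mesh below
  \<open>e / 2\<close> together with \<open>b - a \<le> e / 2\<close> bounds the displacement by
  \<open>e\<close>.\<close>

lemma time_changeable_small_oscillation:
  assumes "e > 0" and ab: "a < b" "b - a \<le> e / 2"
    and osc: "\<And>s s'. s \<in> {a..<b} \<Longrightarrow> s' \<in> {a..<b} \<Longrightarrow> d (w s) (w s') \<le> e"
  shows "time_changeable e w a b"
proof -
  obtain N where N: "N \<ge> 1" "\<And>n. n \<ge> N \<Longrightarrow> T / real n < min (b - a) (e / 2)"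
    using eventually_mesh[of "min (b - a) (e/2)"] assms by auto
  show ?thesis unfolding time_changeable_def
  proof (intro exI[of _ N] conjI allI impI)
    fix n assume n: "N \<le> n"
    then have n1: "1 \<le> n" using N by simp
    define \<alpha> where "\<alpha> = ceil_grid n a"
    define \<beta> where "\<beta> = ceil_grid n b"
    have \<alpha>\<beta>: "a \<le> \<alpha>" "\<alpha> < b" "b \<le> \<beta>" "\<beta> < b + e / 2"
      using ceil_grid[OF n1, of a] ceil_grid[OF n1, of b] N(2)[OF n] unfolding \<alpha>_def \<beta>_def by linarith+
    define q where "q = (b - a) / (\<beta> - \<alpha>)"
    have q0: "q > 0" and q: "q > 0" "q * (\<beta> - \<alpha>) = b - a" using \<alpha>\<beta> ab by (auto simp: q_def)
    define \<tau> where "\<tau> t = a + q * (t - \<alpha>)" for t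
    have mono: "strict_mono_on {\<alpha>..\<beta>} \<tau>" using q by (intro strict_mono_onI) (auto simp: \<tau>_def)
    have ends: "\<tau> \<alpha> = a" "\<tau> \<beta> = b" using q by (auto simp: \<tau>_def)
    have img: "\<tau> ` {\<alpha>..\<beta>} = {a..b}"
    proof (intro equalityI subsetI)
      fix y assume "y \<in> \<tau> ` {\<alpha>..\<beta>}"
      then obtain t where t: "t \<in> {\<alpha>..\<beta>}" "y = \<tau> t" by auto
      have "q * 0 \<le> q * (t - \<alpha>)" "q * (t - \<alpha>) \<le> q * (\<beta> - \<alpha>)"
        using t q0 by (auto intro!: mult_left_mono)
      then show "y \<in> {a..b}" using t q by (auto simp: \<tau>_def)
    next
      fix y assume y: "y \<in> {a..b}"
      have "0 \<le> (y - a) / q" using y q by simp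
      moreover have "(y - a) / q \<le> \<beta> - \<alpha>" using y q by (simp add: divide_le_eq mult.commute)
      moreover have "\<tau> (\<alpha> + (y - a) / q) = y" using q by (simp add: \<tau>_def)
      ultimately show "y \<in> \<tau> ` {\<alpha>..\<beta>}" by (intro image_eqI[of _ _ "\<alpha> + (y - a) / q"]) auto
    qed
    have inab: "\<tau> t \<in> {a..b}" if "t \<in> {\<alpha>..\<beta>}" for t using img that by blast
    show "\<exists>\<tau>. strict_mono_on {ceil_grid n a..ceil_grid n b} \<tau> \<and> \<tau> ` {ceil_grid n a..ceil_grid n b} = {a..b} \<and>
     (\<forall>t\<in>{ceil_grid n a..ceil_grid n b}. \<bar>\<tau> t - t\<bar> \<le> e) \<and>
     (\<forall>t\<in>{ceil_grid n a..<ceil_grid n b}. d (w (floor_grid n t)) (w (\<tau> t)) \<le> e)"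
      unfolding \<alpha>_def[symmetric] \<beta>_def[symmetric]
    proof (intro exI[of _ \<tau>] conjI ballI mono img)
      fix t assume t: "t \<in> {\<alpha>..\<beta>}"
      show "\<bar>\<tau> t - t\<bar> \<le> e" using inab[OF t] t \<alpha>\<beta> ab by auto
    next
      fix t assume t: "t \<in> {\<alpha>..<\<beta>}"
      have "floor_grid n t \<in> {a..<b}" using floor_grid_bounds[OF n1, of a t b] t by (auto simp: \<alpha>_def \<beta>_def)
      moreover have "\<tau> t < \<tau> \<beta>" using t by (intro strict_mono_onD[OF mono]) auto
      then have "\<tau> t \<in> {a..<b}" using inab[of t] t ends by auto
      ultimately show "d (w (floor_grid n t)) (w (\<tau> t)) \<le> e" by (rule osc)
    qed
  qed (rule N(1))
qed

lemma ceil_grid_mono: "1 \<le> n \<Longrightarrow> a \<le> b \<Longrightarrow> ceil_grid n a \<le> ceil_grid n b"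
  unfolding ceil_grid_def using T_pos
  by (intro divide_right_mono) (auto intro!: ceiling_mono mult_left_mono divide_right_mono)

lemma time_changeable_trans:
  assumes ab: "time_changeable e w a b" and bc: "time_changeable e w b c" and le: "a \<le> b" "b \<le> c"
  shows "time_changeable e w a c"
proof -
  let ?P = "\<lambda>a b n \<tau>. strict_mono_on {ceil_grid n a..ceil_grid n b} \<tau> \<and> \<tau> ` {ceil_grid n a..ceil_grid n b} = {a..b} \<and>
     (\<forall>t\<in>{ceil_grid n a..ceil_grid n b}. \<bar>\<tau> t - t\<bar> \<le> e) \<and>
     (\<forall>t\<in>{ceil_grid n a..<ceil_grid n b}. d (w (floor_grid n t)) (w (\<tau> t)) \<le> e)"
  obtain N where N: "N \<ge> 1" "\<And>n. n \<ge> N \<Longrightarrow> \<exists>\<tau>. ?P a b n \<tau>" using ab unfolding time_changeable_def by blast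
  obtain N' where N': "N' \<ge> 1" "\<And>n. n \<ge> N' \<Longrightarrow> \<exists>\<tau>. ?P b c n \<tau>" using bc unfolding time_changeable_def by blast
  show ?thesis unfolding time_changeable_def
  proof (intro exI[of _ "max N N'"] conjI allI impI)
    fix n assume n: "max N N' \<le> n"
    then have n1: "1 \<le> n" using N by simp
    obtain f where f: "?P a b n f" using N(2)[of n] n by auto
    obtain g where g: "?P b c n g" using N'(2)[of n] n by auto
    let ?h = "\<lambda>t. if t \<le> ceil_grid n b then f t else g t"
    note le' = ceil_grid_mono[OF n1 le(1)] ceil_grid_mono[OF n1 le(2)]
    have fm: "strict_mono_on {ceil_grid n a..ceil_grid n b} f" "f ` {ceil_grid n a..ceil_grid n b} = {a..b}"
      and gm: "strict_mono_on {ceil_grid n b..ceil_grid n c} g" "g ` {ceil_grid n b..ceil_grid n c} = {b..c}"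
      using f g by blast+
    have fg: "f (ceil_grid n b) = g (ceil_grid n b)"
      using strict_mono_on_interval_endpoints[OF fm le'(1)] strict_mono_on_interval_endpoints[OF gm le'(2)] by simp
    have "?P a c n ?h"
    proof (intro conjI ballI)
      show "strict_mono_on {ceil_grid n a..ceil_grid n c} ?h" "?h ` {ceil_grid n a..ceil_grid n c} = {a..c}"
        using strict_mono_on_glue[OF fm gm le'] by auto
      show "\<bar>?h t - t\<bar> \<le> e" if "t \<in> {ceil_grid n a..ceil_grid n c}" for t
        using f g that by (cases "t \<le> ceil_grid n b") auto
      show "d (w (floor_grid n t)) (w (?h t)) \<le> e" if "t \<in> {ceil_grid n a..<ceil_grid n c}" for t
      proof (cases "t < ceil_grid n b")
        case True
        then have "t \<in> {ceil_grid n a..<ceil_grid n b}" using that by simp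
        then show ?thesis using f True by simp
      next
        case False
        then have "t \<in> {ceil_grid n b..<ceil_grid n c}" "?h t = g t" using that fg by auto
        then show ?thesis using g by simp
      qed
    qed
    then show "\<exists>\<tau>. ?P a c n \<tau>" by blast
  qed (use N in simp)
qed

text \<open>Around a time \<open>x\<close> the oscillation is small to the left of \<open>x\<close>
  and small from \<open>x\<close> on, but not across \<open>x\<close>. A short interval containing
  \<open>x\<close> is therefore split exactly at \<open>x\<close>, which puts every large jump at a
  common endpoint of two pieces.\<close>

lemma time_changeable:
  assumes w: "w \<in> D" and e: "e > 0" shows "time_changeable e w 0 T"
proof -
  have "0 \<le> (0::real) \<and> T \<le> T \<longrightarrow> time_changeable e w 0 T"
  proof (rule Bolzano[where P="\<lambda>a b. 0 \<le> a \<and> b \<le> T \<longrightarrow> time_changeable e w a b"])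
    show "0 \<le> a \<and> c \<le> T \<longrightarrow> time_changeable e w a c"
      if "0 \<le> a \<and> b \<le> T \<longrightarrow> time_changeable e w a b" "0 \<le> b \<and> c \<le> T \<longrightarrow> time_changeable e w b c"
        "a \<le> b" "b \<le> c" for a b c
      using that time_changeable_trans[of e w a b c] by auto
    fix x assume x: "0 \<le> x" "x \<le> T"
    have "\<exists>\<delta>>0. \<forall>s s'. x - \<delta> < s \<and> s < x \<and> x - \<delta> < s' \<and> s' < x \<and> 0 \<le> s \<and> 0 \<le> s' \<longrightarrow> d (w s) (w s') \<le> e"
    proof (cases "0 < x")
      case True
      obtain u where "u < x" "\<And>s s'. u < s \<and> s < x \<and> u < s' \<and> s' < x \<Longrightarrow> d (w s) (w s') < e"
        using left_ball[OF w True x(2) e] by blast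
      then show ?thesis by (intro exI[of _ "x - u"]) (auto intro!: less_imp_le)
    next
      case False then show ?thesis by (intro exI[of _ 1]) auto
    qed
    then obtain \<delta>1 where l: "\<delta>1 > 0" "\<And>s s'. x - \<delta>1 < s \<Longrightarrow> s < x \<Longrightarrow> x - \<delta>1 < s' \<Longrightarrow> s' < x \<Longrightarrow> 0 \<le> s \<Longrightarrow> 0 \<le> s' \<Longrightarrow> d (w s) (w s') \<le> e"
      by blast
    have "\<exists>\<delta>>0. \<forall>s s'. x \<le> s \<and> s < x + \<delta> \<and> x \<le> s' \<and> s' < x + \<delta> \<and> s < T \<and> s' < T \<longrightarrow> d (w s) (w s') \<le> e"
    proof (cases "x < T")
      case True
      obtain u where u: "x < u" "u \<le> T" "\<And>s. x \<le> s \<Longrightarrow> s < u \<Longrightarrow> d (w x) (w s) < e/2"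
        using right_ball[OF w x(1) True, of "e/2"] e by auto
      have "d (w s) (w s') \<le> e" if "x \<le> s" "s < u" "x \<le> s'" "s' < u" for s s'
      proof -
        have "w s \<in> topspace E" "w s' \<in> topspace E" "w x \<in> topspace E" using in_space[OF w] that x u by auto
        then show ?thesis using E.triangle''[of "w s" "w x" "w s'"] u(3)[of s] u(3)[of s'] that by linarith
      qed
      then show ?thesis using u(1) by (intro exI[of _ "u - x"]) auto
    next
      case False then show ?thesis by (intro exI[of _ 1]) auto
    qed
    then obtain \<delta>2 where r: "\<delta>2 > 0" "\<And>s s'. x \<le> s \<Longrightarrow> s < x + \<delta>2 \<Longrightarrow> x \<le> s' \<Longrightarrow> s' < x + \<delta>2 \<Longrightarrow> s < T \<Longrightarrow> s' < T \<Longrightarrow> d (w s) (w s') \<le> e"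
      by blast
    define \<delta> where "\<delta> = min (min \<delta>1 \<delta>2) (e/2)"
    have \<delta>: "\<delta> > 0" "\<delta> \<le> \<delta>1" "\<delta> \<le> \<delta>2" "\<delta> \<le> e/2" using l(1) r(1) e
      by (simp_all add: \<delta>_def min.coboundedI1 min.coboundedI2)
    show "\<exists>\<delta>>0. \<forall>a b. a \<le> x \<and> x \<le> b \<and> b - a < \<delta> \<longrightarrow> 0 \<le> a \<and> b \<le> T \<longrightarrow> time_changeable e w a b"
    proof (intro exI[of _ \<delta>] conjI allI impI)
      fix a b assume ab: "a \<le> x \<and> x \<le> b \<and> b - a < \<delta>" "0 \<le> a \<and> b \<le> T"
      have "time_changeable e w a x"
      proof (cases "a = x")
        case False
        show ?thesis
        proof (rule time_changeable_small_oscillation[OF e])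
          fix s s' assume "s \<in> {a..<x}" "s' \<in> {a..<x}"
          then show "d (w s) (w s') \<le> e" using l(2)[of s s'] ab \<delta> by auto
        qed (use False ab \<delta> in auto)
      qed (use time_changeable_refl[OF e] in auto)
      moreover have "time_changeable e w x b"
      proof (cases "b = x")
        case False
        show ?thesis
        proof (rule time_changeable_small_oscillation[OF e])
          fix s s' assume "s \<in> {x..<b}" "s' \<in> {x..<b}"
          then show "d (w s) (w s') \<le> e" using r(2)[of s s'] ab \<delta> by auto
        qed (use False ab \<delta> in auto)
      qed (use time_changeable_refl[OF e] in auto)
      ultimately show "time_changeable e w a b" using time_changeable_trans[of e w a x b] ab by blast
    qed (rule \<delta>(1))
  qed (use T_pos in auto)
  then show ?thesis by simp
qed

lemma discretize_eq_floor_grid: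
  assumes "1 \<le> n" "t \<in> {0..T}" shows "discretize n w t = w (floor_grid n t)"
proof -
  have "0 \<le> real n / T * t" using assms T_pos by simp
  then have "0 \<le> \<lfloor>real n / T * t\<rfloor>" by linarith
  then have "real (grid_index n t) * T / real n = floor_grid n t"
    unfolding grid_index_def floor_grid_def by simp
  then show ?thesis using assms(2) by (simp add: discretize_def step_path_def)
qed

lemma discretize_limit:
  assumes w: "w \<in> D" shows "limitin (skorohod_topology T E) (\<lambda>n. discretize (Suc n) w) w sequentially"
  unfolding skorohod_topology_def S.limit_metric_sequentially
proof (intro conjI allI impI)
  show "w \<in> D" by fact
  fix e :: real assume e: "e > 0"
  then have "time_changeable (e/2) w 0 T" using time_changeable[OF w] by simp
  then obtain N where N: "N \<ge> 1" "\<And>n. n \<ge> N \<Longrightarrow> \<exists>\<tau>. strict_mono_on {ceil_grid n 0..ceil_grid n T} \<tau> \<and>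
     \<tau> ` {ceil_grid n 0..ceil_grid n T} = {0..T} \<and>
     (\<forall>t\<in>{ceil_grid n 0..ceil_grid n T}. \<bar>\<tau> t - t\<bar> \<le> e/2) \<and>
     (\<forall>t\<in>{ceil_grid n 0..<ceil_grid n T}. d (w (floor_grid n t)) (w (\<tau> t)) \<le> e/2)"
    unfolding time_changeable_def by blast
  have "discretize (Suc n) w \<in> D \<and> sk (discretize (Suc n) w) w < e" if n: "n \<ge> N" for n
  proof -
    have n1: "1 \<le> Suc n" "Suc n \<ge> N" using N n by auto
    \<comment> \<open>0 and \<open>T\<close> are grid points of every grid, so the time change
      constructed on the rounded-up interval is one of \<open>[0, T]\<close>; the comparison missing
      at the right endpoint holds because sampling is exact at \<open>T\<close>.\<close>
    have c0: "ceil_grid (Suc n) 0 = 0" "ceil_grid (Suc n) T = T" "floor_grid (Suc n) T = T"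
      using T_pos by (auto simp: ceil_grid_def floor_grid_def simp del: of_nat_Suc)
    obtain \<tau> where \<tau>: "strict_mono_on {0..T} \<tau>" "\<tau> ` {0..T} = {0..T}"
      "\<And>t. t \<in> {0..T} \<Longrightarrow> \<bar>\<tau> t - t\<bar> \<le> e/2" "\<And>t. t \<in> {0..<T} \<Longrightarrow> d (w (floor_grid (Suc n) t)) (w (\<tau> t)) \<le> e/2"
      using N(2)[OF n1(2)] unfolding c0 by blast
    have \<tau>T: "\<tau> T = T" using strict_mono_on_interval_endpoints[OF \<tau>(1,2)] T_pos by simp
    have wT: "d (w T) (w T) = 0" using in_space[OF w] T_pos by simp
    have "skor_le T d (discretize (Suc n) w) w (e/2)"
      unfolding skor_le_def
    proof (intro conjI exI[of _ \<tau>] ballI \<tau>(1,2))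
      fix t assume t: "t \<in> {0..T}"
      show "\<bar>\<tau> t - t\<bar> \<le> e/2" using \<tau>(3)[OF t] .
      show "d (discretize (Suc n) w t) (w (\<tau> t)) \<le> e/2"
        unfolding discretize_eq_floor_grid[OF n1(1) t]
        using \<tau>(4)[of t] t \<tau>T wT c0(3) e by (cases "t = T") auto
    qed (use e in simp)
    from skor_le_imp[OF discretize_in_D[OF n1(1) w] w this] show ?thesis
      using discretize_in_D[OF n1(1) w] e by simp
  qed
  then show "\<exists>N. \<forall>n\<ge>N. discretize (Suc n) w \<in> D \<and> sk (discretize (Suc n) w) w < e" by blast
qed

text \<open>One inclusion holds because the identity is a pointwise limit of the measurable sampling
  maps into a metrizable space, the other because evaluations are Borel. This reconciles the
  sigma-algebra used for conditioning with the one on which the conditional laws live.\<close>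

lemma sets_path_borel: "sets (path_borel T E) = sets (coordinate_algebra T E)"
proof
  have id: "(\<lambda>w. w) \<in> coordinate_algebra T E \<rightarrow>\<^sub>M path_borel T E"
    unfolding path_borel_def
  proof (rule measurable_limit_metrizable[OF metrizable_skorohod])
    show "discretize (Suc n) \<in> coordinate_algebra T E \<rightarrow>\<^sub>M borel_of (skorohod_topology T E)" for n
      using measurable_discretize[of "Suc n"] by (simp add: path_borel_def)
    show "limitin (skorohod_topology T E) (\<lambda>n. discretize (Suc n) w) w sequentially"
      if "w \<in> space (coordinate_algebra T E)" for w
      using that discretize_limit by simp
  qed
  show "sets (path_borel T E) \<subseteq> sets (coordinate_algebra T E)"
  proof (intro subsetI)
    fix A assume A: "A \<in> sets (path_borel T E)"
    have "(\<lambda>w. w) -` A \<inter> D \<in> sets (coordinate_algebra T E)" using measurable_sets[OF id A] by simp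
    then show "A \<in> sets (coordinate_algebra T E)" using sets.sets_into_space[OF A] by (simp add: Int_absorb2)
  qed
  have "{w \<in> D. w t \<in> B} \<in> sets (path_borel T E)" if "t \<in> {0..T}" "B \<in> sets (borel_of E)" for t B
    using measurable_sets[OF measurable_evaluation[OF that(1)] that(2)]
    by (simp add: vimage_def Int_def conj_commute)
  then have "{{w \<in> D. w t \<in> B} | t B. t \<in> {0..T} \<and> B \<in> sets (borel_of E)} \<subseteq> sets (path_borel T E)" by auto
  then show "sets (coordinate_algebra T E) \<subseteq> sets (path_borel T E)"
    unfolding sets_coordinate_algebra using sets.sigma_sets_subset[of _ "path_borel T E"] by simp
qed

lemma measurable_path_borelI:
  assumes "\<And>\<omega>. \<omega> \<in> space N \<Longrightarrow> f \<omega> \<in> D" "\<And>t. t \<in> {0..T} \<Longrightarrow> (\<lambda>\<omega>. f \<omega> t) \<in> N \<rightarrow>\<^sub>M borel_of E"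
  shows "f \<in> N \<rightarrow>\<^sub>M path_borel T E"
proof -
  have "f \<in> N \<rightarrow>\<^sub>M coordinate_algebra T E"
    unfolding coordinate_algebra_def
  proof (rule measurable_measure_of)
    fix A assume "A \<in> {{w \<in> D. w t \<in> B} | t B. t \<in> {0..T} \<and> B \<in> sets (borel_of E)}"
    then obtain t B where tB: "t \<in> {0..T}" "B \<in> sets (borel_of E)" "A = {w \<in> D. w t \<in> B}" by auto
    have "f -` A \<inter> space N = (\<lambda>\<omega>. f \<omega> t) -` B \<inter> space N" using tB(3) assms(1) by auto
    then show "f -` A \<inter> space N \<in> sets N" using measurable_sets[OF assms(2)] tB by simp
  qed (use assms(1) in auto)
  then show ?thesis using sets_path_borel by (simp cong: measurable_cong_sets)
qed

lemma measurable_restrict_path: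
  assumes "I \<subseteq> {0..T}" shows "(\<lambda>w. restrict w I) \<in> path_borel T E \<rightarrow>\<^sub>M PiM I (\<lambda>_. borel_of E)"
  using assms measurable_evaluation by (intro measurable_restrict) auto

end

lemma path_map_in_rcll_paths:
  assumes "continuous_map E E' f" "w \<in> rcll_paths T E" shows "path_map T f w \<in> rcll_paths T E'"
proof -
  have "rcll_on 0 T E' (\<lambda>t. f (w t))" using assms rcll_on_compose by (auto simp: rcll_paths_iff)
  then show ?thesis
    using rcll_on_cong[of 0 T "path_map T f w" "\<lambda>t. f (w t)" E'] by (auto simp: rcll_paths_iff path_map_def)
qed

lemma measurable_path_map:
  assumes "path_space T E" "path_space T E'" "continuous_map E E' f"
  shows "path_map T f \<in> path_borel T E \<rightarrow>\<^sub>M path_borel T E'"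
proof (rule path_space.measurable_path_borelI[OF assms(2)])
  show "path_map T f w \<in> rcll_paths T E'" if "w \<in> space (path_borel T E)" for w
    using that path_map_in_rcll_paths[OF assms(3)] path_space.space_path_borel[OF assms(1)] by auto
  show "(\<lambda>w. path_map T f w t) \<in> path_borel T E \<rightarrow>\<^sub>M borel_of E'" if "t \<in> {0..T}" for t
    using that measurable_compose[OF path_space.measurable_evaluation[OF assms(1) that] continuous_map_measurable[OF assms(3)]]
    by (simp add: path_map_def)
qed

section \<open>Homogeneous spaces\<close>

text \<open>Both integrals are integrals of \<open>\<Phi>\<close> over
  \<open>F \<Otimes>\<^sub>M E\<close>, one against the law of the pair formed by the outcome and
  \<open>Y\<close>, the other against the law composed from \<open>N2\<close> and the kernel; the
  two laws agree on a generating pi-system of rectangles. Two base measures are allowed because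
  survival up to the later time restricts one side and survival up to the earlier time the
  other.\<close>

lemma nn_integral_kernel_rectangles:
  assumes fin: "finite_measure N1" "finite_measure N2"
    and sub: "subalgebra N1 F" "subalgebra N2 F"
    and Y: "Y \<in> N1 \<rightarrow>\<^sub>M E" and \<kappa>: "\<kappa> \<in> F \<rightarrow>\<^sub>M subprob_algebra E"
    and P: "Int_stable \<P>" "\<P> \<subseteq> Pow (space E)" "sets E = sigma_sets (space E) \<P>" "space E \<in> \<P>"
    and eq: "\<And>A B. A \<in> sets F \<Longrightarrow> B \<in> \<P> \<Longrightarrow>
      emeasure N1 {\<omega> \<in> A. Y \<omega> \<in> B} = (\<integral>\<^sup>+\<omega>. indicator A \<omega> * emeasure (\<kappa> \<omega>) B \<partial>N2)"
    and \<Phi>: "\<Phi> \<in> borel_measurable (F \<Otimes>\<^sub>M E)"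
  shows "(\<integral>\<^sup>+\<omega>. \<Phi> (\<omega>, Y \<omega>) \<partial>N1) = (\<integral>\<^sup>+\<omega>. \<integral>\<^sup>+e. \<Phi> (\<omega>, e) \<partial>\<kappa> \<omega> \<partial>N2)"
proof -
  interpret N1: finite_measure N1 by fact
  have sp: "space N1 = space F" "space N2 = space F" using sub by (auto simp: subalgebra_def)
  have idF: "(\<lambda>\<omega>. \<omega>) \<in> N1 \<rightarrow>\<^sub>M F" "(\<lambda>\<omega>. \<omega>) \<in> N2 \<rightarrow>\<^sub>M F"
    using sub by (auto simp: measurable_def subalgebra_def sets.sets_into_space Int_absorb2)
  have YF: "(\<lambda>\<omega>. (\<omega>, Y \<omega>)) \<in> N1 \<rightarrow>\<^sub>M F \<Otimes>\<^sub>M E" using idF Y by simp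
  define G where "G \<omega> = distr (\<kappa> \<omega>) (F \<Otimes>\<^sub>M E) (\<lambda>e. (\<omega>, e))" for \<omega>
  have G0: "G \<in> F \<rightarrow>\<^sub>M subprob_algebra (F \<Otimes>\<^sub>M E)"
    unfolding G_def by (rule measurable_distr2[OF _ \<kappa>]) simp
  have G: "G \<in> N2 \<rightarrow>\<^sub>M subprob_algebra (F \<Otimes>\<^sub>M E)" using measurable_compose[OF idF(2) G0] by simp
  have \<kappa>s: "sets (\<kappa> \<omega>) = sets E" if "\<omega> \<in> space F" for \<omega> using sets_kernel[OF \<kappa> that] .
  have pair: "(\<lambda>e. (\<omega>, e)) \<in> \<kappa> \<omega> \<rightarrow>\<^sub>M F \<Otimes>\<^sub>M E" if "\<omega> \<in> space F" for \<omega>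
    using measurable_Pair1'[OF that, of E] \<kappa>s[OF that] by (simp cong: measurable_cong_sets)
  show ?thesis
  \<comment> \<open>\<open>bind\<close> is degenerate over an empty space; both integrals vanish
    there.\<close>
  proof (cases "space F = {}")
    case True
    then show ?thesis by (simp add: sp nn_integral_empty)
  next
    case False
    define \<nu>1 where "\<nu>1 = distr N1 (F \<Otimes>\<^sub>M E) (\<lambda>\<omega>. (\<omega>, Y \<omega>))"
    define \<nu>2 where "\<nu>2 = N2 \<bind> G"
    have s2: "sets \<nu>2 = sets (F \<Otimes>\<^sub>M E)" unfolding \<nu>2_def
      by (rule sets_bind[OF sets_kernel[OF G]]) (use False sp in auto)
    have rect: "emeasure \<nu>1 (A \<times> B) = emeasure \<nu>2 (A \<times> B)" if A: "A \<in> sets F" and B: "B \<in> \<P>" for A B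
    proof -
      have BE: "B \<in> sets E" using B P(3) by auto
      have "emeasure \<nu>1 (A \<times> B) = emeasure N1 ((\<lambda>\<omega>. (\<omega>, Y \<omega>)) -` (A \<times> B) \<inter> space N1)"
        unfolding \<nu>1_def using A BE by (intro emeasure_distr YF) auto
      also have "(\<lambda>\<omega>. (\<omega>, Y \<omega>)) -` (A \<times> B) \<inter> space N1 = {\<omega> \<in> A. Y \<omega> \<in> B}"
        using sets.sets_into_space[OF A] sp by auto
      also have "emeasure N1 \<dots> = (\<integral>\<^sup>+\<omega>. indicator A \<omega> * emeasure (\<kappa> \<omega>) B \<partial>N2)" by (rule eq[OF A B])
      also have "\<dots> = (\<integral>\<^sup>+\<omega>. emeasure (G \<omega>) (A \<times> B) \<partial>N2)"
      proof (rule nn_integral_cong)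
        fix \<omega> assume "\<omega> \<in> space N2"
        then have w: "\<omega> \<in> space F" using sp by simp
        have "emeasure (G \<omega>) (A \<times> B) = emeasure (\<kappa> \<omega>) ((\<lambda>e. (\<omega>, e)) -` (A \<times> B) \<inter> space (\<kappa> \<omega>))"
          unfolding G_def using A BE by (intro emeasure_distr pair w) auto
        also have "(\<lambda>e. (\<omega>, e)) -` (A \<times> B) \<inter> space (\<kappa> \<omega>) = (if \<omega> \<in> A then B else {})"
          using sets.sets_into_space[OF BE] sets_eq_imp_space_eq[OF \<kappa>s[OF w]] by auto
        finally show "indicator A \<omega> * emeasure (\<kappa> \<omega>) B = emeasure (G \<omega>) (A \<times> B)" by simp
      qed
      also have "\<dots> = emeasure \<nu>2 (A \<times> B)"
        unfolding \<nu>2_def using False sp A BE by (intro emeasure_bind[symmetric, OF _ G]) auto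
      finally show ?thesis .
    qed
    have gen: "sets (F \<Otimes>\<^sub>M E) = sigma_sets (space F \<times> space E) {a \<times> b | a b. a \<in> sets F \<and> b \<in> \<P>}"
    proof -
      have "sets (F \<Otimes>\<^sub>M E) = sets (sigma (space F \<times> space E) {a \<times> b | a b. a \<in> sets F \<and> b \<in> \<P>})"
        by (rule sets_pair_eq[where Ca="{space F}" and Cb="{space E}"])
          (use P in \<open>auto simp: sets.sigma_sets_eq dest: sets.sets_into_space\<close>)
      also have "\<dots> = sigma_sets (space F \<times> space E) {a \<times> b | a b. a \<in> sets F \<and> b \<in> \<P>}"
        by (rule sets_measure_of) (use P(2) sets.sets_into_space in fastforce)
      finally show ?thesis .
    qed
    have "\<nu>1 = \<nu>2"
    proof (rule measure_eqI_generator_eq[where \<Omega>="space F \<times> space E"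
          and E="{a \<times> b | a b. a \<in> sets F \<and> b \<in> \<P>}" and A="\<lambda>_. space F \<times> space E"])
      show "Int_stable {a \<times> b | a b. a \<in> sets F \<and> b \<in> \<P>}"
      proof (rule Int_stableI)
        fix x y assume "x \<in> {a \<times> b | a b. a \<in> sets F \<and> b \<in> \<P>}" "y \<in> {a \<times> b | a b. a \<in> sets F \<and> b \<in> \<P>}"
        then obtain a b a' b' where ab: "x = a \<times> b" "y = a' \<times> b'" "a \<in> sets F" "a' \<in> sets F" "b \<in> \<P>" "b' \<in> \<P>" by auto
        then have "x \<inter> y = (a \<inter> a') \<times> (b \<inter> b')" "a \<inter> a' \<in> sets F" "b \<inter> b' \<in> \<P>"
          using P(1) by (auto simp: Int_stable_def)
        then show "x \<inter> y \<in> {a \<times> b | a b. a \<in> sets F \<and> b \<in> \<P>}" by blast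
      qed
      show "{a \<times> b | a b. a \<in> sets F \<and> b \<in> \<P>} \<subseteq> Pow (space F \<times> space E)"
        using P(2) sets.sets_into_space by fastforce
      show "sets \<nu>1 = sigma_sets (space F \<times> space E) {a \<times> b | a b. a \<in> sets F \<and> b \<in> \<P>}"
        "sets \<nu>2 = sigma_sets (space F \<times> space E) {a \<times> b | a b. a \<in> sets F \<and> b \<in> \<P>}"
        using gen s2 by (simp_all add: \<nu>1_def)
      show "emeasure \<nu>1 X = emeasure \<nu>2 X" if "X \<in> {a \<times> b | a b. a \<in> sets F \<and> b \<in> \<P>}" for X
        using that rect by auto
      show "range (\<lambda>_. space F \<times> space E) \<subseteq> {a \<times> b | a b. a \<in> sets F \<and> b \<in> \<P>}" using P(4) by auto
      show "emeasure \<nu>1 (space F \<times> space E) \<noteq> \<infinity>"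
        using finite_measure.emeasure_finite[OF N1.finite_measure_distr[OF YF]] by (simp add: \<nu>1_def)
    qed auto
    then have "(\<integral>\<^sup>+p. \<Phi> p \<partial>\<nu>1) = (\<integral>\<^sup>+p. \<Phi> p \<partial>\<nu>2)" by simp
    moreover have "(\<integral>\<^sup>+p. \<Phi> p \<partial>\<nu>1) = (\<integral>\<^sup>+\<omega>. \<Phi> (\<omega>, Y \<omega>) \<partial>N1)"
      unfolding \<nu>1_def by (rule nn_integral_distr[OF YF]) (use \<Phi> in simp)
    moreover have "(\<integral>\<^sup>+p. \<Phi> p \<partial>\<nu>2) = (\<integral>\<^sup>+\<omega>. \<integral>\<^sup>+e. \<Phi> (\<omega>, e) \<partial>\<kappa> \<omega> \<partial>N2)"
      unfolding \<nu>2_def nn_integral_bind[OF \<Phi> G]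
    proof (rule nn_integral_cong)
      fix \<omega> assume "\<omega> \<in> space N2"
      then have w: "\<omega> \<in> space F" using sp by simp
      show "(\<integral>\<^sup>+p. \<Phi> p \<partial>G \<omega>) = (\<integral>\<^sup>+e. \<Phi> (\<omega>, e) \<partial>\<kappa> \<omega>)"
        unfolding G_def by (rule nn_integral_distr[OF pair[OF w]]) (use \<Phi> in simp)
    qed
    ultimately show ?thesis by simp
  qed
qed

text \<open>Independence of \<open>w\<close> from one event, with prescribed law, in two forms: the
  form with sets is what pi-system arguments use, the form with bounded continuous functions
  survives pointwise limits of \<open>w\<close>.\<close>

lemma emeasure_product_iff_integral_product:
  assumes X: "metrizable_space X" and N: "finite_measure N" and A: "A \<in> sets N" and w: "w \<in> N \<rightarrow>\<^sub>M borel_of X"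
    and \<nu>: "finite_measure \<nu>" "sets \<nu> = sets (borel_of X)"
  shows "(\<forall>B\<in>sets (borel_of X). emeasure N {\<omega> \<in> A. w \<omega> \<in> B} = emeasure N A * emeasure \<nu> B) \<longleftrightarrow>
    (\<forall>f\<in>Cb X. (\<integral>\<omega>. indicator A \<omega> * f (w \<omega>) \<partial>N) = measure N A * (\<integral>x. f x \<partial>\<nu>))"
proof -
  interpret N: finite_measure N by fact
  interpret \<nu>: finite_measure \<nu> by fact
  define \<alpha> where "\<alpha> = distr (density N (indicator A)) (borel_of X) w"
  define \<beta> where "\<beta> = density \<nu> (\<lambda>_. ennreal (measure N A))"
  have iA: "(indicator A :: _ \<Rightarrow> ennreal) = (\<lambda>x. ennreal (indicator A x))" by (auto simp: fun_eq_iff ennreal_indicator)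
  have mw: "w \<in> density N (indicator A) \<rightarrow>\<^sub>M borel_of X" using w by simp
  have \<alpha>: "emeasure \<alpha> B = emeasure N {\<omega> \<in> A. w \<omega> \<in> B}" if "B \<in> sets (borel_of X)" for B
  proof -
    have m: "w -` B \<inter> space N \<in> sets N" using measurable_sets[OF w that] .
    have "emeasure \<alpha> B = emeasure (density N (indicator A)) (w -` B \<inter> space N)"
      unfolding \<alpha>_def using emeasure_distr[OF mw that] by simp
    also have "\<dots> = emeasure N (A \<inter> (w -` B \<inter> space N))"
      using A m by (subst emeasure_density) (auto simp: indicator_inter_arith[symmetric])
    also have "A \<inter> (w -` B \<inter> space N) = {\<omega> \<in> A. w \<omega> \<in> B}" using sets.sets_into_space[OF A] by auto
    finally show ?thesis .
  qed
  have \<beta>: "emeasure \<beta> B = emeasure N A * emeasure \<nu> B" if "B \<in> sets (borel_of X)" for B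
    unfolding \<beta>_def using that \<nu>(2) by (simp add: emeasure_density_const N.emeasure_eq_measure)
  have fm: "finite_measure \<alpha>"
    using \<alpha>[OF borel_of_open[OF openin_topspace]]
    by (intro finite_measureI) (simp add: \<alpha>_def N.emeasure_eq_measure)
  have fm': "finite_measure \<beta>"
    using sets_eq_imp_space_eq[OF \<nu>(2)] \<beta>[OF borel_of_open[OF openin_topspace]] by (intro finite_measureI)
      (simp add: \<beta>_def emeasure_density_const N.emeasure_eq_measure \<nu>.emeasure_eq_measure ennreal_mult_eq_top_iff)
  have s: "sets \<alpha> = sets (borel_of X)" "sets \<beta> = sets (borel_of X)" using \<nu> by (auto simp: \<alpha>_def \<beta>_def)
  have I: "(\<integral>x. f x \<partial>\<alpha>) = (\<integral>\<omega>. indicator A \<omega> * f (w \<omega>) \<partial>N)" "(\<integral>x. f x \<partial>\<beta>) = measure N A * (\<integral>x. f x \<partial>\<nu>)"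
    if f: "f \<in> Cb X" for f
  proof -
    have fb: "f \<in> borel_measurable (borel_of X)" by (rule Cb_measurable[OF f])
    have "(\<integral>x. f x \<partial>\<alpha>) = (\<integral>\<omega>. f (w \<omega>) \<partial>density N (indicator A))"
      unfolding \<alpha>_def by (rule integral_distr[OF mw fb])
    also have "\<dots> = (\<integral>\<omega>. indicator A \<omega> * f (w \<omega>) \<partial>N)"
      unfolding iA using A measurable_compose[OF w fb] by (subst integral_density) auto
    finally show "(\<integral>x. f x \<partial>\<alpha>) = (\<integral>\<omega>. indicator A \<omega> * f (w \<omega>) \<partial>N)" .
    have "f \<in> borel_measurable \<nu>" using fb \<nu>(2) by (simp cong: measurable_cong_sets)
    then show "(\<integral>x. f x \<partial>\<beta>) = measure N A * (\<integral>x. f x \<partial>\<nu>)"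
      unfolding \<beta>_def by (subst integral_density) auto
  qed
  show ?thesis
  proof
    assume "\<forall>B\<in>sets (borel_of X). emeasure N {\<omega> \<in> A. w \<omega> \<in> B} = emeasure N A * emeasure \<nu> B"
    then have "\<alpha> = \<beta>" using s \<alpha> \<beta> by (intro measure_eqI) auto
    then show "\<forall>f\<in>Cb X. (\<integral>\<omega>. indicator A \<omega> * f (w \<omega>) \<partial>N) = measure N A * (\<integral>x. f x \<partial>\<nu>)"
      using I by simp
  next
    assume "\<forall>f\<in>Cb X. (\<integral>\<omega>. indicator A \<omega> * f (w \<omega>) \<partial>N) = measure N A * (\<integral>x. f x \<partial>\<nu>)"
    then have "\<alpha> = \<beta>" using I by (intro measure_eqI_Cb[OF X fm s(1) fm' s(2)]) auto
    then show "\<forall>B\<in>sets (borel_of X). emeasure N {\<omega> \<in> A. w \<omega> \<in> B} = emeasure N A * emeasure \<nu> B"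
      using \<alpha> \<beta> by metis
  qed
qed

section \<open>The coset space, the action on it, and the choice of representatives\<close>

locale homogeneous_space =
  fixes K :: "('k, 'b) monoid_scheme" and L :: "'k manifold" and M :: "'k set"
    and Q :: "'k set manifold" and S :: "'k set \<Rightarrow> 'k"
  assumes lie: "lie_group K L" and M_subgroup: "subgroup M K"
    and hom: "homogeneous_manifold K L M Q" and S_section: "coset_section K L M Q S"
begin

abbreviation TL where "TL \<equiv> top_of L"
abbreviation TQ where "TQ \<equiv> top_of Q"
abbreviation act (infixl "\<rhd>" 75) where "k \<rhd> z \<equiv> k <#\<^bsub>K\<^esub> z"
abbreviation mlt (infixl "\<odot>" 75) where "k \<odot> l \<equiv> k \<otimes>\<^bsub>K\<^esub> l"
abbreviation ginv where "ginv k \<equiv> inv\<^bsub>K\<^esub> k"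
abbreviation G where "G \<equiv> carrier K"
abbreviation C where "C \<equiv> lcosets\<^bsub>K\<^esub> M"

sublocale group K using lie by (simp add: lie_group_def)

lemma topspace_TL [simp]: "topspace TL = G" using lie by (simp add: lie_group_def)

lemma topspace_TQ [simp]: "topspace TQ = C"
proof -
  have eq: "TQ = coset_topology K TL M" using hom by (simp add: homogeneous_manifold_def)
  have "{k \<in> topspace TL. k \<rhd> M \<in> C} = topspace TL" by (auto simp: LCOSETS_def)
  then have "openin TL {k \<in> topspace TL. k \<rhd> M \<in> C}" by (metis openin_topspace)
  then have "openin TQ C" unfolding eq openin_coset_topology by simp
  moreover have "topspace TQ \<subseteq> C"
    using openin_topspace[of TQ] unfolding eq openin_coset_topology by simp
  ultimately show ?thesis using openin_subset by blast
qed

lemma TL_metrizable: "metrizable_space TL" and TL_second_countable: "second_countable TL"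
  using lie smooth_manifold_metrizable by (auto simp: lie_group_def)

lemma TQ_metrizable: "metrizable_space TQ" and TQ_second_countable: "second_countable TQ"
  using hom smooth_manifold_metrizable[of Q] unfolding homogeneous_manifold_def by blast+

lemma M_sub: "M \<subseteq> G" using M_subgroup by (rule subgroup.subset)

lemma M_in_C: "M \<in> C"
proof -
  have "\<one>\<^bsub>K\<^esub> \<rhd> M = M" using lcos_mult_one[OF M_sub] .
  then show ?thesis by (force simp: LCOSETS_def)
qed

lemma coset_in_C [simp]: "k \<in> G \<Longrightarrow> k \<rhd> M \<in> C" by (auto simp: LCOSETS_def)

lemma C_sub: "z \<in> C \<Longrightarrow> z \<subseteq> G" using M_sub l_coset_subset_G by (auto simp: LCOSETS_def)

lemma act_act: "k \<in> G \<Longrightarrow> l \<in> G \<Longrightarrow> z \<in> C \<Longrightarrow> k \<rhd> (l \<rhd> z) = (k \<odot> l) \<rhd> z"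
  using lcos_m_assoc C_sub by simp

lemma act_one: "z \<in> C \<Longrightarrow> \<one>\<^bsub>K\<^esub> \<rhd> z = z" using lcos_mult_one C_sub by simp

lemma act_in_C [simp]: "k \<in> G \<Longrightarrow> z \<in> C \<Longrightarrow> k \<rhd> z \<in> C"
  using lcos_m_assoc[OF M_sub] by (auto simp: LCOSETS_def)

lemma M_act: "h \<in> M \<Longrightarrow> h \<rhd> M = M"
  using coset_join3[of h M] M_subgroup M_sub by auto

lemma coset_eq_imp: assumes "k \<in> G" "l \<in> G" "k \<rhd> M = l \<rhd> M" shows "ginv k \<odot> l \<in> M"
proof -
  have "l \<in> k \<rhd> M" using lcos_self[OF assms(2) M_subgroup] assms(3) by simp
  then show ?thesis using subgroup.lcos_module_imp[OF M_subgroup] assms group_axioms by blast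
qed

lemma S_in_G [simp]: "z \<in> C \<Longrightarrow> S z \<in> G"
  using S_section measurable_space[of S "borel_of TQ" "borel_of TL"] by (auto simp: coset_section_def)

lemma S_coset [simp]: "z \<in> C \<Longrightarrow> S z \<rhd> M = z" using S_section by (simp add: coset_section_def)

lemma measurable_S: "S \<in> borel_of TQ \<rightarrow>\<^sub>M borel_of TL" using S_section by (simp add: coset_section_def)

lemma continuous_mult: "continuous_map (prod_topology TL TL) TL (\<lambda>(a, b). a \<odot> b)"
  and continuous_inv: "continuous_map TL TL (\<lambda>a. ginv a)"
  using lie by (simp_all add: lie_group_def smooth_map_def prod_manifold_def)

lemma continuous_proj: "continuous_map TL TQ (\<lambda>k. k \<rhd> M)"
proof -
  have "smooth_map L Q (\<lambda>k. k \<rhd> M)" using hom unfolding homogeneous_manifold_def by blast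
  then show ?thesis unfolding smooth_map_def by blast
qed

lemma local_section:
  assumes "z \<in> C"
  obtains W \<sigma> where "openin TQ W" "z \<in> W" "continuous_map (subtopology TQ W) TL \<sigma>" "\<And>w. w \<in> W \<Longrightarrow> \<sigma> w \<rhd> M = w"
proof -
  from assms hom obtain W \<sigma> where "openin TQ W" "z \<in> W" "smooth_map (open_submanifold Q W) L \<sigma>" "\<forall>w\<in>W. \<sigma> w \<rhd> M = w"
    unfolding homogeneous_manifold_def by blast
  then show thesis using that[of W \<sigma>] by (auto simp: smooth_map_def open_submanifold_def)
qed

text \<open>Near a coset the action is multiplication by a continuous local section followed by the
  projection, both continuous; on overlaps the local formulas agree, since each of them computes the
  action.\<close>

lemma continuous_act: "continuous_map (prod_topology TL TQ) TQ (\<lambda>(k, z). k \<rhd> z)"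
proof -
  have "\<forall>z\<in>C. \<exists>W \<sigma>. openin TQ W \<and> z \<in> W \<and> continuous_map (subtopology TQ W) TL \<sigma> \<and> (\<forall>w\<in>W. \<sigma> w \<rhd> M = w)"
    using local_section by metis
  then obtain W \<sigma> where W: "\<And>z. z \<in> C \<Longrightarrow> openin TQ (W z)" "\<And>z. z \<in> C \<Longrightarrow> z \<in> W z"
    "\<And>z. z \<in> C \<Longrightarrow> continuous_map (subtopology TQ (W z)) TL (\<sigma> z)" "\<And>z w. z \<in> C \<Longrightarrow> w \<in> W z \<Longrightarrow> \<sigma> z w \<rhd> M = w"
    by metis
  have WC: "W z \<subseteq> C" if "z \<in> C" for z using openin_subset[OF W(1)[OF that]] by simp
  have \<sigma>G: "\<sigma> z w \<in> G" if "z \<in> C" "w \<in> W z" for z w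
    using W(3)[OF that(1)] that WC by (auto simp: continuous_map_def)
  define f where "f z = (\<lambda>(k, w). (k \<odot> \<sigma> z w) \<rhd> M)" for z
  have f: "f z (k, w) = k \<rhd> w" if "z \<in> C" "k \<in> G" "w \<in> W z" for z k w
    using lcos_m_assoc[OF M_sub that(2) \<sigma>G[OF that(1,3)]] W(4)[OF that(1,3)] by (simp add: f_def)
  show ?thesis
  proof (rule pasting_lemma[where I=C and T="\<lambda>z. G \<times> W z" and f=f])
    show "openin (prod_topology TL TQ) (G \<times> W z)" if "z \<in> C" for z
      using W(1)[OF that] openin_topspace[of TL] by (simp add: openin_prod_Times_iff)
    show "continuous_map (subtopology (prod_topology TL TQ) (G \<times> W z)) TQ (f z)" if z: "z \<in> C" for z
    proof -
      have t: "subtopology (prod_topology TL TQ) (G \<times> W z) = prod_topology TL (subtopology TQ (W z))"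
        by (metis subtopology_Times subtopology_topspace topspace_TL)
      have s: "continuous_map (prod_topology TL (subtopology TQ (W z))) TL (\<lambda>p. \<sigma> z (snd p))"
        using continuous_map_compose[OF continuous_map_snd W(3)[OF z], of TL] by (simp add: comp_def)
      have p: "continuous_map (prod_topology TL (subtopology TQ (W z))) (prod_topology TL TL) (\<lambda>p. (fst p, \<sigma> z (snd p)))"
        by (intro continuous_map_pairedI continuous_map_fst s)
      have "continuous_map (prod_topology TL (subtopology TQ (W z))) TQ ((\<lambda>k. k \<rhd> M) \<circ> (\<lambda>(a, b). a \<odot> b) \<circ> (\<lambda>p. (fst p, \<sigma> z (snd p))))"
        by (intro continuous_map_compose[OF p] continuous_map_compose[OF continuous_mult] continuous_proj)
      then show ?thesis unfolding t f_def by (simp add: comp_def case_prod_unfold)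
    qed
    show "f z x = f z' x" if "z \<in> C" "z' \<in> C" "x \<in> topspace (prod_topology TL TQ) \<inter> G \<times> W z \<inter> G \<times> W z'" for z z' x
      using that f by (cases x) auto
    show "\<exists>z. z \<in> C \<and> x \<in> G \<times> W z \<and> (case x of (k, z) \<Rightarrow> k \<rhd> z) = f z x" if "x \<in> topspace (prod_topology TL TQ)" for x
      using that f W(2) by (cases x) auto
  qed
qed

lemma measurable_mult_TL: "f \<in> N \<rightarrow>\<^sub>M borel_of TL \<Longrightarrow> g \<in> N \<rightarrow>\<^sub>M borel_of TL \<Longrightarrow> (\<lambda>x. f x \<odot> g x) \<in> N \<rightarrow>\<^sub>M borel_of TL"
  using measurable_compose[OF measurable_Pair continuous_map_measurable_prod[OF TL_second_countable TL_second_countable continuous_mult]]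
  by simp

lemma measurable_inv_TL: "f \<in> N \<rightarrow>\<^sub>M borel_of TL \<Longrightarrow> (\<lambda>x. ginv (f x)) \<in> N \<rightarrow>\<^sub>M borel_of TL"
  by (rule measurable_compose[OF _ continuous_map_measurable[OF continuous_inv]])

lemma measurable_act: "f \<in> N \<rightarrow>\<^sub>M borel_of TL \<Longrightarrow> g \<in> N \<rightarrow>\<^sub>M borel_of TQ \<Longrightarrow> (\<lambda>x. f x \<rhd> g x) \<in> N \<rightarrow>\<^sub>M borel_of TQ"
  using measurable_compose[OF measurable_Pair continuous_map_measurable_prod[OF TL_second_countable TQ_second_countable continuous_act]]
  by simp

lemma measurable_TL_G: "f \<in> N \<rightarrow>\<^sub>M borel_of TL \<Longrightarrow> x \<in> space N \<Longrightarrow> f x \<in> G"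
  using measurable_space[of f N "borel_of TL" x] by simp

lemma measurable_TQ_C: "f \<in> N \<rightarrow>\<^sub>M borel_of TQ \<Longrightarrow> x \<in> space N \<Longrightarrow> f x \<in> C"
  using measurable_space[of f N "borel_of TQ" x] by simp

lemma continuous_act_const: "k \<in> G \<Longrightarrow> continuous_map TQ TQ (\<lambda>z. k \<rhd> z)"
  using continuous_map_compose[OF _ continuous_act, of TQ "\<lambda>z. (k, z)"] by (simp add: comp_def continuous_map_pairedI)

text \<open>Two representatives of the same coset differ by an \<open>F\<close>-measurable element
  of \<open>M\<close>. Given \<open>F\<close> this element is frozen, and moving a variable with
  \<open>M\<close>-invariant law by it changes neither the law nor the independence. It is the
  device for replacing the merely measurable \<open>S\<close> by whatever representative is
  convenient.\<close>

lemma change_representative: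
  assumes N: "finite_measure N" and sub: "subalgebra N F"
    and k0: "k0 \<in> F \<rightarrow>\<^sub>M borel_of TL" and k: "k \<in> F \<rightarrow>\<^sub>M borel_of TL"
    and same: "\<And>\<omega>. \<omega> \<in> space N \<Longrightarrow> k0 \<omega> \<rhd> M = k \<omega> \<rhd> M"
    and Z: "Z \<in> N \<rightarrow>\<^sub>M borel_of TQ"
    and \<nu>: "prob_space \<nu>" "invariant_measure K M TQ \<nu>"
    and indep: "\<And>A B. A \<in> sets F \<Longrightarrow> B \<in> sets (borel_of TQ) \<Longrightarrow>
       emeasure N {\<omega> \<in> A. ginv (k0 \<omega>) \<rhd> Z \<omega> \<in> B} = emeasure N A * emeasure \<nu> B"
    and A: "A \<in> sets F" and B: "B \<in> sets (borel_of TQ)"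
  shows "emeasure N {\<omega> \<in> A. ginv (k \<omega>) \<rhd> Z \<omega> \<in> B} = emeasure N A * emeasure \<nu> B"
proof -
  interpret N: finite_measure N by fact
  have sp: "space N = space F" and AN: "A \<in> sets N" using sub A by (auto simp: subalgebra_def)
  have s\<nu>: "sets \<nu> = sets (borel_of TQ)" using \<nu>(2) by (simp add: invariant_measure_def)
  have kN: "k \<in> N \<rightarrow>\<^sub>M borel_of TL" "k0 \<in> N \<rightarrow>\<^sub>M borel_of TL" using measurable_from_subalg[OF sub] k k0 by auto
  define Y where "Y \<omega> = ginv (k0 \<omega>) \<rhd> Z \<omega>" for \<omega>
  define m where "m \<omega> = ginv (k \<omega>) \<odot> k0 \<omega>" for \<omega>
  have Y: "Y \<in> N \<rightarrow>\<^sub>M borel_of TQ" unfolding Y_def by (intro measurable_act measurable_inv_TL kN Z)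
  have m: "m \<in> F \<rightarrow>\<^sub>M borel_of TL" unfolding m_def by (intro measurable_mult_TL measurable_inv_TL k k0)
  have mM: "m \<omega> \<in> M" if "\<omega> \<in> space N" for \<omega>
    unfolding m_def using same[OF that] measurable_TL_G[OF kN(1) that] measurable_TL_G[OF kN(2) that] by (intro coset_eq_imp) auto
  have mY: "m \<omega> \<rhd> Y \<omega> = ginv (k \<omega>) \<rhd> Z \<omega>" if "\<omega> \<in> space N" for \<omega>
  proof -
    have G: "k \<omega> \<in> G" "k0 \<omega> \<in> G" "Z \<omega> \<in> C"
      using measurable_TL_G[OF kN(1) that] measurable_TL_G[OF kN(2) that] measurable_TQ_C[OF Z that] by auto
    have "m \<omega> \<rhd> Y \<omega> = (m \<omega> \<odot> ginv (k0 \<omega>)) \<rhd> Z \<omega>"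
      unfolding Y_def m_def using G by (simp add: act_act)
    also have "m \<omega> \<odot> ginv (k0 \<omega>) = ginv (k \<omega>)" using G by (simp add: m_def m_assoc)
    finally show ?thesis .
  qed
  \<comment> \<open>With the first argument frozen, \<open>m \<omega>\<close> is a fixed element of
    \<open>M\<close>, so the integral over \<open>\<nu>\<close> loses it by invariance; with the
    increment inserted, \<open>m \<omega>\<close> turns the representative \<open>k0\<close> into
    \<open>k\<close>.\<close>
  define \<Phi> where "\<Phi> = (\<lambda>(\<omega>, e). indicator A \<omega> * indicator B (m \<omega> \<rhd> e) :: ennreal)"
  have m': "(\<lambda>p. m (fst p)) \<in> F \<Otimes>\<^sub>M borel_of TQ \<rightarrow>\<^sub>M borel_of TL" by (rule measurable_compose[OF measurable_fst m])
  have ma: "(\<lambda>p. m (fst p) \<rhd> snd p) \<in> F \<Otimes>\<^sub>M borel_of TQ \<rightarrow>\<^sub>M borel_of TQ"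
    by (intro measurable_act m' measurable_snd)
  have "(\<lambda>p. indicator A (fst p) :: ennreal) \<in> borel_measurable (F \<Otimes>\<^sub>M borel_of TQ)"
    by (rule measurable_compose[OF measurable_fst borel_measurable_indicator[OF A]])
  moreover have "(\<lambda>p. indicator B (m (fst p) \<rhd> snd p) :: ennreal) \<in> borel_measurable (F \<Otimes>\<^sub>M borel_of TQ)"
    by (rule measurable_compose[OF ma borel_measurable_indicator[OF B]])
  ultimately have \<Phi>: "\<Phi> \<in> borel_measurable (F \<Otimes>\<^sub>M borel_of TQ)"
    unfolding \<Phi>_def case_prod_unfold by (rule borel_measurable_times_ennreal)
  have "(\<integral>\<^sup>+\<omega>. \<Phi> (\<omega>, Y \<omega>) \<partial>N) = (\<integral>\<^sup>+\<omega>. \<integral>\<^sup>+e. \<Phi> (\<omega>, e) \<partial>\<nu> \<partial>N)"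
  proof (rule nn_integral_kernel_rectangles[OF N N sub sub Y _ _ _ _ _ _ \<Phi>, where \<P>="sets (borel_of TQ)"])
    show "(\<lambda>_. \<nu>) \<in> F \<rightarrow>\<^sub>M subprob_algebra (borel_of TQ)"
      using \<nu>(1) s\<nu> by (intro measurable_const) (simp add: space_subprob_algebra prob_space_imp_subprob_space)
    show "Int_stable (sets (borel_of TQ))" by (auto simp: Int_stable_def)
    fix A' B' assume AB: "A' \<in> sets F" "B' \<in> sets (borel_of TQ)"
    then have "A' \<in> sets N" using sub by (auto simp: subalgebra_def)
    then have "(\<integral>\<^sup>+\<omega>. indicator A' \<omega> * emeasure \<nu> B' \<partial>N) = emeasure N A' * emeasure \<nu> B'"
      by (simp add: nn_integral_multc)
    then show "emeasure N {\<omega> \<in> A'. Y \<omega> \<in> B'} = (\<integral>\<^sup>+\<omega>. indicator A' \<omega> * emeasure \<nu> B' \<partial>N)"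
      using indep[OF AB] by (simp add: Y_def)
  next
    show "sets (borel_of TQ) \<subseteq> Pow (space (borel_of TQ))" by (rule sets.space_closed)
    show "sets (borel_of TQ) = sigma_sets (space (borel_of TQ)) (sets (borel_of TQ))"
      by (rule sets.sigma_sets_eq[symmetric])
    show "space (borel_of TQ) \<in> sets (borel_of TQ)" by (rule sets.top)
  qed
  moreover have "(\<integral>\<^sup>+\<omega>. \<Phi> (\<omega>, Y \<omega>) \<partial>N) = emeasure N {\<omega> \<in> A. ginv (k \<omega>) \<rhd> Z \<omega> \<in> B}"
  proof -
    have "{\<omega> \<in> A. ginv (k \<omega>) \<rhd> Z \<omega> \<in> B} = A \<inter> ((\<lambda>\<omega>. ginv (k \<omega>) \<rhd> Z \<omega>) -` B \<inter> space N)"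
      using sets.sets_into_space[OF AN] by auto
    also have "\<dots> \<in> sets N"
      using measurable_sets[OF measurable_act[OF measurable_inv_TL[OF kN(1)] Z] B] AN by auto
    finally have "emeasure N {\<omega> \<in> A. ginv (k \<omega>) \<rhd> Z \<omega> \<in> B} = (\<integral>\<^sup>+\<omega>. indicator {\<omega> \<in> A. ginv (k \<omega>) \<rhd> Z \<omega> \<in> B} \<omega> \<partial>N)"
      by simp
    also have "\<dots> = (\<integral>\<^sup>+\<omega>. \<Phi> (\<omega>, Y \<omega>) \<partial>N)"
      by (rule nn_integral_cong) (auto simp: \<Phi>_def mY indicator_def)
    finally show ?thesis by simp
  qed
  moreover have "(\<integral>\<^sup>+\<omega>. \<integral>\<^sup>+e. \<Phi> (\<omega>, e) \<partial>\<nu> \<partial>N) = emeasure N A * emeasure \<nu> B"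
  proof -
    have "(\<integral>\<^sup>+e. \<Phi> (\<omega>, e) \<partial>\<nu>) = indicator A \<omega> * emeasure \<nu> B" if w: "\<omega> \<in> space N" for \<omega>
    proof -
      have mG: "m \<omega> \<in> G" using mM[OF w] M_sub by auto
      have mm: "(\<lambda>e. m \<omega> \<rhd> e) \<in> \<nu> \<rightarrow>\<^sub>M borel_of TQ"
        using continuous_map_measurable[OF continuous_act_const[OF mG]] s\<nu> by (simp cong: measurable_cong_sets)
      have "(\<integral>\<^sup>+e. \<Phi> (\<omega>, e) \<partial>\<nu>) = indicator A \<omega> * (\<integral>\<^sup>+e. indicator B (m \<omega> \<rhd> e) \<partial>\<nu>)"
        unfolding \<Phi>_def prod.case
        by (rule nn_integral_cmult) (rule measurable_compose[OF mm borel_measurable_indicator[OF B]])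
      also have "(\<integral>\<^sup>+e. indicator B (m \<omega> \<rhd> e) \<partial>\<nu>) = (\<integral>\<^sup>+e. indicator B e \<partial>distr \<nu> (borel_of TQ) (\<lambda>e. m \<omega> \<rhd> e))"
        using B by (intro nn_integral_distr[symmetric, OF mm]) simp
      also have "distr \<nu> (borel_of TQ) (\<lambda>e. m \<omega> \<rhd> e) = \<nu>"
        using \<nu>(2) mM[OF w] by (simp add: invariant_measure_def)
      also have "(\<integral>\<^sup>+e. indicator B e \<partial>\<nu>) = emeasure \<nu> B" using B s\<nu> by simp
      finally show ?thesis .
    qed
    then have "(\<integral>\<^sup>+\<omega>. \<integral>\<^sup>+e. \<Phi> (\<omega>, e) \<partial>\<nu> \<partial>N) = (\<integral>\<^sup>+\<omega>. indicator A \<omega> * emeasure \<nu> B \<partial>N)"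
      by (intro nn_integral_cong) simp
    then show ?thesis using AN by (simp add: nn_integral_multc)
  qed
  ultimately show ?thesis by simp
qed

end

section \<open>Paths in a homogeneous space with independent increments\<close>

lemma limitin_compose_filterlim:
  assumes "limitin X f l F" "filterlim g F G'" shows "limitin X (\<lambda>n. f (g n)) l G'"
  using assms unfolding limitin_def filterlim_iff by auto

text \<open>Dominated convergence, in the form in which independence from a fixed event
  \<open>A\<close> is carried over to a limit.\<close>

lemma countable_set_integral_limit:
  fixes w :: "nat \<Rightarrow> 'a \<Rightarrow> 'b"
  assumes N: "finite_measure N" and A: "A \<in> sets N" and f: "f \<in> Cb X"
    and w: "\<And>n. w n \<in> N \<rightarrow>\<^sub>M borel_of X" and w': "w' \<in> N \<rightarrow>\<^sub>M borel_of X"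
    and lim: "\<And>\<omega>. \<omega> \<in> space N \<Longrightarrow> limitin X (\<lambda>n. w n \<omega>) (w' \<omega>) sequentially"
  shows "(\<lambda>n. \<integral>\<omega>. indicator A \<omega> * f (w n \<omega>) \<partial>N) \<longlonglongrightarrow> (\<integral>\<omega>. indicator A \<omega> * f (w' \<omega>) \<partial>N)"
proof -
  interpret finite_measure N by fact
  obtain B where B: "\<And>x. x \<in> topspace X \<Longrightarrow> \<bar>f x\<bar> \<le> B" using Cb_bounded[OF f] by blast
  have fm: "f \<in> borel_measurable (borel_of X)" using Cb_measurable[OF f] .
  have fc: "continuous_map X euclideanreal f" using f by (simp add: Cb_def)
  show ?thesis
  proof (rule integral_dominated_convergence[where w="\<lambda>_. \<bar>B\<bar>"])
    show "(\<lambda>\<omega>. indicator A \<omega> * f (w' \<omega>)) \<in> borel_measurable N"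
      using measurable_compose[OF w' fm] A by simp
    show "(\<lambda>\<omega>. indicator A \<omega> * f (w n \<omega>)) \<in> borel_measurable N" for n
      using measurable_compose[OF w fm] A by simp
    show "AE \<omega> in N. (\<lambda>n. indicator A \<omega> * f (w n \<omega>)) \<longlonglongrightarrow> indicator A \<omega> * f (w' \<omega>)"
    proof (rule AE_I2)
      fix \<omega> assume "\<omega> \<in> space N"
      from continuous_map_limit[OF fc lim[OF this]]
      have "(\<lambda>n. f (w n \<omega>)) \<longlonglongrightarrow> f (w' \<omega>)" by (simp add: comp_def)
      then show "(\<lambda>n. indicator A \<omega> * f (w n \<omega>)) \<longlonglongrightarrow> indicator A \<omega> * f (w' \<omega>)"
        by (intro tendsto_mult tendsto_const)
    qed
    show "AE \<omega> in N. norm (indicator A \<omega> * f (w n \<omega>)) \<le> \<bar>B\<bar>" for n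
    proof (rule AE_I2)
      fix \<omega> assume "\<omega> \<in> space N"
      then have "w n \<omega> \<in> topspace X" using measurable_space[OF w] by fastforce
      from B[OF this] show "norm (indicator A \<omega> * f (w n \<omega>)) \<le> \<bar>B\<bar>" by (auto simp: indicator_def)
    qed
  qed simp
qed

text \<open>The product of the sections of the successive increments, computed from the positions
  \<open>x\<close> instead of the increments. After \<open>i + 1\<close> factors it represents the
  position \<open>x i\<close>. It is used in place of \<open>S (x i)\<close> because with it the
  increments recombine exactly to \<open>coset_word\<close>.\<close>

primrec frame :: "('k, 'b) monoid_scheme \<Rightarrow> ('k set \<Rightarrow> 'k) \<Rightarrow> (nat \<Rightarrow> 'k set) \<Rightarrow> nat \<Rightarrow> 'k" where
  "frame K S x 0 = \<one>\<^bsub>K\<^esub>"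
| "frame K S x (Suc i) = frame K S x i \<otimes>\<^bsub>K\<^esub> S (inv\<^bsub>K\<^esub> (frame K S x i) <#\<^bsub>K\<^esub> x i)"

text \<open>\<open>Dn\<close> plays the part of the rational times. It contains \<open>T\<close>,
  which cannot be approached from the right within the interval.\<close>

locale homogeneous_path_measure = homogeneous_space K L M Q S
  for K :: "('k, 'b) monoid_scheme" and L :: "'k manifold" and M :: "'k set"
    and Q :: "'k set manifold" and S :: "'k set \<Rightarrow> 'k" +
  fixes T :: real and N :: "(real \<Rightarrow> 'k set) measure" and Dn :: "real set"
  assumes T_pos: "0 < T" and prob_N: "prob_space N" and sets_N: "sets N = sets (path_borel T (top_of Q))"
    and Dn: "Dn \<subseteq> {0..T}" "T \<in> Dn" "\<And>s t. 0 \<le> s \<Longrightarrow> s < t \<Longrightarrow> t \<le> T \<Longrightarrow> \<exists>q\<in>Dn. s < q \<and> q < t"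
begin

definition Fil :: "real set \<Rightarrow> (real \<Rightarrow> 'k set) measure" where
  "Fil I = vimage_algebra (space N) (\<lambda>\<omega>. restrict \<omega> I) (PiM I (\<lambda>_. borel_of TQ))"

definition incr :: "real \<Rightarrow> real \<Rightarrow> (real \<Rightarrow> 'k set) \<Rightarrow> 'k set" where
  "incr s t \<omega> = ginv (S (\<omega> s)) \<rhd> \<omega> t"

definition \<mu>0 :: "real \<Rightarrow> real \<Rightarrow> 'k set measure" where
  "\<mu>0 s t = distr N (borel_of TQ) (incr s t)"

end

text \<open>This is as much as can be extracted almost surely from countably many identities; all
  other times are reached from it path by path.\<close>

locale homogeneous_independent_increments = homogeneous_path_measure +
  assumes rational_indep: "\<And>s t A B. s \<in> Dn \<Longrightarrow> t \<in> Dn \<Longrightarrow> s < t \<Longrightarrow> A \<in> sets (Fil (Dn \<inter> {..s})) \<Longrightarrow>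
      B \<in> sets (borel_of TQ) \<Longrightarrow> emeasure N {\<omega> \<in> A. incr s t \<omega> \<in> B} = emeasure N A * emeasure (\<mu>0 s t) B"
    and rational_inv: "\<And>s t. s \<in> Dn \<Longrightarrow> t \<in> Dn \<Longrightarrow> s < t \<Longrightarrow> invariant_measure K M TQ (\<mu>0 s t)"

context homogeneous_path_measure
begin

sublocale N: prob_space N by (rule prob_N)

sublocale PQ: path_space T TQ
  by unfold_locales (use T_pos TQ_metrizable TQ_second_countable in auto)

lemma space_N: "space N = rcll_paths T TQ"
  using sets_eq_imp_space_eq[OF sets_N] by simp

lemma measurable_ev: "t \<in> {0..T} \<Longrightarrow> (\<lambda>\<omega>. \<omega> t) \<in> N \<rightarrow>\<^sub>M borel_of TQ"
  using PQ.measurable_evaluation measurable_cong_sets[OF sets_N refl] by blast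

lemma ev_in_C: "\<omega> \<in> space N \<Longrightarrow> t \<in> {0..T} \<Longrightarrow> \<omega> t \<in> C"
  using measurable_TQ_C[OF measurable_ev] by blast

lemma space_Fil [simp]: "space (Fil I) = space N" by (simp add: Fil_def)

lemma Fil_ev:
  assumes "u \<in> I" "I \<subseteq> {0..T}" shows "(\<lambda>\<omega>. \<omega> u) \<in> Fil I \<rightarrow>\<^sub>M borel_of TQ"
proof -
  have "(\<lambda>\<omega>. restrict \<omega> I) \<in> space N \<rightarrow> space (PiM I (\<lambda>_. borel_of TQ))"
    using ev_in_C assms(2) by (auto simp: space_PiM)
  from measurable_vimage_algebra1[OF this]
  have "(\<lambda>\<omega>. restrict \<omega> I) \<in> Fil I \<rightarrow>\<^sub>M PiM I (\<lambda>_. borel_of TQ)" by (simp add: Fil_def)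
  from measurable_compose[OF this measurable_component_singleton[OF assms(1)]] assms(1)
  show ?thesis by simp
qed

lemma sets_Fil_subset:
  assumes "space H = space N" and "\<And>u. u \<in> I \<Longrightarrow> (\<lambda>\<omega>. \<omega> u) \<in> H \<rightarrow>\<^sub>M borel_of TQ"
  shows "sets (Fil I) \<subseteq> sets H"
proof -
  have "(\<lambda>\<omega>. restrict \<omega> I) \<in> H \<rightarrow>\<^sub>M PiM I (\<lambda>_. borel_of TQ)"
    by (rule measurable_restrict) (rule assms(2))
  then have "(\<lambda>\<omega>. \<omega>) \<in> H \<rightarrow>\<^sub>M Fil I"
    unfolding Fil_def using assms(1) by (intro measurable_vimage_algebra2) auto
  from measurable_sets[OF this] show ?thesis
    using assms(1) sets.sets_into_space[of _ "Fil I"] by (auto simp: vimage_def Int_absorb2)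
qed

lemma Fil_subalgebra: "I \<subseteq> {0..T} \<Longrightarrow> subalgebra N (Fil I)"
  unfolding subalgebra_def by (intro conjI sets_Fil_subset measurable_ev) auto

lemma Fil_mono: "I \<subseteq> I' \<Longrightarrow> I' \<subseteq> {0..T} \<Longrightarrow> sets (Fil I) \<subseteq> sets (Fil I')"
  using sets_Fil_subset[of "Fil I'" I] Fil_ev by auto

lemma measurable_Fil_mono:
  assumes "f \<in> Fil I \<rightarrow>\<^sub>M B" "I \<subseteq> I'" "I' \<subseteq> {0..T}" shows "f \<in> Fil I' \<rightarrow>\<^sub>M B"
  using assms(1) Fil_mono[OF assms(2,3)] by (auto simp: measurable_def)

lemma approx_right:
  assumes "0 \<le> u" "u < s" "s \<le> T"
  obtains q where "\<And>n::nat. q n \<in> Dn" "\<And>n. u < q n" "\<And>n. q n < s" "filterlim q (at_right u) sequentially"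
proof -
  have "\<exists>q\<in>Dn. u < q \<and> q < min s (u + 1 / real (Suc n))" for n
    using Dn(3)[of u "min s (u + 1 / real (Suc n))"] assms by auto
  then obtain q where q: "\<And>n. q n \<in> Dn" "\<And>n. u < q n" "\<And>n. q n < min s (u + 1 / real (Suc n))" by metis
  have "q \<longlonglongrightarrow> u"
  proof (rule tendsto_sandwich)
    show "\<forall>\<^sub>F n in sequentially. u \<le> q n" using q(2) by (simp add: less_imp_le)
    show "\<forall>\<^sub>F n in sequentially. q n \<le> u + 1 / real (Suc n)" using q(3) by (auto intro!: always_eventually less_imp_le)
    show "(\<lambda>n. u + 1 / real (Suc n)) \<longlonglongrightarrow> u"
      using tendsto_add[OF tendsto_const[of u] LIMSEQ_inverse_real_of_nat] by (simp add: inverse_eq_divide)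
  qed simp
  then have "filterlim q (at_right u) sequentially"
    unfolding filterlim_at using q(2) by (auto intro!: always_eventually simp: less_imp_neq[symmetric])
  then show thesis using that[of q] q by auto
qed

lemma path_right_limit:
  assumes "\<omega> \<in> space N" "0 \<le> u" "u < T" "filterlim q (at_right u) sequentially"
  shows "limitin TQ (\<lambda>n. \<omega> (q n)) (\<omega> u) sequentially"
  using limitin_compose_filterlim[OF PQ.limit_right assms(4)] assms(1-3) by (simp add: space_N)

lemma Fil_right_ev:
  assumes "0 \<le> u" "u < s" "s \<le> T" shows "(\<lambda>\<omega>. \<omega> u) \<in> Fil (Dn \<inter> {..s}) \<rightarrow>\<^sub>M borel_of TQ"
proof -
  obtain q where q: "\<And>n. q n \<in> Dn" "\<And>n. u < q n" "\<And>n. q n < s" "filterlim q (at_right u) sequentially"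
    using approx_right[OF assms] by metis
  show ?thesis
  proof (rule measurable_limit_metrizable[OF TQ_metrizable])
    show "(\<lambda>\<omega>. \<omega> (q n)) \<in> Fil (Dn \<inter> {..s}) \<rightarrow>\<^sub>M borel_of TQ" for n
      using q Dn(1) by (intro Fil_ev) (auto intro: less_imp_le)
    show "limitin TQ (\<lambda>n. \<omega> (q n)) (\<omega> u) sequentially" if "\<omega> \<in> space (Fil (Dn \<inter> {..s}))" for \<omega>
      using path_right_limit[OF _ assms(1) _ q(4)] that assms by simp
  qed
qed

text \<open>A position at time \<open>u \<le> s\<close> is a right limit of positions at times in
  \<open>Dn\<close> below \<open>s'\<close>. So an increment starting at a time of \<open>Dn\<close>
  after \<open>s\<close> is independent of the full past of \<open>s\<close>.\<close>

lemma Fil_right_mono: "0 \<le> s \<Longrightarrow> s < s' \<Longrightarrow> s' \<le> T \<Longrightarrow> sets (Fil {0..s}) \<subseteq> sets (Fil (Dn \<inter> {..s'}))"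
  by (rule sets_Fil_subset) (auto intro!: Fil_right_ev)

lemma measurable_incr:
  assumes "s \<in> I" "t \<in> I" "I \<subseteq> {0..T}" shows "incr s t \<in> Fil I \<rightarrow>\<^sub>M borel_of TQ"
proof -
  have "(\<lambda>\<omega>. S (\<omega> s)) \<in> Fil I \<rightarrow>\<^sub>M borel_of TL"
    by (rule measurable_compose[OF Fil_ev[OF assms(1,3)] measurable_S])
  from measurable_act[OF measurable_inv_TL[OF this] Fil_ev[OF assms(2,3)]]
  show ?thesis unfolding incr_def[abs_def] .
qed

lemma measurable_incr_N: "s \<in> {0..T} \<Longrightarrow> t \<in> {0..T} \<Longrightarrow> incr s t \<in> N \<rightarrow>\<^sub>M borel_of TQ"
  using measurable_incr[of s "{0..T}" t] measurable_from_subalg[OF Fil_subalgebra] by blast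

lemma sets_\<mu>0 [simp]: "sets (\<mu>0 s t) = sets (borel_of TQ)" by (simp add: \<mu>0_def)

lemma space_\<mu>0 [simp]: "space (\<mu>0 s t) = C" by (simp add: \<mu>0_def)

lemma prob_\<mu>0: "s \<in> {0..T} \<Longrightarrow> t \<in> {0..T} \<Longrightarrow> prob_space (\<mu>0 s t)"
  unfolding \<mu>0_def by (rule N.prob_space_distr[OF measurable_incr_N])

lemma incr_same: "\<omega> \<in> space N \<Longrightarrow> s \<in> {0..T} \<Longrightarrow> incr s s \<omega> = M"
proof -
  assume "\<omega> \<in> space N" "s \<in> {0..T}"
  then have "\<omega> s \<in> C" using ev_in_C by simp
  then have "ginv (S (\<omega> s)) \<rhd> (S (\<omega> s) \<rhd> M) = M" using M_in_C by (simp add: act_act act_one del: S_coset)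
  then show ?thesis using \<open>\<omega> s \<in> C\<close> by (simp add: incr_def)
qed

lemma \<mu>0_same: "s \<in> {0..T} \<Longrightarrow> \<mu>0 s s = return (borel_of TQ) M"
proof -
  assume s: "s \<in> {0..T}"
  have "\<mu>0 s s = distr N (borel_of TQ) (\<lambda>_. M)"
    unfolding \<mu>0_def by (rule distr_cong) (use incr_same s in auto)
  also have "\<dots> = return (borel_of TQ) M" using M_in_C by (intro N.distr_const) simp
  finally show ?thesis .
qed

lemma invariant_return: "invariant_measure K M TQ (return (borel_of TQ) M)"
  unfolding invariant_measure_def
proof (intro conjI ballI)
  fix h assume h: "h \<in> M"
  then have "h \<in> G" using M_sub by auto
  from continuous_map_measurable[OF continuous_act_const[OF this]] M_act[OF h] M_in_C
  show "distr (return (borel_of TQ) M) (borel_of TQ) (\<lambda>z. h \<rhd> z) = return (borel_of TQ) M"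
    by (subst distr_return) auto
qed simp

text \<open>The Lindelof property makes countably many local sections suffice, so that choosing
  among them is a measurable operation.\<close>

lemma countable_local_sections:
  obtains W :: "nat \<Rightarrow> 'k set set" and \<sigma> where "\<And>j. openin TQ (W j)" "(\<Union>j. W j) = C"
    "\<And>j. continuous_map (subtopology TQ (W j)) TL (\<sigma> j)" "\<And>j w. w \<in> W j \<Longrightarrow> \<sigma> j w \<rhd> M = w"
proof -
  let ?U = "{W. \<exists>\<sigma>. openin TQ W \<and> continuous_map (subtopology TQ W) TL \<sigma> \<and> (\<forall>w\<in>W. \<sigma> w \<rhd> M = w)}"
  have "Lindelof_space TQ" using TQ_second_countable by (rule second_countable_imp_Lindelof_space)
  moreover have "\<Union>?U = topspace TQ"
  proof
    show "\<Union>?U \<subseteq> topspace TQ" using openin_subset by blast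
    show "topspace TQ \<subseteq> \<Union>?U"
    proof
      fix z assume "z \<in> topspace TQ"
      then obtain W \<sigma> where "openin TQ W" "z \<in> W" "continuous_map (subtopology TQ W) TL \<sigma>" "\<And>w. w \<in> W \<Longrightarrow> \<sigma> w \<rhd> M = w"
        using local_section[of z] by auto
      then show "z \<in> \<Union>?U" by blast
    qed
  qed
  ultimately obtain \<V> where V: "countable \<V>" "\<V> \<subseteq> ?U" "\<Union>\<V> = topspace TQ"
    unfolding Lindelof_space_def by (metis (no_types, lifting) mem_Collect_eq)
  have ne: "\<V> \<noteq> {}" using V(3) M_in_C by auto
  define W where "W = from_nat_into \<V>"
  have WV: "W j \<in> \<V>" for j using from_nat_into[OF ne] by (simp add: W_def)
  then have "\<exists>\<sigma>. openin TQ (W j) \<and> continuous_map (subtopology TQ (W j)) TL \<sigma> \<and> (\<forall>w\<in>W j. \<sigma> w \<rhd> M = w)" for j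
    using V(2) by blast
  then obtain \<sigma> where \<sigma>: "\<And>j. openin TQ (W j) \<and> continuous_map (subtopology TQ (W j)) TL (\<sigma> j) \<and> (\<forall>w\<in>W j. \<sigma> j w \<rhd> M = w)"
    by metis
  moreover have "(\<Union>j. W j) = C"
    using V(3) range_from_nat_into[OF ne V(1)] by (simp add: W_def)
  ultimately show thesis using that[of W \<sigma>] by blast
qed

end

context homogeneous_independent_increments
begin

lemma rational_representative:
  assumes st: "s \<in> Dn" "t \<in> Dn" "s < t" and k: "k \<in> Fil (Dn \<inter> {..s}) \<rightarrow>\<^sub>M borel_of TL"
    and kM: "\<And>\<omega>. \<omega> \<in> space N \<Longrightarrow> k \<omega> \<rhd> M = \<omega> s"
    and AB: "A \<in> sets (Fil (Dn \<inter> {..s}))" "B \<in> sets (borel_of TQ)"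
  shows "emeasure N {\<omega> \<in> A. ginv (k \<omega>) \<rhd> \<omega> t \<in> B} = emeasure N A * emeasure (\<mu>0 s t) B"
proof (rule change_representative[where ?k0.0="\<lambda>\<omega>. S (\<omega> s)" and Z="\<lambda>\<omega>. \<omega> t", OF N.finite_measure_axioms])
  show "subalgebra N (Fil (Dn \<inter> {..s}))" using Dn by (intro Fil_subalgebra) auto
  show "(\<lambda>\<omega>. S (\<omega> s)) \<in> Fil (Dn \<inter> {..s}) \<rightarrow>\<^sub>M borel_of TL"
    using st Dn by (intro measurable_compose[OF Fil_ev measurable_S]) auto
  show "S (\<omega> s) \<rhd> M = k \<omega> \<rhd> M" if "\<omega> \<in> space N" for \<omega>
    using kM[OF that] ev_in_C[OF that] st Dn by auto
  show "(\<lambda>\<omega>. \<omega> t) \<in> N \<rightarrow>\<^sub>M borel_of TQ" using st Dn by (intro measurable_ev) auto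
  show "prob_space (\<mu>0 s t)" using st Dn(1) by (intro prob_\<mu>0) auto
  show "invariant_measure K M TQ (\<mu>0 s t)" by (rule rational_inv[OF st])
  show "emeasure N {\<omega> \<in> A. ginv (S (\<omega> s)) \<rhd> \<omega> t \<in> B} = emeasure N A * emeasure (\<mu>0 s t) B"
    if "A \<in> sets (Fil (Dn \<inter> {..s}))" "B \<in> sets (borel_of TQ)" for A B
    using rational_indep[OF st that] by (simp add: incr_def)
qed (use k AB in auto)

text \<open>Rational times are approached from the right. The section used at the approximating times is
  continuous near the limit point and is selected by the position at time \<open>s\<close>, so that it is
  measurable with respect to the past and the increments converge pointwise.\<close>

lemma increment_limit:
  assumes s: "0 \<le> s" and st: "s < t" and t: "t \<le> T"
  obtains k where "k \<in> Fil {0..s} \<rightarrow>\<^sub>M borel_of TL" "\<And>\<omega>. \<omega> \<in> space N \<Longrightarrow> k \<omega> \<rhd> M = \<omega> s"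
    "invariant_measure K M TQ (distr N (borel_of TQ) (\<lambda>\<omega>. ginv (k \<omega>) \<rhd> \<omega> t))"
    "\<And>A B. A \<in> sets (Fil {0..s}) \<Longrightarrow> B \<in> sets (borel_of TQ) \<Longrightarrow>
      emeasure N {\<omega> \<in> A. ginv (k \<omega>) \<rhd> \<omega> t \<in> B} = emeasure N A * emeasure (distr N (borel_of TQ) (\<lambda>\<omega>. ginv (k \<omega>) \<rhd> \<omega> t)) B"
proof -
  obtain W :: "nat \<Rightarrow> 'a set set" and \<sigma> where W: "\<And>j. openin TQ (W j)" "(\<Union>j. W j) = C"
    "\<And>j. continuous_map (subtopology TQ (W j)) TL (\<sigma> j)" "\<And>j w. w \<in> W j \<Longrightarrow> \<sigma> j w \<rhd> M = w"
    using countable_local_sections by metis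
  have WC: "W j \<subseteq> C" for j using W(2) by blast
  \<comment> \<open>The local section is continued by \<open>S\<close> outside its domain. This
    gives a Borel section on the whole space that is continuous on the open set
    \<open>W j\<close>.\<close>
  define \<sigma>' where "\<sigma>' j z = (if z \<in> W j then \<sigma> j z else S z)" for j z
  have \<sigma>G: "\<sigma> j w \<in> G" if "w \<in> W j" for j w
    using W(3)[of j] that WC by (auto simp: continuous_map_def)
  have \<sigma>'M: "\<sigma>' j z \<rhd> M = z" if "z \<in> C" for j z using W(4) that by (simp add: \<sigma>'_def)
  have m\<sigma>': "\<sigma>' j \<in> borel_of TQ \<rightarrow>\<^sub>M borel_of TL" for j
  proof (rule measurable_borel_ofI)
    show "\<sigma>' j z \<in> topspace TL" if "z \<in> space (borel_of TQ)" for z using \<sigma>G that by (simp add: \<sigma>'_def)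
    fix U assume U: "openin TL U"
    have "openin (subtopology TQ (W j)) {z \<in> topspace (subtopology TQ (W j)). \<sigma> j z \<in> U}"
      by (rule openin_continuous_map_preimage[OF W(3) U])
    then have o: "openin TQ {z \<in> W j. \<sigma> j z \<in> U}"
      using openin_trans_full[OF _ W(1)] WC by (simp add: Int_absorb1 Int_absorb2)
    have "\<sigma>' j -` U \<inter> space (borel_of TQ) = {z \<in> W j. \<sigma> j z \<in> U} \<union> ((S -` U \<inter> space (borel_of TQ)) - W j)"
      using WC by (auto simp: \<sigma>'_def split: if_splits)
    then show "\<sigma>' j -` U \<inter> space (borel_of TQ) \<in> sets (borel_of TQ)"
      using borel_of_open[OF o] borel_of_open[OF W(1)] measurable_sets[OF measurable_S borel_of_open[OF U]] by auto
  qed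
  \<comment> \<open>The first chart of the cover containing \<open>z\<close>; the level sets are
    differences of open sets.\<close>
  define J where "J z = (LEAST j. z \<in> W j)" for z
  have J: "z \<in> W (J z)" if z: "z \<in> C" for z
  proof -
    have "\<exists>j. z \<in> W j" using that W(2) by auto
    then show ?thesis unfolding J_def by (rule LeastI_ex)
  qed
  have mJ: "J \<in> borel_of TQ \<rightarrow>\<^sub>M count_space UNIV"
  proof (rule measurableI)
    fix A :: "nat set"
    have e: "J -` {i} \<inter> space (borel_of TQ) = W i - (\<Union>l<i. W l)" for i
    proof (intro equalityI subsetI)
      fix z assume "z \<in> J -` {i} \<inter> space (borel_of TQ)"
      then have z: "z \<in> C" "J z = i" by auto
      have "z \<in> W i" using J[OF z(1)] z(2) by simp
      moreover have "z \<notin> W l" if "l < i" for l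
        using not_less_Least[of l "\<lambda>j. z \<in> W j"] that z(2) unfolding J_def by simp
      ultimately show "z \<in> W i - (\<Union>l<i. W l)" by blast
    next
      fix z assume z: "z \<in> W i - (\<Union>l<i. W l)"
      have "J z = i" unfolding J_def using z by (intro Least_equality) (auto intro: leI)
      then show "z \<in> J -` {i} \<inter> space (borel_of TQ)" using z WC by auto
    qed
    have "J -` A \<inter> space (borel_of TQ) = (\<Union>i\<in>A. J -` {i} \<inter> space (borel_of TQ))" by auto
    also have "\<dots> \<in> sets (borel_of TQ)"
      unfolding e using borel_of_open[OF W(1)] by (intro sets.countable_UN'') auto
    finally show "J -` A \<inter> space (borel_of TQ) \<in> sets (borel_of TQ)" .
  qed simp
  obtain q where q: "\<And>n. q n \<in> Dn" "\<And>n. s < q n" "\<And>n. q n < t" "filterlim q (at_right s) sequentially"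
    using approx_right[OF s st t] by metis
  \<comment> \<open>The later time is approached from the right as well, except when it is
    \<open>T\<close>; then it belongs to \<open>Dn\<close> and a constant sequence serves.\<close>
  obtain r where r: "\<And>n. r n \<in> Dn" "\<And>n. t \<le> r n" "\<And>\<omega>. \<omega> \<in> space N \<Longrightarrow> limitin TQ (\<lambda>n. \<omega> (r n)) (\<omega> t) sequentially"
  proof (cases "t = T")
    case True
    then show thesis using that[of "\<lambda>_. T"] Dn(2) ev_in_C[of _ T] T_pos by auto
  next
    case False
    then have "t < T" "0 \<le> t" using t st s by auto
    from approx_right[OF this(2,1)] obtain r where "\<And>n. r n \<in> Dn" "\<And>n. t < r n" "filterlim r (at_right t) sequentially"
      by (metis order_refl)
    then show thesis using that[of r] path_right_limit[OF _ \<open>0 \<le> t\<close> \<open>t < T\<close>] by (metis less_imp_le)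
  qed
  have sT: "s < T" "s \<in> {0..T}" "t \<in> {0..T}" using s st t by auto
  have qr: "q n < r n" "q n \<in> {0..T}" "r n \<in> {0..T}" for n
    using q(1,3)[of n] r(1,2)[of n] Dn(1) by auto
  define kk where "kk n \<omega> = \<sigma>' (J (\<omega> s)) (\<omega> (q n))" for n \<omega>
  define k where "k \<omega> = \<sigma>' (J (\<omega> s)) (\<omega> s)" for \<omega>
  \<comment> \<open>Since \<open>s < q n\<close>, the position at \<open>s\<close>, and with it the
    chosen chart, is already known to the dense past of \<open>q n\<close>.\<close>
  have mkk: "kk n \<in> Fil (Dn \<inter> {..q n}) \<rightarrow>\<^sub>M borel_of TL" for n
  proof -
    have a: "(\<lambda>\<omega>. \<omega> s) \<in> Fil (Dn \<inter> {..q n}) \<rightarrow>\<^sub>M borel_of TQ"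
      using s q(2)[of n] qr(2)[of n] by (intro Fil_right_ev) auto
    have b: "(\<lambda>\<omega>. \<omega> (q n)) \<in> Fil (Dn \<inter> {..q n}) \<rightarrow>\<^sub>M borel_of TQ"
      using q(1)[of n] Dn(1) by (intro Fil_ev) auto
    show ?thesis unfolding kk_def
      by (rule measurable_compose_countable[where f="\<lambda>j \<omega>. \<sigma>' j (\<omega> (q n))" and g="\<lambda>\<omega>. J (\<omega> s)",
            OF measurable_compose[OF b m\<sigma>'] measurable_compose[OF a mJ]])
  qed
  have mk: "k \<in> Fil {0..s} \<rightarrow>\<^sub>M borel_of TL"
  proof -
    have a: "(\<lambda>\<omega>. \<omega> s) \<in> Fil {0..s} \<rightarrow>\<^sub>M borel_of TQ" using s sT by (intro Fil_ev) auto
    show ?thesis unfolding k_def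
      by (rule measurable_compose_countable[where f="\<lambda>j \<omega>. \<sigma>' j (\<omega> s)" and g="\<lambda>\<omega>. J (\<omega> s)",
            OF measurable_compose[OF a m\<sigma>'] measurable_compose[OF a mJ]])
  qed
  have kM: "k \<omega> \<rhd> M = \<omega> s" if "\<omega> \<in> space N" for \<omega> using \<sigma>'M ev_in_C[OF that sT(2)] by (simp add: k_def)
  have kkM: "kk n \<omega> \<rhd> M = \<omega> (q n)" if "\<omega> \<in> space N" for n \<omega>
    using \<sigma>'M ev_in_C[OF that qr(2)] by (simp add: kk_def)
  define w where "w n \<omega> = ginv (kk n \<omega>) \<rhd> \<omega> (r n)" for n \<omega>
  define w' where "w' \<omega> = ginv (k \<omega>) \<rhd> \<omega> t" for \<omega>
  have sub: "subalgebra N (Fil (Dn \<inter> {..q n}))" "subalgebra N (Fil {0..s})" for n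
    using Dn s sT by (auto intro!: Fil_subalgebra)
  have mw: "w n \<in> N \<rightarrow>\<^sub>M borel_of TQ" for n unfolding w_def
    by (intro measurable_act measurable_inv_TL measurable_from_subalg[OF sub(1) mkk] measurable_ev qr)
  have mw': "w' \<in> N \<rightarrow>\<^sub>M borel_of TQ" unfolding w'_def
    by (intro measurable_act measurable_inv_TL measurable_from_subalg[OF sub(2) mk] measurable_ev sT)
  \<comment> \<open>For a fixed path the chart is fixed by the position at \<open>s\<close>. The
    approximating positions are eventually in this chart, where the section is continuous.\<close>
  have lim: "limitin TQ (\<lambda>n. w n \<omega>) (w' \<omega>) sequentially" if w: "\<omega> \<in> space N" for \<omega>
  proof -
    define j where "j = J (\<omega> s)"
    have zs: "\<omega> s \<in> W j" using J[OF ev_in_C[OF w sT(2)]] by (simp add: j_def)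
    have lq: "limitin TQ (\<lambda>n. \<omega> (q n)) (\<omega> s) sequentially" using path_right_limit[OF w s sT(1) q(4)] .
    then have ev: "\<forall>\<^sub>F n in sequentially. \<omega> (q n) \<in> W j" using limitinD[OF _ W(1) zs] by blast
    then have "limitin (subtopology TQ (W j)) (\<lambda>n. \<omega> (q n)) (\<omega> s) sequentially"
      using lq zs by (simp add: limitin_subtopology)
    from continuous_map_limit[OF W(3) this]
    have "limitin TL (\<lambda>n. \<sigma> j (\<omega> (q n))) (k \<omega>) sequentially"
      using zs by (simp add: comp_def k_def \<sigma>'_def j_def)
    then have "limitin TL (\<lambda>n. kk n \<omega>) (k \<omega>) sequentially"
      by (rule limitin_transform_eventually[rotated]) (use ev in \<open>auto elim!: eventually_mono simp: kk_def \<sigma>'_def j_def\<close>)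
    from continuous_map_limit[OF continuous_inv this]
    have "limitin TL (\<lambda>n. ginv (kk n \<omega>)) (ginv (k \<omega>)) sequentially" by (simp add: comp_def)
    then have "limitin (prod_topology TL TQ) (\<lambda>n. (ginv (kk n \<omega>), \<omega> (r n))) (ginv (k \<omega>), \<omega> t) sequentially"
      using r(3)[OF w] by (simp add: limitin_pairwise comp_def)
    from continuous_map_limit[OF continuous_act this] show ?thesis by (simp add: comp_def w_def w'_def)
  qed
  define \<nu> where "\<nu> = distr N (borel_of TQ) w'"
  have \<nu>: "finite_measure \<nu>" "sets \<nu> = sets (borel_of TQ)"
    unfolding \<nu>_def using N.finite_measure_distr[OF mw'] by auto
  \<comment> \<open>An event of the past of \<open>s\<close> belongs to the dense past of every
    \<open>q n\<close>, so the independence known for pairs of times in \<open>Dn\<close> applies to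
    it.\<close>
  have rat: "(\<integral>\<omega>. indicator A \<omega> * f (w n \<omega>) \<partial>N) = measure N A * (\<integral>x. f x \<partial>\<mu>0 (q n) (r n))"
    if A: "A \<in> sets (Fil {0..s})" and f: "f \<in> Cb TQ" for A f n
  proof -
    have A': "A \<in> sets (Fil (Dn \<inter> {..q n}))" using Fil_right_mono[OF s q(2)[of n]] qr(2)[of n] A by auto
    then have AN: "A \<in> sets N" using sub(1) by (auto simp: subalgebra_def)
    have "\<forall>B\<in>sets (borel_of TQ). emeasure N {\<omega> \<in> A. w n \<omega> \<in> B} = emeasure N A * emeasure (\<mu>0 (q n) (r n)) B"
      using rational_representative[OF q(1) r(1) qr(1) mkk kkM A'] by (simp add: w_def)
    then show ?thesis
      using emeasure_product_iff_integral_product[OF TQ_metrizable N.finite_measure_axioms AN mw[of n]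
        prob_space.finite_measure[OF prob_\<mu>0[OF qr(2,3)]] sets_\<mu>0] f by blast
  qed
  have spA: "space N \<in> sets (Fil {0..s})" using sets.top[of "Fil {0..s}"] by simp
  have \<nu>lim: "(\<lambda>n. \<integral>x. f x \<partial>\<mu>0 (q n) (r n)) \<longlonglongrightarrow> (\<integral>x. f x \<partial>\<nu>)" if f: "f \<in> Cb TQ" for f
  proof -
    have "(\<integral>\<omega>. indicator (space N) \<omega> * f (w' \<omega>) \<partial>N) = (\<integral>x. f x \<partial>\<nu>)"
      unfolding \<nu>_def integral_distr[OF mw' Cb_measurable[OF f]] by (rule Bochner_Integration.integral_cong) auto
    then show ?thesis
      using countable_set_integral_limit[OF N.finite_measure_axioms sets.top f mw mw' lim] rat[OF spA f] N.prob_space by simp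
  qed
  have indep: "emeasure N {\<omega> \<in> A. w' \<omega> \<in> B} = emeasure N A * emeasure \<nu> B"
    if A: "A \<in> sets (Fil {0..s})" and B: "B \<in> sets (borel_of TQ)" for A B
  proof -
    have AN: "A \<in> sets N" using A sub(2) by (auto simp: subalgebra_def)
    have "(\<integral>\<omega>. indicator A \<omega> * f (w' \<omega>) \<partial>N) = measure N A * (\<integral>x. f x \<partial>\<nu>)" if f: "f \<in> Cb TQ" for f
    proof (rule LIMSEQ_unique)
      show "(\<lambda>n. \<integral>\<omega>. indicator A \<omega> * f (w n \<omega>) \<partial>N) \<longlonglongrightarrow> (\<integral>\<omega>. indicator A \<omega> * f (w' \<omega>) \<partial>N)"
        by (rule countable_set_integral_limit[OF N.finite_measure_axioms AN f mw mw' lim])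
      show "(\<lambda>n. \<integral>\<omega>. indicator A \<omega> * f (w n \<omega>) \<partial>N) \<longlonglongrightarrow> measure N A * (\<integral>x. f x \<partial>\<nu>)"
        unfolding rat[OF A f] by (intro tendsto_mult tendsto_const \<nu>lim f)
    qed
    then show ?thesis
      using emeasure_product_iff_integral_product[OF TQ_metrizable N.finite_measure_axioms AN mw' \<nu>] B by blast
  qed
  \<comment> \<open>Invariance passes to the weak limit because composing a test function with the
    action of \<open>h\<close> gives again a bounded continuous function.\<close>
  have inv: "invariant_measure K M TQ \<nu>"
    unfolding invariant_measure_def
  proof (intro conjI ballI \<nu>(2))
    fix h assume h: "h \<in> M"
    then have hG: "h \<in> G" using M_sub by auto
    have c: "continuous_map TQ TQ (\<lambda>z. h \<rhd> z)" by (rule continuous_act_const[OF hG])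
    have mh: "(\<lambda>z. h \<rhd> z) \<in> \<rho> \<rightarrow>\<^sub>M borel_of TQ" if "sets \<rho> = sets (borel_of TQ)" for \<rho>
      using continuous_map_measurable[OF c] that by (simp cong: measurable_cong_sets)
    show "distr \<nu> (borel_of TQ) (\<lambda>z. h \<rhd> z) = \<nu>"
    proof (rule measure_eqI_Cb[OF TQ_metrizable finite_measure.finite_measure_distr[OF \<nu>(1) mh[OF \<nu>(2)]] _ \<nu>])
      fix f assume f: "f \<in> Cb TQ"
      have fh: "(\<lambda>z. f (h \<rhd> z)) \<in> Cb TQ"
      proof -
        have "continuous_map TQ euclideanreal (f \<circ> (\<lambda>z. h \<rhd> z))"
          using f c by (intro continuous_map_compose) (auto simp: Cb_def)
        moreover have "(\<lambda>z. f (h \<rhd> z)) ` topspace TQ \<subseteq> f ` topspace TQ" using hG by auto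
        ultimately show ?thesis using f by (auto simp: Cb_def comp_def intro: bounded_subset)
      qed
      have I: "(\<integral>z. f z \<partial>distr \<rho> (borel_of TQ) (\<lambda>z. h \<rhd> z)) = (\<integral>z. f (h \<rhd> z) \<partial>\<rho>)" if "sets \<rho> = sets (borel_of TQ)" for \<rho>
        by (rule integral_distr[OF mh[OF that] Cb_measurable[OF f]])
      have "distr (\<mu>0 (q n) (r n)) (borel_of TQ) (\<lambda>z. h \<rhd> z) = \<mu>0 (q n) (r n)" for n
        using rational_inv[OF q(1) r(1) qr(1)] h by (simp add: invariant_measure_def)
      then have "(\<integral>z. f (h \<rhd> z) \<partial>\<mu>0 (q n) (r n)) = (\<integral>z. f z \<partial>\<mu>0 (q n) (r n))" for n
        using I[OF sets_\<mu>0, of "q n" "r n"] by metis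
      then have "(\<integral>z. f (h \<rhd> z) \<partial>\<nu>) = (\<integral>z. f z \<partial>\<nu>)"
        using \<nu>lim[OF f] \<nu>lim[OF fh] LIMSEQ_unique by auto
      then show "(\<integral>z. f z \<partial>distr \<nu> (borel_of TQ) (\<lambda>z. h \<rhd> z)) = (\<integral>z. f z \<partial>\<nu>)" using I[OF \<nu>(2)] by simp
    qed simp
  qed
  have w'_eq: "w' = (\<lambda>\<omega>. ginv (k \<omega>) \<rhd> \<omega> t)" by (simp add: fun_eq_iff w'_def)
  show thesis
    by (rule that[OF mk kM inv[unfolded \<nu>_def w'_eq] indep[unfolded \<nu>_def w'_eq]])
qed

text \<open>The limit argument provides one representative. Invariance of the limit law permits any
  other, in particular \<open>S\<close> itself, and this identifies the limit law as the law
  \<open>\<mu>0 s t\<close> of the actual increment.\<close>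

lemma increment_independent:
  assumes st: "0 \<le> s" "s < t" "t \<le> T"
  shows "invariant_measure K M TQ (\<mu>0 s t)"
    and "\<And>k A B. k \<in> Fil {0..s} \<rightarrow>\<^sub>M borel_of TL \<Longrightarrow> (\<And>\<omega>. \<omega> \<in> space N \<Longrightarrow> k \<omega> \<rhd> M = \<omega> s) \<Longrightarrow>
      A \<in> sets (Fil {0..s}) \<Longrightarrow> B \<in> sets (borel_of TQ) \<Longrightarrow>
      emeasure N {\<omega> \<in> A. ginv (k \<omega>) \<rhd> \<omega> t \<in> B} = emeasure N A * emeasure (\<mu>0 s t) B"
proof -
  obtain k0 where k0: "k0 \<in> Fil {0..s} \<rightarrow>\<^sub>M borel_of TL" "\<And>\<omega>. \<omega> \<in> space N \<Longrightarrow> k0 \<omega> \<rhd> M = \<omega> s"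
    "invariant_measure K M TQ (distr N (borel_of TQ) (\<lambda>\<omega>. ginv (k0 \<omega>) \<rhd> \<omega> t))"
    "\<And>A B. A \<in> sets (Fil {0..s}) \<Longrightarrow> B \<in> sets (borel_of TQ) \<Longrightarrow>
      emeasure N {\<omega> \<in> A. ginv (k0 \<omega>) \<rhd> \<omega> t \<in> B} = emeasure N A * emeasure (distr N (borel_of TQ) (\<lambda>\<omega>. ginv (k0 \<omega>) \<rhd> \<omega> t)) B"
    by (rule increment_limit[OF assms]) (rule that, assumption+)
  define \<nu> where "\<nu> = distr N (borel_of TQ) (\<lambda>\<omega>. ginv (k0 \<omega>) \<rhd> \<omega> t)"
  have sT: "s \<in> {0..T}" "t \<in> {0..T}" using st by auto
  have sub: "subalgebra N (Fil {0..s})" using sT by (intro Fil_subalgebra) auto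
  have "(\<lambda>\<omega>. ginv (k0 \<omega>) \<rhd> \<omega> t) \<in> N \<rightarrow>\<^sub>M borel_of TQ"
    by (intro measurable_act measurable_inv_TL measurable_from_subalg[OF sub k0(1)] measurable_ev sT)
  then have p\<nu>: "prob_space \<nu>" unfolding \<nu>_def by (rule N.prob_space_distr)
  have gen: "emeasure N {\<omega> \<in> A. ginv (k \<omega>) \<rhd> \<omega> t \<in> B} = emeasure N A * emeasure \<nu> B"
    if k: "k \<in> Fil {0..s} \<rightarrow>\<^sub>M borel_of TL" "\<And>\<omega>. \<omega> \<in> space N \<Longrightarrow> k \<omega> \<rhd> M = \<omega> s"
      and AB: "A \<in> sets (Fil {0..s})" "B \<in> sets (borel_of TQ)" for k A B
    by (rule change_representative[where ?k0.0=k0 and Z="\<lambda>\<omega>. \<omega> t", OF N.finite_measure_axioms sub k0(1) k(1) _ measurable_ev[OF sT(2)] p\<nu> _ _ AB])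
      (use k0 k(2) in \<open>auto simp: \<nu>_def\<close>)
  have "\<mu>0 s t = \<nu>"
  proof (rule measure_eqI)
    fix B assume B: "B \<in> sets (\<mu>0 s t)"
    have mS: "(\<lambda>\<omega>. S (\<omega> s)) \<in> Fil {0..s} \<rightarrow>\<^sub>M borel_of TL"
      using st by (intro measurable_compose[OF Fil_ev measurable_S]) auto
    have "emeasure (\<mu>0 s t) B = emeasure N (incr s t -` B \<inter> space N)"
      unfolding \<mu>0_def using B by (intro emeasure_distr measurable_incr_N sT) simp
    also have "incr s t -` B \<inter> space N = {\<omega> \<in> space N. ginv (S (\<omega> s)) \<rhd> \<omega> t \<in> B}" by (auto simp: incr_def)
    also have "emeasure N \<dots> = emeasure N (space N) * emeasure \<nu> B"
      by (rule gen[OF mS]) (use B ev_in_C sT sets.top[of "Fil {0..s}"] in auto)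
    finally show "emeasure (\<mu>0 s t) B = emeasure \<nu> B" using N.emeasure_space_1 by simp
  qed (simp add: \<nu>_def)
  then show "invariant_measure K M TQ (\<mu>0 s t)" using k0(3) by (simp add: \<nu>_def)
  show "emeasure N {\<omega> \<in> A. ginv (k \<omega>) \<rhd> \<omega> t \<in> B} = emeasure N A * emeasure (\<mu>0 s t) B"
    if "k \<in> Fil {0..s} \<rightarrow>\<^sub>M borel_of TL" "\<And>\<omega>. \<omega> \<in> space N \<Longrightarrow> k \<omega> \<rhd> M = \<omega> s"
      "A \<in> sets (Fil {0..s})" "B \<in> sets (borel_of TQ)" for k A B
    using gen[OF that] \<open>\<mu>0 s t = \<nu>\<close> by simp
qed

end

section \<open>The convolution semigroup and the finite-dimensional laws\<close>

context homogeneous_independent_increments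
begin

text \<open>A convolution semigroup is indexed by all nonnegative times while the process lives on
  \<open>[0, T]\<close>. Freezing the time at \<open>T\<close> makes all later increments
  trivial.\<close>

definition \<mu>T :: "real \<Rightarrow> real \<Rightarrow> 'a set measure" where
  "\<mu>T s t = \<mu>0 (min s T) (min t T)"

text \<open>A convolution is computed by exhibiting independent variables with the two laws; their
  combination through \<open>S\<close> is the variable whose law is sought.\<close>

lemma convolution_of_joint_law:
  assumes a: "a \<in> N \<rightarrow>\<^sub>M borel_of TQ" and b: "b \<in> N \<rightarrow>\<^sub>M borel_of TQ"
    and \<alpha>: "prob_space \<alpha>" "sets \<alpha> = sets (borel_of TQ)" and \<beta>: "prob_space \<beta>" "sets \<beta> = sets (borel_of TQ)"
    and joint: "\<And>A B. A \<in> sets (borel_of TQ) \<Longrightarrow> B \<in> sets (borel_of TQ) \<Longrightarrow>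
      emeasure N {\<omega> \<in> space N. a \<omega> \<in> A \<and> b \<omega> \<in> B} = emeasure \<alpha> A * emeasure \<beta> B"
    and c: "\<And>\<omega>. \<omega> \<in> space N \<Longrightarrow> S (a \<omega>) \<rhd> b \<omega> = c \<omega>"
  shows "coset_convolution K S TQ \<alpha> \<beta> = distr N (borel_of TQ) c"
proof -
  have ab: "(\<lambda>\<omega>. (a \<omega>, b \<omega>)) \<in> N \<rightarrow>\<^sub>M borel_of TQ \<Otimes>\<^sub>M borel_of TQ" using a b by simp
  have s: "sets (\<alpha> \<Otimes>\<^sub>M \<beta>) = sets (borel_of TQ \<Otimes>\<^sub>M borel_of TQ)" using \<alpha>(2) \<beta>(2) by (rule sets_pair_measure_cong)
  have "\<alpha> \<Otimes>\<^sub>M \<beta> = distr N (borel_of TQ \<Otimes>\<^sub>M borel_of TQ) (\<lambda>\<omega>. (a \<omega>, b \<omega>))"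
  proof (rule pair_measure_eqI)
    show "sigma_finite_measure \<alpha>" "sigma_finite_measure \<beta>"
      using \<alpha>(1) \<beta>(1) by (simp_all add: prob_space_imp_sigma_finite)
    fix A B assume AB: "A \<in> sets \<alpha>" "B \<in> sets \<beta>"
    have "emeasure (distr N (borel_of TQ \<Otimes>\<^sub>M borel_of TQ) (\<lambda>\<omega>. (a \<omega>, b \<omega>))) (A \<times> B)
        = emeasure N ((\<lambda>\<omega>. (a \<omega>, b \<omega>)) -` (A \<times> B) \<inter> space N)"
      using AB \<alpha>(2) \<beta>(2) by (intro emeasure_distr[OF ab]) auto
    also have "(\<lambda>\<omega>. (a \<omega>, b \<omega>)) -` (A \<times> B) \<inter> space N = {\<omega> \<in> space N. a \<omega> \<in> A \<and> b \<omega> \<in> B}" by auto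
    finally show "emeasure \<alpha> A * emeasure \<beta> B = emeasure (distr N (borel_of TQ \<Otimes>\<^sub>M borel_of TQ) (\<lambda>\<omega>. (a \<omega>, b \<omega>))) (A \<times> B)"
      using joint AB \<alpha>(2) \<beta>(2) by simp
  qed (use s in simp)
  moreover have "(\<lambda>(x, y). S x \<rhd> y) \<in> borel_of TQ \<Otimes>\<^sub>M borel_of TQ \<rightarrow>\<^sub>M borel_of TQ"
    unfolding case_prod_unfold
    by (intro measurable_act measurable_snd measurable_compose[OF measurable_fst measurable_S])
  ultimately have "coset_convolution K S TQ \<alpha> \<beta> = distr N (borel_of TQ) ((\<lambda>(x, y). S x \<rhd> y) \<circ> (\<lambda>\<omega>. (a \<omega>, b \<omega>)))"
    unfolding coset_convolution_def using ab by (simp add: distr_distr)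
  also have "\<dots> = distr N (borel_of TQ) c" by (rule distr_cong) (use c in auto)
  finally show ?thesis .
qed

lemma emeasure_\<mu>0:
  assumes "s \<in> {0..T}" "t \<in> {0..T}" "B \<in> sets (borel_of TQ)"
  shows "emeasure (\<mu>0 s t) B = emeasure N {\<omega> \<in> space N. incr s t \<omega> \<in> B}"
proof -
  have "emeasure (\<mu>0 s t) B = emeasure N (incr s t -` B \<inter> space N)"
    unfolding \<mu>0_def using assms by (intro emeasure_distr measurable_incr_N) auto
  also have "incr s t -` B \<inter> space N = {\<omega> \<in> space N. incr s t \<omega> \<in> B}" by auto
  finally show ?thesis .
qed

lemma S_incr:
  assumes "\<omega> \<in> space N" "s \<in> {0..T}" "t \<in> {0..T}" shows "S (\<omega> s) \<rhd> incr s t \<omega> = \<omega> t" "incr s t \<omega> \<in> C"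
  using ev_in_C[OF assms(1,2)] ev_in_C[OF assms(1,3)] by (simp_all add: incr_def act_act act_one)

lemma \<mu>0_convolution:
  assumes st: "0 \<le> s" "s < t" "t < u" "u \<le> T"
  shows "coset_convolution K S TQ (\<mu>0 s t) (\<mu>0 t u) = \<mu>0 s u"
proof -
  have T: "s \<in> {0..T}" "t \<in> {0..T}" "u \<in> {0..T}" using st by auto
  \<comment> \<open>A representative of the position at \<open>t\<close> other than
    \<open>S (\<omega> t)\<close>: with this product the two increments multiply exactly to the
    increment from \<open>s\<close> to \<open>u\<close>.\<close>
  define k where "k \<omega> = S (\<omega> s) \<odot> S (incr s t \<omega>)" for \<omega>
  have sub: "subalgebra N (Fil {0..t})" using T by (intro Fil_subalgebra) auto
  have mi: "incr s t \<in> Fil {0..t} \<rightarrow>\<^sub>M borel_of TQ" using st by (intro measurable_incr) auto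
  have mk: "k \<in> Fil {0..t} \<rightarrow>\<^sub>M borel_of TL" unfolding k_def using st T
    by (intro measurable_mult_TL measurable_compose[OF Fil_ev measurable_S] measurable_compose[OF mi measurable_S]) auto
  have kM: "k \<omega> \<rhd> M = \<omega> t" if "\<omega> \<in> space N" for \<omega>
  proof -
    have "k \<omega> \<rhd> M = S (\<omega> s) \<rhd> (S (incr s t \<omega>) \<rhd> M)"
      using S_incr[OF that T(1,2)] ev_in_C[OF that T(1)] M_in_C by (simp add: k_def act_act del: S_coset)
    then show ?thesis using S_incr[OF that T(1,2)] by simp
  qed
  show ?thesis unfolding \<mu>0_def[of s u]
  proof (rule convolution_of_joint_law[where a="incr s t" and b="\<lambda>\<omega>. ginv (k \<omega>) \<rhd> \<omega> u"])
    show "incr s t \<in> N \<rightarrow>\<^sub>M borel_of TQ" using measurable_from_subalg[OF sub mi] .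
    show "(\<lambda>\<omega>. ginv (k \<omega>) \<rhd> \<omega> u) \<in> N \<rightarrow>\<^sub>M borel_of TQ"
      by (intro measurable_act measurable_inv_TL measurable_from_subalg[OF sub mk] measurable_ev T)
    show "prob_space (\<mu>0 s t)" "prob_space (\<mu>0 t u)" using prob_\<mu>0 T by auto
    show "S (incr s t \<omega>) \<rhd> (ginv (k \<omega>) \<rhd> \<omega> u) = incr s u \<omega>" if w: "\<omega> \<in> space N" for \<omega>
    proof -
      have C: "S (incr s t \<omega>) \<in> G" "S (\<omega> s) \<in> G" "\<omega> u \<in> C"
        using S_incr[OF w T(1,2)] ev_in_C[OF w] T by auto
      have "S (incr s t \<omega>) \<odot> ginv (k \<omega>) = ginv (S (\<omega> s))"
        using C by (simp add: k_def inv_mult_group m_assoc[symmetric])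
      then show ?thesis using C by (simp add: act_act k_def incr_def)
    qed
    fix A B assume AB: "A \<in> sets (borel_of TQ)" "B \<in> sets (borel_of TQ)"
    have A': "{\<omega> \<in> space N. incr s t \<omega> \<in> A} \<in> sets (Fil {0..t})"
      using measurable_sets[OF mi AB(1)] by (simp add: vimage_def Int_def conj_commute)
    have "{\<omega> \<in> space N. incr s t \<omega> \<in> A \<and> ginv (k \<omega>) \<rhd> \<omega> u \<in> B} = {\<omega> \<in> {\<omega> \<in> space N. incr s t \<omega> \<in> A}. ginv (k \<omega>) \<rhd> \<omega> u \<in> B}" by auto
    then show "emeasure N {\<omega> \<in> space N. incr s t \<omega> \<in> A \<and> ginv (k \<omega>) \<rhd> \<omega> u \<in> B} = emeasure (\<mu>0 s t) A * emeasure (\<mu>0 t u) B"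
      using increment_independent(2)[OF _ st(3,4) mk kM A' AB(2)] st T by (simp add: emeasure_\<mu>0[OF T(1,2) AB(1)])
  qed simp_all
qed

text \<open>Covers the convolution identities in which the second increment lies beyond
  \<open>T\<close> and is a unit mass.\<close>

lemma \<mu>0_convolution_return:
  assumes T: "s \<in> {0..T}" "t \<in> {0..T}"
  shows "coset_convolution K S TQ (\<mu>0 s t) (return (borel_of TQ) M) = \<mu>0 s t"
  unfolding \<mu>0_def[of s t, symmetric]
proof -
  have "coset_convolution K S TQ (\<mu>0 s t) (return (borel_of TQ) M) = distr N (borel_of TQ) (incr s t)"
  proof (rule convolution_of_joint_law[where b="\<lambda>\<omega>. M"])
    show "incr s t \<in> N \<rightarrow>\<^sub>M borel_of TQ" using measurable_incr_N[OF T] .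
    show "(\<lambda>\<omega>. M) \<in> N \<rightarrow>\<^sub>M borel_of TQ" using M_in_C by simp
    show "prob_space (\<mu>0 s t)" "prob_space (return (borel_of TQ) M)" using prob_\<mu>0 T M_in_C by (auto intro: prob_space_return)
    show "S (incr s t \<omega>) \<rhd> M = incr s t \<omega>" if "\<omega> \<in> space N" for \<omega> using S_incr[OF that T] by simp
    fix A B assume AB: "A \<in> sets (borel_of TQ)" "B \<in> sets (borel_of TQ)"
    show "emeasure N {\<omega> \<in> space N. incr s t \<omega> \<in> A \<and> M \<in> B} = emeasure (\<mu>0 s t) A * emeasure (return (borel_of TQ) M) B"
      using AB by (cases "M \<in> B") (auto simp: emeasure_\<mu>0[OF T AB(1)])
  qed simp_all
  then show ?thesis by (simp add: \<mu>0_def)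
qed

lemma convolution_semigroup_\<mu>T: "convolution_semigroup K M S TQ \<mu>T"
  unfolding convolution_semigroup_def
proof (intro conjI allI impI ballI)
  fix s t :: real assume st: "0 \<le> s \<and> s \<le> t"
  show "prob_space (\<mu>T s t)" unfolding \<mu>T_def using st T_pos by (intro prob_\<mu>0) auto
  show "invariant_measure K M TQ (\<mu>T s t)"
  proof (cases "min s T < min t T")
    case True then show ?thesis unfolding \<mu>T_def using st T_pos by (intro increment_independent(1)) auto
  next
    case False
    then have "min t T = min s T" using st by auto
    then show ?thesis unfolding \<mu>T_def using st T_pos invariant_return by (simp add: \<mu>0_same)
  qed
next
  fix s t u :: real assume st: "0 \<le> s \<and> s < t \<and> t < u"
  show "coset_convolution K S TQ (\<mu>T s t) (\<mu>T t u) = \<mu>T s u"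
  proof (cases "t < T")
    case True
    then show ?thesis unfolding \<mu>T_def using st by (intro \<mu>0_convolution) auto
  next
    case False
    then have "min t T = T" "min u T = T" using st by auto
    moreover have "min s T \<in> {0..T}" "T \<in> {0..T}" using st T_pos by auto
    ultimately show ?thesis unfolding \<mu>T_def using \<mu>0_convolution_return \<mu>0_same by simp
  qed
next
  fix t :: real assume "0 \<le> t"
  then show "\<mu>T t t = return (borel_of TQ) M" unfolding \<mu>T_def using T_pos by (intro \<mu>0_same) auto
next
  fix s :: real and f assume s: "0 \<le> s" and f: "f \<in> Cb TQ"
  show "((\<lambda>t. \<integral>z. f z \<partial>\<mu>T s t) \<longlongrightarrow> (\<integral>z. f z \<partial>\<mu>T s s)) (at_right s)"
  proof (cases "s < T")
    case False
    then have "\<forall>\<^sub>F t in at_right s. (\<integral>z. f z \<partial>\<mu>T s t) = (\<integral>z. f z \<partial>\<mu>T s s)"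
      unfolding eventually_at_right_field \<mu>T_def by (intro exI[of _ "s + 1"]) auto
    then show ?thesis by (rule tendsto_eventually)
  next
    case True
    show ?thesis
    proof (rule tendsto_at_right_sequentially[OF True])
      fix r assume r: "\<And>n. s < r n" "\<And>n. r n < T" "decseq r" "r \<longlonglongrightarrow> s"
      have fl: "filterlim r (at_right s) sequentially"
        unfolding filterlim_at using r(1,4) by (auto intro!: always_eventually simp: less_imp_neq[symmetric])
      have sT: "s \<in> {0..T}" "r n \<in> {0..T}" for n using s True r(1,2)[of n] by auto
      have I: "(\<integral>z. f z \<partial>\<mu>T s t) = (\<integral>\<omega>. indicator (space N) \<omega> * f (incr s t \<omega>) \<partial>N)" if t: "t \<in> {0..T}" for t
      proof -
        have "\<mu>T s t = \<mu>0 s t" using sT(1) t by (simp add: \<mu>T_def min_def)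
        then have "(\<integral>z. f z \<partial>\<mu>T s t) = (\<integral>\<omega>. f (incr s t \<omega>) \<partial>N)"
          unfolding \<mu>0_def using integral_distr[OF measurable_incr_N[OF sT(1) t] Cb_measurable[OF f]] by simp
        then show ?thesis by (auto intro: Bochner_Integration.integral_cong)
      qed
      \<comment> \<open>The representative at the fixed time \<open>s\<close> is one group element,
        whose action is continuous, so measurability of \<open>S\<close> is enough here.\<close>
      have lim: "limitin TQ (\<lambda>n. incr s (r n) \<omega>) (incr s s \<omega>) sequentially" if w: "\<omega> \<in> space N" for \<omega>
      proof -
        have "ginv (S (\<omega> s)) \<in> G" using ev_in_C[OF w sT(1)] by simp
        from continuous_map_limit[OF continuous_act_const[OF this] path_right_limit[OF w s True fl]]
        show ?thesis by (simp add: incr_def comp_def)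
      qed
      show "(\<lambda>n. \<integral>z. f z \<partial>\<mu>T s (r n)) \<longlonglongrightarrow> (\<integral>z. f z \<partial>\<mu>T s s)"
        unfolding I[OF sT(1)] I[OF sT(2)]
        by (rule countable_set_integral_limit[OF N.finite_measure_axioms sets.top f
              measurable_incr_N[OF sT] measurable_incr_N[OF sT(1) sT(1)] lim])
    qed
  qed
qed

text \<open>Relative to the accumulated frame the increments are independent with laws
  \<open>\<Lambda> i\<close>, and \<open>coset_word\<close> turns them back into the positions for
  every single path. The formula for the finite-dimensional laws is then a change of
  variables.\<close>

lemma levy: "nonhomogeneous_levy_process K M S TQ T N (\<lambda>t \<omega>. \<omega> t)"
  unfolding nonhomogeneous_levy_process_def
proof (intro conjI ballI exI[of _ \<mu>T] allI impI convolution_semigroup_\<mu>T)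
  show "prob_space N" by (rule prob_N)
  show "(\<lambda>\<omega>. \<omega> t) \<in> N \<rightarrow>\<^sub>M borel_of TQ" if "t \<in> {0..T}" for t using measurable_ev[OF that] .
  show "(\<lambda>t\<in>{0..T}. \<omega> t) \<in> rcll_paths T TQ" if "\<omega> \<in> space N" for \<omega>
  proof -
    have "\<omega> \<in> rcll_paths T TQ" using that by (simp add: space_N)
    moreover from this have "\<omega> \<in> extensional {0..T}" by (simp add: rcll_paths_iff)
    ultimately show ?thesis by (simp add: extensional_restrict)
  qed
  fix n :: nat and t :: "nat \<Rightarrow> real" and f :: "(nat \<Rightarrow> 'a set) \<Rightarrow> real"
  assume H: "t 0 = 0 \<and> (\<forall>i<n. t i < t (Suc i)) \<and> t n \<le> T \<and> f \<in> Cb (product_topology (\<lambda>_. TQ) {..n})"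
  have tmono: "i \<le> j \<Longrightarrow> j \<le> n \<Longrightarrow> t i \<le> t j" for i j
  proof (induction j)
    case (Suc j)
    show ?case
    proof (cases "i = Suc j")
      case False
      then have "t i \<le> t j" using Suc by auto
      moreover have "t j < t (Suc j)" using H Suc.prems by auto
      ultimately show ?thesis by simp
    qed simp
  qed simp
  have tT: "t i \<in> {0..T}" if "i \<le> n" for i using tmono[of 0 i] tmono[of i n] that H by auto
  define x where "x \<omega> i = \<omega> (t i)" for \<omega> :: "real \<Rightarrow> 'a set" and i
  define kk where "kk i \<omega> = frame K S (x \<omega>) i" for i \<omega>
  define w where "w i \<omega> = ginv (kk i \<omega>) \<rhd> \<omega> (t i)" for i \<omega>
  have kkS: "kk (Suc i) \<omega> = kk i \<omega> \<odot> S (w i \<omega>)" for i \<omega> by (simp add: kk_def w_def x_def)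
  have kk0: "kk 0 \<omega> = \<one>\<^bsub>K\<^esub>" for \<omega> by (simp add: kk_def)
  have kkG: "kk i \<omega> \<in> G" if "\<omega> \<in> space N" "i \<le> Suc n" for i \<omega>
    using that(2)
  proof (induction i)
    case (Suc i)
    then have "kk i \<omega> \<in> G" "\<omega> (t i) \<in> C" using ev_in_C[OF that(1) tT] by auto
    then show ?case by (simp add: kkS w_def)
  qed (simp add: kk0)
  have wC: "w i \<omega> \<in> C" if "\<omega> \<in> space N" "i \<le> n" for i \<omega>
    using kkG[OF that(1), of i] ev_in_C[OF that(1) tT[OF that(2)]] that(2) by (simp add: w_def)
  have kw: "kk i \<omega> \<rhd> w i \<omega> = \<omega> (t i)" if "\<omega> \<in> space N" "i \<le> n" for i \<omega>
    using kkG[OF that(1), of i] ev_in_C[OF that(1) tT[OF that(2)]] that(2) by (simp add: w_def act_act act_one)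
  have kkM: "kk (Suc i) \<omega> \<rhd> M = \<omega> (t i)" if "\<omega> \<in> space N" "i \<le> n" for i \<omega>
  proof -
    have "kk (Suc i) \<omega> \<rhd> M = kk i \<omega> \<rhd> (S (w i \<omega>) \<rhd> M)"
      unfolding kkS using kkG[OF that(1), of i] wC[OF that] M_in_C that(2) by (simp add: act_act del: S_coset)
    then show ?thesis using wC[OF that] kw[OF that] by simp
  qed
  \<comment> \<open>The frame with index \<open>i + 1\<close> represents the position at
    \<open>t i\<close> and is known at time \<open>t i\<close>; so it is an admissible
    representative for the increment that starts there.\<close>
  have meas: "(i \<le> n \<longrightarrow> w i \<in> Fil {0..t i} \<rightarrow>\<^sub>M borel_of TQ \<and> kk (Suc i) \<in> Fil {0..t i} \<rightarrow>\<^sub>M borel_of TL)" for i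
  proof (induction i)
    case 0
    show ?case
    proof
      have ev: "(\<lambda>\<omega>. \<omega> (t 0)) \<in> Fil {0..t 0} \<rightarrow>\<^sub>M borel_of TQ" using H T_pos by (intro Fil_ev) auto
      have one: "(\<lambda>\<omega>. \<one>\<^bsub>K\<^esub>) \<in> Fil {0..t 0} \<rightarrow>\<^sub>M borel_of TL" by simp
      have w0: "w 0 \<in> Fil {0..t 0} \<rightarrow>\<^sub>M borel_of TQ"
        unfolding w_def[abs_def] kk0 by (intro measurable_act measurable_inv_TL ev one)
      have "kk (Suc 0) \<in> Fil {0..t 0} \<rightarrow>\<^sub>M borel_of TL"
        unfolding kkS[abs_def] kk0 by (intro measurable_mult_TL one measurable_compose[OF w0 measurable_S])
      with w0 show "w 0 \<in> Fil {0..t 0} \<rightarrow>\<^sub>M borel_of TQ \<and> kk (Suc 0) \<in> Fil {0..t 0} \<rightarrow>\<^sub>M borel_of TL" by blast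
    qed
  next
    case (Suc i)
    show ?case
    proof
      assume i: "Suc i \<le> n"
      have ev: "(\<lambda>\<omega>. \<omega> (t (Suc i))) \<in> Fil {0..t (Suc i)} \<rightarrow>\<^sub>M borel_of TQ" using tT[OF i] by (intro Fil_ev) auto
      have k: "kk (Suc i) \<in> Fil {0..t (Suc i)} \<rightarrow>\<^sub>M borel_of TL"
      proof (rule measurable_Fil_mono)
        show "kk (Suc i) \<in> Fil {0..t i} \<rightarrow>\<^sub>M borel_of TL" using Suc.IH i by simp
        have "t i \<le> t (Suc i)" using i by (intro tmono) auto
        then show "{0..t i} \<subseteq> {0..t (Suc i)}" by simp
        show "{0..t (Suc i)} \<subseteq> {0..T}" using tT[OF i] by simp
      qed
      have ws: "w (Suc i) \<in> Fil {0..t (Suc i)} \<rightarrow>\<^sub>M borel_of TQ"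
        unfolding w_def[abs_def] by (intro measurable_act measurable_inv_TL ev k)
      have "kk (Suc (Suc i)) \<in> Fil {0..t (Suc i)} \<rightarrow>\<^sub>M borel_of TL"
        unfolding kkS[of "Suc i", abs_def] by (intro measurable_mult_TL k measurable_compose[OF ws measurable_S])
      with ws show "w (Suc i) \<in> Fil {0..t (Suc i)} \<rightarrow>\<^sub>M borel_of TQ \<and> kk (Suc (Suc i)) \<in> Fil {0..t (Suc i)} \<rightarrow>\<^sub>M borel_of TL" by blast
    qed
  qed
  have subt: "subalgebra N (Fil {0..t i})" if "i \<le> n" for i using tT[OF that] by (intro Fil_subalgebra) auto
  have mw: "w i \<in> N \<rightarrow>\<^sub>M borel_of TQ" if "i \<le> n" for i
    using measurable_from_subalg[OF subt[OF that]] meas that by blast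
  define \<Lambda> where "\<Lambda> i = (case i of 0 \<Rightarrow> distr N (borel_of TQ) (\<lambda>\<omega>. \<omega> 0) | Suc j \<Rightarrow> \<mu>T (t j) (t i))" for i
  have \<Lambda>s: "sets (\<Lambda> i) = sets (borel_of TQ)" for i by (simp add: \<Lambda>_def \<mu>T_def split: nat.split)
  have \<Lambda>S: "\<Lambda> (Suc j) = \<mu>0 (t j) (t (Suc j))" if "Suc j \<le> n" for j
    using tT[of j] tT[of "Suc j"] that by (simp add: \<Lambda>_def \<mu>T_def min_def)
  have T0: "0 \<in> {0..T}" using T_pos by simp
  have \<Lambda>p: "prob_space (\<Lambda> i)" if "i \<le> n" for i
  proof (cases i)
    case 0
    then show ?thesis using N.prob_space_distr[OF measurable_ev[OF T0]] by (simp add: \<Lambda>_def)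
  next
    case (Suc j)
    then show ?thesis using \<Lambda>S[of j] that prob_\<mu>0[OF tT tT] by simp
  qed
  \<comment> \<open>Induction on the number of increments: the event about the first ones belongs to
    the past of \<open>t m\<close>, and the next increment, taken relative to the frame, is
    independent of it. For \<open>m = 0\<close> the frame is the unit, so \<open>w 0\<close> is the
    initial position.\<close>
  have rect: "m \<le> n \<longrightarrow> (\<forall>B. (\<forall>i\<le>m. B i \<in> sets (borel_of TQ)) \<longrightarrow>
      emeasure N {\<omega> \<in> space N. \<forall>i\<le>m. w i \<omega> \<in> B i} = (\<Prod>i\<le>m. emeasure (\<Lambda> i) (B i)))" for m
  proof (induction m)
    case 0
    show ?case
    proof (intro impI allI)
      fix B :: "nat \<Rightarrow> 'a set set" assume B: "\<forall>i\<le>0. B i \<in> sets (borel_of TQ)"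
      have "emeasure (\<Lambda> 0) (B 0) = emeasure N ((\<lambda>\<omega>. \<omega> 0) -` B 0 \<inter> space N)"
        unfolding \<Lambda>_def using B by (auto intro!: emeasure_distr measurable_ev T0)
      also have "(\<lambda>\<omega>. \<omega> 0) -` B 0 \<inter> space N = {\<omega> \<in> space N. \<forall>i\<le>0. w i \<omega> \<in> B i}"
        using ev_in_C[OF _ T0] H by (auto simp: w_def kk0 act_one)
      finally show "emeasure N {\<omega> \<in> space N. \<forall>i\<le>0. w i \<omega> \<in> B i} = (\<Prod>i\<le>0. emeasure (\<Lambda> i) (B i))" by simp
    qed
  next
    case (Suc m)
    show ?case
    proof (intro impI allI)
      fix B :: "nat \<Rightarrow> 'a set set" assume m: "Suc m \<le> n" and B: "\<forall>i\<le>Suc m. B i \<in> sets (borel_of TQ)"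
      let ?A = "{\<omega> \<in> space N. \<forall>i\<le>m. w i \<omega> \<in> B i}"
      have "?A = (\<Inter>i\<in>{..m}. w i -` B i \<inter> space N)" by auto
      also have "\<dots> \<in> sets (Fil {0..t m})"
      proof (rule sets.finite_INT)
        fix i assume i: "i \<in> {..m}"
        have "w i \<in> Fil {0..t m} \<rightarrow>\<^sub>M borel_of TQ"
        proof (rule measurable_Fil_mono)
          show "w i \<in> Fil {0..t i} \<rightarrow>\<^sub>M borel_of TQ" using meas[of i] i m by simp
          have "t i \<le> t m" using i m by (intro tmono) auto
          then show "{0..t i} \<subseteq> {0..t m}" by simp
          show "{0..t m} \<subseteq> {0..T}" using tT[of m] m by simp
        qed
        from measurable_sets[OF this, of "B i"] show "w i -` B i \<inter> space N \<in> sets (Fil {0..t m})"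
          using B i by simp
      qed auto
      finally have A: "?A \<in> sets (Fil {0..t m})" .
      have "{\<omega> \<in> space N. \<forall>i\<le>Suc m. w i \<omega> \<in> B i} = {\<omega> \<in> ?A. ginv (kk (Suc m) \<omega>) \<rhd> \<omega> (t (Suc m)) \<in> B (Suc m)}"
        by (auto simp: le_Suc_eq w_def)
      also have "emeasure N \<dots> = emeasure N ?A * emeasure (\<mu>0 (t m) (t (Suc m))) (B (Suc m))"
        using m B H tT[of m] tT[of "Suc m"] meas[of m] kkM[of _ m] by (intro increment_independent(2)[OF _ _ _ _ _ A]) auto
      finally show "emeasure N {\<omega> \<in> space N. \<forall>i\<le>Suc m. w i \<omega> \<in> B i} = (\<Prod>i\<le>Suc m. emeasure (\<Lambda> i) (B i))"
        using Suc m B \<Lambda>S[OF m] by simp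
    qed
  qed
  \<comment> \<open>The locale of product probability spaces asks for a probability measure at every
    index; beyond \<open>n\<close> any such measure may be inserted.\<close>
  define \<Lambda>' where "\<Lambda>' i = (if i \<le> n then \<Lambda> i else \<Lambda> 0)" for i
  interpret \<Lambda>': product_prob_space \<Lambda>' "{..n}"
    unfolding product_prob_space_def product_prob_space_axioms_def product_sigma_finite_def
    using \<Lambda>p by (auto simp: \<Lambda>'_def intro: prob_space_imp_sigma_finite)
  have \<Lambda>'eq: "PiM {..n} \<Lambda>' = PiM {..n} \<Lambda>" by (rule PiM_cong) (auto simp: \<Lambda>'_def)
  define W where "W \<omega> = (\<lambda>i\<in>{..n}. w i \<omega>)" for \<omega>
  have mW: "W \<in> N \<rightarrow>\<^sub>M PiM {..n} (\<lambda>_. borel_of TQ)"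
    unfolding W_def by (rule measurable_restrict) (use mw in auto)
  have law: "distr N (PiM {..n} (\<lambda>_. borel_of TQ)) W = PiM {..n} \<Lambda>'"
  proof (rule \<Lambda>'.PiM_eqI)
    show "sets (distr N (PiM {..n} (\<lambda>_. borel_of TQ)) W) = sets (PiM {..n} \<Lambda>')"
      using \<Lambda>s by (auto simp: \<Lambda>'_def intro!: sets_PiM_cong)
    fix A assume "\<And>i. i \<in> {..n} \<Longrightarrow> A i \<in> sets (\<Lambda>' i)"
    then have A: "\<And>i. i \<le> n \<Longrightarrow> A i \<in> sets (borel_of TQ)" using \<Lambda>s by (auto simp: \<Lambda>'_def)
    have "emeasure (distr N (PiM {..n} (\<lambda>_. borel_of TQ)) W) (PiE {..n} A) = emeasure N (W -` (PiE {..n} A) \<inter> space N)"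
      using A by (intro emeasure_distr[OF mW] sets_PiM_I_finite) auto
    also have "W -` (PiE {..n} A) \<inter> space N = {\<omega> \<in> space N. \<forall>i\<le>n. w i \<omega> \<in> A i}"
      by (auto simp: W_def PiE_iff)
    also have "emeasure N \<dots> = (\<Prod>i\<le>n. emeasure (\<Lambda> i) (A i))" using rect[of n] A by blast
    also have "\<dots> = (\<Prod>i\<in>{..n}. emeasure (\<Lambda>' i) (A i))" by (rule prod.cong) (auto simp: \<Lambda>'_def)
    finally show "emeasure (distr N (PiM {..n} (\<lambda>_. borel_of TQ)) W) (PiE {..n} A) = (\<Prod>i\<in>{..n}. emeasure (\<Lambda>' i) (A i))" .
  qed simp
  have msp: "i \<le> Suc n \<Longrightarrow> (\<lambda>v. section_prod K S v i) \<in> PiM {..n} (\<lambda>_. borel_of TQ) \<rightarrow>\<^sub>M borel_of TL" for i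
  proof (induction i)
    case (Suc i)
    then have "(\<lambda>v. section_prod K S v i) \<in> PiM {..n} (\<lambda>_. borel_of TQ) \<rightarrow>\<^sub>M borel_of TL" by simp
    moreover have "(\<lambda>v. S (v i)) \<in> PiM {..n} (\<lambda>_. borel_of TQ) \<rightarrow>\<^sub>M borel_of TL"
      using Suc by (intro measurable_compose[OF measurable_component_singleton[where M="\<lambda>_. borel_of TQ"] measurable_S]) auto
    ultimately show ?case by (simp add: measurable_mult_TL)
  qed simp
  have mcw: "(\<lambda>v. \<lambda>i\<in>{..n}. coset_word K S v i) \<in> PiM {..n} (\<lambda>_. borel_of TQ) \<rightarrow>\<^sub>M PiM {..n} (\<lambda>_. borel_of TQ)"
  proof (rule measurable_restrict)
    fix i assume i: "i \<in> {..n}"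
    show "(\<lambda>v. coset_word K S v i) \<in> PiM {..n} (\<lambda>_. borel_of TQ) \<rightarrow>\<^sub>M borel_of TQ"
      unfolding coset_word_def using i by (intro measurable_act msp measurable_component_singleton) auto
  qed
  have mf: "f \<in> borel_measurable (PiM {..n} (\<lambda>_. borel_of TQ))"
    using continuous_map_measurable_PiM[OF TQ_second_countable _, of "{..n}" euclideanreal f] H by (simp add: Cb_def)
  have sp: "section_prod K S (W \<omega>) i = kk i \<omega>" if "i \<le> Suc n" for i \<omega>
    using that by (induction i) (auto simp: kk0 kkS W_def)
  have cw: "coset_word K S (W \<omega>) i = \<omega> (t i)" if "\<omega> \<in> space N" "i \<le> n" for \<omega> i
    using sp[of i] kw[OF that] that(2) by (simp add: coset_word_def W_def)
  have "(\<integral>v. f (\<lambda>i\<in>{..n}. coset_word K S v i) \<partial>PiM {..n} \<Lambda>) = (\<integral>v. f (\<lambda>i\<in>{..n}. coset_word K S v i) \<partial>distr N (PiM {..n} (\<lambda>_. borel_of TQ)) W)"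
    unfolding law \<Lambda>'eq ..
  also have "\<dots> = (\<integral>\<omega>. f (\<lambda>i\<in>{..n}. coset_word K S (W \<omega>) i) \<partial>N)"
    by (rule integral_distr[OF mW measurable_compose[OF mcw mf]])
  also have "\<dots> = (\<integral>\<omega>. f (\<lambda>i\<in>{..n}. \<omega> (t i)) \<partial>N)"
    by (intro Bochner_Integration.integral_cong refl arg_cong[where f=f]) (auto simp: cw intro!: restrict_ext)
  finally show "(\<integral>\<omega>. f (\<lambda>i\<in>{..n}. \<omega> (t i)) \<partial>N) = (\<integral>w. f (\<lambda>i\<in>{..n}. coset_word K S w i)
             \<partial>PiM {..n} (\<lambda>i. case i of 0 \<Rightarrow> distr N (borel_of TQ) (\<lambda>\<omega>. \<omega> 0) | Suc j \<Rightarrow> \<mu>T (t j) (t i)))"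
    by (simp add: \<Lambda>_def[abs_def])
qed

end

text \<open>One point from each nonempty basic open set gives a countable dense set; metrizability
  turns density into approximation by sequences.\<close>

lemma countable_dense_sequences:
  assumes X: "metrizable_space X" and sc: "second_countable X"
  obtains D where "countable D" "D \<subseteq> topspace X"
    "\<And>x. x \<in> topspace X \<Longrightarrow> \<exists>\<sigma>::nat \<Rightarrow> 'a. range \<sigma> \<subseteq> D \<and> limitin X \<sigma> x sequentially"
proof -
  obtain \<B> where \<B>: "countable \<B>" "\<And>B. B \<in> \<B> \<Longrightarrow> openin X B"
    "\<And>U x. openin X U \<Longrightarrow> x \<in> U \<Longrightarrow> \<exists>B\<in>\<B>. x \<in> B \<and> B \<subseteq> U"
    using second_countable_base[OF sc] by blast
  define D where "D = (\<lambda>B. SOME x. x \<in> B) ` (\<B> - {{}})"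
  have some: "(SOME x. x \<in> B) \<in> B" if "B \<in> \<B> - {{}}" for B using that by (auto intro: some_in_eq[THEN iffD2])
  obtain M d where M: "Metric_space M d" "X = Metric_space.mtopology M d" using X unfolding metrizable_space_def by blast
  interpret Metric_space M d by (rule M)
  have sub: "D \<subseteq> topspace X" using some \<B>(2) openin_subset unfolding D_def by blast
  have "topspace X \<subseteq> mtopology closure_of D"
  proof
    fix x assume "x \<in> topspace X"
    moreover have "\<exists>y. y \<in> D \<and> y \<in> U" if U: "x \<in> U" "openin X U" for U
    proof -
      obtain B where B: "B \<in> \<B>" "x \<in> B" "B \<subseteq> U" using \<B>(3)[OF U(2,1)] by blast
      then have "B \<in> \<B> - {{}}" by auto
      then show ?thesis using some[of B] B(3) unfolding D_def by blast
    qed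
    ultimately show "x \<in> mtopology closure_of D" unfolding in_closure_of M(2) by blast
  qed
  then have "\<exists>\<sigma>::nat \<Rightarrow> 'a. range \<sigma> \<subseteq> D \<and> limitin X \<sigma> x sequentially" if "x \<in> topspace X" for x
    using that unfolding closure_of_sequentially M(2) by blast
  then show thesis using that[of D] \<B>(1) sub unfolding D_def by (metis countable_Diff countable_image)
qed

lemma finite_measure_density_bounded:
  assumes "finite_measure M" "f \<in> borel_measurable M" "\<And>x. f x \<le> 1"
  shows "finite_measure (density M f)"
proof -
  interpret finite_measure M by fact
  have "emeasure (density M f) (space M) \<le> (\<integral>\<^sup>+x. 1 \<partial>M)"
    unfolding emeasure_density[OF assms(2) sets.top] using assms(3) by (intro nn_integral_mono) (auto split: split_indicator)
  also have "\<dots> < \<top>" by (simp add: less_top[symmetric] emeasure_eq_measure)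
  finally show ?thesis by (intro finite_measureI) auto
qed

section \<open>From countably many identities to independent and invariant increments\<close>

context homogeneous_path_measure
begin

text \<open>If \<open>h\<close> is a limit of elements of \<open>D\<close>, then by continuity of
  the action and dominated convergence the integrals of moved test functions converge, so invariance
  under the dense set gives invariance under \<open>h\<close>.\<close>

lemma invariant_measure_of_dense:
  assumes \<nu>: "finite_measure \<nu>" "sets \<nu> = sets (borel_of TQ)"
    and D: "\<And>h. h \<in> M \<Longrightarrow> \<exists>\<sigma>::nat \<Rightarrow> 'k. range \<sigma> \<subseteq> D \<and> limitin TL \<sigma> h sequentially"
    and inv: "\<And>h. h \<in> D \<Longrightarrow> distr \<nu> (borel_of TQ) (\<lambda>z. h \<rhd> z) = \<nu>"
    and DM: "D \<subseteq> M"
  shows "invariant_measure K M TQ \<nu>"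
  unfolding invariant_measure_def
proof (intro conjI ballI \<nu>(2))
  fix h assume h: "h \<in> M"
  have m: "(\<lambda>z. k \<rhd> z) \<in> \<nu> \<rightarrow>\<^sub>M borel_of TQ" if "k \<in> M" for k
    using continuous_map_measurable[OF continuous_act_const] that M_sub measurable_cong_sets[OF \<nu>(2) refl] by blast
  show "distr \<nu> (borel_of TQ) (\<lambda>z. h \<rhd> z) = \<nu>"
  proof (rule measure_eqI_Cb[OF TQ_metrizable])
    show "finite_measure (distr \<nu> (borel_of TQ) (\<lambda>z. h \<rhd> z))"
      by (rule finite_measure.finite_measure_distr[OF \<nu>(1) m[OF h]])
    fix f assume f: "f \<in> Cb TQ"
    obtain \<sigma> :: "nat \<Rightarrow> 'k" where \<sigma>: "range \<sigma> \<subseteq> D" "limitin TL \<sigma> h sequentially" using D[OF h] by blast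
    have \<sigma>M: "\<sigma> n \<in> M" for n using \<sigma>(1) DM by auto
    have lim: "limitin TQ (\<lambda>n. \<sigma> n \<rhd> z) (h \<rhd> z) sequentially" if z: "z \<in> space \<nu>" for z
    proof -
      have "z \<in> C" using z sets_eq_imp_space_eq[OF \<nu>(2)] by simp
      then have "continuous_map TL TQ (\<lambda>k. k \<rhd> z)"
        using continuous_map_compose[OF _ continuous_act, of TL "\<lambda>k. (k, z)"] by (simp add: comp_def continuous_map_pairedI)
      from continuous_map_limit[OF this \<sigma>(2)] show ?thesis by (simp add: comp_def)
    qed
    have "(\<lambda>n. \<integral>z. indicator (space \<nu>) z * f (\<sigma> n \<rhd> z) \<partial>\<nu>) \<longlonglongrightarrow> (\<integral>z. indicator (space \<nu>) z * f (h \<rhd> z) \<partial>\<nu>)"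
      by (rule countable_set_integral_limit[OF \<nu>(1) sets.top f m[OF \<sigma>M] m[OF h] lim])
    moreover have "(\<integral>z. indicator (space \<nu>) z * f (k \<rhd> z) \<partial>\<nu>) = (\<integral>z. f z \<partial>distr \<nu> (borel_of TQ) (\<lambda>z. k \<rhd> z))" if "k \<in> M" for k
      using integral_distr[OF m[OF that] Cb_measurable[OF f]] by (simp cong: Bochner_Integration.integral_cong)
    moreover have "distr \<nu> (borel_of TQ) (\<lambda>z. \<sigma> n \<rhd> z) = \<nu>" for n using inv \<sigma>(1) by auto
    ultimately have "(\<lambda>n::nat. \<integral>z. f z \<partial>\<nu>) \<longlonglongrightarrow> (\<integral>z. f z \<partial>distr \<nu> (borel_of TQ) (\<lambda>z. h \<rhd> z))"
      using \<sigma>M h by simp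
    then show "(\<integral>z. f z \<partial>distr \<nu> (borel_of TQ) (\<lambda>z. h \<rhd> z)) = (\<integral>z. f z \<partial>\<nu>)"
      using LIMSEQ_unique tendsto_const by blast
  qed (use \<nu> in auto)
qed

text \<open>The force of the hypothesis is that the factor \<open>b s t B\<close> is the same for
  all \<open>A\<close> and all \<open>h\<close>. Varying \<open>A\<close> gives independence,
  varying \<open>h\<close> gives invariance, and only generators are involved, so countably many
  identities decide the matter.\<close>

lemma independent_increments_of_generators:
  assumes \<B>: "Int_stable \<B>" "\<B> \<subseteq> Pow C" "C \<in> \<B>" "sets (borel_of TQ) = sigma_sets C \<B>"
    and \<G>: "\<And>s. s \<in> Dn \<Longrightarrow> Int_stable (\<G> s)" "\<And>s. s \<in> Dn \<Longrightarrow> space N \<in> \<G> s" "\<And>s. s \<in> Dn \<Longrightarrow> \<G> s \<subseteq> sets N"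
      "\<And>s u B. s \<in> Dn \<Longrightarrow> u \<in> Dn \<Longrightarrow> u \<le> s \<Longrightarrow> B \<in> \<B> \<Longrightarrow> {\<omega> \<in> space N. \<omega> u \<in> B} \<in> sigma_sets (space N) (\<G> s)"
    and D: "\<And>h. h \<in> M \<Longrightarrow> \<exists>\<sigma>::nat \<Rightarrow> 'k. range \<sigma> \<subseteq> D \<and> limitin TL \<sigma> h sequentially"
    and DM: "D \<subseteq> M" and one: "\<one>\<^bsub>K\<^esub> \<in> D"
    and eq: "\<And>s t A B h. s \<in> Dn \<Longrightarrow> t \<in> Dn \<Longrightarrow> s < t \<Longrightarrow> A \<in> \<G> s \<Longrightarrow> B \<in> \<B> \<Longrightarrow> h \<in> D \<Longrightarrow>
      emeasure N {\<omega> \<in> A. h \<rhd> incr s t \<omega> \<in> B} = emeasure N A * b s t B"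
  shows "homogeneous_independent_increments K L M Q S T N Dn"
proof unfold_locales
  fix s t assume st: "s \<in> Dn" "t \<in> Dn" "s < t"
  then have stT: "s \<in> {0..T}" "t \<in> {0..T}" using Dn(1) by auto
  note mi = measurable_incr_N[OF stT]
  have incrC: "incr s t \<omega> \<in> C" if "\<omega> \<in> space N" for \<omega> using measurable_TQ_C[OF mi that] .
  have em\<mu>: "emeasure (\<mu>0 s t) B = emeasure N {\<omega> \<in> space N. incr s t \<omega> \<in> B}" if "B \<in> sets (borel_of TQ)" for B
    unfolding \<mu>0_def using that mi by (simp add: emeasure_distr vimage_def Int_def conj_commute)
  have \<B>s: "B \<in> sets (borel_of TQ)" if "B \<in> \<B>" for B using that \<B>(4) by auto
  have indep0: "emeasure N {\<omega> \<in> A. incr s t \<omega> \<in> B} = emeasure N A * emeasure (\<mu>0 s t) B"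
    if A: "A \<in> \<G> s" and B: "B \<in> \<B>" for A B
  proof -
    have 1: "emeasure N {\<omega> \<in> A. incr s t \<omega> \<in> B} = emeasure N A * b s t B" if A: "A \<in> \<G> s" for A
    proof -
      have "A \<subseteq> space N" using A \<G>(3)[OF st(1)] sets.sets_into_space by blast
      then have "{\<omega> \<in> A. \<one>\<^bsub>K\<^esub> \<rhd> incr s t \<omega> \<in> B} = {\<omega> \<in> A. incr s t \<omega> \<in> B}" using incrC act_one by auto
      then show ?thesis using eq[OF st A B one] by simp
    qed
    \<comment> \<open>Taking the whole space for \<open>A\<close> identifies the unknown factor as
      the unconditional law of the increment.\<close>
    from 1[OF \<G>(2)[OF st(1)]] have "b s t B = emeasure (\<mu>0 s t) B" using em\<mu>[OF \<B>s[OF B]] N.emeasure_space_1 by simp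
    then show ?thesis using 1[OF A] by simp
  qed
  show "emeasure N {\<omega> \<in> A. incr s t \<omega> \<in> B} = emeasure N A * emeasure (\<mu>0 s t) B"
    if A: "A \<in> sets (Fil (Dn \<inter> {..s}))" and B: "B \<in> sets (borel_of TQ)" for A B
  proof -
    let ?I = "{incr s t -` B \<inter> space N | B. B \<in> \<B>}"
    have pre: "{\<omega> \<in> A. incr s t \<omega> \<in> B} = A \<inter> (incr s t -` B \<inter> space N)" if "A \<in> sets N" for A B
      using sets.sets_into_space[OF that] by auto
    \<comment> \<open>Independence on two pi-systems extends to the sigma-algebras they
      generate.\<close>
    have "N.indep_set (\<G> s) ?I"
    proof (rule N.indep_setI[OF \<G>(3)[OF st(1)]])
      show "?I \<subseteq> sets N" using measurable_sets[OF mi \<B>s] by auto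
      fix a e assume a: "a \<in> \<G> s" and "e \<in> ?I"
      then obtain B where B: "B \<in> \<B>" "e = incr s t -` B \<inter> space N" by auto
      have aN: "a \<in> sets N" using a \<G>(3)[OF st(1)] by auto
      have "emeasure N (a \<inter> e) = emeasure N a * emeasure N e"
        using indep0[OF a B(1)] em\<mu>[OF \<B>s[OF B(1)]] pre[OF aN] pre[OF sets.top] B(2) by (simp add: Int_ac)
      then have "ennreal (measure N (a \<inter> e)) = ennreal (measure N a * measure N e)"
        by (simp add: N.emeasure_eq_measure ennreal_mult)
      then show "measure N (a \<inter> e) = measure N a * measure N e" by (simp add: mult_nonneg_nonneg)
    qed
    moreover have "Int_stable ?I"
    proof (rule Int_stableI)
      fix a e assume "a \<in> ?I" "e \<in> ?I"
      then obtain B B' where "B \<in> \<B>" "B' \<in> \<B>" "a = incr s t -` B \<inter> space N" "e = incr s t -` B' \<inter> space N" by auto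
      then show "a \<inter> e \<in> ?I" using \<B>(1) by (auto simp: Int_stable_def intro!: exI[of _ "B \<inter> B'"])
    qed
    ultimately have ind: "N.indep_set (sigma_sets (space N) (\<G> s)) (sigma_sets (space N) ?I)"
      using N.indep_set_sigma_sets \<G>(1)[OF st(1)] by blast
    have I: "incr s t -` B \<inter> space N \<in> sigma_sets (space N) ?I"
      using sigma_sets_vimage_commute[of "incr s t" "space N" C \<B>] B \<B>(4) incrC by auto
    have gsp: "\<G> s \<subseteq> Pow (space N)" using \<G>(3)[OF st(1)] sets.sets_into_space by blast
    have "sets (Fil (Dn \<inter> {..s})) \<subseteq> sets (sigma (space N) (\<G> s))"
    proof (rule sets_Fil_subset)
      fix u assume u: "u \<in> Dn \<inter> {..s}"
      have "(\<lambda>\<omega>. \<omega> u) \<in> sigma (space N) (\<G> s) \<rightarrow>\<^sub>M sigma C \<B>"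
      proof (rule measurable_sigma_sets[OF sets_measure_of[OF \<B>(2)]])
        show "(\<lambda>\<omega>. \<omega> u) \<in> space (sigma (space N) (\<G> s)) \<rightarrow> C" using u Dn(1) ev_in_C gsp by (auto simp: space_measure_of)
        show "(\<lambda>\<omega>. \<omega> u) -` B \<inter> space (sigma (space N) (\<G> s)) \<in> sets (sigma (space N) (\<G> s))" if B: "B \<in> \<B>" for B
        proof -
          have "(\<lambda>\<omega>. \<omega> u) -` B \<inter> space N = {\<omega> \<in> space N. \<omega> u \<in> B}" by auto
          then show ?thesis using \<G>(4)[OF st(1) _ _ B, of u] u gsp by (simp add: space_measure_of sets_measure_of)
        qed
      qed (use \<B>(2) in auto)
      then show "(\<lambda>\<omega>. \<omega> u) \<in> sigma (space N) (\<G> s) \<rightarrow>\<^sub>M borel_of TQ"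
        by (rule subst[OF measurable_cong_sets[OF refl], rotated]) (simp add: \<B>(2,4) sets_measure_of)
    qed (use gsp in \<open>simp add: space_measure_of\<close>)
    then have AG: "A \<in> sigma_sets (space N) (\<G> s)" using A gsp by (auto simp: sets_measure_of)
    have AN: "A \<in> sets N" using A Fil_subalgebra[of "Dn \<inter> {..s}"] Dn(1) by (auto simp: subalgebra_def)
    have "measure N (A \<inter> (incr s t -` B \<inter> space N)) = measure N A * measure N (incr s t -` B \<inter> space N)"
      by (rule N.indep_setD[OF ind AG I])
    then have "emeasure N (A \<inter> (incr s t -` B \<inter> space N)) = emeasure N A * emeasure N (incr s t -` B \<inter> space N)"
      by (simp add: N.emeasure_eq_measure ennreal_mult)
    then show ?thesis using em\<mu>[OF B] pre[OF AN] pre[OF sets.top] by (simp add: Int_ac)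
  qed
  show "invariant_measure K M TQ (\<mu>0 s t)"
  proof (rule invariant_measure_of_dense[OF _ sets_\<mu>0 D _ DM])
    show fm: "finite_measure (\<mu>0 s t)" using prob_\<mu>0[OF stT] by (simp add: prob_space_def)
    fix h assume h: "h \<in> D"
    have hm: "(\<lambda>z. h \<rhd> z) \<in> borel_of TQ \<rightarrow>\<^sub>M borel_of TQ"
      using continuous_map_measurable[OF continuous_act_const] h DM M_sub by blast
    have hm': "(\<lambda>z. h \<rhd> z) \<in> \<mu>0 s t \<rightarrow>\<^sub>M borel_of TQ" using hm by (simp cong: measurable_cong_sets)
    show "distr (\<mu>0 s t) (borel_of TQ) (\<lambda>z. h \<rhd> z) = \<mu>0 s t"
    proof (rule measure_eqI_generator_eq[where \<Omega>=C and E=\<B> and A="\<lambda>_. C"])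
      \<comment> \<open>The factor \<open>b s t B\<close> for \<open>h\<close> is compared with the
        one for the unit; this is where the unit in \<open>D\<close> is used.\<close>
      show "emeasure (distr (\<mu>0 s t) (borel_of TQ) (\<lambda>z. h \<rhd> z)) B = emeasure (\<mu>0 s t) B" if B: "B \<in> \<B>" for B
      proof -
        have "emeasure (distr (\<mu>0 s t) (borel_of TQ) (\<lambda>z. h \<rhd> z)) B = emeasure (\<mu>0 s t) ((\<lambda>z. h \<rhd> z) -` B \<inter> C)"
          using emeasure_distr[OF hm' \<B>s[OF B]] by simp
        also have "\<dots> = emeasure N {\<omega> \<in> space N. incr s t \<omega> \<in> (\<lambda>z. h \<rhd> z) -` B \<inter> C}"
          using measurable_sets[OF hm \<B>s[OF B]] by (intro em\<mu>) simp
        also have "\<dots> = emeasure N {\<omega> \<in> space N. h \<rhd> incr s t \<omega> \<in> B}" using incrC by (auto intro!: arg_cong[where f="emeasure N"])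
        also have "\<dots> = emeasure N (space N) * b s t B" by (rule eq[OF st \<G>(2)[OF st(1)] B h])
        also have "\<dots> = emeasure N {\<omega> \<in> space N. \<one>\<^bsub>K\<^esub> \<rhd> incr s t \<omega> \<in> B}" by (rule eq[OF st \<G>(2)[OF st(1)] B one, symmetric])
        also have "\<dots> = emeasure (\<mu>0 s t) B" unfolding em\<mu>[OF \<B>s[OF B]] using incrC act_one by (auto intro!: arg_cong[where f="emeasure N"])
        finally show ?thesis .
      qed
      show "emeasure (distr (\<mu>0 s t) (borel_of TQ) (\<lambda>z. h \<rhd> z)) C \<noteq> \<infinity>"
        using finite_measure.emeasure_finite[OF finite_measure.finite_measure_distr[OF fm hm']] by simp
    qed (use \<B> in auto)
  qed
qed

end

section \<open>Invariant Markov processes with finite life time\<close>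

text \<open>A bound for \<open>f\<close> is added to make it nonnegative. The test function 1 shows
  that the masses agree, so the constant cancels.\<close>

lemma measure_eqI_Cb_nonneg:
  assumes X: "metrizable_space X" and \<mu>: "finite_measure \<mu>" "sets \<mu> = sets (borel_of X)"
    and \<nu>: "finite_measure \<nu>" "sets \<nu> = sets (borel_of X)"
    and eq: "\<And>f. f \<in> Cb X \<Longrightarrow> (\<And>x. x \<in> topspace X \<Longrightarrow> 0 \<le> f x) \<Longrightarrow>
      (\<integral>\<^sup>+x. ennreal (f x) \<partial>\<mu>) = (\<integral>\<^sup>+x. ennreal (f x) \<partial>\<nu>)"
  shows "\<mu> = \<nu>"
proof (rule measure_eqI_Cb[OF X \<mu> \<nu>])
  fix f assume f: "f \<in> Cb X"
  obtain B where B: "\<And>x. x \<in> topspace X \<Longrightarrow> \<bar>f x\<bar> \<le> B" using Cb_bounded[OF f] by blast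
  have sp: "space \<mu> = topspace X" "space \<nu> = topspace X" using sets_eq_imp_space_eq[OF \<mu>(2)] sets_eq_imp_space_eq[OF \<nu>(2)] by simp_all
  have fm: "f \<in> borel_measurable \<mu>" "f \<in> borel_measurable \<nu>"
    using Cb_measurable[OF f] \<mu>(2) \<nu>(2) by (simp_all cong: measurable_cong_sets)
  have int: "integrable \<mu> f" "integrable \<nu> f"
    using B sp fm \<mu>(1) \<nu>(1) by (auto intro!: finite_measure.integrable_const_bound[where B=B])
  interpret \<mu>: finite_measure \<mu> by fact
  interpret \<nu>: finite_measure \<nu> by fact
  have fB: "(\<lambda>x. f x + B) \<in> Cb X"
    using f by (auto simp: Cb_def intro!: continuous_map_add bounded_plus_comp) (auto simp: bounded_iff)
  have c1: "(\<lambda>x. 1) \<in> Cb X" by (auto simp: Cb_def bounded_iff)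
  have "emeasure \<mu> (topspace X) = emeasure \<nu> (topspace X)" using eq[OF c1] sp by simp
  then have tot: "measure \<mu> (space \<mu>) = measure \<nu> (space \<nu>)" using sp by (simp add: measure_def)
  have nn: "0 \<le> f x + B" if "x \<in> topspace X" for x using B[OF that] by auto
  have "ennreal (\<integral>x. f x + B \<partial>\<mu>) = (\<integral>\<^sup>+x. ennreal (f x + B) \<partial>\<mu>)"
    using int nn sp by (intro nn_integral_eq_integral[symmetric]) auto
  also have "\<dots> = (\<integral>\<^sup>+x. ennreal (f x + B) \<partial>\<nu>)" using eq[OF fB] nn by blast
  also have "\<dots> = ennreal (\<integral>x. f x + B \<partial>\<nu>)"
    using int nn sp by (intro nn_integral_eq_integral) auto
  finally have "(\<integral>x. f x + B \<partial>\<mu>) = (\<integral>x. f x + B \<partial>\<nu>)"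
    using nn sp by (subst (asm) ennreal_inj) (auto intro!: Bochner_Integration.integral_nonneg)
  then show "(\<integral>x. f x \<partial>\<mu>) = (\<integral>x. f x \<partial>\<nu>)" using int tot by simp
qed

locale killed_markov =
  fixes E :: "'x topology" and P :: "real \<Rightarrow> 'x \<Rightarrow> 'x measure" and N :: "'w measure"
    and p :: "real \<Rightarrow> 'w \<Rightarrow> 'x" and \<xi> :: "'w \<Rightarrow> ereal" and x0 :: 'x
  assumes E_metrizable: "metrizable_space E" and E_second_countable: "second_countable E"
    and semigroup: "transition_semigroup E P" and markov: "markov_process E P N p \<xi>"
    and x0: "x0 \<in> topspace E" and start: "AE \<omega> in N. 0 < \<xi> \<omega> \<and> p 0 \<omega> = x0"
begin

lemma rcll: "rcll_process E N p \<xi>" using markov by (simp add: markov_process_def)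

sublocale N: prob_space N using rcll by (simp add: rcll_process_def)

abbreviation F where "F s \<equiv> natural_filtration E N p \<xi> s"

definition alive :: "real \<Rightarrow> 'w set" where "alive s = {\<omega> \<in> space N. ereal s < \<xi> \<omega>}"

text \<open>A total version of the process with values in \<open>E\<close>. After the life time it
  sits at \<open>x0\<close>; every use is accompanied by the indicator of \<open>alive\<close>, so
  this value never contributes.\<close>

definition pt :: "real \<Rightarrow> 'w \<Rightarrow> 'x" where "pt s \<omega> = (if ereal s < \<xi> \<omega> then p s \<omega> else x0)"

lemma kernel: "0 \<le> t \<Longrightarrow> P t \<in> borel_of E \<rightarrow>\<^sub>M subprob_algebra (borel_of E)"
  using semigroup by (simp add: transition_semigroup_def)

lemma space_F [simp]: "space (F s) = space N"
  unfolding natural_filtration_def by (rule space_measure_of) auto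

lemma sets_F: "sets (F s) = sigma_sets (space N)
    {{\<omega> \<in> space N. ereal u < \<xi> \<omega> \<and> p u \<omega> \<in> B} | u B. u \<in> {0..s} \<and> B \<in> sets (borel_of E)}"
  unfolding natural_filtration_def by (rule sets_measure_of) auto

lemma subalgebra_F: "subalgebra N (F s)"
  unfolding subalgebra_def space_F sets_F
  using rcll by (intro conjI refl sets.sigma_sets_subset) (auto simp: rcll_process_def)

lemma F_mono: "s \<le> t \<Longrightarrow> subalgebra (F t) (F s)"
  unfolding subalgebra_def space_F sets_F by (intro conjI refl sigma_sets_mono') (use order_trans in fastforce)

lemma p_in_E: "\<omega> \<in> space N \<Longrightarrow> 0 \<le> t \<Longrightarrow> ereal t < \<xi> \<omega> \<Longrightarrow> p t \<omega> \<in> topspace E"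
  using rcll limitin_topspace unfolding rcll_process_def by metis

lemma pt_in_E: "\<omega> \<in> space N \<Longrightarrow> 0 \<le> t \<Longrightarrow> pt t \<omega> \<in> topspace E"
  using p_in_E x0 by (simp add: pt_def)

lemma F_basic:
  assumes "0 \<le> u" "u \<le> s" "B \<in> sets (borel_of E)"
  shows "{\<omega> \<in> space N. ereal u < \<xi> \<omega> \<and> p u \<omega> \<in> B} \<in> sets (F s)"
  unfolding sets_F using assms by (intro sigma_sets.Basic) auto

lemma alive_F: "0 \<le> u \<Longrightarrow> u \<le> s \<Longrightarrow> alive u \<in> sets (F s)"
proof -
  assume "0 \<le> u" "u \<le> s"
  moreover have "alive u = {\<omega> \<in> space N. ereal u < \<xi> \<omega> \<and> p u \<omega> \<in> topspace E}"
    using p_in_E \<open>0 \<le> u\<close> by (auto simp: alive_def)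
  ultimately show ?thesis using F_basic[OF _ _ borel_of_open[OF openin_topspace], of u s] by simp
qed

lemma alive_N: "0 \<le> u \<Longrightarrow> alive u \<in> sets N"
  using alive_F[of u u] subalgebra_F[of u] by (auto simp: subalgebra_def)

lemma alive_mono: "u \<le> s \<Longrightarrow> alive s \<subseteq> alive u"
  unfolding alive_def using order.strict_trans1[of "ereal u" "ereal s"] by auto

lemma measurable_pt:
  assumes "0 \<le> u" "u \<le> s" shows "pt u \<in> F s \<rightarrow>\<^sub>M borel_of E"
proof (rule measurableI)
  show "pt u \<omega> \<in> space (borel_of E)" if "\<omega> \<in> space (F s)" for \<omega> using pt_in_E that assms by simp
  fix B assume B: "B \<in> sets (borel_of E)"
  have "pt u -` B \<inter> space (F s) = {\<omega> \<in> space N. ereal u < \<xi> \<omega> \<and> p u \<omega> \<in> B} \<union> (if x0 \<in> B then space (F s) - alive u else {})"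
    by (auto simp: pt_def alive_def split: if_splits)
  then show "pt u -` B \<inter> space (F s) \<in> sets (F s)"
    using F_basic[OF assms B] sets.compl_sets[OF alive_F[OF assms]] by auto
qed

lemma measurable_pt_N: "0 \<le> u \<Longrightarrow> pt u \<in> N \<rightarrow>\<^sub>M borel_of E"
  using measurable_pt[of u u] measurable_from_subalg[OF subalgebra_F] by blast

lemma kernel_pt:
  assumes "0 \<le> u" "u \<le> s" "0 \<le> t" shows "(\<lambda>\<omega>. P t (pt u \<omega>)) \<in> F s \<rightarrow>\<^sub>M subprob_algebra (borel_of E)"
  by (rule measurable_compose[OF measurable_pt[OF assms(1,2)] kernel[OF assms(3)]])

lemma markov_step:
  "0 \<le> t \<Longrightarrow> 0 \<le> s \<Longrightarrow> f \<in> Cb E \<Longrightarrow> AE \<omega> in N.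
        real_cond_exp N (F t) (\<lambda>\<omega>. if ereal (t + s) < \<xi> \<omega> then f (p (t + s) \<omega>) else 0) \<omega> =
        (if ereal t < \<xi> \<omega> then (\<integral>x. f x \<partial>P s (p t \<omega>)) else 0)"
  using markov unfolding markov_process_def by blast

text \<open>The conditional expectation of the Markov property is integrated over an event of the
  past. Nonnegative integrals replace Bochner integrals so that later extensions need no
  integrability.\<close>

lemma one_step_Cb:
  assumes st: "0 \<le> s" "s \<le> t" and A: "A \<in> sets (F s)" and f: "f \<in> Cb E" "\<And>x. x \<in> topspace E \<Longrightarrow> 0 \<le> f x"
  shows "(\<integral>\<^sup>+\<omega>. indicator A \<omega> * indicator (alive t) \<omega> * ennreal (f (pt t \<omega>)) \<partial>N)
    = (\<integral>\<^sup>+\<omega>. indicator A \<omega> * indicator (alive s) \<omega> * (\<integral>\<^sup>+x. ennreal (f x) \<partial>P (t - s) (pt s \<omega>)) \<partial>N)"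
proof -
  obtain B where B: "\<And>x. x \<in> topspace E \<Longrightarrow> \<bar>f x\<bar> \<le> B" using Cb_bounded[OF f(1)] by blast
  interpret finite_measure_subalgebra N "F s" by unfold_locales (rule subalgebra_F)
  have AN: "A \<in> sets N" using A subalgebra_F by (auto simp: subalgebra_def)
  have aN: "alive t \<in> sets N" using st by (intro alive_N) auto
  define g where "g \<omega> = (if ereal t < \<xi> \<omega> then f (p t \<omega>) else 0)" for \<omega>
  define h where "h \<omega> = (if ereal s < \<xi> \<omega> then (\<integral>x. f x \<partial>P (t - s) (p s \<omega>)) else 0)" for \<omega>
  have g: "g \<omega> = indicator (alive t) \<omega> * f (pt t \<omega>)" if "\<omega> \<in> space N" for \<omega>
    using that by (auto simp: g_def alive_def pt_def)
  have fpt: "(\<lambda>\<omega>. f (pt t \<omega>)) \<in> borel_measurable N"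
    using st by (intro measurable_compose[OF measurable_pt_N Cb_measurable[OF f(1)]]) auto
  have gm: "g \<in> borel_measurable N"
    using fpt aN by (subst measurable_cong[OF g]) auto
  have t0: "0 \<le> t" using st by simp
  have g0: "0 \<le> g \<omega>" "g \<omega> \<le> B" "0 \<le> B" if "\<omega> \<in> space N" for \<omega>
    using f(2)[OF pt_in_E[OF that t0]] B[OF pt_in_E[OF that t0]] by (auto simp: g[OF that] indicator_def)
  have gi: "integrable N g"
    using gm g0 by (intro N.integrable_const_bound[where B=B]) auto
  have AE: "AE \<omega> in N. real_cond_exp N (F s) g \<omega> = h \<omega>"
  proof -
    have "s + (t - s) = t" by simp
    from markov_step[OF st(1) _ f(1), of "t - s", unfolded this] st
    show ?thesis unfolding g_def[abs_def] h_def by (simp only: diff_ge_0_iff_ge)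
  qed
  have h0: "0 \<le> h \<omega>" if "\<omega> \<in> space N" for \<omega>
  proof (cases "ereal s < \<xi> \<omega>")
    case True
    then have e: "p s \<omega> \<in> topspace E" using p_in_E that st by auto
    have "space (P (t - s) (p s \<omega>)) = topspace E"
      using sets_eq_imp_space_eq[OF sets_kernel[OF kernel]] e st by simp
    then show ?thesis using f(2) by (auto simp: h_def intro!: integral_nonneg_AE AE_I2)
  qed (simp add: h_def)
  have ci: "integrable N (real_cond_exp N (F s) g)" using gi by (rule real_cond_exp_int)
  have "(\<integral>\<^sup>+\<omega>. indicator A \<omega> * indicator (alive t) \<omega> * ennreal (f (pt t \<omega>)) \<partial>N) = (\<integral>\<^sup>+\<omega>. ennreal (indicator A \<omega> * g \<omega>) \<partial>N)"
    by (rule nn_integral_cong) (auto simp: g indicator_def)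
  also have "\<dots> = ennreal (\<integral>\<omega>. indicator A \<omega> * g \<omega> \<partial>N)"
    using integrable_mult_indicator[OF AN gi] g0 by (intro nn_integral_eq_integral) auto
  also have "(\<integral>\<omega>. indicator A \<omega> * g \<omega> \<partial>N) = (\<integral>\<omega>. indicator A \<omega> * real_cond_exp N (F s) g \<omega> \<partial>N)"
    using real_cond_exp_intA[OF gi A] by (simp add: set_lebesgue_integral_def)
  also have "ennreal \<dots> = (\<integral>\<^sup>+\<omega>. ennreal (indicator A \<omega> * real_cond_exp N (F s) g \<omega>) \<partial>N)"
  proof (rule nn_integral_eq_integral[symmetric])
    show "integrable N (\<lambda>\<omega>. indicator A \<omega> * real_cond_exp N (F s) g \<omega>)"
      using integrable_mult_indicator[OF AN ci] by simp
    have "AE \<omega> in N. 0 \<le> h \<omega>" using h0 by (rule AE_I2)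
    with AE show "AE \<omega> in N. 0 \<le> indicator A \<omega> * real_cond_exp N (F s) g \<omega>"
      by eventually_elim simp
  qed
  also have "\<dots> = (\<integral>\<^sup>+\<omega>. ennreal (indicator A \<omega> * h \<omega>) \<partial>N)"
    using AE by (intro nn_integral_cong_AE) auto
  also have "\<dots> = (\<integral>\<^sup>+\<omega>. indicator A \<omega> * indicator (alive s) \<omega> * (\<integral>\<^sup>+x. ennreal (f x) \<partial>P (t - s) (pt s \<omega>)) \<partial>N)"
  proof (rule nn_integral_cong)
    fix \<omega> assume w: "\<omega> \<in> space N"
    show "ennreal (indicator A \<omega> * h \<omega>) = indicator A \<omega> * indicator (alive s) \<omega> * (\<integral>\<^sup>+x. ennreal (f x) \<partial>P (t - s) (pt s \<omega>))"
    proof (cases "ereal s < \<xi> \<omega>")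
      case True
      then have e: "p s \<omega> \<in> topspace E" using p_in_E w st by auto
      have k: "P (t - s) (p s \<omega>) \<in> space (subprob_algebra (borel_of E))"
        using measurable_space[OF kernel, of "t - s" "p s \<omega>"] e st by simp
      then have sub: "subprob_space (P (t - s) (p s \<omega>))" and ss: "sets (P (t - s) (p s \<omega>)) = sets (borel_of E)"
        by (auto simp: space_subprob_algebra)
      have sp: "space (P (t - s) (p s \<omega>)) = topspace E" using sets_eq_imp_space_eq[OF ss] by simp
      have "integrable (P (t - s) (p s \<omega>)) f"
        using sub sp B Cb_measurable[OF f(1)] ss
        by (intro finite_measure.integrable_const_bound[where B=B])
          (auto simp: subprob_space_def cong: measurable_cong_sets)
      then have "(\<integral>\<^sup>+x. ennreal (f x) \<partial>P (t - s) (p s \<omega>)) = ennreal (\<integral>x. f x \<partial>P (t - s) (p s \<omega>))"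
        using f(2) sp by (intro nn_integral_eq_integral) auto
      then show ?thesis using True w by (auto simp: h_def pt_def alive_def indicator_def)
    qed (simp add: h_def alive_def)
  qed
  finally show ?thesis .
qed

text \<open>For fixed \<open>A\<close> both sides are measures in \<open>B\<close>, and they agree
  on nonnegative bounded continuous functions. The function 1 among them transfers finiteness from
  the law \<open>\<alpha>\<close> to the composed measure \<open>\<beta>\<close>.\<close>

lemma one_step_sets:
  assumes st: "0 \<le> s" "s \<le> t" and A: "A \<in> sets (F s)" and B: "B \<in> sets (borel_of E)"
  shows "(\<integral>\<^sup>+\<omega>. indicator A \<omega> * indicator (alive t) \<omega> * indicator B (pt t \<omega>) \<partial>N)
    = (\<integral>\<^sup>+\<omega>. indicator A \<omega> * indicator (alive s) \<omega> * emeasure (P (t - s) (pt s \<omega>)) B \<partial>N)"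
proof -
  have AN: "A \<in> sets N" using A subalgebra_F by (auto simp: subalgebra_def)
  have aN: "alive t \<in> sets N" "alive s \<in> sets N" using st by (auto intro: alive_N)
  define N1 where "N1 = density N (\<lambda>\<omega>. indicator (A \<inter> alive t) \<omega>)"
  define N2 where "N2 = density N (\<lambda>\<omega>. indicator (A \<inter> alive s) \<omega>)"
  have fin1: "finite_measure N1" "finite_measure N2"
    unfolding N1_def N2_def using AN aN
    by (auto intro!: finite_measureI simp: emeasure_density nn_integral_indicator N.emeasure_eq_measure)
  define \<alpha> where "\<alpha> = distr N1 (borel_of E) (pt t)"
  define \<beta> where "\<beta> = N2 \<bind> (\<lambda>\<omega>. P (t - s) (pt s \<omega>))"
  have mpt: "pt t \<in> N1 \<rightarrow>\<^sub>M borel_of E" unfolding N1_def using measurable_pt_N[of t] st by simp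
  have mk: "(\<lambda>\<omega>. P (t - s) (pt s \<omega>)) \<in> N2 \<rightarrow>\<^sub>M subprob_algebra (borel_of E)"
    unfolding N2_def using measurable_from_subalg[OF subalgebra_F kernel_pt[of s s "t - s"]] st by simp
  have ne: "space N2 \<noteq> {}" using N.not_empty by (simp add: N2_def)
  have s\<beta>: "sets \<beta> = sets (borel_of E)" unfolding \<beta>_def by (rule sets_bind[OF sets_kernel[OF mk] ne])
  have I1: "(\<integral>\<^sup>+x. f x \<partial>\<alpha>) = (\<integral>\<^sup>+\<omega>. indicator A \<omega> * indicator (alive t) \<omega> * f (pt t \<omega>) \<partial>N)"
    if f: "f \<in> borel_measurable (borel_of E)" for f :: "'x \<Rightarrow> ennreal"
  proof -
    have "(\<integral>\<^sup>+x. f x \<partial>\<alpha>) = (\<integral>\<^sup>+\<omega>. f (pt t \<omega>) \<partial>N1)" unfolding \<alpha>_def using f by (intro nn_integral_distr[OF mpt]) simp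
    also have "\<dots> = (\<integral>\<^sup>+\<omega>. indicator (A \<inter> alive t) \<omega> * f (pt t \<omega>) \<partial>N)"
      unfolding N1_def using AN aN measurable_compose[OF measurable_pt_N f, of t] st by (intro nn_integral_density) auto
    finally show ?thesis by (simp add: indicator_inter_arith)
  qed
  have I2: "(\<integral>\<^sup>+x. f x \<partial>\<beta>) = (\<integral>\<^sup>+\<omega>. indicator A \<omega> * indicator (alive s) \<omega> * (\<integral>\<^sup>+x. f x \<partial>P (t - s) (pt s \<omega>)) \<partial>N)"
    if f: "f \<in> borel_measurable (borel_of E)" for f :: "'x \<Rightarrow> ennreal"
  proof -
    have "(\<lambda>\<omega>. \<integral>\<^sup>+x. f x \<partial>P (t - s) (pt s \<omega>)) \<in> borel_measurable N2"
      by (rule measurable_compose[OF mk nn_integral_measurable_subprob_algebra[OF f]])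
    then have "(\<lambda>\<omega>. \<integral>\<^sup>+x. f x \<partial>P (t - s) (pt s \<omega>)) \<in> borel_measurable N" by (simp add: N2_def)
    then show ?thesis
      unfolding \<beta>_def nn_integral_bind[OF f mk] using AN aN
      unfolding N2_def by (subst nn_integral_density) (auto simp: indicator_inter_arith)
  qed
  have one: "(\<lambda>_. 1) \<in> borel_measurable (borel_of E)" by simp
  have fin\<alpha>: "finite_measure \<alpha>" unfolding \<alpha>_def by (rule finite_measure.finite_measure_distr[OF fin1(1) mpt])
  have eqCb: "(\<integral>\<^sup>+x. ennreal (f x) \<partial>\<alpha>) = (\<integral>\<^sup>+x. ennreal (f x) \<partial>\<beta>)"
    if f: "f \<in> Cb E" "\<And>x. x \<in> topspace E \<Longrightarrow> 0 \<le> f x" for f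
  proof -
    have m: "(\<lambda>x. ennreal (f x)) \<in> borel_measurable (borel_of E)" using Cb_measurable[OF f(1)] by simp
    show ?thesis unfolding I1[OF m] I2[OF m] by (rule one_step_Cb[OF st A f])
  qed
  have "(\<lambda>x. 1::real) \<in> Cb E" by (auto simp: Cb_def bounded_iff)
  from eqCb[OF this] have "emeasure \<alpha> (space \<alpha>) = emeasure \<beta> (space \<beta>)" by simp
  then have fin\<beta>: "finite_measure \<beta>" using finite_measure.finite_emeasure_space[OF fin\<alpha>] by (intro finite_measureI) simp
  have \<alpha>\<beta>: "\<alpha> = \<beta>"
    by (rule measure_eqI_Cb_nonneg[OF E_metrizable fin\<alpha> _ fin\<beta> s\<beta>]) (use eqCb in \<open>auto simp: \<alpha>_def\<close>)
  have iB: "indicator B \<in> borel_measurable (borel_of E)" using B by simp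
  have PB: "(\<integral>\<^sup>+x. indicator B x \<partial>P (t - s) (pt s \<omega>)) = emeasure (P (t - s) (pt s \<omega>)) B" if "\<omega> \<in> space N" for \<omega>
  proof -
    have "sets (P (t - s) (pt s \<omega>)) = sets (borel_of E)"
      using sets_kernel[OF kernel] pt_in_E[OF that] st by simp
    then show ?thesis using B by simp
  qed
  have "(\<integral>\<^sup>+\<omega>. indicator A \<omega> * indicator (alive t) \<omega> * indicator B (pt t \<omega>) \<partial>N) = (\<integral>\<^sup>+x. indicator B x \<partial>\<alpha>)"
    by (rule I1[OF iB, symmetric])
  also have "\<dots> = (\<integral>\<^sup>+\<omega>. indicator A \<omega> * indicator (alive s) \<omega> * (\<integral>\<^sup>+x. indicator B x \<partial>P (t - s) (pt s \<omega>)) \<partial>N)"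
    unfolding \<alpha>\<beta> by (rule I2[OF iB])
  finally show ?thesis using PB by (simp cong: nn_integral_cong_simp)
qed

lemma killed_finite: "0 \<le> t \<Longrightarrow> finite_measure (density N (indicator (alive t)))"
  using alive_N[of t] by (intro finite_measureI) (simp add: emeasure_density N.emeasure_eq_measure)

lemma subalgebra_killed: "subalgebra (density N f) (F s)"
  using subalgebra_F[of s] by (simp add: subalgebra_def)

text \<open>Functionals of past and present jointly, obtained from products of a past event and a
  set of positions. Survival up to \<open>t\<close> weights the left side, survival up to
  \<open>s\<close> the right side: the mass lost in between is the defect of the sub-probability
  kernel.\<close>

lemma one_step:
  assumes st: "0 \<le> s" "s \<le> t" and \<Phi>: "\<Phi> \<in> borel_measurable (F s \<Otimes>\<^sub>M borel_of E)"
  shows "(\<integral>\<^sup>+\<omega>. indicator (alive t) \<omega> * \<Phi> (\<omega>, pt t \<omega>) \<partial>N)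
    = (\<integral>\<^sup>+\<omega>. indicator (alive s) \<omega> * (\<integral>\<^sup>+x. \<Phi> (\<omega>, x) \<partial>P (t - s) (pt s \<omega>)) \<partial>N)"
proof -
  have t0: "0 \<le> t" using st by simp
  have k: "(\<lambda>\<omega>. P (t - s) (pt s \<omega>)) \<in> F s \<rightarrow>\<^sub>M subprob_algebra (borel_of E)" using st by (intro kernel_pt) auto
  have mpt: "pt t \<in> N \<rightarrow>\<^sub>M borel_of E" by (rule measurable_pt_N[OF t0])
  have idF: "(\<lambda>\<omega>. \<omega>) \<in> N \<rightarrow>\<^sub>M F s"
    using measurable_from_subalg[OF subalgebra_F[of s], of "\<lambda>\<omega>. \<omega>" "F s"] by simp
  have m1: "(\<lambda>\<omega>. \<Phi> (\<omega>, pt t \<omega>)) \<in> borel_measurable N"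
    using measurable_compose[OF measurable_Pair[OF idF mpt] \<Phi>] by simp
  have m2: "(\<lambda>\<omega>. \<integral>\<^sup>+x. \<Phi> (\<omega>, x) \<partial>P (t - s) (pt s \<omega>)) \<in> borel_measurable N"
    using measurable_compose[OF idF nn_integral_measurable_subprob_algebra2[OF _ k, of "\<lambda>\<omega> x. \<Phi> (\<omega>, x)"]] \<Phi> by simp
  have "(\<integral>\<^sup>+\<omega>. \<Phi> (\<omega>, pt t \<omega>) \<partial>density N (indicator (alive t)))
    = (\<integral>\<^sup>+\<omega>. \<integral>\<^sup>+x. \<Phi> (\<omega>, x) \<partial>P (t - s) (pt s \<omega>) \<partial>density N (indicator (alive s)))"
  proof (rule nn_integral_kernel_rectangles[OF killed_finite[OF t0] killed_finite[OF st(1)] subalgebra_killed subalgebra_killed _ k _ _ _ _ _ \<Phi>,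
        where \<P>="sets (borel_of E)"])
    show "pt t \<in> density N (indicator (alive t)) \<rightarrow>\<^sub>M borel_of E" using mpt by simp
    show "Int_stable (sets (borel_of E))" by (auto simp: Int_stable_def)
    show "sets (borel_of E) \<subseteq> Pow (space (borel_of E))" by (rule sets.space_closed)
    show "sets (borel_of E) = sigma_sets (space (borel_of E)) (sets (borel_of E))"
      by (rule sets.sigma_sets_eq[symmetric])
    show "space (borel_of E) \<in> sets (borel_of E)" by (rule sets.top)
    fix A B assume A: "A \<in> sets (F s)" and B: "B \<in> sets (borel_of E)"
    have AN: "A \<in> sets N" using A subalgebra_F by (auto simp: subalgebra_def)
    have aN: "alive t \<in> sets N" "alive s \<in> sets N" using st by (auto intro: alive_N)
    have e: "{\<omega> \<in> A. pt t \<omega> \<in> B} = A \<inter> (pt t -` B \<inter> space N)" using sets.sets_into_space[OF AN] by auto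
    have AB: "{\<omega> \<in> A. pt t \<omega> \<in> B} \<in> sets N" unfolding e using AN measurable_sets[OF mpt B] by auto
    have "emeasure (density N (indicator (alive t))) {\<omega> \<in> A. pt t \<omega> \<in> B}
        = (\<integral>\<^sup>+\<omega>. indicator (alive t) \<omega> * indicator {\<omega> \<in> A. pt t \<omega> \<in> B} \<omega> \<partial>N)"
      using aN AB by (intro emeasure_density) auto
    also have "\<dots> = (\<integral>\<^sup>+\<omega>. indicator A \<omega> * indicator (alive t) \<omega> * indicator B (pt t \<omega>) \<partial>N)"
      by (rule nn_integral_cong) (auto simp: indicator_def)
    also have "\<dots> = (\<integral>\<^sup>+\<omega>. indicator A \<omega> * indicator (alive s) \<omega> * emeasure (P (t - s) (pt s \<omega>)) B \<partial>N)"
      by (rule one_step_sets[OF st A B])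
    also have "\<dots> = (\<integral>\<^sup>+\<omega>. indicator (alive s) \<omega> * (indicator A \<omega> * emeasure (P (t - s) (pt s \<omega>)) B) \<partial>N)"
      by (simp add: mult_ac)
    also have "\<dots> = (\<integral>\<^sup>+\<omega>. indicator A \<omega> * emeasure (P (t - s) (pt s \<omega>)) B \<partial>density N (indicator (alive s)))"
      using aN AN measurable_compose[OF measurable_compose[OF idF k] measurable_emeasure_subprob_algebra[OF B]]
      by (intro nn_integral_density[symmetric]) auto
    finally show "emeasure (density N (indicator (alive t))) {\<omega> \<in> A. pt t \<omega> \<in> B}
        = (\<integral>\<^sup>+\<omega>. indicator A \<omega> * emeasure (P (t - s) (pt s \<omega>)) B \<partial>density N (indicator (alive s)))" .
  qed
  then show ?thesis
    using alive_N[OF t0] alive_N[OF st(1)] m1 m2 by (simp add: nn_integral_density)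
qed

end

section \<open>Several times, and translation by the group\<close>

primrec admissible :: "'x topology \<Rightarrow> (real \<times> 'x set) list \<Rightarrow> real \<Rightarrow> bool" where
  "admissible E [] = (\<lambda>s. True)"
| "admissible E (a # l) = (\<lambda>s. s \<le> fst a \<and> snd a \<in> sets (borel_of E) \<and> admissible E l (fst a))"

primrec end_time :: "(real \<times> 'x set) list \<Rightarrow> real \<Rightarrow> real" where
  "end_time [] = (\<lambda>s. s)"
| "end_time (a # l) = (\<lambda>s. end_time l (fst a))"

text \<open>The mass of being in the listed sets at the listed times when starting from
  \<open>x\<close> at time \<open>s\<close>. The kernels are sub-probabilities, so survival up to
  the last listed time is included.\<close>

primrec path_weight :: "(real \<Rightarrow> 'x \<Rightarrow> 'x measure) \<Rightarrow> (real \<times> 'x set) list \<Rightarrow> real \<Rightarrow> 'x \<Rightarrow> ennreal" where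
  "path_weight P [] = (\<lambda>s x. 1)"
| "path_weight P (a # l) = (\<lambda>s x. \<integral>\<^sup>+x'. indicator (snd a) x' * path_weight P l (fst a) x' \<partial>P (fst a - s) x)"

lemma path_weight_shift:
  "path_weight P (map (\<lambda>u. (u - s, B u)) us) (a - s) = path_weight P (map (\<lambda>u. (u, B u)) us) a"
  by (induction us arbitrary: a) auto

lemma admissible_sorted:
  "sorted us \<Longrightarrow> (\<And>u. u \<in> set us \<Longrightarrow> s \<le> u) \<Longrightarrow> (\<And>u. B u \<in> sets (borel_of E)) \<Longrightarrow>
    admissible E (map (\<lambda>u. (u, B u)) us) s"
  by (induction us arbitrary: s) auto

lemma end_time_append: "end_time (l @ [a]) s = fst a"
  by (induction l arbitrary: s) auto

lemma prod_list_indicator: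
  "(\<Prod>u\<leftarrow>us. indicator (B u) (g u) :: ennreal) = (if \<forall>u\<in>set us. g u \<in> B u then 1 else 0)"
  by (induction us) (auto simp: indicator_def)

locale killed_invariant_markov = killed_markov E P N p \<xi> x0
  for E :: "'x topology" and P and N :: "'w measure" and p and \<xi> and x0 +
  fixes K :: "('k, 'b) monoid_scheme" and L :: "'k manifold" and \<alpha> :: "'k \<Rightarrow> 'x \<Rightarrow> 'x"
  assumes lie: "lie_group K L" and action: "group_action K (topspace E) \<alpha>"
    and act_cont: "continuous_map (prod_topology (top_of L) E) E (\<lambda>(k, x). \<alpha> k x)"
    and invariant: "invariant_semigroup K \<alpha> E P"
begin

lemma TL_second_countable: "second_countable (top_of L)" and topspace_L: "topspace (top_of L) = carrier K"
  using lie smooth_manifold_metrizable by (auto simp: lie_group_def)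

lemma measurable_translate:
  "f \<in> M \<rightarrow>\<^sub>M borel_of (top_of L) \<Longrightarrow> g \<in> M \<rightarrow>\<^sub>M borel_of E \<Longrightarrow> (\<lambda>x. \<alpha> (f x) (g x)) \<in> M \<rightarrow>\<^sub>M borel_of E"
  using measurable_compose[OF measurable_Pair continuous_map_measurable_prod[OF TL_second_countable E_second_countable act_cont]]
  by simp

lemma translate_in_E: "k \<in> carrier K \<Longrightarrow> x \<in> topspace E \<Longrightarrow> \<alpha> k x \<in> topspace E"
  using group_action.element_image[OF action] by blast

lemma continuous_translate: "k \<in> carrier K \<Longrightarrow> continuous_map E E (\<alpha> k)"
proof -
  assume "k \<in> carrier K"
  then have "continuous_map E (prod_topology (top_of L) E) (\<lambda>x. (k, x))"
    using topspace_L by (intro continuous_map_pairedI) auto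
  from continuous_map_compose[OF this act_cont] show ?thesis by (simp add: comp_def)
qed

text \<open>Invariance is given for bounded continuous functions; these determine finite measures on
  a metrizable space, so the kernel from a moved point is the moved kernel.\<close>

lemma nn_integral_translate:
  assumes t: "0 \<le> t" and k: "k \<in> carrier K" and x: "x \<in> topspace E" and f: "f \<in> borel_measurable (borel_of E)"
  shows "(\<integral>\<^sup>+x'. f x' \<partial>P t (\<alpha> k x)) = (\<integral>\<^sup>+x'. f (\<alpha> k x') \<partial>P t x)"
proof -
  have sp: "sets (P t y) = sets (borel_of E)" "subprob_space (P t y)" if "y \<in> topspace E" for y
    using measurable_space[OF kernel[OF t], of y] that by (auto simp: space_subprob_algebra)
  have m: "\<alpha> k \<in> P t x \<rightarrow>\<^sub>M borel_of E"
    using continuous_map_measurable[OF continuous_translate[OF k]] sp(1)[OF x] by (simp cong: measurable_cong_sets)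
  have "P t (\<alpha> k x) = distr (P t x) (borel_of E) (\<alpha> k)"
  proof (rule measure_eqI_Cb[OF E_metrizable])
    show "finite_measure (P t (\<alpha> k x))" "finite_measure (distr (P t x) (borel_of E) (\<alpha> k))"
      using sp translate_in_E[OF k x] x by (auto simp: subprob_space_def intro!: finite_measure.finite_measure_distr m)
    show "sets (P t (\<alpha> k x)) = sets (borel_of E)" using sp translate_in_E[OF k x] by simp
    fix f assume f: "f \<in> Cb E"
    have "(\<integral>x'. f (\<alpha> k x') \<partial>P t x) = (\<integral>x'. f x' \<partial>P t (\<alpha> k x))"
      using invariant t k x f unfolding invariant_semigroup_def by blast
    then show "(\<integral>x'. f x' \<partial>P t (\<alpha> k x)) = (\<integral>x'. f x' \<partial>distr (P t x) (borel_of E) (\<alpha> k))"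
      using integral_distr[OF m Cb_measurable[OF f]] by simp
  qed simp
  then show ?thesis using nn_integral_distr[OF m, of f] f by simp
qed

lemma measurable_path_weight:
  "admissible E l s \<Longrightarrow> path_weight P l s \<in> borel_measurable (borel_of E)"
proof (induction l arbitrary: s)
  case (Cons a l)
  have "(\<lambda>x'. indicator (snd a) x' * path_weight P l (fst a) x') \<in> borel_measurable (borel_of E)"
    using Cons.IH[of "fst a"] Cons.prems
    by (intro borel_measurable_times_ennreal borel_measurable_indicator) auto
  from measurable_compose[OF kernel nn_integral_measurable_subprob_algebra[OF this], of "fst a - s"]
  show ?case using Cons.prems by simp
qed simp

text \<open>The positions are moved by a group element \<open>\<kappa>\<close> that is random but
  known at time \<open>s\<close>. Given the past it is a constant, and invariance transfers it from
  the later positions to the starting point of the iterated kernel.\<close>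

lemma multi_step:
  assumes "admissible E l s" "0 \<le> s" "\<kappa> \<in> F s \<rightarrow>\<^sub>M borel_of (top_of L)" "\<Gamma> \<in> borel_measurable (F s)"
  shows "(\<integral>\<^sup>+\<omega>. \<Gamma> \<omega> * (indicator (alive (end_time l s)) \<omega> * (\<Prod>a\<leftarrow>l. indicator (snd a) (\<alpha> (\<kappa> \<omega>) (pt (fst a) \<omega>)))) \<partial>N)
    = (\<integral>\<^sup>+\<omega>. \<Gamma> \<omega> * (indicator (alive s) \<omega> * path_weight P l s (\<alpha> (\<kappa> \<omega>) (pt s \<omega>))) \<partial>N)"
  using assms
proof (induction l arbitrary: s \<Gamma>)
  case (Cons a l)
  define u where "u = fst a"
  define B where "B = snd a"
  have su: "s \<le> u" "0 \<le> u" and B: "B \<in> sets (borel_of E)" and l: "admissible E l u"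
    using Cons.prems by (auto simp: u_def B_def)
  have \<kappa>u: "\<kappa> \<in> F u \<rightarrow>\<^sub>M borel_of (top_of L)" and \<Gamma>u: "\<Gamma> \<in> borel_measurable (F u)"
    using measurable_from_subalg[OF F_mono[OF su(1)]] Cons.prems by auto
  have \<kappa>G: "\<kappa> \<omega> \<in> carrier K" if "\<omega> \<in> space N" for \<omega>
    using measurable_space[OF Cons.prems(3), of \<omega>] that topspace_L by simp
  \<comment> \<open>The condition at the earliest time is known at that time and joins the weight of
    the past, which leaves a shorter list to the induction hypothesis.\<close>
  define \<Gamma>' where "\<Gamma>' \<omega> = \<Gamma> \<omega> * indicator B (\<alpha> (\<kappa> \<omega>) (pt u \<omega>))" for \<omega>
  have \<Gamma>': "\<Gamma>' \<in> borel_measurable (F u)"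
    unfolding \<Gamma>'_def using su
    by (intro borel_measurable_times_ennreal \<Gamma>u measurable_compose[OF measurable_translate[OF \<kappa>u measurable_pt] borel_measurable_indicator[OF B]]) auto
  define g where "g x' = indicator B x' * path_weight P l u x'" for x'
  have g: "g \<in> borel_measurable (borel_of E)" unfolding g_def using B measurable_path_weight[OF l] by simp
  define \<Phi> where "\<Phi> q = \<Gamma> (fst q) * g (\<alpha> (\<kappa> (fst q)) (snd q))" for q
  have \<Phi>: "\<Phi> \<in> borel_measurable (F s \<Otimes>\<^sub>M borel_of E)"
    unfolding \<Phi>_def
    by (intro borel_measurable_times_ennreal measurable_compose[OF measurable_fst Cons.prems(4)]
        measurable_compose[OF measurable_translate[OF measurable_compose[OF measurable_fst Cons.prems(3)] measurable_snd] g])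
  have "(\<integral>\<^sup>+\<omega>. \<Gamma> \<omega> * (indicator (alive (end_time (a # l) s)) \<omega> * (\<Prod>a\<leftarrow>a # l. indicator (snd a) (\<alpha> (\<kappa> \<omega>) (pt (fst a) \<omega>)))) \<partial>N)
    = (\<integral>\<^sup>+\<omega>. \<Gamma>' \<omega> * (indicator (alive (end_time l u)) \<omega> * (\<Prod>a\<leftarrow>l. indicator (snd a) (\<alpha> (\<kappa> \<omega>) (pt (fst a) \<omega>)))) \<partial>N)"
    by (rule nn_integral_cong) (simp add: \<Gamma>'_def u_def B_def mult_ac)
  also have "\<dots> = (\<integral>\<^sup>+\<omega>. \<Gamma>' \<omega> * (indicator (alive u) \<omega> * path_weight P l u (\<alpha> (\<kappa> \<omega>) (pt u \<omega>))) \<partial>N)"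
    by (rule Cons.IH[OF l su(2) \<kappa>u \<Gamma>'])
  also have "\<dots> = (\<integral>\<^sup>+\<omega>. indicator (alive u) \<omega> * \<Phi> (\<omega>, pt u \<omega>) \<partial>N)"
    by (rule nn_integral_cong) (simp add: \<Gamma>'_def \<Phi>_def g_def mult_ac)
  also have "\<dots> = (\<integral>\<^sup>+\<omega>. indicator (alive s) \<omega> * (\<integral>\<^sup>+x. \<Phi> (\<omega>, x) \<partial>P (u - s) (pt s \<omega>)) \<partial>N)"
    by (rule one_step[OF Cons.prems(2) su(1) \<Phi>])
  also have "\<dots> = (\<integral>\<^sup>+\<omega>. \<Gamma> \<omega> * (indicator (alive s) \<omega> * path_weight P (a # l) s (\<alpha> (\<kappa> \<omega>) (pt s \<omega>))) \<partial>N)"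
  proof (rule nn_integral_cong)
    fix \<omega> assume w: "\<omega> \<in> space N"
    have e: "pt s \<omega> \<in> topspace E" using pt_in_E[OF w Cons.prems(2)] .
    have "sets (P (u - s) (pt s \<omega>)) = sets (borel_of E)" using sets_kernel[OF kernel] e su by simp
    then have m: "(\<lambda>x. g (\<alpha> (\<kappa> \<omega>) x)) \<in> borel_measurable (P (u - s) (pt s \<omega>))"
      using measurable_compose[OF continuous_map_measurable[OF continuous_translate[OF \<kappa>G[OF w]]] g]
      by (simp cong: measurable_cong_sets)
    have "(\<integral>\<^sup>+x. \<Phi> (\<omega>, x) \<partial>P (u - s) (pt s \<omega>)) = \<Gamma> \<omega> * (\<integral>\<^sup>+x. g (\<alpha> (\<kappa> \<omega>) x) \<partial>P (u - s) (pt s \<omega>))"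
      unfolding \<Phi>_def fst_conv snd_conv by (rule nn_integral_cmult[OF m])
    also have "(\<integral>\<^sup>+x. g (\<alpha> (\<kappa> \<omega>) x) \<partial>P (u - s) (pt s \<omega>)) = (\<integral>\<^sup>+x. g x \<partial>P (u - s) (\<alpha> (\<kappa> \<omega>) (pt s \<omega>)))"
      using su by (intro nn_integral_translate[symmetric] \<kappa>G[OF w] e g) auto
    also have "\<dots> = path_weight P (a # l) s (\<alpha> (\<kappa> \<omega>) (pt s \<omega>))" by (simp add: g_def u_def B_def)
    finally show "indicator (alive s) \<omega> * (\<integral>\<^sup>+x. \<Phi> (\<omega>, x) \<partial>P (u - s) (pt s \<omega>))
      = \<Gamma> \<omega> * (indicator (alive s) \<omega> * path_weight P (a # l) s (\<alpha> (\<kappa> \<omega>) (pt s \<omega>)))" by (simp add: mult_ac)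
  qed
  finally show ?case .
qed simp

text \<open>\<open>T\<close> is appended to the list so that the survival event on the left is
  survival up to \<open>T\<close>, whatever the times of interest are.\<close>

lemma multi_step_rectangle:
  assumes s: "0 \<le> s" and us: "sorted us" "\<And>u. u \<in> set us \<Longrightarrow> s \<le> u \<and> u \<le> T" "s \<le> T"
    and B: "\<And>u. B u \<in> sets (borel_of E)"
    and \<kappa>: "\<kappa> \<in> F s \<rightarrow>\<^sub>M borel_of (top_of L)" and \<Gamma>: "\<Gamma> \<in> borel_measurable (F s)"
  shows "(\<integral>\<^sup>+\<omega>. \<Gamma> \<omega> * (indicator (alive T) \<omega> * (if \<forall>u\<in>insert T (set us). \<alpha> (\<kappa> \<omega>) (pt u \<omega>) \<in> B u then 1 else 0)) \<partial>N)
    = (\<integral>\<^sup>+\<omega>. \<Gamma> \<omega> * (indicator (alive s) \<omega> * path_weight P (map (\<lambda>u. (u, B u)) (us @ [T])) s (\<alpha> (\<kappa> \<omega>) (pt s \<omega>))) \<partial>N)"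
proof -
  let ?l = "map (\<lambda>u. (u, B u)) (us @ [T])"
  have "admissible E ?l s" using us B by (intro admissible_sorted) (auto simp: sorted_append)
  note m = multi_step[OF this s \<kappa> \<Gamma>]
  have e: "end_time ?l s = T" using end_time_append[of "map (\<lambda>u. (u, B u)) us" "(T, B T)" s] by simp
  have "(\<Prod>a\<leftarrow>?l. indicator (snd a) (\<alpha> (\<kappa> \<omega>) (pt (fst a) \<omega>))) = (\<Prod>u\<leftarrow>us @ [T]. indicator (B u) (\<alpha> (\<kappa> \<omega>) (pt u \<omega>)) :: ennreal)" for \<omega>
    unfolding map_map comp_def fst_conv snd_conv ..
  then have "(\<Prod>a\<leftarrow>?l. indicator (snd a) (\<alpha> (\<kappa> \<omega>) (pt (fst a) \<omega>))) = (if \<forall>u\<in>insert T (set us). \<alpha> (\<kappa> \<omega>) (pt u \<omega>) \<in> B u then 1 else 0 :: ennreal)" for \<omega>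
    by (simp only: prod_list_indicator) auto
  with m show ?thesis unfolding e by simp
qed

end

section \<open>The law of the whole future as a kernel\<close>

locale invariant_markov_family =
  fixes E :: "'x topology" and P :: "real \<Rightarrow> 'x \<Rightarrow> 'x measure" and N :: "'x \<Rightarrow> 'w measure"
    and p :: "real \<Rightarrow> 'w \<Rightarrow> 'x" and \<xi> :: "'w \<Rightarrow> ereal"
    and K :: "('k, 'b) monoid_scheme" and L :: "'k manifold" and \<alpha> :: "'k \<Rightarrow> 'x \<Rightarrow> 'x" and T :: real
  assumes killed: "\<And>x. x \<in> topspace E \<Longrightarrow> killed_invariant_markov E P (N x) p \<xi> x K L \<alpha>" and T_pos: "0 < T"
begin

abbreviation alv where "alv x \<equiv> killed_markov.alive (N x) \<xi>"
abbreviation ptx where "ptx x \<equiv> killed_markov.pt p \<xi> x"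
abbreviation PE where "PE s \<equiv> PiM {s..T} (\<lambda>_. borel_of E)"

text \<open>The time is shifted so that the process from \<open>y\<close> starts at \<open>s\<close>
  and lives on the index set of the future after \<open>s\<close>. The product sigma-algebra is
  used, so the law is determined by finitely many times at once; path regularity is brought in
  separately.\<close>

definition future_law :: "real \<Rightarrow> 'x \<Rightarrow> (real \<Rightarrow> 'x) measure" where
  "future_law s y = distr (density (N y) (indicator (alv y (T - s)))) (PE s) (\<lambda>\<omega>. \<lambda>u\<in>{s..T}. ptx y (u - s) \<omega>)"

lemma sets_future_law [simp]: "sets (future_law s y) = sets (PE s)" by (simp add: future_law_def)

lemma space_future_law [simp]: "space (future_law s y) = space (PE s)" by (simp add: future_law_def)

lemma measurable_future_path:
  assumes y: "y \<in> topspace E" and s: "s \<le> T"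
  shows "(\<lambda>\<omega>. \<lambda>u\<in>{s..T}. ptx y (u - s) \<omega>) \<in> density (N y) f \<rightarrow>\<^sub>M PE s"
proof -
  interpret killed_invariant_markov E P "N y" p \<xi> y K L \<alpha> using y by (rule killed)
  show ?thesis by (rule measurable_restrict) (auto intro!: measurable_pt_N)
qed

text \<open>Brings a cylinder set into the form handled by the iterated kernels: a sorted list of
  times with \<open>T\<close> added, where times without a condition receive the whole
  space.\<close>

lemma rectangle_list:
  assumes "finite I" "I \<subseteq> {s..T}" "\<forall>u\<in>I. B u \<in> sets (borel_of E)" "s \<le> T"
  shows "\<exists>us B'. sorted us \<and> (\<forall>u\<in>set us. s \<le> u \<and> u \<le> T) \<and> (\<forall>u. B' u \<in> sets (borel_of E)) \<and>
    (\<forall>f. (\<forall>u\<in>{s..T}. f u \<in> topspace E) \<longrightarrow> (\<forall>u\<in>insert T (set us). f u \<in> B' u) = (\<forall>u\<in>I. f u \<in> B u))"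
proof (intro exI conjI ballI allI impI)
  define B' where "B' u = (if u \<in> I then B u else topspace E)" for u
  show "sorted (sorted_list_of_set I)" by simp
  show "s \<le> u" "u \<le> T" if "u \<in> set (sorted_list_of_set I)" for u using that assms(1,2) by auto
  show "B' u \<in> sets (borel_of E)" for u using assms(3) by (auto simp: B'_def borel_of_open)
  show "(\<forall>u\<in>insert T (set (sorted_list_of_set I)). f u \<in> B' u) = (\<forall>u\<in>I. f u \<in> B u)"
    if "\<forall>u\<in>{s..T}. f u \<in> topspace E" for f
    using that assms by (auto simp: B'_def)
qed

text \<open>The several-times formula from time 0, with the unit as group element. At time 0 the
  process is almost surely alive and at \<open>y\<close>, so the integral over the start disappears;
  only time differences matter, so the shift by \<open>s\<close> does too.\<close>

lemma future_law_rectangle: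
  assumes y: "y \<in> topspace E" and s: "s \<le> T"
    and us: "sorted us" "\<And>u. u \<in> set us \<Longrightarrow> s \<le> u \<and> u \<le> T" and B: "\<And>u. B u \<in> sets (borel_of E)"
  shows "emeasure (future_law s y) {f \<in> space (PE s). \<forall>u\<in>insert T (set us). f u \<in> B u}
    = path_weight P (map (\<lambda>u. (u, B u)) (us @ [T])) s y"
proof -
  interpret killed_invariant_markov E P "N y" p \<xi> y K L \<alpha> using y by (rule killed)
  interpret ga: group_action K "topspace E" \<alpha> by (rule action)
  have Kg: "group K" using lie by (simp add: lie_group_def)
  let ?R = "{f \<in> space (PE s). \<forall>u\<in>insert T (set us). f u \<in> B u}"
  let ?Y = "\<lambda>\<omega>. \<lambda>u\<in>{s..T}. pt (u - s) \<omega>"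
  have R: "?R \<in> sets (PE s)"
  proof -
    have "?R = (\<Inter>u\<in>insert T (set us). (\<lambda>f. f u) -` B u \<inter> space (PE s))" by auto
    also have "\<dots> \<in> sets (PE s)"
      by (rule sets.finite_INT) (use us s B in \<open>auto intro!: measurable_sets[OF measurable_component_singleton]\<close>)
    finally show ?thesis .
  qed
  have Y: "?Y \<in> density (N y) (indicator (alive (T - s))) \<rightarrow>\<^sub>M PE s"
    using measurable_future_path[OF y s] .
  have YN: "?Y \<in> N y \<rightarrow>\<^sub>M PE s" using Y by simp
  have aN: "alive (T - s) \<in> sets (N y)" using s by (intro alive_N) simp
  have sp: "?Y \<omega> \<in> space (PE s)" if "\<omega> \<in> space (N y)" for \<omega> using measurable_space[OF YN that] .
  let ?us = "map (\<lambda>u. u - s) us"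
  let ?B = "\<lambda>u. B (u + s)"
  have one: "(\<lambda>_. \<one>\<^bsub>K\<^esub>) \<in> F 0 \<rightarrow>\<^sub>M borel_of (top_of L)"
    using Kg topspace_L by (simp add: group.is_monoid)
  have eq: "map (\<lambda>u. (u, ?B u)) (?us @ [T - s]) = map (\<lambda>u. (u - s, B u)) (us @ [T])" by simp
  have "emeasure (future_law s y) ?R = emeasure (density (N y) (indicator (alive (T - s)))) (?Y -` ?R \<inter> space (N y))"
    unfolding future_law_def using emeasure_distr[OF Y R] by simp
  also have "\<dots> = (\<integral>\<^sup>+\<omega>. indicator (alive (T - s)) \<omega> * indicator (?Y -` ?R \<inter> space (N y)) \<omega> \<partial>N y)"
    using aN measurable_sets[OF YN R] by (intro emeasure_density) auto
  also have "\<dots> = (\<integral>\<^sup>+\<omega>. 1 * (indicator (alive (T - s)) \<omega> *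
      (if \<forall>u\<in>insert (T - s) (set ?us). \<alpha> \<one>\<^bsub>K\<^esub> (pt u \<omega>) \<in> ?B u then 1 else 0)) \<partial>N y)"
  proof (rule nn_integral_cong)
    fix \<omega> assume w: "\<omega> \<in> space (N y)"
    have "\<alpha> \<one>\<^bsub>K\<^esub> (pt u \<omega>) = pt u \<omega>" if "0 \<le> u" for u
      using ga.id_eq_one pt_in_E[OF w that] by (metis restrict_apply')
    then have "(\<forall>u\<in>insert (T - s) (set ?us). \<alpha> \<one>\<^bsub>K\<^esub> (pt u \<omega>) \<in> ?B u) \<longleftrightarrow> ?Y \<omega> \<in> ?R"
      using sp[OF w] us s by auto
    then show "indicator (alive (T - s)) \<omega> * indicator (?Y -` ?R \<inter> space (N y)) \<omega> = (1 * (indicator (alive (T - s)) \<omega> *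
      (if \<forall>u\<in>insert (T - s) (set ?us). \<alpha> \<one>\<^bsub>K\<^esub> (pt u \<omega>) \<in> ?B u then 1 else 0)) :: ennreal)"
      using w by (simp add: indicator_def)
  qed
  also have "\<dots> = (\<integral>\<^sup>+\<omega>. 1 * (indicator (alive 0) \<omega> * path_weight P (map (\<lambda>u. (u, ?B u)) (?us @ [T - s])) 0 (\<alpha> \<one>\<^bsub>K\<^esub> (pt 0 \<omega>))) \<partial>N y)"
  proof (rule multi_step_rectangle[OF order_refl _ _ _ _ one])
    show "sorted ?us" using us(1) by (simp add: sorted_map)
  qed (use us s B in auto)
  also have "\<dots> = (\<integral>\<^sup>+\<omega>. path_weight P (map (\<lambda>u. (u, B u)) (us @ [T])) s y \<partial>N y)"
  proof (rule nn_integral_cong_AE)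
    have "AE \<omega> in N y. \<omega> \<in> space (N y)" by simp
    with start show "AE \<omega> in N y. 1 * (indicator (alive 0) \<omega> * path_weight P (map (\<lambda>u. (u, ?B u)) (?us @ [T - s])) 0 (\<alpha> \<one>\<^bsub>K\<^esub> (pt 0 \<omega>)))
        = path_weight P (map (\<lambda>u. (u, B u)) (us @ [T])) s y"
    proof eventually_elim
      case (elim \<omega>)
      then have "\<omega> \<in> alive 0" "pt 0 \<omega> = y" by (auto simp: alive_def pt_def zero_ereal_def)
      moreover have "\<alpha> \<one>\<^bsub>K\<^esub> y = y" using ga.id_eq_one y by (metis restrict_apply')
      moreover have "path_weight P (map (\<lambda>u. (u - s, B u)) (us @ [T])) 0 = path_weight P (map (\<lambda>u. (u, B u)) (us @ [T])) s"
        using path_weight_shift[of P s B "us @ [T]" s] by simp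
      ultimately show ?case unfolding eq by simp
    qed
  qed
  also have "\<dots> = path_weight P (map (\<lambda>u. (u, B u)) (us @ [T])) s y" by (simp add: N.emeasure_space_1)
  finally show ?thesis .
qed

lemma prod_algebra_rectangle:
  assumes "R \<in> prod_algebra {s..T} (\<lambda>_. borel_of E)"
  obtains I B where "finite I" "I \<subseteq> {s..T}" "\<And>u. u \<in> I \<Longrightarrow> B u \<in> sets (borel_of E)"
    "R = {f \<in> space (PE s). \<forall>u\<in>I. f u \<in> B u}"
proof -
  from assms obtain I B where IB: "R = prod_emb {s..T} (\<lambda>_. borel_of E) I (PiE I B)" "finite I" "I \<subseteq> {s..T}"
    "B \<in> (\<Pi> i\<in>I. sets (borel_of E))"
    by (auto simp: prod_algebra_def)
  then have "R = {f \<in> space (PE s). \<forall>u\<in>I. f u \<in> B u}"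
    by (auto simp: prod_emb_def space_PiM PiE_iff extensional_def)
  then show thesis using that[of I B] IB by auto
qed

lemma subprob_future_law:
  assumes "y \<in> topspace E" "s \<le> T" shows "subprob_space (future_law s y)"
proof -
  interpret killed_invariant_markov E P "N y" p \<xi> y K L \<alpha> using assms(1) by (rule killed)
  have a: "alive (T - s) \<in> sets (N y)" using assms by (intro alive_N) simp
  show ?thesis unfolding future_law_def
  proof (rule subprob_space.subprob_space_distr[OF _ measurable_future_path[OF assms]])
    show "subprob_space (density (N y) (indicator (alive (T - s))))"
      using a N.prob_le_1 N.not_empty by (intro subprob_spaceI) (auto simp: emeasure_density N.emeasure_eq_measure)
    show "space (PE s) \<noteq> {}" using assms by (auto simp: space_PiM PiE_eq_empty_iff)
  qed
qed

lemma space_in_prod_algebra: "s \<le> T \<Longrightarrow> space (PE s) \<in> prod_algebra {s..T} (\<lambda>_. borel_of E)"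
proof -
  assume "s \<le> T"
  then have "prod_emb {s..T} (\<lambda>_. borel_of E) {T} (PiE {T} (\<lambda>_. topspace E)) \<in> prod_algebra {s..T} (\<lambda>_. borel_of E)"
    by (intro prod_algebraI) (auto simp: borel_of_open)
  also have "prod_emb {s..T} (\<lambda>_. borel_of E) {T} (PiE {T} (\<lambda>_. topspace E)) = space (PE s)"
    using \<open>s \<le> T\<close> by (auto simp: prod_emb_def space_PiM PiE_iff)
  finally show ?thesis .
qed

text \<open>Measurability in the starting point comes from the semigroup: on cylinder sets the law
  is an iterated kernel, and the cylinder sets form a generating pi-system.\<close>

lemma measurable_future_law:
  assumes s: "s \<le> T" and ne: "topspace E \<noteq> {}" shows "future_law s \<in> borel_of E \<rightarrow>\<^sub>M subprob_algebra (PE s)"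
proof (rule measurable_subprob_algebra_generated[OF sets_PiM Int_stable_prod_algebra])
  show "prod_algebra {s..T} (\<lambda>_. borel_of E) \<subseteq> Pow (\<Pi>\<^sub>E i\<in>{s..T}. space (borel_of E))" by (rule prod_algebra_sets_into_space)
  show "subprob_space (future_law s y)" if "y \<in> space (borel_of E)" for y using that s by (simp add: subprob_future_law)
  show "sets (future_law s y) = sets (PE s)" for y by simp
  have main: "(\<lambda>y. emeasure (future_law s y) R) \<in> borel_measurable (borel_of E)"
    if R: "R \<in> prod_algebra {s..T} (\<lambda>_. borel_of E)" for R
  proof -
    obtain x where x: "x \<in> topspace E" using ne by blast
    interpret killed_invariant_markov E P "N x" p \<xi> x K L \<alpha> using x by (rule killed)
    obtain I B where IB: "finite I" "I \<subseteq> {s..T}" "\<And>u. u \<in> I \<Longrightarrow> B u \<in> sets (borel_of E)"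
      "R = {f \<in> space (PE s). \<forall>u\<in>I. f u \<in> B u}" by (rule prod_algebra_rectangle[OF R]) (rule that; assumption)
    have IB3: "\<forall>u\<in>I. B u \<in> sets (borel_of E)" using IB(3) by blast
    obtain us B' where us': "sorted us \<and> (\<forall>u\<in>set us. s \<le> u \<and> u \<le> T) \<and> (\<forall>u. B' u \<in> sets (borel_of E)) \<and>
      (\<forall>f. (\<forall>u\<in>{s..T}. f u \<in> topspace E) \<longrightarrow> (\<forall>u\<in>insert T (set us). f u \<in> B' u) = (\<forall>u\<in>I. f u \<in> B u))"
      using rectangle_list[where B=B, OF IB(1,2) IB3 s] by (elim exE)
    then have us: "sorted us" "\<And>u. u \<in> set us \<Longrightarrow> s \<le> u \<and> u \<le> T" "\<And>u. B' u \<in> sets (borel_of E)"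
      "\<And>f. (\<And>u. u \<in> {s..T} \<Longrightarrow> f u \<in> topspace E) \<Longrightarrow> (\<forall>u\<in>insert T (set us). f u \<in> B' u) \<longleftrightarrow> (\<forall>u\<in>I. f u \<in> B u)"
      by blast+
    have R': "R = {f \<in> space (PE s). \<forall>u\<in>insert T (set us). f u \<in> B' u}"
      unfolding IB(4) by (rule Collect_cong, rule conj_cong[OF refl], rule us(4)[symmetric]) (auto simp: space_PiM PiE_iff)
    have "path_weight P (map (\<lambda>u. (u, B' u)) (us @ [T])) s \<in> borel_measurable (borel_of E)"
      using us s by (intro measurable_path_weight admissible_sorted) (auto simp: sorted_append)
    then show ?thesis
      by (rule measurable_cong[THEN iffD1, rotated])
        (use future_law_rectangle[where B=B', OF _ s us(1-3)] R' in \<open>simp del: ball_simps list.set map_append\<close>)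
  qed
  then show "(\<lambda>y. emeasure (future_law s y) R) \<in> borel_measurable (borel_of E)"
    if "R \<in> prod_algebra {s..T} (\<lambda>_. borel_of E)" for R using that .
  show "(\<lambda>y. emeasure (future_law s y) (\<Pi>\<^sub>E i\<in>{s..T}. space (borel_of E))) \<in> borel_measurable (borel_of E)"
    using main[OF space_in_prod_algebra[OF s]] by (simp add: space_PiM)
qed

text \<open>The Markov property for the entire future, moved by a group element known at time
  \<open>s\<close>: its law given the past is the future law from the moved position. Cylinder sets
  suffice, and on them it is the several-times formula.\<close>

lemma markov_future:
  assumes x: "x \<in> topspace E" and s: "0 \<le> s" "s \<le> T"
    and \<kappa>: "\<kappa> \<in> natural_filtration E (N x) p \<xi> s \<rightarrow>\<^sub>M borel_of (top_of L)"
    and \<Phi>: "\<Phi> \<in> borel_measurable (natural_filtration E (N x) p \<xi> s \<Otimes>\<^sub>M PE s)"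
  shows "(\<integral>\<^sup>+\<omega>. indicator (alv x T) \<omega> * \<Phi> (\<omega>, \<lambda>u\<in>{s..T}. \<alpha> (\<kappa> \<omega>) (ptx x u \<omega>)) \<partial>N x)
    = (\<integral>\<^sup>+\<omega>. indicator (alv x s) \<omega> * (\<integral>\<^sup>+f. \<Phi> (\<omega>, f) \<partial>future_law s (\<alpha> (\<kappa> \<omega>) (ptx x s \<omega>))) \<partial>N x)"
proof -
  interpret killed_invariant_markov E P "N x" p \<xi> x K L \<alpha> using x by (rule killed)
  have T0: "0 \<le> T" using s by simp
  have ne: "topspace E \<noteq> {}" using x by auto
  define Y where "Y \<omega> = (\<lambda>u\<in>{s..T}. \<alpha> (\<kappa> \<omega>) (pt u \<omega>))" for \<omega>
  have \<kappa>N: "\<kappa> \<in> N x \<rightarrow>\<^sub>M borel_of (top_of L)" using measurable_from_subalg[OF subalgebra_F \<kappa>] .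
  have \<kappa>G: "\<kappa> \<omega> \<in> carrier K" if "\<omega> \<in> space (N x)" for \<omega>
    using measurable_space[OF \<kappa>N that] topspace_L by simp
  have Y: "Y \<in> N x \<rightarrow>\<^sub>M PE s" unfolding Y_def
    using s by (intro measurable_restrict measurable_translate[OF \<kappa>N] measurable_pt_N) auto
  have k: "(\<lambda>\<omega>. future_law s (\<alpha> (\<kappa> \<omega>) (pt s \<omega>))) \<in> F s \<rightarrow>\<^sub>M subprob_algebra (PE s)"
    by (rule measurable_compose[OF measurable_translate[OF \<kappa> measurable_pt] measurable_future_law[OF s(2) ne]]) (use s in auto)
  have idF: "(\<lambda>\<omega>. \<omega>) \<in> N x \<rightarrow>\<^sub>M F s"
    using measurable_from_subalg[OF subalgebra_F[of s], of "\<lambda>\<omega>. \<omega>" "F s"] by simp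
  have m1: "(\<lambda>\<omega>. \<Phi> (\<omega>, Y \<omega>)) \<in> borel_measurable (N x)"
    using measurable_compose[OF measurable_Pair[OF idF Y] \<Phi>] by simp
  have m2: "(\<lambda>\<omega>. \<integral>\<^sup>+f. \<Phi> (\<omega>, f) \<partial>future_law s (\<alpha> (\<kappa> \<omega>) (pt s \<omega>))) \<in> borel_measurable (N x)"
    using measurable_compose[OF idF nn_integral_measurable_subprob_algebra2[OF _ k, of "\<lambda>\<omega> f. \<Phi> (\<omega>, f)"]] \<Phi> by simp
  have "(\<integral>\<^sup>+\<omega>. \<Phi> (\<omega>, Y \<omega>) \<partial>density (N x) (indicator (alive T)))
    = (\<integral>\<^sup>+\<omega>. \<integral>\<^sup>+f. \<Phi> (\<omega>, f) \<partial>future_law s (\<alpha> (\<kappa> \<omega>) (pt s \<omega>)) \<partial>density (N x) (indicator (alive s)))"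
  proof (rule nn_integral_kernel_rectangles[OF killed_finite[OF T0] killed_finite[OF s(1)] subalgebra_killed subalgebra_killed _ k
        Int_stable_prod_algebra _ _ _ _ \<Phi>])
    show "Y \<in> density (N x) (indicator (alive T)) \<rightarrow>\<^sub>M PE s" using Y by simp
    show "prod_algebra {s..T} (\<lambda>_. borel_of E) \<subseteq> Pow (space (PE s))"
      using prod_algebra_sets_into_space[of "{s..T}" "\<lambda>_. borel_of E"] by (simp add: space_PiM)
    show "sets (PE s) = sigma_sets (space (PE s)) (prod_algebra {s..T} (\<lambda>_. borel_of E))"
      unfolding space_PiM by (rule sets_PiM)
    show "space (PE s) \<in> prod_algebra {s..T} (\<lambda>_. borel_of E)" by (rule space_in_prod_algebra[OF s(2)])
    fix A R assume A: "A \<in> sets (F s)" and R: "R \<in> prod_algebra {s..T} (\<lambda>_. borel_of E)"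
    have RS: "R \<in> sets (PE s)" using R unfolding sets_PiM by (rule sigma_sets.Basic)
    obtain I B where IB: "finite I" "I \<subseteq> {s..T}" "\<And>u. u \<in> I \<Longrightarrow> B u \<in> sets (borel_of E)"
      "R = {f \<in> space (PE s). \<forall>u\<in>I. f u \<in> B u}" by (rule prod_algebra_rectangle[OF R]) (rule that; assumption)
    have IB3: "\<forall>u\<in>I. B u \<in> sets (borel_of E)" using IB(3) by blast
    obtain us B' where us': "sorted us \<and> (\<forall>u\<in>set us. s \<le> u \<and> u \<le> T) \<and> (\<forall>u. B' u \<in> sets (borel_of E)) \<and>
      (\<forall>f. (\<forall>u\<in>{s..T}. f u \<in> topspace E) \<longrightarrow> (\<forall>u\<in>insert T (set us). f u \<in> B' u) = (\<forall>u\<in>I. f u \<in> B u))"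
      using rectangle_list[where B=B, OF IB(1,2) IB3 s(2)] by (elim exE)
    then have us: "sorted us" "\<And>u. u \<in> set us \<Longrightarrow> s \<le> u \<and> u \<le> T" "\<And>u. B' u \<in> sets (borel_of E)"
      "\<And>f. (\<And>u. u \<in> {s..T} \<Longrightarrow> f u \<in> topspace E) \<Longrightarrow> (\<forall>u\<in>insert T (set us). f u \<in> B' u) \<longleftrightarrow> (\<forall>u\<in>I. f u \<in> B u)"
      by blast+
    have R': "R = {f \<in> space (PE s). \<forall>u\<in>insert T (set us). f u \<in> B' u}"
      unfolding IB(4) by (rule Collect_cong, rule conj_cong[OF refl], rule us(4)[symmetric]) (auto simp: space_PiM PiE_iff)
    have AN: "A \<in> sets (N x)" using A subalgebra_F by (auto simp: subalgebra_def)
    have aN: "alive T \<in> sets (N x)" "alive s \<in> sets (N x)" using s by (auto intro: alive_N)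
    have e: "{\<omega> \<in> A. Y \<omega> \<in> R} = A \<inter> (Y -` R \<inter> space (N x))" using sets.sets_into_space[OF AN] by auto
    have AB: "{\<omega> \<in> A. Y \<omega> \<in> R} \<in> sets (N x)" unfolding e using AN measurable_sets[OF Y RS] by auto
    have "emeasure (density (N x) (indicator (alive T))) {\<omega> \<in> A. Y \<omega> \<in> R}
        = (\<integral>\<^sup>+\<omega>. indicator (alive T) \<omega> * indicator {\<omega> \<in> A. Y \<omega> \<in> R} \<omega> \<partial>N x)"
      using aN AB by (intro emeasure_density) auto
    also have "\<dots> = (\<integral>\<^sup>+\<omega>. indicator A \<omega> * (indicator (alive T) \<omega> * (if \<forall>u\<in>insert T (set us). \<alpha> (\<kappa> \<omega>) (pt u \<omega>) \<in> B' u then 1 else 0)) \<partial>N x)"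
    proof (rule nn_integral_cong)
      fix \<omega> assume w: "\<omega> \<in> space (N x)"
      have "Y \<omega> \<in> R \<longleftrightarrow> (\<forall>u\<in>insert T (set us). \<alpha> (\<kappa> \<omega>) (pt u \<omega>) \<in> B' u)"
        using measurable_space[OF Y w] us(2) s unfolding R' Y_def by auto
      then show "indicator (alive T) \<omega> * indicator {\<omega> \<in> A. Y \<omega> \<in> R} \<omega> = (indicator A \<omega> * (indicator (alive T) \<omega> *
          (if \<forall>u\<in>insert T (set us). \<alpha> (\<kappa> \<omega>) (pt u \<omega>) \<in> B' u then 1 else 0)) :: ennreal)"
        by (simp add: indicator_def)
    qed
    also have "\<dots> = (\<integral>\<^sup>+\<omega>. indicator A \<omega> * (indicator (alive s) \<omega> * path_weight P (map (\<lambda>u. (u, B' u)) (us @ [T])) s (\<alpha> (\<kappa> \<omega>) (pt s \<omega>))) \<partial>N x)"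
      by (rule multi_step_rectangle[OF s(1) us(1,2) s(2) us(3) \<kappa>]) (use A in auto)
    also have "\<dots> = (\<integral>\<^sup>+\<omega>. indicator (alive s) \<omega> * (indicator A \<omega> * emeasure (future_law s (\<alpha> (\<kappa> \<omega>) (pt s \<omega>))) R) \<partial>N x)"
    proof (rule nn_integral_cong)
      fix \<omega> assume w: "\<omega> \<in> space (N x)"
      have "\<alpha> (\<kappa> \<omega>) (pt s \<omega>) \<in> topspace E" using translate_in_E[OF \<kappa>G[OF w] pt_in_E[OF w s(1)]] .
      from future_law_rectangle[where B=B', OF this s(2) us(1-3)]
      show "indicator A \<omega> * (indicator (alive s) \<omega> * path_weight P (map (\<lambda>u. (u, B' u)) (us @ [T])) s (\<alpha> (\<kappa> \<omega>) (pt s \<omega>)))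
        = indicator (alive s) \<omega> * (indicator A \<omega> * emeasure (future_law s (\<alpha> (\<kappa> \<omega>) (pt s \<omega>))) R)"
        unfolding R' by (simp add: mult_ac)
    qed
    also have "\<dots> = (\<integral>\<^sup>+\<omega>. indicator A \<omega> * emeasure (future_law s (\<alpha> (\<kappa> \<omega>) (pt s \<omega>))) R \<partial>density (N x) (indicator (alive s)))"
      using aN AN measurable_compose[OF measurable_compose[OF idF k] measurable_emeasure_subprob_algebra[OF RS]]
      by (intro nn_integral_density[symmetric]) auto
    finally show "emeasure (density (N x) (indicator (alive T))) {\<omega> \<in> A. Y \<omega> \<in> R}
        = (\<integral>\<^sup>+\<omega>. indicator A \<omega> * emeasure (future_law s (\<alpha> (\<kappa> \<omega>) (pt s \<omega>))) R \<partial>density (N x) (indicator (alive s)))" .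
  qed
  then show ?thesis
    using alive_N[OF T0] alive_N[OF s(1)] m1 m2 by (simp add: nn_integral_density Y_def)
qed

end

section \<open>Radial and angular parts\<close>

lemma rcll_on_concat:
  assumes "a \<le> b" "b \<le> c" shows "rcll_on a c E w \<longleftrightarrow> rcll_on a b E w \<and> rcll_on b c E w"
proof -
  have "{a..c} = {a..b} \<union> {b..c}" "{a..<c} = {a..<b} \<union> {b..<c}" "{a<..c} = {a<..b} \<union> {b<..c}" using assms by auto
  then show ?thesis unfolding rcll_on_def by (simp only: ball_Un) blast
qed

lemma countable_rational_times: "countable (({a..b} \<inter> \<rat>) \<union> {b::real})"
  by (auto intro: countable_subset[OF _ countable_rat])

text \<open>To remain in \<open>U\<close> together with its left limits, an rcll path must remain in
  a single \<open>C n\<close> of an exhaustion; being in \<open>U\<close> at each time would not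
  control the left limits. A closed set is never left if it is not left at countably many dense
  times, by right continuity.\<close>

lemma stay_set:
  assumes E: "metrizable_space E" and U: "openin E U" and ab: "a \<le> (b::real)"
  obtains St where "St \<in> sets (PiM {a..b} (\<lambda>_. borel_of E))"
    "\<And>w. rcll_on a b E w \<Longrightarrow> restrict w {a..b} \<in> St \<longleftrightarrow> rcll_on a b (subtopology E U) w"
proof -
  obtain C V :: "nat \<Rightarrow> 'a set" where CV: "\<And>n. closedin E (C n)" "\<And>n. openin E (V n)" "\<And>n. V n \<subseteq> C n"
    "\<And>n. C n \<subseteq> U" "incseq V" "incseq C" "(\<Union>n. V n) = U"
    by (rule open_exhaustion[OF E U]) (rule that; assumption)
  \<comment> \<open>The endpoint \<open>b\<close> is added because right continuity does not reach
    it.\<close>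
  define Qd where "Qd = ({a..b} \<inter> \<rat>) \<union> {b}"
  have Qd: "countable Qd" "Qd \<subseteq> {a..b}" "b \<in> Qd" unfolding Qd_def using countable_rational_times ab by auto
  let ?P = "PiM {a..b} (\<lambda>_. borel_of E)"
  define St where "St = (\<Union>n. \<Inter>q\<in>Qd. (\<lambda>f. f q) -` C n \<inter> space ?P)"
  have "St \<in> sets ?P" unfolding St_def
  proof (rule sets.countable_UN'')
    fix n show "(\<Inter>q\<in>Qd. (\<lambda>f. f q) -` C n \<inter> space ?P) \<in> sets ?P"
    proof (rule sets.countable_INT')
      show "(\<lambda>q. (\<lambda>f. f q) -` C n \<inter> space ?P) ` Qd \<subseteq> sets ?P"
        using Qd(2) borel_of_closed[OF CV(1)] by (auto intro!: measurable_sets[OF measurable_component_singleton])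
    qed (use Qd in auto)
  qed simp
  moreover have "restrict w {a..b} \<in> St \<longleftrightarrow> rcll_on a b (subtopology E U) w" if w: "rcll_on a b E w" for w
  proof
    assume "restrict w {a..b} \<in> St"
    then obtain n where "\<forall>q\<in>Qd. restrict w {a..b} q \<in> C n" unfolding St_def by blast
    then have n: "w q \<in> C n" if "q \<in> Qd" for q using that Qd(2) by (metis restrict_apply' subsetD)
    have all: "w t \<in> C n" if t: "t \<in> {a..b}" for t
    proof (cases "t = b")
      case False
      then have "t \<in> {a..<b}" using t by auto
      then have lim: "limitin E w (w t) (at_right t)" using w by (simp add: rcll_on_def)
      show ?thesis
      proof (rule ccontr)
        assume "w t \<notin> C n"
        then have "w t \<in> topspace E - C n" using limitin_topspace[OF lim] by blast
        moreover have "openin E (topspace E - C n)" using CV(1) by auto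
        ultimately obtain u where u: "u > t" "\<forall>y>t. y < u \<longrightarrow> w y \<in> topspace E - C n"
          using limitinD[OF lim] unfolding eventually_at_right_field by meson
        obtain q where "q \<in> \<rat>" "t < q" "q < min u b" using Rats_dense_in_real[of t "min u b"] u(1) \<open>t \<in> {a..<b}\<close> by auto
        then have "q \<in> Qd" "w q \<in> topspace E - C n" using u(2) t by (auto simp: Qd_def)
        then show False using n by auto
      qed
    qed (use n Qd in auto)
    then have inU: "w t \<in> U" if "t \<in> {a..b}" for t using CV(4) that by auto
    show "rcll_on a b (subtopology E U) w" unfolding rcll_on_def limitin_subtopology
    proof (intro conjI ballI)
      fix t assume t: "t \<in> {a..<b}"
      show "w t \<in> U" using inU t by auto
      show "\<forall>\<^sub>F s in at_right t. w s \<in> U"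
        unfolding eventually_at_right_field using t inU by (intro exI[of _ b]) auto
      show "limitin E w (w t) (at_right t)" using w t by (auto simp: rcll_on_def)
    next
      fix t assume t: "t \<in> {a<..b}"
      then obtain l where l: "limitin E w l (at_left t)" using w unfolding rcll_on_def by blast
      have ev: "\<forall>\<^sub>F s in at_left t. w s \<in> C n"
        unfolding eventually_at_left_field using t all by (intro exI[of _ a]) auto
      have "l \<in> C n" using limitin_closedin[OF l CV(1) ev] by simp
      then show "\<exists>l. l \<in> U \<and> (\<forall>\<^sub>F s in at_left t. w s \<in> U) \<and> limitin E w l (at_left t)"
        using l ev CV(4)[of n] by (intro exI[of _ l]) (auto elim: eventually_mono)
    qed (use w inU in \<open>auto simp: rcll_on_def\<close>)
  next
    assume s: "rcll_on a b (subtopology E U) w"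
    have VU: "V n \<subseteq> U" for n using CV(7) by auto
    have "\<exists>n. \<forall>t\<in>{a..b}. w t \<in> V n"
    proof (rule rcll_on_exhaustion[OF s CV(5) _ _ ab])
      show "openin (subtopology E U) (V n)" for n
        using CV(2)[of n] VU by (auto simp: openin_subtopology)
      show "(\<Union>n. V n) = topspace (subtopology E U)" using CV(7) openin_subset[OF U] by auto
    qed
    then obtain n where n: "\<And>t. t \<in> {a..b} \<Longrightarrow> w t \<in> C n" using CV(3) by blast
    have "restrict w {a..b} \<in> space ?P" using w by (auto simp: space_PiM rcll_on_def)
    then have "restrict w {a..b} \<in> (\<Inter>q\<in>Qd. (\<lambda>f. f q) -` C n \<inter> space ?P)" using n Qd(2) by (auto simp: subset_eq)
    then show "restrict w {a..b} \<in> St" unfolding St_def by blast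
  qed
  ultimately show thesis by (rule that)
qed

locale radial_decomposition = homogeneous_space K L M Q S
  for K :: "('k, 'b) monoid_scheme" and L :: "'k manifold" and M :: "'k set"
    and Q :: "'k set manifold" and S :: "'k set \<Rightarrow> 'k" +
  fixes X :: "'x manifold" and \<alpha> :: "'k \<Rightarrow> 'x \<Rightarrow> 'x" and Y :: "'x set" and m :: nat
    and P :: "real \<Rightarrow> 'x \<Rightarrow> 'x measure"
    and N :: "'x \<Rightarrow> 'w measure" and p :: "real \<Rightarrow> 'w \<Rightarrow> 'x" and \<xi> :: "'w \<Rightarrow> ereal" and T :: real
  fixes Yo Xo J J2 XT YT \<zeta> Px
  defines "Yo \<equiv> submanifold_interior X Y m"
  defines "Xo \<equiv> (\<Union>y\<in>Yo. orbit K \<alpha> y)"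
  defines "J \<equiv> radial_part K \<alpha> Y"
  defines "J2 \<equiv> angular_part K \<alpha> Yo M S"
  defines "XT \<equiv> subtopology (top_of X) Xo"
  defines "YT \<equiv> subtopology (top_of X) Yo"
  defines "\<zeta> \<equiv> \<lambda>\<omega>. exit_time (top_of X) Xo (\<xi> \<omega>) (\<lambda>t. p t \<omega>)"
  defines "Px \<equiv> \<lambda>x. path_law T XT (N x) p \<zeta>"
  assumes manifold_X: "smooth_manifold X" and smooth_act: "smooth_action K L X \<alpha>"
    and submanifold: "submanifold_with_boundary X Y m" and trans: "transversal K \<alpha> X Y"
    and Xo_open: "openin (top_of X) Xo"
    and stab: "\<And>y. y \<in> Yo \<Longrightarrow> stabilizer K \<alpha> y = M"
    and diffeo: "diffeomorphism (prod_manifold (interior_manifold X Y m) Q) (open_submanifold X Xo)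
           (\<lambda>(y, z). \<alpha> (S z) y)"
    and semigroup: "transition_semigroup (top_of X) P" and invariant: "invariant_semigroup K \<alpha> (top_of X) P"
    and markov: "\<And>x. x \<in> topspace (top_of X) \<Longrightarrow> markov_process (top_of X) P (N x) p \<xi>"
    and start: "\<And>x. x \<in> topspace (top_of X) \<Longrightarrow> AE \<omega> in N x. 0 < \<xi> \<omega> \<and> p 0 \<omega> = x"
    and T_pos: "0 < T"
begin

abbreviation E where "E \<equiv> top_of X"

lemma E_metrizable: "metrizable_space E" and E_second_countable: "second_countable E"
  using smooth_manifold_metrizable[OF manifold_X] by auto

lemma action: "group_action K (topspace E) \<alpha>" using smooth_act by (simp add: smooth_action_def)

lemma act_cont: "continuous_map (prod_topology TL E) E (\<lambda>(k, x). \<alpha> k x)"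
  using smooth_act by (simp add: smooth_action_def smooth_map_def prod_manifold_def)

sublocale ga: group_action K "topspace E" \<alpha> by (rule action)

lemma killed: "x \<in> topspace E \<Longrightarrow> killed_invariant_markov E P (N x) p \<xi> x K L \<alpha>"
  using E_metrizable E_second_countable semigroup markov start lie action act_cont invariant
  by unfold_locales auto

sublocale MF: invariant_markov_family E P N p \<xi> K L \<alpha> T
  by (rule invariant_markov_family.intro) (use killed T_pos in auto)

lemma alpha_one: "x \<in> topspace E \<Longrightarrow> \<alpha> \<one>\<^bsub>K\<^esub> x = x"
  using ga.id_eq_one by (metis restrict_apply')

lemma alpha_mult: "k \<in> G \<Longrightarrow> l \<in> G \<Longrightarrow> x \<in> topspace E \<Longrightarrow> \<alpha> k (\<alpha> l x) = \<alpha> (k \<odot> l) x"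
  using ga.composition_rule by simp

lemma continuous_alpha: "k \<in> G \<Longrightarrow> continuous_map E E (\<alpha> k)"
  using continuous_map_compose[OF _ act_cont, of E "\<lambda>x. (k, x)"] by (simp add: comp_def continuous_map_pairedI)

lemma Y_sub: "Y \<subseteq> topspace E" using submanifold by (simp add: submanifold_with_boundary_def)

lemma Yo_Y: "Yo \<subseteq> Y" by (auto simp: Yo_def submanifold_interior_def)

lemma Yo_E: "Yo \<subseteq> topspace E" using Yo_Y Y_sub by blast

lemma Xo_E: "Xo \<subseteq> topspace E" using openin_subset[OF Xo_open] .

lemma Xo_cases: assumes "x \<in> Xo" obtains k y where "k \<in> G" "y \<in> Yo" "x = \<alpha> k y"
  using assms by (auto simp: Xo_def orbit_def)

lemma Xo_I: "k \<in> G \<Longrightarrow> y \<in> Yo \<Longrightarrow> \<alpha> k y \<in> Xo"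
  by (auto simp: Xo_def orbit_def)

lemma Xo_alpha: "k \<in> G \<Longrightarrow> x \<in> Xo \<Longrightarrow> \<alpha> k x \<in> Xo"
  using Xo_I alpha_mult Yo_E by (elim Xo_cases) (metis m_closed subsetD)

lemma Yo_Xo: "Yo \<subseteq> Xo" using Xo_I[OF one_closed] alpha_one Yo_E by force

lemma J_eq: assumes k: "k \<in> G" and y: "y \<in> Yo" shows "J (\<alpha> k y) = y"
  unfolding J_def radial_part_def
proof (rule the_equality)
  show "y \<in> Y \<and> \<alpha> k y \<in> orbit K \<alpha> y" using k y Yo_Y by (auto simp: orbit_def)
  fix y' assume y': "y' \<in> Y \<and> \<alpha> k y \<in> orbit K \<alpha> y'"
  then obtain l where l: "l \<in> G" "\<alpha> k y = \<alpha> l y'" by (auto simp: orbit_def)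
  have E: "y \<in> topspace E" "y' \<in> topspace E" using y y' Yo_E Y_sub by auto
  have "y = \<alpha> (ginv k) (\<alpha> k y)" using k E by (simp add: alpha_mult alpha_one)
  also have "\<dots> = \<alpha> (ginv k \<odot> l) y'" using k l E by (simp add: alpha_mult)
  finally have "y \<in> orbit K \<alpha> y'" using k l by (auto simp: orbit_def)
  then have "y \<in> orbit K \<alpha> y' \<inter> Y" using y Yo_Y by blast
  moreover have "orbit K \<alpha> y' \<inter> Y = {y'}" using trans y' unfolding transversal_def by blast
  ultimately show "y' = y" by simp
qed

lemma stab_M: "y \<in> Yo \<Longrightarrow> h \<in> M \<Longrightarrow> \<alpha> h y = y"
  using stab by (auto simp: stabilizer_def)

lemma coset_eqI: assumes "k \<in> G" "l \<in> G" "ginv k \<odot> l \<in> M" shows "k \<rhd> M = l \<rhd> M"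
proof -
  have "l = k \<odot> (ginv k \<odot> l)" using assms by (simp add: m_assoc[symmetric])
  then have "l \<rhd> M = k \<rhd> ((ginv k \<odot> l) \<rhd> M)" using assms M_in_C by (simp add: act_act)
  then show ?thesis using M_act[OF assms(3)] by simp
qed

text \<open>\<open>k\<close> and \<open>S (k \<rhd> M)\<close> differ by an element of
  \<open>M\<close>, which fixes \<open>y\<close>. Conversely transversality fixes the radial part,
  and the stabilizer being exactly \<open>M\<close> fixes the coset.\<close>

lemma J2_eq: assumes k: "k \<in> G" and y: "y \<in> Yo" shows "J2 (\<alpha> k y) = k \<rhd> M"
  unfolding J2_def angular_part_def
proof (rule the_equality)
  have yE: "y \<in> topspace E" using y Yo_E by auto
  show "k \<rhd> M \<in> C \<and> (\<exists>y'\<in>Yo. \<alpha> k y = \<alpha> (S (k \<rhd> M)) y')"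
  proof (intro conjI bexI[OF _ y])
    show "k \<rhd> M \<in> C" using k by simp
    have sG: "S (k \<rhd> M) \<in> G" using k by simp
    have h: "ginv k \<odot> S (k \<rhd> M) \<in> M" using k sG by (intro coset_eq_imp) auto
    then have hG: "ginv k \<odot> S (k \<rhd> M) \<in> G" using M_sub by auto
    have "\<alpha> (S (k \<rhd> M)) y = \<alpha> (k \<odot> (ginv k \<odot> S (k \<rhd> M))) y" using k sG by (simp add: m_assoc[symmetric])
    also have "\<dots> = \<alpha> k (\<alpha> (ginv k \<odot> S (k \<rhd> M)) y)" using k hG yE by (simp add: alpha_mult)
    finally show "\<alpha> k y = \<alpha> (S (k \<rhd> M)) y" using stab_M[OF y h] by simp
  qed
  fix z assume "z \<in> C \<and> (\<exists>y'\<in>Yo. \<alpha> k y = \<alpha> (S z) y')"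
  then obtain y' where z: "z \<in> C" "y' \<in> Yo" "\<alpha> k y = \<alpha> (S z) y'" by blast
  then have "y' = y" using J_eq[OF k y] J_eq[OF S_in_G[OF z(1)] z(2)] by simp
  have "\<alpha> (ginv k) (\<alpha> (S z) y) = \<alpha> (ginv k) (\<alpha> k y)" using z(3) \<open>y' = y\<close> by simp
  then have "\<alpha> (ginv k \<odot> S z) y = y" using z(1) k yE by (simp add: alpha_mult alpha_one)
  then have "ginv k \<odot> S z \<in> stabilizer K \<alpha> y" using k z by (simp add: stabilizer_def)
  then have "k \<rhd> M = S z \<rhd> M" using k z stab[OF y] by (intro coset_eqI) auto
  then show "z = k \<rhd> M" using z by simp
qed

lemma J_in: "x \<in> Xo \<Longrightarrow> J x \<in> Yo" by (elim Xo_cases) (simp add: J_eq)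

lemma J2_in: "x \<in> Xo \<Longrightarrow> J2 x \<in> C" by (elim Xo_cases) (simp add: J2_eq)

lemma J_alpha: "k \<in> G \<Longrightarrow> x \<in> Xo \<Longrightarrow> J (\<alpha> k x) = J x"
  using Yo_E by (elim Xo_cases) (auto simp: alpha_mult J_eq subset_eq)

lemma J2_alpha: "k \<in> G \<Longrightarrow> x \<in> Xo \<Longrightarrow> J2 (\<alpha> k x) = k \<rhd> J2 x"
  using Yo_E M_in_C by (elim Xo_cases) (auto simp: alpha_mult J2_eq act_act subset_eq)

lemma J_Yo: "y \<in> Yo \<Longrightarrow> J y = y" using J_eq[OF one_closed] alpha_one Yo_E by force

lemma decompose: assumes x: "x \<in> Xo" shows "\<alpha> (S (J2 x)) (J x) = x" "\<alpha> (ginv (S (J2 x))) x = J x"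
proof -
  obtain k y where ky: "k \<in> G" "y \<in> Yo" "x = \<alpha> k y" using Xo_cases[OF x] by blast
  have yE: "y \<in> topspace E" using ky Yo_E by auto
  have s: "S (J2 x) \<in> G" using J2_in[OF x] by simp
  have h: "ginv k \<odot> S (J2 x) \<in> M" using ky s J2_in[OF x] by (intro coset_eq_imp) (auto simp: J2_eq)
  then have hG: "ginv k \<odot> S (J2 x) \<in> G" using M_sub by auto
  have "\<alpha> (S (J2 x)) y = \<alpha> (k \<odot> (ginv k \<odot> S (J2 x))) y" using ky s by (simp add: m_assoc[symmetric])
  also have "\<dots> = \<alpha> k (\<alpha> (ginv k \<odot> S (J2 x)) y)" using ky hG yE by (simp add: alpha_mult)
  also have "\<dots> = x" using stab_M[OF ky(2) h] ky by simp
  finally show 1: "\<alpha> (S (J2 x)) (J x) = x" using ky by (simp add: J_eq)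
  have "J x \<in> topspace E" using J_in[OF x] Yo_E by auto
  then have "\<alpha> (ginv (S (J2 x))) (\<alpha> (S (J2 x)) (J x)) = J x" using s by (simp add: alpha_mult alpha_one)
  then show "\<alpha> (ginv (S (J2 x))) x = J x" using 1 by simp
qed

lemma topspace_XT [simp]: "topspace XT = Xo" using Xo_E by (auto simp: XT_def)

lemma topspace_YT [simp]: "topspace YT = Yo" using Yo_E by (auto simp: YT_def)

text \<open>The pair of the two parts is the inverse of the product diffeomorphism, so both parts
  inherit continuity from it.\<close>

lemma continuous_J_J2: "continuous_map XT YT J" "continuous_map XT TQ J2"
proof -
  let ?f = "\<lambda>(y, z). \<alpha> (S z) y"
  have tp: "topspace (prod_topology YT TQ) = Yo \<times> C" by simp
  have tx: "top_of (open_submanifold X Xo) = XT" by (simp add: open_submanifold_def XT_def)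
  have tt: "top_of (prod_manifold (interior_manifold X Y m) Q) = prod_topology YT TQ"
    by (simp add: prod_manifold_def interior_manifold_def Yo_def[symmetric] YT_def)
  have bij: "bij_betw ?f (Yo \<times> C) Xo"
    using diffeo unfolding diffeomorphism_def tx tt tp by simp
  have cont: "continuous_map XT (prod_topology YT TQ) (inv_into (Yo \<times> C) ?f)"
    using diffeo unfolding diffeomorphism_def smooth_map_def tx tt tp by blast
  have inv: "inv_into (Yo \<times> C) ?f x = (J x, J2 x)" if x: "x \<in> Xo" for x
  proof (rule inv_into_f_eq)
    show "inj_on ?f (Yo \<times> C)" using bij by (simp add: bij_betw_def)
  qed (use J_in[OF x] J2_in[OF x] decompose(1)[OF x] in auto)
  have "continuous_map XT (prod_topology YT TQ) (\<lambda>x. (J x, J2 x))"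
    by (rule continuous_map_eq[OF cont]) (use inv in auto)
  then show "continuous_map XT YT J" "continuous_map XT TQ J2" by (simp_all add: continuous_map_paired)
qed

lemma path_spaces: "path_space T XT" "path_space T YT" "path_space T TQ" "path_space T E"
  by unfold_locales (auto simp: XT_def YT_def T_pos E_metrizable E_second_countable TQ_metrizable TQ_second_countable
      metrizable_space_subtopology second_countable_subtopology)

lemma measurable_totalize:
  assumes f: "continuous_map XT Z f" and c: "c \<in> topspace Z"
  shows "(\<lambda>x. if x \<in> Xo then f x else c) \<in> borel_of E \<rightarrow>\<^sub>M borel_of Z"
proof (rule measurable_borel_ofI)
  show "(if x \<in> Xo then f x else c) \<in> topspace Z" if "x \<in> space (borel_of E)" for x
    using f c by (auto simp: continuous_map_def)
  fix U assume U: "openin Z U"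
  have "openin XT {x \<in> Xo. f x \<in> U}" using openin_continuous_map_preimage[OF f U] by simp
  then have o: "openin E {x \<in> Xo. f x \<in> U}" unfolding XT_def using openin_trans_full Xo_open by blast
  have "(\<lambda>x. if x \<in> Xo then f x else c) -` U \<inter> space (borel_of E)
      = {x \<in> Xo. f x \<in> U} \<union> (if c \<in> U then space (borel_of E) - Xo else {})"
    using Xo_E by (auto split: if_splits)
  then show "(\<lambda>x. if x \<in> Xo then f x else c) -` U \<inter> space (borel_of E) \<in> sets (borel_of E)"
    using borel_of_open[OF o] sets.compl_sets[OF borel_of_open[OF Xo_open]] by auto
qed

text \<open>The value \<open>M\<close> off \<open>Xo\<close>, like \<open>y0\<close> in
  \<open>Jr\<close>, makes the angular and radial part total Borel maps, applicable to coordinates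
  of functions that are not paths in \<open>Xo\<close>.\<close>

definition J2r :: "'x \<Rightarrow> 'k set" where "J2r x = (if x \<in> Xo then J2 x else M)"

lemma measurable_J2r: "J2r \<in> borel_of E \<rightarrow>\<^sub>M borel_of TQ"
  unfolding J2r_def[abs_def] using M_in_C by (intro measurable_totalize continuous_J_J2) simp

definition y0 :: 'x where "y0 = (SOME y. y \<in> Yo)"

definition Jr :: "'x \<Rightarrow> 'x" where "Jr x = (if x \<in> Xo then J x else y0)"

lemma measurable_Jr: "Yo \<noteq> {} \<Longrightarrow> Jr \<in> borel_of E \<rightarrow>\<^sub>M borel_of YT"
  unfolding Jr_def[abs_def] y0_def by (intro measurable_totalize continuous_J_J2) (simp add: some_in_eq)

lemma rcll_process_path:
  assumes x: "x \<in> topspace E" and w: "\<omega> \<in> space (N x)" and s: "0 \<le> s" "ereal s < \<xi> \<omega>"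
  shows "rcll_on 0 s E (\<lambda>t. p t \<omega>)"
proof -
  interpret killed_invariant_markov E P "N x" p \<xi> x K L \<alpha> using x by (rule killed)
  have a: "ereal t < \<xi> \<omega>" if "t \<le> s" for t using that s(2) order.strict_trans1[of "ereal t" "ereal s"] by simp
  have r: "limitin E (\<lambda>s. p s \<omega>) (p t \<omega>) (at_right t)" "0 < t \<Longrightarrow> \<exists>l. limitin E (\<lambda>s. p s \<omega>) l (at_left t)"
    if "0 \<le> t" "t \<le> s" for t
    using rcll w that a unfolding rcll_process_def by blast+
  show ?thesis unfolding rcll_on_def using r limitin_topspace[OF r(1)] by auto
qed

text \<open>The exit time is an infimum, so staying in \<open>Xo\<close> up to \<open>T\<close> must
  be shown to imply staying a little longer: right continuity at \<open>T\<close> and openness keep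
  the path in some \<open>V n\<close>, left limits then lie in the closed \<open>C n\<close>, and
  the life time exceeds \<open>T\<close> strictly. Time 0, which the exit time ignores, is
  controlled by the path condition.\<close>

lemma exit_time_iff:
  assumes x: "x \<in> topspace E" and w: "\<omega> \<in> space (N x)"
  shows "ereal T < \<zeta> \<omega> \<and> (\<lambda>t\<in>{0..T}. p t \<omega>) \<in> rcll_paths T XT \<longleftrightarrow>
    ereal T < \<xi> \<omega> \<and> rcll_on 0 T XT (\<lambda>t. p t \<omega>)"
proof -
  interpret killed_invariant_markov E P "N x" p \<xi> x K L \<alpha> using x by (rule killed)
  let ?A = "{ereal t | t. 0 < t \<and> (p t \<omega> \<notin> Xo \<or> \<not> (\<exists>l\<in>Xo. limitin E (\<lambda>t. p t \<omega>) l (at_left t)) \<or> \<xi> \<omega> \<le> ereal t)}"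
  have z: "\<zeta> \<omega> = Inf ?A" by (simp add: \<zeta>_def exit_time_def)
  have path: "(\<lambda>t\<in>{0..T}. p t \<omega>) \<in> rcll_paths T XT \<longleftrightarrow> rcll_on 0 T XT (\<lambda>t. p t \<omega>)"
    unfolding rcll_paths_iff using rcll_on_cong[of 0 T "\<lambda>t\<in>{0..T}. p t \<omega>" "\<lambda>t. p t \<omega>" XT] by auto
  have "ereal T < \<zeta> \<omega> \<longleftrightarrow> ereal T < \<xi> \<omega>" if rc: "rcll_on 0 T XT (\<lambda>t. p t \<omega>)"
  proof
    assume "ereal T < \<zeta> \<omega>"
    then have "ereal T \<notin> ?A" unfolding z using Inf_lower[of "ereal T" ?A] by (meson leD)
    then show "ereal T < \<xi> \<omega>" using T_pos by auto
  next
    assume a: "ereal T < \<xi> \<omega>"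
    obtain C V :: "nat \<Rightarrow> 'x set" where CV: "\<And>n. closedin E (C n)" "\<And>n. openin E (V n)" "\<And>n. V n \<subseteq> C n"
      "\<And>n. C n \<subseteq> Xo" "incseq V" "incseq C" "(\<Union>n. V n) = Xo"
      by (rule open_exhaustion[OF E_metrizable Xo_open]) (rule that; assumption)
    have "p T \<omega> \<in> Xo" using rc T_pos by (auto simp: rcll_on_def)
    then obtain n where n: "p T \<omega> \<in> V n" using CV(7) by auto
    have T0: "0 \<le> T" using T_pos by simp
    have "limitin E (\<lambda>s. p s \<omega>) (p T \<omega>) (at_right T)"
      using rcll w a T0 unfolding rcll_process_def by blast
    from limitinD[OF this CV(2) n] obtain u where u: "u > T" "\<And>s. T < s \<Longrightarrow> s < u \<Longrightarrow> p s \<omega> \<in> V n"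
      unfolding eventually_at_right_field by auto
    \<comment> \<open>A time strictly between \<open>T\<close> and the life time; up to the smaller
      of \<open>u\<close> and \<open>e\<close> no reason for exit can occur.\<close>
    obtain e where e: "ereal T < ereal e" "ereal e < \<xi> \<omega>" using ereal_dense2[OF a] by blast
    have "ereal (min u e) \<le> Inf ?A"
    proof (rule Inf_greatest)
      fix y assume "y \<in> ?A"
      then obtain t where t: "y = ereal t" "0 < t"
        "p t \<omega> \<notin> Xo \<or> \<not> (\<exists>l\<in>Xo. limitin E (\<lambda>t. p t \<omega>) l (at_left t)) \<or> \<xi> \<omega> \<le> ereal t" by auto
      show "ereal (min u e) \<le> y"
      proof (rule ccontr)
        assume "\<not> ereal (min u e) \<le> y"
        then have "t < min u e" using t(1) by (metis ereal_less_eq(3) not_le)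
        then have tu: "t < u" "t < e" by auto
        then have tx: "ereal t < \<xi> \<omega>" using e(2) by (meson ereal_less_eq(3) less_imp_le order.strict_trans1)
        show False
        proof (cases "t \<le> T")
          case True
          then have "t \<in> {0<..T}" "t \<in> {0..T}" using t(2) by auto
          then have "p t \<omega> \<in> Xo" "\<exists>l. limitin XT (\<lambda>t. p t \<omega>) l (at_left t)" using rc unfolding rcll_on_def by auto
          then show False using t(3) tx by (auto simp: XT_def limitin_subtopology)
        next
          case False
          have "p t \<omega> \<in> Xo" using u(2)[of t] False tu CV(7) by auto
          obtain l where l: "limitin E (\<lambda>t. p t \<omega>) l (at_left t)"
            using rcll w tx t(2) unfolding rcll_process_def by (meson less_imp_le)
          have ev: "\<forall>\<^sub>F s in at_left t. p s \<omega> \<in> C n"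
            unfolding eventually_at_left_field using u(2) False tu CV(3)[of n] by (intro exI[of _ T]) auto
          have "l \<in> C n" using limitin_closedin[OF l CV(1) ev] by simp
          then show False using t(3) tx l \<open>p t \<omega> \<in> Xo\<close> CV(4)[of n] by auto
        qed
      qed
    qed
    moreover have "ereal T < ereal (min u e)" using u(1) e(1) by simp
    ultimately show "ereal T < \<zeta> \<omega>" unfolding z by (rule order.strict_trans2[rotated])
  qed
  then show ?thesis using path by blast
qed

end

section \<open>Remaining in \<open>Xo\<close>, and the Markov property relative to the angular
  position\<close>

context radial_decomposition
begin

text \<open>Whether a path remains in \<open>Xo\<close> is not a measurable question about arbitrary functions; on rcll
  paths in \<open>X\<close> it is decided by countably many coordinates, which yields a measurable surrogate.\<close>

definition stay :: "real \<Rightarrow> real \<Rightarrow> (real \<Rightarrow> 'x) set" where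
  "stay a b = (SOME St. St \<in> sets (PiM {a..b} (\<lambda>_. borel_of E)) \<and>
     (\<forall>w. rcll_on a b E w \<longrightarrow> (restrict w {a..b} \<in> St \<longleftrightarrow> rcll_on a b XT w)))"

lemma stay:
  assumes "a \<le> b"
  shows "stay a b \<in> sets (PiM {a..b} (\<lambda>_. borel_of E))"
    and "rcll_on a b E w \<Longrightarrow> restrict w {a..b} \<in> stay a b \<longleftrightarrow> rcll_on a b XT w"
proof -
  obtain St where "St \<in> sets (PiM {a..b} (\<lambda>_. borel_of E))"
    "\<And>w. rcll_on a b E w \<Longrightarrow> restrict w {a..b} \<in> St \<longleftrightarrow> rcll_on a b (subtopology E Xo) w"
    by (rule stay_set[OF E_metrizable Xo_open assms]) (rule that; assumption)
  then have "\<exists>St. St \<in> sets (PiM {a..b} (\<lambda>_. borel_of E)) \<and>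
     (\<forall>w. rcll_on a b E w \<longrightarrow> (restrict w {a..b} \<in> St \<longleftrightarrow> rcll_on a b XT w))"
    unfolding XT_def by blast
  from someI_ex[OF this] show "stay a b \<in> sets (PiM {a..b} (\<lambda>_. borel_of E))"
    "rcll_on a b E w \<Longrightarrow> restrict w {a..b} \<in> stay a b \<longleftrightarrow> rcll_on a b XT w"
    unfolding stay_def by blast+
qed

abbreviation alv where "alv x \<equiv> killed_markov.alive (N x) \<xi>"
abbreviation ptx where "ptx x \<equiv> killed_markov.pt p \<xi> x"
abbreviation PE where "PE s \<equiv> PiM {s..T} (\<lambda>_. borel_of E)"
abbreviation PP where "PP s \<equiv> PiM {0..s} (\<lambda>_. borel_of E)"
abbreviation D where "D \<equiv> rcll_paths T XT"

text \<open>The part of \<open>\<zeta> > T\<close> that is decided at time \<open>s\<close>, written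
  through the total version of the process and the surrogate set, so that it visibly belongs to the
  past.\<close>

definition inside :: "'x \<Rightarrow> real \<Rightarrow> 'w set" where
  "inside x s = {\<omega> \<in> alv x s. (\<lambda>u\<in>{0..s}. ptx x u \<omega>) \<in> stay 0 s}"

lemma alv_iff: "x \<in> topspace E \<Longrightarrow> \<omega> \<in> alv x s \<longleftrightarrow> \<omega> \<in> space (N x) \<and> ereal s < \<xi> \<omega>"
proof -
  assume x: "x \<in> topspace E"
  interpret killed_invariant_markov E P "N x" p \<xi> x K L \<alpha> using x by (rule killed)
  show ?thesis by (simp add: alive_def)
qed

lemma ptx_eq: "x \<in> topspace E \<Longrightarrow> \<omega> \<in> alv x s \<Longrightarrow> u \<le> s \<Longrightarrow> ptx x u \<omega> = p u \<omega>"
proof -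
  assume x: "x \<in> topspace E" and w: "\<omega> \<in> alv x s" and u: "u \<le> s"
  interpret killed_invariant_markov E P "N x" p \<xi> x K L \<alpha> using x by (rule killed)
  have "ereal u < \<xi> \<omega>" using w u alv_iff[OF x] order.strict_trans1[of "ereal u" "ereal s"] by simp
  then show ?thesis by (simp add: pt_def)
qed

lemma inside_iff:
  assumes x: "x \<in> topspace E" and s: "0 \<le> s"
  shows "\<omega> \<in> inside x s \<longleftrightarrow> \<omega> \<in> alv x s \<and> rcll_on 0 s XT (\<lambda>t. p t \<omega>)"
proof -
  have "(\<lambda>u\<in>{0..s}. ptx x u \<omega>) \<in> stay 0 s \<longleftrightarrow> rcll_on 0 s XT (\<lambda>t. p t \<omega>)" if w: "\<omega> \<in> alv x s"
  proof -
    have "(\<lambda>u\<in>{0..s}. ptx x u \<omega>) = restrict (\<lambda>t. p t \<omega>) {0..s}"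
      using ptx_eq[OF x w] by (auto intro!: restrict_ext)
    moreover have "rcll_on 0 s E (\<lambda>t. p t \<omega>)"
      using w alv_iff[OF x] s by (intro rcll_process_path[OF x]) auto
    ultimately show ?thesis using stay(2)[OF s] by simp
  qed
  then show ?thesis by (auto simp: inside_def)
qed

lemma inside_T:
  assumes x: "x \<in> topspace E"
  shows "inside x T = {\<omega> \<in> space (N x). ereal T < \<zeta> \<omega> \<and> (\<lambda>t\<in>{0..T}. p t \<omega>) \<in> D}"
proof -
  have "\<omega> \<in> inside x T \<longleftrightarrow> \<omega> \<in> space (N x) \<and> (ereal T < \<zeta> \<omega> \<and> (\<lambda>t\<in>{0..T}. p t \<omega>) \<in> D)" for \<omega>
    using inside_iff[OF x, of T \<omega>] alv_iff[OF x, of \<omega> T] exit_time_iff[OF x, of \<omega>] T_pos by auto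
  then show ?thesis by auto
qed

lemma measurable_past:
  assumes x: "x \<in> topspace E" and s: "0 \<le> s"
  shows "(\<lambda>\<omega>. \<lambda>u\<in>{0..s}. ptx x u \<omega>) \<in> natural_filtration E (N x) p \<xi> s \<rightarrow>\<^sub>M PP s"
proof -
  interpret killed_invariant_markov E P "N x" p \<xi> x K L \<alpha> using x by (rule killed)
  show ?thesis by (rule measurable_restrict) (auto intro: measurable_pt)
qed

lemma inside_measurable:
  assumes x: "x \<in> topspace E" and s: "0 \<le> s"
  shows "inside x s \<in> sets (natural_filtration E (N x) p \<xi> s)" "inside x s \<in> sets (N x)"
proof -
  interpret killed_invariant_markov E P "N x" p \<xi> x K L \<alpha> using x by (rule killed)
  have "inside x s = alive s \<inter> ((\<lambda>\<omega>. \<lambda>u\<in>{0..s}. ptx x u \<omega>) -` stay 0 s \<inter> space (F s))"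
    using sets.sets_into_space[OF alive_N[OF s]] by (auto simp: inside_def)
  then show 1: "inside x s \<in> sets (F s)"
    using alive_F[OF s order_refl] measurable_sets[OF measurable_past[OF x s] stay(1)[OF s]] by auto
  then show "inside x s \<in> sets (N x)" using subalgebra_F[of s] by (auto simp: subalgebra_def)
qed

definition pathof :: "'w \<Rightarrow> real \<Rightarrow> 'x" where "pathof \<omega> = (\<lambda>t\<in>{0..T}. p t \<omega>)"

lemma Px_eq: "x \<in> topspace E \<Longrightarrow> Px x = distr (restrict_space (N x) (inside x T)) (path_borel T XT) pathof"
  by (simp add: Px_def path_law_def inside_T pathof_def[abs_def])

lemma measurable_pathof:
  assumes x: "x \<in> topspace E" shows "pathof \<in> restrict_space (N x) (inside x T) \<rightarrow>\<^sub>M path_borel T XT"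
proof -
  interpret killed_invariant_markov E P "N x" p \<xi> x K L \<alpha> using x by (rule killed)
  have T0: "0 \<le> T" using T_pos by simp
  have sub: "inside x T \<inter> space (N x) = inside x T" using sets.sets_into_space[OF inside_measurable(2)[OF x T0]] by auto
  show ?thesis
  proof (rule path_space.measurable_path_borelI[OF path_spaces(1)])
    show "pathof \<omega> \<in> D" if "\<omega> \<in> space (restrict_space (N x) (inside x T))" for \<omega>
      using that by (simp add: space_restrict_space inside_T[OF x] pathof_def)
    fix t assume t: "t \<in> {0..T}"
    have m: "(\<lambda>\<omega>. ptx x t \<omega>) \<in> restrict_space (N x) (inside x T) \<rightarrow>\<^sub>M borel_of E"
      using t by (intro measurable_restrict_space1 measurable_pt_N) auto
    have eq: "pathof \<omega> t = ptx x t \<omega>" if "\<omega> \<in> inside x T" for \<omega>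
      using ptx_eq[OF x, of \<omega> T t] that t by (simp add: pathof_def inside_def)
    have "(\<lambda>\<omega>. pathof \<omega> t) \<in> restrict_space (N x) (inside x T) \<rightarrow>\<^sub>M borel_of E"
      by (rule measurable_cong[THEN iffD1, OF _ m]) (auto simp: space_restrict_space eq)
    then show "(\<lambda>\<omega>. pathof \<omega> t) \<in> restrict_space (N x) (inside x T) \<rightarrow>\<^sub>M borel_of XT"
      unfolding XT_def
    proof (rule measurable_borel_of_subtopology)
      fix \<omega> assume "\<omega> \<in> space (restrict_space (N x) (inside x T))"
      then have "rcll_on 0 T XT (\<lambda>t. p t \<omega>)" using inside_iff[OF x T0] by (simp add: space_restrict_space)
      then show "pathof \<omega> t \<in> Xo" using t by (simp add: rcll_on_def pathof_def)
    qed
  qed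
qed

lemma space_Px [simp]: "space (Px x) = D"
  using path_space.space_path_borel[OF path_spaces(1)] by (simp add: Px_def path_law_def)

lemma sets_Px [simp, measurable_cong]: "sets (Px x) = sets (path_borel T XT)"
  by (simp add: Px_def path_law_def)

lemma nn_integral_Px:
  assumes x: "x \<in> topspace E" and f: "f \<in> borel_measurable (path_borel T XT)"
  shows "(\<integral>\<^sup>+w. f w \<partial>Px x) = (\<integral>\<^sup>+\<omega>. indicator (inside x T) \<omega> * f (pathof \<omega>) \<partial>N x)"
proof -
  have T0: "0 \<le> T" using T_pos by simp
  have "(\<integral>\<^sup>+w. f w \<partial>Px x) = (\<integral>\<^sup>+\<omega>. f (pathof \<omega>) \<partial>restrict_space (N x) (inside x T))"
    unfolding Px_eq[OF x] by (rule nn_integral_distr[OF measurable_pathof[OF x]]) (use f in simp)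
  also have "\<dots> = (\<integral>\<^sup>+\<omega>. f (pathof \<omega>) * indicator (inside x T) \<omega> \<partial>N x)"
    using sets.sets_into_space[OF inside_measurable(2)[OF x T0]] inside_measurable(2)[OF x T0]
    by (intro nn_integral_restrict_space) (simp add: Int_absorb2)
  finally show ?thesis by (simp add: mult.commute)
qed

lemma finite_Px: "x \<in> topspace E \<Longrightarrow> finite_measure (Px x)"
proof -
  assume x: "x \<in> topspace E"
  interpret killed_invariant_markov E P "N x" p \<xi> x K L \<alpha> using x by (rule killed)
  have T0: "0 \<le> T" using T_pos by simp
  have "emeasure (Px x) (space (Px x)) = (\<integral>\<^sup>+w. 1 \<partial>Px x)" by simp
  also have "\<dots> = (\<integral>\<^sup>+\<omega>. indicator (inside x T) \<omega> * 1 \<partial>N x)" by (rule nn_integral_Px[OF x]) simp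
  also have "\<dots> = emeasure (N x) (inside x T)" using inside_measurable(2)[OF x T0] by simp
  finally show ?thesis by (intro finite_measureI) (simp add: N.emeasure_eq_measure)
qed

lemma measurable_ev_XT: "t \<in> {0..T} \<Longrightarrow> (\<lambda>w. w t) \<in> path_borel T XT \<rightarrow>\<^sub>M borel_of XT"
  by (rule path_space.measurable_evaluation[OF path_spaces(1)])

lemma measurable_ev_E: "t \<in> {0..T} \<Longrightarrow> (\<lambda>w. w t) \<in> path_borel T XT \<rightarrow>\<^sub>M borel_of E"
  using measurable_borel_of_subtopologyD[of _ _ E Xo] measurable_ev_XT unfolding XT_def by blast

lemma measurable_alpha:
  "f \<in> A \<rightarrow>\<^sub>M borel_of TL \<Longrightarrow> g \<in> A \<rightarrow>\<^sub>M borel_of E \<Longrightarrow> (\<lambda>x. \<alpha> (f x) (g x)) \<in> A \<rightarrow>\<^sub>M borel_of E"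
  using measurable_compose[OF measurable_Pair continuous_map_measurable_prod[OF TL_second_countable E_second_countable act_cont]]
  by simp

text \<open>Sends the position at time \<open>s\<close> to the transversal by its section and adds a
  free element \<open>h\<close>. Only the future after \<open>s\<close> is recorded, as a point of a
  product space.\<close>

definition recenter :: "'k \<Rightarrow> real \<Rightarrow> (real \<Rightarrow> 'x) \<Rightarrow> real \<Rightarrow> 'x" where
  "recenter h s w = (\<lambda>u\<in>{s..T}. \<alpha> (h \<odot> ginv (S (J2 (w s)))) (w u))"

lemma measurable_angle: "t \<in> {0..T} \<Longrightarrow> (\<lambda>w. J2 (w t)) \<in> path_borel T XT \<rightarrow>\<^sub>M borel_of TQ"
  by (rule measurable_compose[OF measurable_ev_XT continuous_map_measurable[OF continuous_J_J2(2)]])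

lemma measurable_radius: "t \<in> {0..T} \<Longrightarrow> (\<lambda>w. J (w t)) \<in> path_borel T XT \<rightarrow>\<^sub>M borel_of YT"
  by (rule measurable_compose[OF measurable_ev_XT continuous_map_measurable[OF continuous_J_J2(1)]])

lemma measurable_recenter:
  assumes s: "0 \<le> s" "s \<le> T" and h: "h \<in> M"
  shows "recenter h s \<in> path_borel T XT \<rightarrow>\<^sub>M PE s"
  unfolding recenter_def[abs_def]
proof (rule measurable_restrict)
  fix u assume u: "u \<in> {s..T}"
  have hm: "(\<lambda>_. h) \<in> path_borel T XT \<rightarrow>\<^sub>M borel_of TL" using h M_sub by auto
  show "(\<lambda>w. \<alpha> (h \<odot> ginv (S (J2 (w s)))) (w u)) \<in> path_borel T XT \<rightarrow>\<^sub>M borel_of E"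
    using u s by (intro measurable_alpha measurable_mult_TL measurable_inv_TL hm measurable_ev_E
        measurable_compose[OF measurable_angle measurable_S]) auto
qed

lemma measurable_path_past: "s \<le> T \<Longrightarrow> (\<lambda>w. restrict w {0..s}) \<in> path_borel T XT \<rightarrow>\<^sub>M PP s"
  by (rule measurable_restrict) (auto intro: measurable_ev_E)

definition past_law :: "'x \<Rightarrow> real \<Rightarrow> (real \<Rightarrow> 'x) measure" where
  "past_law x s = distr (density (N x) (indicator (inside x s))) (PP s) (\<lambda>\<omega>. \<lambda>u\<in>{0..s}. ptx x u \<omega>)"

text \<open>\<open>Xo\<close> is a union of orbits, so a fixed group element acts on it by
  homeomorphisms and does not affect whether a path stays in it.\<close>

lemma rcll_on_translate:
  assumes k: "k \<in> G"
  shows "rcll_on a b XT (\<lambda>t. \<alpha> k (w t)) \<Longrightarrow> (\<And>t. t \<in> {a..b} \<Longrightarrow> w t \<in> topspace E) \<Longrightarrow> rcll_on a b XT w"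
    and "rcll_on a b XT w \<Longrightarrow> rcll_on a b XT (\<lambda>t. \<alpha> k (w t))"
proof -
  have c: "continuous_map XT XT (\<alpha> k)" if "k \<in> G" for k
    unfolding XT_def continuous_map_in_subtopology
    using continuous_map_from_subtopology[OF continuous_alpha[OF that]] Xo_alpha[OF that] by auto
  show "rcll_on a b XT w \<Longrightarrow> rcll_on a b XT (\<lambda>t. \<alpha> k (w t))" by (rule rcll_on_compose[OF _ c[OF k]])
  assume 1: "rcll_on a b XT (\<lambda>t. \<alpha> k (w t))" and 2: "\<And>t. t \<in> {a..b} \<Longrightarrow> w t \<in> topspace E"
  have "rcll_on a b XT (\<lambda>t. \<alpha> (ginv k) (\<alpha> k (w t)))" by (rule rcll_on_compose[OF 1 c]) (use k in simp)
  moreover have "\<alpha> (ginv k) (\<alpha> k (w t)) = w t" if "t \<in> {a..b}" for t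
    using k 2[OF that] by (simp add: alpha_mult alpha_one)
  ultimately show "rcll_on a b XT w" using rcll_on_cong by (metis (no_types, lifting))
qed

text \<open>The Markov property at time \<open>s\<close>, with the future brought back to the transversal by the angular
  position at time \<open>s\<close>: by invariance its conditional law depends on the radial position only. The
  extra factor \<open>h\<close> of \<open>M\<close> is invisible because \<open>M\<close> fixes the transversal.\<close>

lemma markov_recenter:
  assumes x: "x \<in> Xo" and s: "0 \<le> s" "s \<le> T" and h: "h \<in> M"
    and \<phi>: "\<phi> \<in> borel_measurable (PP s)" and \<psi>: "\<psi> \<in> borel_measurable (PE s)"
  shows "(\<integral>\<^sup>+w. \<phi> (restrict w {0..s}) * \<psi> (recenter h s w) \<partial>Px x)
    = (\<integral>\<^sup>+a. \<phi> a * (\<integral>\<^sup>+f. indicator (stay s T) f * \<psi> f \<partial>MF.future_law s (Jr (a s))) \<partial>past_law x s)"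
proof -
  have xE: "x \<in> topspace E" using x Xo_E by auto
  interpret killed_invariant_markov E P "N x" p \<xi> x K L \<alpha> using xE by (rule killed)
  have hG: "h \<in> G" using h M_sub by auto
  have T0: "0 \<le> T" using T_pos by simp
  have Yne: "Yo \<noteq> {}" using J_in[OF x] by auto
  have Ene: "topspace E \<noteq> {}" using xE by auto
  define past where "past \<omega> = (\<lambda>u\<in>{0..s}. pt u \<omega>)" for \<omega>
  have mpast: "past \<in> F s \<rightarrow>\<^sub>M PP s" unfolding past_def using measurable_past[OF xE s(1)] .
  have mpastN: "past \<in> N x \<rightarrow>\<^sub>M PP s" using measurable_from_subalg[OF subalgebra_F mpast] .
  \<comment> \<open>Built from total versions so that it is measurable everywhere. It is the
    intended group element as soon as the position at \<open>s\<close> lies in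
    \<open>Xo\<close>.\<close>
  define \<kappa> where "\<kappa> \<omega> = h \<odot> ginv (S (J2r (pt s \<omega>)))" for \<omega>
  have hm: "(\<lambda>_. h) \<in> F s \<rightarrow>\<^sub>M borel_of TL" using hG by auto
  have \<kappa>: "\<kappa> \<in> F s \<rightarrow>\<^sub>M borel_of TL" unfolding \<kappa>_def
    using s by (intro measurable_mult_TL measurable_inv_TL hm measurable_compose[OF measurable_compose[OF measurable_pt measurable_J2r] measurable_S]) auto
  have \<kappa>G: "\<kappa> \<omega> \<in> G" if "\<omega> \<in> space (N x)" for \<omega> using measurable_TL_G[OF \<kappa>] that by simp
  define \<Phi> where "\<Phi> q = indicator (inside x s) (fst q) * \<phi> (past (fst q)) * (indicator (stay s T) (snd q) * \<psi> (snd q))" for q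
  have "(\<lambda>q. indicator (inside x s) (fst q) :: ennreal) \<in> borel_measurable (F s \<Otimes>\<^sub>M PE s)"
    by (rule measurable_compose[OF measurable_fst borel_measurable_indicator[OF inside_measurable(1)[OF xE s(1)]]])
  moreover have "(\<lambda>q. \<phi> (past (fst q))) \<in> borel_measurable (F s \<Otimes>\<^sub>M PE s)"
    by (rule measurable_compose[OF measurable_compose[OF measurable_fst mpast] \<phi>])
  moreover have "(\<lambda>q. indicator (stay s T) (snd q) :: ennreal) \<in> borel_measurable (F s \<Otimes>\<^sub>M PE s)"
    by (rule measurable_compose[OF measurable_snd borel_measurable_indicator[OF stay(1)[OF s(2)]]])
  moreover have "(\<lambda>q. \<psi> (snd q)) \<in> borel_measurable (F s \<Otimes>\<^sub>M PE s)"
    by (rule measurable_compose[OF measurable_snd \<psi>])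
  ultimately have \<Phi>: "\<Phi> \<in> borel_measurable (F s \<Otimes>\<^sub>M PE s)"
    unfolding \<Phi>_def by (intro borel_measurable_times_ennreal)
  define g where "g y = (\<integral>\<^sup>+f. indicator (stay s T) f * \<psi> f \<partial>MF.future_law s y)" for y
  have "(\<lambda>w. \<phi> (restrict w {0..s}) * \<psi> (recenter h s w)) \<in> borel_measurable (path_borel T XT)"
    by (intro borel_measurable_times_ennreal measurable_compose[OF measurable_path_past[OF s(2)] \<phi>] measurable_compose[OF measurable_recenter[OF s h] \<psi>])
  then have "(\<integral>\<^sup>+w. \<phi> (restrict w {0..s}) * \<psi> (recenter h s w) \<partial>Px x)
    = (\<integral>\<^sup>+\<omega>. indicator (inside x T) \<omega> * (\<phi> (restrict (pathof \<omega>) {0..s}) * \<psi> (recenter h s (pathof \<omega>))) \<partial>N x)"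
    by (rule nn_integral_Px[OF xE])
  also have "\<dots> = (\<integral>\<^sup>+\<omega>. indicator (alive T) \<omega> * \<Phi> (\<omega>, \<lambda>u\<in>{s..T}. \<alpha> (\<kappa> \<omega>) (pt u \<omega>)) \<partial>N x)"
  proof (rule nn_integral_cong)
    fix \<omega> assume w: "\<omega> \<in> space (N x)"
    show "indicator (inside x T) \<omega> * (\<phi> (restrict (pathof \<omega>) {0..s}) * \<psi> (recenter h s (pathof \<omega>)))
      = indicator (alive T) \<omega> * \<Phi> (\<omega>, \<lambda>u\<in>{s..T}. \<alpha> (\<kappa> \<omega>) (pt u \<omega>))"
    proof (cases "\<omega> \<in> alive T")
      case False
      then show ?thesis using inside_iff[OF xE T0] by simp
    next
      case aT: True
      then have as: "\<omega> \<in> alive s" using alive_mono[OF s(2)] by auto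
      have pt: "pt u \<omega> = p u \<omega>" if "u \<le> T" for u using ptx_eq[OF xE aT that] .
      have rE: "rcll_on 0 T E (\<lambda>t. p t \<omega>)" using aT alv_iff[OF xE] T0 by (intro rcll_process_path[OF xE]) auto
      let ?U = "\<lambda>u\<in>{s..T}. \<alpha> (\<kappa> \<omega>) (pt u \<omega>)"
      have Ueq: "?U = restrict (\<lambda>u. \<alpha> (\<kappa> \<omega>) (p u \<omega>)) {s..T}" using pt by (auto intro!: restrict_ext)
      have rs: "rcll_on s T E (\<lambda>t. p t \<omega>)" using rcll_on_subinterval[OF rE s(1) order_refl] .
      have rU: "rcll_on s T E (\<lambda>u. \<alpha> (\<kappa> \<omega>) (p u \<omega>))"
        by (rule rcll_on_compose[OF rs continuous_alpha[OF \<kappa>G[OF w]]])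
      have st: "?U \<in> stay s T \<longleftrightarrow> rcll_on s T XT (\<lambda>t. p t \<omega>)"
        unfolding Ueq stay(2)[OF s(2) rU]
        using rcll_on_translate[OF \<kappa>G[OF w], of s T "\<lambda>t. p t \<omega>"] rs by (auto simp: rcll_on_def[of s T E])
      \<comment> \<open>The survival event factors: staying in \<open>Xo\<close> up to
        \<open>s\<close> is a condition on the past, and staying there afterwards is one on the
        moved future, since moving by \<open>\<kappa> \<omega>\<close> preserves
        \<open>Xo\<close>.\<close>
      have ins: "\<omega> \<in> inside x T \<longleftrightarrow> \<omega> \<in> inside x s \<and> ?U \<in> stay s T"
        unfolding inside_iff[OF xE T0] inside_iff[OF xE s(1)] st using aT as rcll_on_concat[OF s] by blast
      show ?thesis
      proof (cases "\<omega> \<in> inside x T")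
        case False
        then show ?thesis using ins by (auto simp: \<Phi>_def)
      next
        case True
        then have i: "\<omega> \<in> inside x s" "?U \<in> stay s T" using ins by auto
        have "p s \<omega> \<in> Xo" using i(1) inside_iff[OF xE s(1)] s by (auto simp: rcll_on_def)
        then have "\<kappa> \<omega> = h \<odot> ginv (S (J2 (p s \<omega>)))" using pt[OF s(2)] by (simp add: \<kappa>_def J2r_def)
        then have "recenter h s (pathof \<omega>) = ?U"
          using s pt by (auto simp: recenter_def pathof_def intro!: restrict_ext)
        moreover have "restrict (pathof \<omega>) {0..s} = past \<omega>"
          using s pt by (auto simp: past_def pathof_def intro!: restrict_ext)
        ultimately show ?thesis using True aT i by (simp add: \<Phi>_def)
      qed
    qed
  qed
  also have "\<dots> = (\<integral>\<^sup>+\<omega>. indicator (alive s) \<omega> * (\<integral>\<^sup>+f. \<Phi> (\<omega>, f) \<partial>MF.future_law s (\<alpha> (\<kappa> \<omega>) (pt s \<omega>))) \<partial>N x)"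
    by (rule MF.markov_future[OF xE s \<kappa> \<Phi>])
  also have "\<dots> = (\<integral>\<^sup>+\<omega>. indicator (inside x s) \<omega> * (\<phi> (past \<omega>) * g (Jr (past \<omega> s))) \<partial>N x)"
  proof (rule nn_integral_cong)
    fix \<omega> assume w: "\<omega> \<in> space (N x)"
    show "indicator (alive s) \<omega> * (\<integral>\<^sup>+f. \<Phi> (\<omega>, f) \<partial>MF.future_law s (\<alpha> (\<kappa> \<omega>) (pt s \<omega>)))
      = indicator (inside x s) \<omega> * (\<phi> (past \<omega>) * g (Jr (past \<omega> s)))"
    proof (cases "\<omega> \<in> inside x s")
      case True
      then have as: "\<omega> \<in> alive s" by (simp add: inside_def)
      have ps: "past \<omega> s = pt s \<omega>" "pt s \<omega> = p s \<omega>" using s ptx_eq[OF xE as order_refl] by (auto simp: past_def)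
      have Xs: "p s \<omega> \<in> Xo" using True inside_iff[OF xE s(1)] s by (auto simp: rcll_on_def)
      \<comment> \<open>The moved position at time \<open>s\<close> is a point of the transversal,
        which \<open>h\<close> fixes. So the future law starts from the radial position, and
        \<open>h\<close> disappears from the right-hand side.\<close>
      have "\<alpha> (\<kappa> \<omega>) (pt s \<omega>) = \<alpha> h (\<alpha> (ginv (S (J2 (p s \<omega>)))) (p s \<omega>))"
        using Xs Xo_E hG J2_in[OF Xs] ps by (simp add: \<kappa>_def J2r_def alpha_mult subset_eq)
      also have "\<dots> = J (p s \<omega>)" using decompose(2)[OF Xs] stab_M[OF J_in[OF Xs] h] by simp
      also have "\<dots> = Jr (past \<omega> s)" using Xs ps by (simp add: Jr_def)
      finally have e: "\<alpha> (\<kappa> \<omega>) (pt s \<omega>) = Jr (past \<omega> s)" .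
      have mf: "(\<lambda>f. indicator (stay s T) f * \<psi> f) \<in> borel_measurable (MF.future_law s (Jr (past \<omega> s)))"
        using stay(1)[OF s(2)] \<psi> by (simp cong: measurable_cong_sets)
      show ?thesis unfolding e \<Phi>_def fst_conv snd_conv g_def
        using True as nn_integral_cmult[OF mf] by simp
    next
      case False
      then show ?thesis by (simp add: \<Phi>_def)
    qed
  qed
  also have "\<dots> = (\<integral>\<^sup>+a. \<phi> a * g (Jr (a s)) \<partial>past_law x s)"
  proof -
    have gm: "g \<in> borel_measurable (borel_of E)"
      unfolding g_def using stay(1)[OF s(2)] \<psi>
      by (intro measurable_compose[OF MF.measurable_future_law[OF s(2) Ene] nn_integral_measurable_subprob_algebra]) simp
    have JE: "Jr \<in> borel_of E \<rightarrow>\<^sub>M borel_of E"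
      using measurable_Jr[OF Yne] measurable_borel_of_subtopologyD[of _ _ E Yo] unfolding YT_def by blast
    have m: "(\<lambda>a. \<phi> a * g (Jr (a s))) \<in> borel_measurable (PP s)"
      using s by (intro borel_measurable_times_ennreal \<phi> measurable_compose[OF measurable_compose[OF measurable_component_singleton[where M="\<lambda>_. borel_of E"] JE] gm]) auto
    have md: "past \<in> density (N x) (indicator (inside x s)) \<rightarrow>\<^sub>M PP s" using mpastN by simp
    have "(\<integral>\<^sup>+a. \<phi> a * g (Jr (a s)) \<partial>past_law x s) = (\<integral>\<^sup>+\<omega>. \<phi> (past \<omega>) * g (Jr (past \<omega> s)) \<partial>density (N x) (indicator (inside x s)))"
      unfolding past_law_def past_def[abs_def, symmetric] by (rule nn_integral_distr[OF md]) (use m in simp)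
    also have "\<dots> = (\<integral>\<^sup>+\<omega>. indicator (inside x s) \<omega> * (\<phi> (past \<omega>) * g (Jr (past \<omega> s))) \<partial>N x)"
      using inside_measurable(2)[OF xE s(1)] measurable_compose[OF mpastN m] by (intro nn_integral_density) auto
    finally show ?thesis by simp
  qed
  finally show ?thesis unfolding g_def .
qed

end

section \<open>The conditional law of the angular part\<close>

context radial_decomposition
begin

abbreviation PY where "PY s \<equiv> PiM {s..T} (\<lambda>_. borel_of YT)"

definition radial_future :: "real \<Rightarrow> (real \<Rightarrow> 'x) \<Rightarrow> real \<Rightarrow> 'x" where
  "radial_future s w = (\<lambda>u\<in>{s..T}. J (w u))"

definition angle_increment :: "real \<Rightarrow> real \<Rightarrow> (real \<Rightarrow> 'x) \<Rightarrow> 'k set" where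
  "angle_increment s t w = ginv (S (J2 (w s))) \<rhd> J2 (w t)"

lemma path_in_Xo: "w \<in> D \<Longrightarrow> t \<in> {0..T} \<Longrightarrow> w t \<in> Xo"
  by (auto simp: rcll_paths_iff rcll_on_def)

text \<open>The radial and angular parts are respectively invariant and equivariant under
  \<open>K\<close>. Hence the radial future and the increment moved by \<open>h\<close> are
  functionals of the recentred path, to which the Markov property applies.\<close>

lemma recenter_parts:
  assumes w: "w \<in> D" and s: "0 \<le> s" "s \<le> T" and h: "h \<in> M" and u: "u \<in> {s..T}"
  shows "Jr (recenter h s w u) = J (w u)" "J2r (recenter h s w u) = h \<rhd> angle_increment s u w"
proof -
  have X: "w s \<in> Xo" "w u \<in> Xo" using path_in_Xo[OF w] s u by auto
  have hG: "h \<in> G" using h M_sub by auto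
  have sG: "ginv (S (J2 (w s))) \<in> G" using J2_in[OF X(1)] by simp
  have "recenter h s w u = \<alpha> (h \<odot> ginv (S (J2 (w s)))) (w u)" using u by (simp add: recenter_def)
  moreover have "h \<odot> ginv (S (J2 (w s))) \<in> G" using hG sG by simp
  ultimately show "Jr (recenter h s w u) = J (w u)" "J2r (recenter h s w u) = h \<rhd> angle_increment s u w"
    using X Xo_alpha J_alpha J2_alpha act_act[OF hG sG J2_in[OF X(2)]]
    by (simp_all add: Jr_def J2r_def angle_increment_def)
qed

lemma measurable_radial_future: "0 \<le> s \<Longrightarrow> radial_future s \<in> path_borel T XT \<rightarrow>\<^sub>M PY s"
  unfolding radial_future_def[abs_def] by (rule measurable_restrict) (auto intro: measurable_radius)

lemma measurable_angle_increment:
  "s \<in> {0..T} \<Longrightarrow> t \<in> {0..T} \<Longrightarrow> angle_increment s t \<in> path_borel T XT \<rightarrow>\<^sub>M borel_of TQ"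
  unfolding angle_increment_def[abs_def]
  by (intro measurable_act measurable_inv_TL measurable_compose[OF measurable_angle measurable_S] measurable_angle)

lemma sets_past_law [simp, measurable_cong]: "sets (past_law x s) = sets (PP s)" by (simp add: past_law_def)

lemma finite_past_law:
  assumes x: "x \<in> topspace E" and s: "0 \<le> s" shows "finite_measure (past_law x s)"
proof -
  interpret killed_invariant_markov E P "N x" p \<xi> x K L \<alpha> using x by (rule killed)
  have "finite_measure (density (N x) (indicator (inside x s)))"
    using inside_measurable(2)[OF x s] by (intro finite_measure_density_bounded) (auto split: split_indicator simp: N.finite_measure_axioms)
  moreover have "(\<lambda>\<omega>. \<lambda>u\<in>{0..s}. pt u \<omega>) \<in> density (N x) (indicator (inside x s)) \<rightarrow>\<^sub>M PP s"
    using measurable_from_subalg[OF subalgebra_F measurable_past[OF x s]] by simp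
  ultimately show ?thesis unfolding past_law_def by (rule finite_measure.finite_measure_distr)
qed

text \<open>The right-hand side of \<open>markov_recenter\<close> does not involve \<open>h\<close> and depends on the past only
  through the radial position. This gives at once the conditional independence of the increment
  from the past given the radial future, and the \<open>M\<close>-invariance of its conditional law \<open>b\<close>.\<close>

lemma conditional_increment:
  assumes x: "x \<in> Xo" and st: "0 \<le> s" "s < t" "t \<le> T" and B: "B \<in> sets (borel_of TQ)"
  obtains b where "b \<in> borel_measurable (PY s)"
    "\<And>h A C. h \<in> M \<Longrightarrow> A \<in> sets (PP s) \<Longrightarrow> C \<in> sets (PY s) \<Longrightarrow>
      emeasure (Px x) {w \<in> D. restrict w {0..s} \<in> A \<and> radial_future s w \<in> C \<and> h \<rhd> angle_increment s t w \<in> B}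
      = (\<integral>\<^sup>+w. indicator A (restrict w {0..s}) * (indicator C (radial_future s w) * b (radial_future s w)) \<partial>Px x)"
proof -
  have xE: "x \<in> topspace E" using x Xo_E by auto
  have sT: "s \<le> T" "s \<in> {0..T}" "t \<in> {0..T}" "t \<in> {s..T}" "s \<in> {s..T}" using st by auto
  have Yne: "Yo \<noteq> {}" using J_in[OF x] by auto
  have Ene: "topspace E \<noteq> {}" using xE by auto
  interpret P: finite_measure "Px x" by (rule finite_Px[OF xE])
  have mr: "radial_future s \<in> Px x \<rightarrow>\<^sub>M PY s" using measurable_radial_future[OF st(1)] by (simp cong: measurable_cong_sets)
  have mi: "angle_increment s t \<in> Px x \<rightarrow>\<^sub>M borel_of TQ" using measurable_angle_increment[OF sT(2,3)] by (simp cong: measurable_cong_sets)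
  have mp: "(\<lambda>w. restrict w {0..s}) \<in> Px x \<rightarrow>\<^sub>M PP s" using measurable_path_past[OF sT(1)] by (simp cong: measurable_cong_sets)
  have mB: "(\<lambda>w. indicator B (angle_increment s t w) :: ennreal) \<in> borel_measurable (Px x)"
    using B by (intro measurable_compose[OF mi]) simp
  \<comment> \<open>The law of the radial future, and below its restriction \<open>\<nu>\<close> to
    paths with increment in \<open>B\<close>. The second is dominated by the first, so a density
    exists.\<close>
  define R where "R = distr (Px x) (PY s) (radial_future s)"
  define \<nu> where "\<nu> = distr (density (Px x) (\<lambda>w. indicator B (angle_increment s t w))) (PY s) (radial_future s)"
  have sR [simp, measurable_cong]: "sets R = sets (PY s)" "sets \<nu> = sets (PY s)" by (simp_all add: R_def \<nu>_def)
  interpret R: finite_measure R unfolding R_def by (rule P.finite_measure_distr[OF mr])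
  have \<nu>C: "emeasure \<nu> C = (\<integral>\<^sup>+w. indicator C (radial_future s w) * indicator B (angle_increment s t w) \<partial>Px x)"
    if C: "C \<in> sets (PY s)" for C
  proof -
    have "emeasure \<nu> C = emeasure (density (Px x) (\<lambda>w. indicator B (angle_increment s t w))) (radial_future s -` C \<inter> space (Px x))"
      unfolding \<nu>_def using mr C by (subst emeasure_distr) auto
    also have "\<dots> = (\<integral>\<^sup>+w. indicator B (angle_increment s t w) * indicator (radial_future s -` C \<inter> space (Px x)) w \<partial>Px x)"
      by (rule emeasure_density[OF mB measurable_sets[OF mr C]])
    also have "\<dots> = (\<integral>\<^sup>+w. indicator C (radial_future s w) * indicator B (angle_increment s t w) \<partial>Px x)"
      by (rule nn_integral_cong) (auto split: split_indicator)
    finally show ?thesis .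
  qed
  have RC: "emeasure R C = (\<integral>\<^sup>+w. indicator C (radial_future s w) \<partial>Px x)" if C: "C \<in> sets (PY s)" for C
  proof -
    have "emeasure R C = (\<integral>\<^sup>+y. indicator C y \<partial>R)" using C by simp
    also have "\<dots> = (\<integral>\<^sup>+w. indicator C (radial_future s w) \<partial>Px x)"
      unfolding R_def using C by (intro nn_integral_distr[OF mr]) simp
    finally show ?thesis .
  qed
  have ac: "absolutely_continuous R \<nu>" unfolding absolutely_continuous_def
  proof
    fix C assume C: "C \<in> null_sets R"
    then have C': "C \<in> sets (PY s)" "emeasure R C = 0" by auto
    have "emeasure \<nu> C \<le> emeasure R C"
      unfolding \<nu>C[OF C'(1)] RC[OF C'(1)] by (intro nn_integral_mono) (auto split: split_indicator)
    then show "C \<in> null_sets \<nu>" using C' by auto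
  qed
  \<comment> \<open>The conditional probability that the increment lies in \<open>B\<close>, given
    the radial future only. What remains is to show that the past and \<open>h\<close> do not change
    it.\<close>
  define b where "b = RN_deriv R \<nu>"
  have bm: "b \<in> borel_measurable (PY s)" unfolding b_def using borel_measurable_RN_deriv[of R \<nu>] by (simp cong: measurable_cong_sets)
  have bC: "(\<integral>\<^sup>+w. indicator C (radial_future s w) * indicator B (angle_increment s t w) \<partial>Px x)
      = (\<integral>\<^sup>+w. indicator C (radial_future s w) * b (radial_future s w) \<partial>Px x)" if C: "C \<in> sets (PY s)" for C
  proof -
    have "density R b = \<nu>" unfolding b_def using R.density_RN_deriv[OF ac] by simp
    then have "emeasure \<nu> C = (\<integral>\<^sup>+y. b y * indicator C y \<partial>R)"
      using emeasure_density[of b R C] bm C by simp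
    also have "\<dots> = (\<integral>\<^sup>+w. b (radial_future s w) * indicator C (radial_future s w) \<partial>Px x)"
      unfolding R_def using bm C by (intro nn_integral_distr[OF mr]) simp
    finally show ?thesis using \<nu>C[OF C] by (simp add: mult.commute)
  qed
  define jf where "jf f = (\<lambda>u\<in>{s..T}. Jr (f u))" for f :: "real \<Rightarrow> 'x"
  have jfm: "jf \<in> PE s \<rightarrow>\<^sub>M PY s" unfolding jf_def[abs_def]
    by (rule measurable_restrict) (auto intro!: measurable_compose[OF measurable_component_singleton[where M="\<lambda>_. borel_of E"] measurable_Jr[OF Yne]])
  have jf_rec: "jf (recenter h s w) = radial_future s w" if "w \<in> D" "h \<in> M" for h w
    unfolding jf_def radial_future_def using recenter_parts(1)[OF that(1) st(1) sT(1) that(2)] by (intro restrict_ext)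
  have JE: "Jr \<in> borel_of E \<rightarrow>\<^sub>M borel_of E"
    using measurable_Jr[OF Yne] measurable_borel_of_subtopologyD[of _ _ E Yo] unfolding YT_def by blast
  have js: "(\<lambda>a. Jr (a s)) \<in> PP s \<rightarrow>\<^sub>M borel_of E"
    using st by (intro measurable_compose[OF measurable_component_singleton[where M="\<lambda>_. borel_of E"] JE]) auto
  \<comment> \<open>The same event with the actual increment and with its conditional probability,
    both written as functionals of the recentred future.\<close>
  define \<psi>1 \<psi>2 where "\<psi>1 C f = indicator C (jf f) * (indicator B (J2r (f t)) :: ennreal)"
    and "\<psi>2 C f = indicator C (jf f) * b (jf f)" for C f
  have \<psi>1m: "\<psi>1 C \<in> borel_measurable (PE s)" and \<psi>2m: "\<psi>2 C \<in> borel_measurable (PE s)" if C: "C \<in> sets (PY s)" for C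
  proof -
    have "(\<lambda>f. indicator C (jf f) :: ennreal) \<in> borel_measurable (PE s)"
      by (rule measurable_compose[OF jfm]) (use C in simp)
    moreover have "(\<lambda>f. indicator B (J2r (f t)) :: ennreal) \<in> borel_measurable (PE s)"
      using B sT by (intro measurable_compose[OF measurable_compose[OF measurable_component_singleton[where M="\<lambda>_. borel_of E"] measurable_J2r]]) auto
    ultimately show "\<psi>1 C \<in> borel_measurable (PE s)" "\<psi>2 C \<in> borel_measurable (PE s)"
      unfolding \<psi>1_def[abs_def] \<psi>2_def[abs_def] using measurable_compose[OF jfm bm] by auto
  qed
  define \<Psi> where "\<Psi> \<psi> y = (\<integral>\<^sup>+f. indicator (stay s T) f * \<psi> f \<partial>MF.future_law s y)" for \<psi> y
  have \<Psi>m: "\<Psi> \<psi> \<in> borel_measurable (borel_of E)" if "\<psi> \<in> borel_measurable (PE s)" for \<psi>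
    unfolding \<Psi>_def[abs_def] using stay(1)[OF sT(1)] that
    by (intro measurable_compose[OF MF.measurable_future_law[OF sT(1) Ene] nn_integral_measurable_subprob_algebra]) simp
  have past1: "(\<integral>\<^sup>+w. \<phi> (restrict w {0..s}) * (indicator C (radial_future s w) * indicator B (h \<rhd> angle_increment s t w)) \<partial>Px x)
      = (\<integral>\<^sup>+a. \<phi> a * \<Psi> (\<psi>1 C) (Jr (a s)) \<partial>past_law x s)"
    if "h \<in> M" "\<phi> \<in> borel_measurable (PP s)" "C \<in> sets (PY s)" for h \<phi> C
    unfolding \<Psi>_def markov_recenter[OF x st(1) sT(1) that(1,2) \<psi>1m[OF that(3)], symmetric]
    using recenter_parts(2)[OF _ st(1) sT(1) that(1) sT(4)] jf_rec[OF _ that(1)]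
    by (intro nn_integral_cong) (simp add: \<psi>1_def)
  have one: "\<one>\<^bsub>K\<^esub> \<in> M" using M_subgroup by (rule subgroup.one_closed)
  have past2: "(\<integral>\<^sup>+w. \<phi> (restrict w {0..s}) * (indicator C (radial_future s w) * b (radial_future s w)) \<partial>Px x)
      = (\<integral>\<^sup>+a. \<phi> a * \<Psi> (\<psi>2 C) (Jr (a s)) \<partial>past_law x s)"
    if "\<phi> \<in> borel_measurable (PP s)" "C \<in> sets (PY s)" for \<phi> C
    unfolding \<Psi>_def markov_recenter[OF x st(1) sT(1) one that(1) \<psi>2m[OF that(2)], symmetric]
    using jf_rec[OF _ one] by (intro nn_integral_cong) (simp add: \<psi>2_def)
  \<comment> \<open>Both sides are functions of the radial position at \<open>s\<close>. It is
    therefore enough to compare them on events \<open>U\<close> of this position, with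
    \<open>h\<close> the unit.\<close>
  have AE_eq: "AE a in past_law x s. \<Psi> (\<psi>1 C) (Jr (a s)) = \<Psi> (\<psi>2 C) (Jr (a s))" if C: "C \<in> sets (PY s)" for C
  proof -
    define \<Lambda> where "\<Lambda> = distr (past_law x s) (borel_of E) (\<lambda>a. Jr (a s))"
    have js': "(\<lambda>a. Jr (a s)) \<in> past_law x s \<rightarrow>\<^sub>M borel_of E" using js by (simp cong: measurable_cong_sets)
    interpret L: finite_measure \<Lambda> unfolding \<Lambda>_def
      by (rule finite_measure.finite_measure_distr[OF finite_past_law[OF xE st(1)] js'])
    have s\<Lambda> [simp, measurable_cong]: "sets \<Lambda> = sets (borel_of E)" by (simp add: \<Lambda>_def)
    have \<Psi>\<Lambda>: "\<Psi> (\<psi>1 C) \<in> borel_measurable \<Lambda>" "\<Psi> (\<psi>2 C) \<in> borel_measurable \<Lambda>"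
      using \<Psi>m[OF \<psi>1m[OF C]] \<Psi>m[OF \<psi>2m[OF C]] by (simp_all cong: measurable_cong_sets)
    have "density \<Lambda> (\<Psi> (\<psi>1 C)) = density \<Lambda> (\<Psi> (\<psi>2 C))"
    proof (rule measure_eqI)
      fix U assume "U \<in> sets (density \<Lambda> (\<Psi> (\<psi>1 C)))"
      then have U: "U \<in> sets (borel_of E)" by simp
      have dens: "emeasure (density \<Lambda> (\<Psi> \<psi>)) U = (\<integral>\<^sup>+a. indicator U (Jr (a s)) * \<Psi> \<psi> (Jr (a s)) \<partial>past_law x s)"
        if "\<psi> \<in> borel_measurable (PE s)" for \<psi>
      proof -
        have "emeasure (density \<Lambda> (\<Psi> \<psi>)) U = (\<integral>\<^sup>+y. \<Psi> \<psi> y * indicator U y \<partial>\<Lambda>)"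
          using U \<Psi>m[OF that] by (intro emeasure_density) (simp_all cong: measurable_cong_sets)
        also have "\<dots> = (\<integral>\<^sup>+a. \<Psi> \<psi> (Jr (a s)) * indicator U (Jr (a s)) \<partial>past_law x s)"
          unfolding \<Lambda>_def using U \<Psi>m[OF that] by (intro nn_integral_distr[OF js']) simp
        finally show ?thesis by (simp add: mult.commute)
      qed
      have \<phi>: "(\<lambda>a. indicator U (Jr (a s)) :: ennreal) \<in> borel_measurable (PP s)"
        by (rule measurable_compose[OF js]) (use U in simp)
      \<comment> \<open>The time \<open>s\<close> belongs to the radial future, so a condition on
        the radial position at \<open>s\<close> can be included in the future event; then the
        defining property of \<open>b\<close> applies.\<close>
      define C' where "C' = C \<inter> ((\<lambda>g. g s) -` U \<inter> space (PY s))"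
      have gs: "(\<lambda>g. g s) \<in> PY s \<rightarrow>\<^sub>M borel_of E"
        using measurable_component_singleton[OF sT(5), of "\<lambda>_. borel_of YT"] measurable_borel_of_subtopologyD[of _ _ E Yo]
        unfolding YT_def by blast
      have C': "C' \<in> sets (PY s)" unfolding C'_def using C measurable_sets[OF gs U] by auto
      have split: "indicator U (Jr (restrict w {0..s} s)) * (indicator C (radial_future s w) * c) = (indicator C' (radial_future s w) * c :: ennreal)"
        if w: "w \<in> D" for w c
      proof -
        have "radial_future s w \<in> space (PY s)" using measurable_space[OF mr, of w] w by simp
        moreover have "radial_future s w s = Jr (restrict w {0..s} s)"
          using path_in_Xo[OF w sT(2)] sT st by (simp add: radial_future_def Jr_def)
        ultimately show ?thesis by (auto simp: C'_def split: split_indicator)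
      qed
      have "emeasure (density \<Lambda> (\<Psi> (\<psi>1 C))) U
        = (\<integral>\<^sup>+w. indicator U (Jr (restrict w {0..s} s)) * (indicator C (radial_future s w) * indicator B (\<one>\<^bsub>K\<^esub> \<rhd> angle_increment s t w)) \<partial>Px x)"
        unfolding dens[OF \<psi>1m[OF C]] by (rule past1[OF one \<phi> C, symmetric])
      also have "\<dots> = (\<integral>\<^sup>+w. indicator C' (radial_future s w) * indicator B (angle_increment s t w) \<partial>Px x)"
        using split act_one measurable_TQ_C[OF mi] by (intro nn_integral_cong) simp
      also have "\<dots> = (\<integral>\<^sup>+w. indicator C' (radial_future s w) * b (radial_future s w) \<partial>Px x)" by (rule bC[OF C'])
      also have "\<dots> = (\<integral>\<^sup>+w. indicator U (Jr (restrict w {0..s} s)) * (indicator C (radial_future s w) * b (radial_future s w)) \<partial>Px x)"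
        using split by (intro nn_integral_cong) simp
      also have "\<dots> = emeasure (density \<Lambda> (\<Psi> (\<psi>2 C))) U"
        unfolding dens[OF \<psi>2m[OF C]] by (rule past2[OF \<phi> C])
      finally show "emeasure (density \<Lambda> (\<Psi> (\<psi>1 C))) U = emeasure (density \<Lambda> (\<Psi> (\<psi>2 C))) U" .
    qed simp
    then have "AE y in \<Lambda>. \<Psi> (\<psi>1 C) y = \<Psi> (\<psi>2 C) y" by (rule L.density_unique[OF \<Psi>\<Lambda>])
    then show ?thesis unfolding \<Lambda>_def by (rule AE_distrD[OF js'])
  qed
  have "emeasure (Px x) {w \<in> D. restrict w {0..s} \<in> A \<and> radial_future s w \<in> C \<and> h \<rhd> angle_increment s t w \<in> B}
      = (\<integral>\<^sup>+w. indicator A (restrict w {0..s}) * (indicator C (radial_future s w) * b (radial_future s w)) \<partial>Px x)"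
    if h: "h \<in> M" and A: "A \<in> sets (PP s)" and C: "C \<in> sets (PY s)" for h A C
  proof -
    let ?V = "{w \<in> D. restrict w {0..s} \<in> A \<and> radial_future s w \<in> C \<and> h \<rhd> angle_increment s t w \<in> B}"
    have hi: "(\<lambda>w. h \<rhd> angle_increment s t w) \<in> Px x \<rightarrow>\<^sub>M borel_of TQ"
      by (rule measurable_compose[OF mi continuous_map_measurable[OF continuous_act_const]]) (use h M_sub in auto)
    have "?V = ((\<lambda>w. restrict w {0..s}) -` A \<inter> space (Px x)) \<inter> (radial_future s -` C \<inter> space (Px x))
        \<inter> ((\<lambda>w. h \<rhd> angle_increment s t w) -` B \<inter> space (Px x))" by auto
    then have V: "?V \<in> sets (Px x)"
      by (simp only: sets.Int[OF sets.Int[OF measurable_sets[OF mp A] measurable_sets[OF mr C]] measurable_sets[OF hi B]])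
    have "emeasure (Px x) ?V = (\<integral>\<^sup>+w. indicator ?V w \<partial>Px x)" using V by simp
    also have "\<dots> = (\<integral>\<^sup>+w. indicator A (restrict w {0..s}) * (indicator C (radial_future s w) * indicator B (h \<rhd> angle_increment s t w)) \<partial>Px x)"
      by (rule nn_integral_cong) (auto split: split_indicator)
    also have "\<dots> = (\<integral>\<^sup>+a. indicator A a * \<Psi> (\<psi>1 C) (Jr (a s)) \<partial>past_law x s)"
      by (rule past1[OF h _ C]) (use A in simp)
    also have "\<dots> = (\<integral>\<^sup>+a. indicator A a * \<Psi> (\<psi>2 C) (Jr (a s)) \<partial>past_law x s)"
      by (rule nn_integral_cong_AE) (use AE_eq[OF C] in auto)
    also have "\<dots> = (\<integral>\<^sup>+w. indicator A (restrict w {0..s}) * (indicator C (radial_future s w) * b (radial_future s w)) \<partial>Px x)"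
      by (rule past2[OF _ C, symmetric]) (use A in simp)
    finally show ?thesis .
  qed
  then show thesis by (rule that[OF bm])
qed

end

text \<open>Borel sets of paths are written as traces of product sets. In this way they can be
  combined with laws on the full product space without measurability of the path space in
  it.\<close>

lemma (in path_space) path_set_trace:
  assumes "H \<in> sets (path_borel T E)"
  obtains H' where "H' \<in> sets (PiM {0..T} (\<lambda>_. borel_of E))" "H = {v \<in> D. v \<in> H'}"
proof -
  let ?P = "PiM {0..T} (\<lambda>_. borel_of E)"
  have sp: "D \<subseteq> space ?P" by (auto simp: rcll_paths_def space_PiM)
  have "H \<in> sigma_sets D {{w \<in> D. w t \<in> B} | t B. t \<in> {0..T} \<and> B \<in> sets (borel_of E)}"
    using assms sets_path_borel sets_coordinate_algebra by simp
  then have "\<exists>H'\<in>sets ?P. H = {v \<in> D. v \<in> H'}"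
  proof induction
    case (Basic a)
    then obtain t B where tB: "a = {w \<in> D. w t \<in> B}" "t \<in> {0..T}" "B \<in> sets (borel_of E)" by blast
    have "(\<lambda>f. f t) -` B \<inter> space ?P \<in> sets ?P"
      using measurable_sets[OF measurable_component_singleton[where M="\<lambda>_. borel_of E", OF tB(2)] tB(3)] .
    moreover have "a = {v \<in> D. v \<in> (\<lambda>f. f t) -` B \<inter> space ?P}" using tB(1) sp by auto
    ultimately show ?case by blast
  next
    case Empty then show ?case by (intro bexI[of _ "{}"]) auto
  next
    case (Compl a)
    then obtain H' where H': "H' \<in> sets ?P" "a = {v \<in> D. v \<in> H'}" by (elim bexE)
    have "D - a = {v \<in> D. v \<in> space ?P - H'}" unfolding H'(2) using sp by auto
    then show ?case using H'(1) by (intro bexI[of _ "space ?P - H'"]) auto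
  next
    case (Union a)
    then have "\<forall>i. \<exists>H'. H' \<in> sets ?P \<and> a i = {v \<in> D. v \<in> H'}" by (simp only: Bex_def) simp
    from choice[OF this] obtain H' where H0: "\<forall>i. H' i \<in> sets ?P \<and> a i = {v \<in> D. v \<in> H' i}" by (elim exE)
    have H': "\<And>i. H' i \<in> sets ?P" "\<And>i. a i = {v \<in> D. v \<in> H' i}" using H0 by (simp_all only:)
    have "(\<Union>i. a i) = {v \<in> D. v \<in> (\<Union>i. H' i)}" unfolding H'(2) by auto
    then show ?case using H'(1) by (intro bexI[of _ "\<Union>i. H' i"]) auto
  qed
  then show thesis using that by blast
qed

text \<open>A condition at a single time concerns the past or the future of \<open>s\<close>, so
  rectangles generate, and they are closed under intersection. Identities about the whole radial
  path need to be checked on them only.\<close>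

lemma (in path_space) sets_path_borel_past_future:
  assumes s: "s \<in> {0..T}"
  defines "\<G> \<equiv> {{v \<in> D. restrict v {0..s} \<in> A \<and> restrict v {s..T} \<in> C} | A C.
      A \<in> sets (PiM {0..s} (\<lambda>_. borel_of E)) \<and> C \<in> sets (PiM {s..T} (\<lambda>_. borel_of E))}"
  shows "sets (path_borel T E) = sigma_sets D \<G>" and "Int_stable \<G>" and "\<G> \<subseteq> sets (path_borel T E)" and "D \<in> \<G>"
proof -
  let ?P = "PiM {0..s} (\<lambda>_. borel_of E)" and ?F = "PiM {s..T} (\<lambda>_. borel_of E)"
  have mp: "(\<lambda>v. restrict v {0..s}) \<in> path_borel T E \<rightarrow>\<^sub>M ?P" and mf: "(\<lambda>v. restrict v {s..T}) \<in> path_borel T E \<rightarrow>\<^sub>M ?F"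
    using s by (auto intro!: measurable_restrict_path)
  have sp: "restrict v {0..s} \<in> space ?P" "restrict v {s..T} \<in> space ?F" if "v \<in> D" for v
    using measurable_space[OF mp, of v] measurable_space[OF mf, of v] that by auto
  show sub: "\<G> \<subseteq> sets (path_borel T E)"
  proof
    fix G assume "G \<in> \<G>"
    then obtain A C where AC: "A \<in> sets ?P" "C \<in> sets ?F" "G = {v \<in> D. restrict v {0..s} \<in> A \<and> restrict v {s..T} \<in> C}"
      unfolding \<G>_def by blast
    have "G = ((\<lambda>v. restrict v {0..s}) -` A \<inter> space (path_borel T E)) \<inter> ((\<lambda>v. restrict v {s..T}) -` C \<inter> space (path_borel T E))"
      using AC(3) by auto
    then show "G \<in> sets (path_borel T E)"
      by (simp only: sets.Int[OF measurable_sets[OF mp AC(1)] measurable_sets[OF mf AC(2)]])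
  qed
  show "D \<in> \<G>" unfolding \<G>_def using sp by (intro CollectI exI[of _ "space ?P"] exI[of _ "space ?F"]) auto
  show "Int_stable \<G>"
  proof (rule Int_stableI)
    fix a e assume "a \<in> \<G>" "e \<in> \<G>"
    then obtain A C A' C' where AC: "A \<in> sets ?P" "C \<in> sets ?F" "A' \<in> sets ?P" "C' \<in> sets ?F"
      "a = {v \<in> D. restrict v {0..s} \<in> A \<and> restrict v {s..T} \<in> C}" "e = {v \<in> D. restrict v {0..s} \<in> A' \<and> restrict v {s..T} \<in> C'}"
      unfolding \<G>_def by blast
    then show "a \<inter> e \<in> \<G>" unfolding \<G>_def by (intro CollectI exI[of _ "A \<inter> A'"] exI[of _ "C \<inter> C'"]) auto
  qed
  show "sets (path_borel T E) = sigma_sets D \<G>"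
  proof
    show "sigma_sets D \<G> \<subseteq> sets (path_borel T E)" using sets.sigma_sets_subset[OF sub] by simp
    have "{w \<in> D. w t \<in> B} \<in> \<G>" if t: "t \<in> {0..T}" and B: "B \<in> sets (borel_of E)" for t B
    proof (cases "t \<le> s")
      case True
      then have ts: "t \<in> {0..s}" using t by auto
      let ?A = "(\<lambda>f. f t) -` B \<inter> space ?P"
      have "?A \<in> sets ?P" using measurable_sets[OF measurable_component_singleton[where M="\<lambda>_. borel_of E", OF ts] B] .
      moreover have "{w \<in> D. w t \<in> B} = {v \<in> D. restrict v {0..s} \<in> ?A \<and> restrict v {s..T} \<in> space ?F}" using sp ts by auto
      ultimately show ?thesis unfolding \<G>_def by blast
    next
      case False
      then have ts: "t \<in> {s..T}" using t by auto
      let ?A = "(\<lambda>f. f t) -` B \<inter> space ?F"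
      have "?A \<in> sets ?F" using measurable_sets[OF measurable_component_singleton[where M="\<lambda>_. borel_of E", OF ts] B] .
      moreover have "{w \<in> D. w t \<in> B} = {v \<in> D. restrict v {0..s} \<in> space ?P \<and> restrict v {s..T} \<in> ?A}" using sp ts by auto
      ultimately show ?thesis unfolding \<G>_def by blast
    qed
    then show "sets (path_borel T E) \<subseteq> sigma_sets D \<G>"
      unfolding sets_path_borel sets_coordinate_algebra by (intro sigma_sets_mono) blast
  qed
qed

section \<open>The law of the radial path and the disintegration over it\<close>

context radial_decomposition
begin

abbreviation rad where "rad \<equiv> path_map T J"
abbreviation ang where "ang \<equiv> path_map T J2"
abbreviation radial_law where "radial_law x \<equiv> distr (Px x) (path_borel T YT) rad"

lemma measurable_rad: "rad \<in> path_borel T XT \<rightarrow>\<^sub>M path_borel T YT"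
  by (rule measurable_path_map[OF path_spaces(1,2) continuous_J_J2(1)])

lemma measurable_ang: "ang \<in> path_borel T XT \<rightarrow>\<^sub>M path_borel T TQ"
  by (rule measurable_path_map[OF path_spaces(1,3) continuous_J_J2(2)])

lemma measurable_rad_Px: "rad \<in> Px x \<rightarrow>\<^sub>M path_borel T YT" and measurable_ang_Px: "ang \<in> Px x \<rightarrow>\<^sub>M path_borel T TQ"
  using measurable_rad measurable_ang by (simp_all cong: measurable_cong_sets)

text \<open>At time 0 the process is almost surely alive and at \<open>x\<close>, a point of
  \<open>Xo\<close>; nothing has been lost yet, and the past is a constant.\<close>

lemma nn_integral_past_law_0:
  assumes x: "x \<in> Xo" and g: "g \<in> borel_measurable (borel_of E)"
  shows "(\<integral>\<^sup>+a. g (Jr (a 0)) \<partial>past_law x 0) = g (J x)"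
proof -
  have xE: "x \<in> topspace E" using x Xo_E by auto
  have Yne: "Yo \<noteq> {}" using J_in[OF x] by auto
  note st = start[OF xE]
  interpret killed_invariant_markov E P "N x" p \<xi> x K L \<alpha> using xE by (rule killed)
  have JE: "Jr \<in> borel_of E \<rightarrow>\<^sub>M borel_of E"
    using measurable_Jr[OF Yne] measurable_borel_of_subtopologyD[of _ _ E Yo] unfolding YT_def by blast
  have m: "(\<lambda>a. g (Jr (a 0))) \<in> borel_measurable (PP (0::real))"
    by (rule measurable_compose[OF measurable_compose[OF measurable_component_singleton[where M="\<lambda>_. borel_of E"] JE] g]) simp
  have past: "(\<lambda>\<omega>. \<lambda>u\<in>{0..0}. pt u \<omega>) \<in> N x \<rightarrow>\<^sub>M PP (0::real)"
    using measurable_from_subalg[OF subalgebra_F measurable_past[OF xE order_refl]] .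
  have "(\<integral>\<^sup>+a. g (Jr (a 0)) \<partial>past_law x 0) = (\<integral>\<^sup>+\<omega>. g (Jr (pt 0 \<omega>)) \<partial>density (N x) (indicator (inside x 0)))"
    unfolding past_law_def using past m by (subst nn_integral_distr) auto
  also have "\<dots> = (\<integral>\<^sup>+\<omega>. indicator (inside x 0) \<omega> * g (Jr (pt 0 \<omega>)) \<partial>N x)"
    using inside_measurable(2)[OF xE order_refl] measurable_compose[OF past m] by (intro nn_integral_density) auto
  also have "\<dots> = (\<integral>\<^sup>+\<omega>. g (J x) \<partial>N x)"
  proof (rule nn_integral_cong_AE)
    have "AE \<omega> in N x. \<omega> \<in> space (N x)" by simp
    with st show "AE \<omega> in N x. indicator (inside x 0) \<omega> * g (Jr (pt 0 \<omega>)) = g (J x)"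
    proof eventually_elim
      case (elim \<omega>)
      then have a: "\<omega> \<in> alv x 0" using alv_iff[OF xE] by (simp add: zero_ereal_def)
      have "rcll_on 0 0 XT (\<lambda>t. p t \<omega>)" using elim x by (simp add: rcll_on_def)
      then have "\<omega> \<in> inside x 0" using a inside_iff[OF xE order_refl] by simp
      then show ?case using ptx_eq[OF xE a order_refl] elim x by (simp add: Jr_def)
    qed
  qed
  finally show ?thesis by (simp add: N.emeasure_space_1)
qed

text \<open>The moved form of the Markov property at time 0, with the unit of \<open>M\<close>:
  recentring does not change the radial path, and the result is a function of \<open>J x\<close>
  alone.\<close>

lemma radial_law_eq:
  assumes x: "x \<in> Xo" shows "radial_law x = radial_law (J x)"
proof (rule measure_eqI)
  fix H assume "H \<in> sets (radial_law x)"
  then have H: "H \<in> sets (path_borel T YT)" by simp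
  obtain H' where H': "H' \<in> sets (PiM {0..T} (\<lambda>_. borel_of YT))" "H = {v \<in> rcll_paths T YT. v \<in> H'}"
    by (rule path_space.path_set_trace[OF path_spaces(2) H])
  have T0: "0 \<le> T" using T_pos by simp
  have one: "\<one>\<^bsub>K\<^esub> \<in> M" using M_subgroup by (rule subgroup.one_closed)
  have Yne: "Yo \<noteq> {}" and Ene: "topspace E \<noteq> {}" using J_in[OF x] Yo_E by auto
  have jfm: "(\<lambda>f. \<lambda>u\<in>{0..T}. Jr (f u)) \<in> PE 0 \<rightarrow>\<^sub>M PiM {0..T} (\<lambda>_. borel_of YT)"
    by (rule measurable_restrict) (auto intro!: measurable_compose[OF measurable_component_singleton[where M="\<lambda>_. borel_of E"] measurable_Jr[OF Yne]])
  define \<psi> :: "(real \<Rightarrow> 'x) \<Rightarrow> ennreal" where "\<psi> f = indicator H' (\<lambda>u\<in>{0..T}. Jr (f u))" for f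
  have \<psi>: "\<psi> \<in> borel_measurable (PE 0)" unfolding \<psi>_def[abs_def]
    by (rule measurable_compose[OF jfm]) (use H' in simp)
  define g where "g y = (\<integral>\<^sup>+f. indicator (stay 0 T) f * \<psi> f \<partial>MF.future_law 0 y)" for y
  have gm: "g \<in> borel_measurable (borel_of E)"
    unfolding g_def using stay(1)[OF T0] \<psi>
    by (intro measurable_compose[OF MF.measurable_future_law[OF T0 Ene] nn_integral_measurable_subprob_algebra]) simp
  have "emeasure (radial_law x) H = g (J x)" if x: "x \<in> Xo" for x
  proof -
    have "emeasure (radial_law x) H = (\<integral>\<^sup>+v. indicator H v \<partial>radial_law x)" using H by simp
    also have "\<dots> = (\<integral>\<^sup>+w. indicator H (rad w) \<partial>Px x)"
      using H by (intro nn_integral_distr[OF measurable_rad_Px]) simp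
    also have "\<dots> = (\<integral>\<^sup>+w. 1 * \<psi> (recenter \<one>\<^bsub>K\<^esub> 0 w) \<partial>Px x)"
    proof (rule nn_integral_cong)
      fix w assume "w \<in> space (Px x)"
      then have w: "w \<in> D" by simp
      have "(\<lambda>u\<in>{0..T}. Jr (recenter \<one>\<^bsub>K\<^esub> 0 w u)) = rad w"
        unfolding path_map_def using recenter_parts(1)[OF w order_refl T0 one] by (intro restrict_ext)
      moreover have "rad w \<in> rcll_paths T YT" by (rule path_map_in_rcll_paths[OF continuous_J_J2(1) w])
      ultimately show "indicator H (rad w) = 1 * \<psi> (recenter \<one>\<^bsub>K\<^esub> 0 w)" by (simp add: \<psi>_def H'(2) indicator_def)
    qed
    also have "\<dots> = (\<integral>\<^sup>+a. 1 * g (Jr (a 0)) \<partial>past_law x 0)"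
      unfolding g_def by (rule markov_recenter[OF x order_refl T0 one _ \<psi>]) simp
    also have "\<dots> = g (J x)" using nn_integral_past_law_0[OF x gm] by simp
    finally show ?thesis .
  qed
  from this[OF x] this[of "J x"] show "emeasure (radial_law x) H = emeasure (radial_law (J x)) H"
    using J_in[OF x] Yo_Xo J_Yo[OF J_in[OF x]] by auto
qed simp

lemma radial_restrict: "w \<in> D \<Longrightarrow> 0 \<le> s \<Longrightarrow> restrict (rad w) {s..T} = radial_future s w"
  by (auto simp: path_map_def radial_future_def restrict_def fun_eq_iff)

end

locale radial_conditioning = radial_decomposition K L M Q S X \<alpha> Y m P N p \<xi> T Yo Xo J J2 XT YT \<zeta> Px
  for K :: "('k, 'b) monoid_scheme" and L M Q S and X :: "'x manifold" and \<alpha> Y m P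
    and N :: "'x \<Rightarrow> 'w measure" and p \<xi> T Yo Xo J J2 XT YT \<zeta> Px +
  fixes R :: "'k set \<Rightarrow> (real \<Rightarrow> 'x) \<Rightarrow> (real \<Rightarrow> 'k set) measure"
  assumes conditional: "angular_conditional_distribution T XT YT (top_of Q) J J2 Px R"
begin

lemma measurable_R: "z \<in> C \<Longrightarrow> R z \<in> path_borel T YT \<rightarrow>\<^sub>M prob_algebra (path_borel T TQ)"
proof -
  assume z: "z \<in> C"
  have "(\<lambda>v. (v, z)) \<in> path_borel T YT \<rightarrow>\<^sub>M path_borel T YT \<Otimes>\<^sub>M borel_of TQ" using z by (intro measurable_Pair2') simp
  moreover have "(\<lambda>(v, z). R z v) \<in> path_borel T YT \<Otimes>\<^sub>M borel_of TQ \<rightarrow>\<^sub>M prob_algebra (path_borel T TQ)"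
    using conditional unfolding angular_conditional_distribution_def by (rule conjunct1)
  ultimately have "(\<lambda>v. (\<lambda>(v, z). R z v) (v, z)) \<in> path_borel T YT \<rightarrow>\<^sub>M prob_algebra (path_borel T TQ)"
    by (rule measurable_compose)
  then show ?thesis by simp
qed

lemma prob_R: "z \<in> C \<Longrightarrow> v \<in> rcll_paths T YT \<Longrightarrow> prob_space (R z v)"
  and sets_R: "z \<in> C \<Longrightarrow> v \<in> rcll_paths T YT \<Longrightarrow> sets (R z v) = sets (path_borel T TQ)"
  using measurable_space[OF measurable_R, of z v] path_space.space_path_borel[OF path_spaces(2)]
  by (auto simp: space_prob_algebra)

lemma measurable_R_emeasure:
  "z \<in> C \<Longrightarrow> F \<in> sets (path_borel T TQ) \<Longrightarrow> (\<lambda>v. emeasure (R z v) F) \<in> borel_measurable (path_borel T YT)"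
  by (rule measurable_compose[OF measurable_prob_algebraD[OF measurable_R] measurable_emeasure_subprob_algebra])

text \<open>The property defining \<open>R\<close> is integrated over an event of the radial path.
  Values of \<open>R\<close> lie between 0 and 1 and the law is finite, so real and nonnegative
  integrals can be exchanged.\<close>

lemma conditional_rectangle:
  assumes x: "x \<in> Xo" and H: "H \<in> sets (path_borel T YT)" and F: "F \<in> sets (path_borel T TQ)"
  shows "(\<integral>\<^sup>+w. indicator H (rad w) * emeasure (R (J2 x) (rad w)) F \<partial>Px x) = (\<integral>\<^sup>+w. indicator H (rad w) * indicator F (ang w) \<partial>Px x)"
proof -
  have xE: "x \<in> topspace E" using x Xo_E by auto
  let ?z = "J2 x"
  have z: "?z \<in> C" using J2_in[OF x] .
  interpret P: finite_measure "Px x" by (rule finite_Px[OF xE])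
  define V where "V = vimage_algebra D rad (coordinate_algebra T YT)"
  have sY: "sets (path_borel T YT) = sets (coordinate_algebra T YT)" by (rule path_space.sets_path_borel[OF path_spaces(2)])
  have spY: "space (coordinate_algebra T YT) = rcll_paths T YT" by (rule path_space.space_coordinate_algebra[OF path_spaces(2)])
  have radD: "rad w \<in> rcll_paths T YT" if "w \<in> D" for w by (rule path_map_in_rcll_paths[OF continuous_J_J2(1) that])
  \<comment> \<open>Because coordinate and Skorohod Borel sets coincide, the conditioning
    sigma-algebra consists exactly of the preimages of Borel sets under \<open>rad\<close>.\<close>
  have V: "sets V = {rad -` U \<inter> D | U. U \<in> sets (path_borel T YT)}"
    unfolding V_def sY by (rule sets_vimage_algebra2) (use radD spY in auto)
  have "subalgebra (Px x) V"
    unfolding subalgebra_def using V measurable_sets[OF measurable_rad_Px[of x]] by (auto simp: V_def)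
  then interpret S: finite_measure_subalgebra "Px x" V by unfold_locales
  define f :: "(real \<Rightarrow> 'x) \<Rightarrow> real" where "f = indicator {w \<in> D. ang w \<in> F}"
  have fF: "f w = indicator F (ang w)" if "w \<in> D" for w using that by (simp add: f_def indicator_def)
  have "{w \<in> D. ang w \<in> F} = ang -` F \<inter> space (Px x)" by auto
  then have W: "{w \<in> D. ang w \<in> F} \<in> sets (Px x)" using measurable_sets[OF measurable_ang_Px F] by metis
  then have fi: "integrable (Px x) f" unfolding f_def by (simp add: P.emeasure_finite less_top[symmetric])
  define A where "A = rad -` H \<inter> D"
  have AV: "A \<in> sets V" unfolding V A_def using H by blast
  have AP: "A \<in> sets (Px x)" unfolding A_def using measurable_sets[OF measurable_rad_Px H] by simp
  have AH: "indicator A w = indicator H (rad w)" if "w \<in> D" for w using that by (simp add: A_def indicator_def)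
  have mm: "(\<lambda>w. emeasure (R ?z (rad w)) F) \<in> borel_measurable (Px x)"
    by (rule measurable_compose[OF measurable_rad_Px measurable_R_emeasure[OF z F]])
  then have mm': "(\<lambda>w. measure (R ?z (rad w)) F) \<in> borel_measurable (Px x)" unfolding measure_def by simp
  have pb: "measure (R ?z (rad w)) F \<le> 1" "emeasure (R ?z (rad w)) F = ennreal (measure (R ?z (rad w)) F)" if "w \<in> D" for w
    using prob_R[OF z radD[OF that]] by (auto simp: prob_space.prob_le_1 finite_measure.emeasure_eq_measure prob_space.finite_measure)
  have ce: "AE w in Px x. measure (R ?z (rad w)) F = real_cond_exp (Px x) V f w"
    using conditional x F unfolding angular_conditional_distribution_def V_def f_def by simp
  have gi: "integrable (Px x) (\<lambda>w. indicator A w * measure (R ?z (rad w)) F)"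
    using pb(1) AP mm' by (intro P.integrable_const_bound[where B=1] AE_I2) (auto split: split_indicator)
  have hi: "integrable (Px x) (\<lambda>w. indicator A w * f w)"
    using integrable_real_mult_indicator[OF AP fi] by (simp add: mult.commute)
  have "(\<integral>w. indicator A w * f w \<partial>Px x) = (\<integral>w. indicator A w * real_cond_exp (Px x) V f w \<partial>Px x)"
    using S.real_cond_exp_intA[OF fi AV] by (simp add: set_lebesgue_integral_def)
  also have "\<dots> = (\<integral>w. indicator A w * measure (R ?z (rad w)) F \<partial>Px x)"
    using ce AP mm' by (intro integral_cong_AE) (auto intro: measurable_from_subalg[OF S.subalg] borel_measurable_cond_exp)
  finally have eq: "(\<integral>w. indicator A w * f w \<partial>Px x) = (\<integral>w. indicator A w * measure (R ?z (rad w)) F \<partial>Px x)" .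
  have "(\<integral>\<^sup>+w. indicator H (rad w) * emeasure (R ?z (rad w)) F \<partial>Px x) = (\<integral>\<^sup>+w. ennreal (indicator A w * measure (R ?z (rad w)) F) \<partial>Px x)"
    using pb(2) AH by (intro nn_integral_cong) (auto simp: A_def split: split_indicator)
  also have "\<dots> = ennreal (\<integral>w. indicator A w * f w \<partial>Px x)" unfolding eq by (rule nn_integral_eq_integral[OF gi]) simp
  also have "\<dots> = (\<integral>\<^sup>+w. ennreal (indicator A w * f w) \<partial>Px x)"
    by (rule nn_integral_eq_integral[OF hi, symmetric]) (simp add: f_def)
  also have "\<dots> = (\<integral>\<^sup>+w. indicator H (rad w) * indicator F (ang w) \<partial>Px x)"
    using fF by (intro nn_integral_cong) (auto simp: A_def f_def split: split_indicator)
  finally show ?thesis .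
qed

text \<open>For a fixed angular event both sides are integrals of \<open>g\<close> against measures
  on radial paths; these agree on every Borel set, hence for every nonnegative
  \<open>g\<close>.\<close>

lemma disintegration:
  assumes x: "x \<in> Xo" and g: "g \<in> borel_measurable (path_borel T YT)" and F: "F \<in> sets (path_borel T TQ)"
  shows "(\<integral>\<^sup>+v. g v * emeasure (R (J2 x) v) F \<partial>radial_law x) = (\<integral>\<^sup>+w. g (rad w) * indicator F (ang w) \<partial>Px x)"
proof -
  let ?z = "J2 x"
  have z: "?z \<in> C" using J2_in[OF x] .
  note mR = measurable_R_emeasure[OF z F]
  have mR': "(\<lambda>v. emeasure (R ?z v) F) \<in> borel_measurable (radial_law x)" using mR by simp
  have mF: "(\<lambda>w. indicator F (ang w) :: ennreal) \<in> borel_measurable (Px x)"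
    by (rule measurable_compose[OF measurable_ang_Px]) (use F in simp)
  have mr: "rad \<in> density (Px x) (\<lambda>w. indicator F (ang w)) \<rightarrow>\<^sub>M path_borel T YT" using measurable_rad_Px by simp
  have "density (radial_law x) (\<lambda>v. emeasure (R ?z v) F) = distr (density (Px x) (\<lambda>w. indicator F (ang w))) (path_borel T YT) rad"
    (is "?\<mu> = ?\<nu>")
  proof (rule measure_eqI)
    fix H assume "H \<in> sets ?\<mu>"
    then have H: "H \<in> sets (path_borel T YT)" by simp
    have "emeasure ?\<mu> H = (\<integral>\<^sup>+v. emeasure (R ?z v) F * indicator H v \<partial>radial_law x)"
      by (rule emeasure_density[OF mR']) (use H in simp)
    also have "\<dots> = (\<integral>\<^sup>+w. emeasure (R ?z (rad w)) F * indicator H (rad w) \<partial>Px x)"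
      using mR H by (intro nn_integral_distr[OF measurable_rad_Px]) simp
    also have "\<dots> = (\<integral>\<^sup>+w. indicator H (rad w) * indicator F (ang w) \<partial>Px x)"
      using conditional_rectangle[OF x H F] by (simp add: mult.commute)
    also have "\<dots> = (\<integral>\<^sup>+w. indicator F (ang w) * indicator (rad -` H \<inter> space (Px x)) w \<partial>Px x)"
      by (rule nn_integral_cong) (auto split: split_indicator)
    also have "\<dots> = emeasure (density (Px x) (\<lambda>w. indicator F (ang w))) (rad -` H \<inter> space (Px x))"
      by (rule emeasure_density[OF mF measurable_sets[OF measurable_rad_Px H], symmetric])
    also have "\<dots> = emeasure ?\<nu> H" using emeasure_distr[OF mr H] by simp
    finally show "emeasure ?\<mu> H = emeasure ?\<nu> H" .
  qed simp
  then have eq: "(\<integral>\<^sup>+v. g v \<partial>?\<mu>) = (\<integral>\<^sup>+v. g v \<partial>?\<nu>)" by (rule arg_cong[where f="\<lambda>\<mu>. nn_integral \<mu> g"])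
  have "(\<integral>\<^sup>+v. g v \<partial>?\<mu>) = (\<integral>\<^sup>+v. emeasure (R ?z v) F * g v \<partial>radial_law x)"
    by (rule nn_integral_density[OF mR']) (use g in simp)
  moreover have "(\<integral>\<^sup>+v. g v \<partial>?\<nu>) = (\<integral>\<^sup>+w. g (rad w) \<partial>density (Px x) (\<lambda>w. indicator F (ang w)))"
    by (rule nn_integral_distr[OF mr]) (use g in simp)
  moreover have "\<dots> = (\<integral>\<^sup>+w. indicator F (ang w) * g (rad w) \<partial>Px x)"
    by (rule nn_integral_density[OF mF measurable_compose[OF measurable_rad_Px g]])
  ultimately show ?thesis using eq by (simp add: mult.commute)
qed

end

section \<open>Increments under the conditional laws\<close>

context radial_conditioning
begin

text \<open>Both sides are compared as densities with respect to the law of the radial path, on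
  rectangles of a radial past and a radial future. The radial past joins the angular past
  \<open>A\<close> in one event of the full past, and the increment contributes a factor depending
  on the radial future. The factor does not depend on \<open>h\<close> and \<open>A\<close>; only
  the null set does.\<close>

lemma AE_conditional_increment:
  assumes x: "x \<in> Xo" and st: "0 \<le> s" "s < t" "t \<le> T" and B: "B \<in> sets (borel_of TQ)"
  shows "\<exists>b. \<forall>h\<in>M. \<forall>A\<in>sets (PiM {0..s} (\<lambda>_. borel_of TQ)). AE v in radial_law x.
      emeasure (R (J2 x) v) {\<omega> \<in> rcll_paths T TQ. restrict \<omega> {0..s} \<in> A \<and> h \<rhd> (ginv (S (\<omega> s)) \<rhd> \<omega> t) \<in> B}
      = emeasure (R (J2 x) v) {\<omega> \<in> rcll_paths T TQ. restrict \<omega> {0..s} \<in> A} * b v"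
proof -
  have xE: "x \<in> topspace E" using x Xo_E by auto
  have sT: "s \<le> T" "s \<in> {0..T}" "t \<in> {0..T}" using st by auto
  have z: "J2 x \<in> C" using J2_in[OF x] .
  have Yne: "Yo \<noteq> {}" using J_in[OF x] by auto
  interpret P: finite_measure "Px x" by (rule finite_Px[OF xE])
  interpret JP: finite_measure "radial_law x" by (rule P.finite_measure_distr[OF measurable_rad_Px])
  interpret pY: path_space T YT by (rule path_spaces(2))
  interpret pQ: path_space T TQ by (rule path_spaces(3))
  let ?PQ = "PiM {0..s} (\<lambda>_. borel_of TQ)" and ?PYs = "PiM {0..s} (\<lambda>_. borel_of YT)"
  obtain b0 where b0: "b0 \<in> borel_measurable (PY s)"
    and eq0: "\<And>h A C. h \<in> M \<Longrightarrow> A \<in> sets (PP s) \<Longrightarrow> C \<in> sets (PY s) \<Longrightarrow>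
      emeasure (Px x) {w \<in> D. restrict w {0..s} \<in> A \<and> radial_future s w \<in> C \<and> h \<rhd> angle_increment s t w \<in> B}
      = (\<integral>\<^sup>+w. indicator A (restrict w {0..s}) * (indicator C (radial_future s w) * b0 (radial_future s w)) \<partial>Px x)"
    by (rule conditional_increment[OF x st B]) (rule that; assumption)
  \<comment> \<open>The conditional probability depends on the radial path through its part from
    \<open>s\<close> on.\<close>
  define b where "b v = b0 (restrict v {s..T})" for v
  have bm: "b \<in> borel_measurable (path_borel T YT)"
    unfolding b_def by (rule measurable_compose[OF pY.measurable_restrict_path b0]) (use st in auto)
  have restr: "(\<lambda>\<omega>. restrict \<omega> {0..s}) \<in> path_borel T TQ \<rightarrow>\<^sub>M ?PQ" using sT by (intro pQ.measurable_restrict_path) auto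
  have "AE v in radial_law x. emeasure (R (J2 x) v) {\<omega> \<in> rcll_paths T TQ. restrict \<omega> {0..s} \<in> A \<and> h \<rhd> (ginv (S (\<omega> s)) \<rhd> \<omega> t) \<in> B}
      = emeasure (R (J2 x) v) {\<omega> \<in> rcll_paths T TQ. restrict \<omega> {0..s} \<in> A} * b v"
    if h: "h \<in> M" and A: "A \<in> sets ?PQ" for h A
  proof -
    define F0 F1 where "F0 = {\<omega> \<in> rcll_paths T TQ. restrict \<omega> {0..s} \<in> A}"
      and "F1 = {\<omega> \<in> rcll_paths T TQ. restrict \<omega> {0..s} \<in> A \<and> h \<rhd> (ginv (S (\<omega> s)) \<rhd> \<omega> t) \<in> B}"
    have hm: "(\<lambda>_. h) \<in> path_borel T TQ \<rightarrow>\<^sub>M borel_of TL" using h M_sub by auto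
    have im: "(\<lambda>\<omega>. h \<rhd> (ginv (S (\<omega> s)) \<rhd> \<omega> t)) \<in> path_borel T TQ \<rightarrow>\<^sub>M borel_of TQ"
      by (intro measurable_act hm measurable_inv_TL measurable_compose[OF pQ.measurable_evaluation measurable_S] pQ.measurable_evaluation sT)
    have F0_eq: "F0 = (\<lambda>\<omega>. restrict \<omega> {0..s}) -` A \<inter> space (path_borel T TQ)" by (auto simp: F0_def)
    then have F0: "F0 \<in> sets (path_borel T TQ)" by (simp only: measurable_sets[OF restr A])
    have "F1 = F0 \<inter> ((\<lambda>\<omega>. h \<rhd> (ginv (S (\<omega> s)) \<rhd> \<omega> t)) -` B \<inter> space (path_borel T TQ))" by (auto simp: F0_def F1_def)
    then have F1: "F1 \<in> sets (path_borel T TQ)" by (simp only: sets.Int[OF F0 measurable_sets[OF im B]])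
    let ?f0 = "\<lambda>v. emeasure (R (J2 x) v) F0" and ?f1 = "\<lambda>v. emeasure (R (J2 x) v) F1"
    have f1m: "?f1 \<in> borel_measurable (radial_law x)" using measurable_R_emeasure[OF z F1] by simp
    have f2m: "(\<lambda>v. ?f0 v * b v) \<in> borel_measurable (radial_law x)" using measurable_R_emeasure[OF z F0] bm by simp
    define \<G> where "\<G> = {{v \<in> rcll_paths T YT. restrict v {0..s} \<in> A \<and> restrict v {s..T} \<in> C} | A C. A \<in> sets ?PYs \<and> C \<in> sets (PY s)}"
    note \<G> = pY.sets_path_borel_past_future[OF sT(2), folded \<G>_def]
    have gen: "emeasure (density (radial_law x) ?f1) H = emeasure (density (radial_law x) (\<lambda>v. ?f0 v * b v)) H" if H: "H \<in> \<G>" for H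
    proof -
      have Hs: "H \<in> sets (path_borel T YT)" using H \<G>(3) by auto
      obtain A' C' where AC: "A' \<in> sets ?PYs" "C' \<in> sets (PY s)"
        "H = {v \<in> rcll_paths T YT. restrict v {0..s} \<in> A' \<and> restrict v {s..T} \<in> C'}" using H unfolding \<G>_def by blast
      have jm: "(\<lambda>a. \<lambda>u\<in>{0..s}. Jr (a u)) \<in> PP s \<rightarrow>\<^sub>M ?PYs"
        by (rule measurable_restrict) (auto intro!: measurable_compose[OF measurable_component_singleton[where M="\<lambda>_. borel_of E"] measurable_Jr[OF Yne]])
      have j2m: "(\<lambda>a. \<lambda>u\<in>{0..s}. J2r (a u)) \<in> PP s \<rightarrow>\<^sub>M ?PQ"
        by (rule measurable_restrict) (auto intro!: measurable_compose[OF measurable_component_singleton[where M="\<lambda>_. borel_of E"] measurable_J2r])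
      \<comment> \<open>The conditions on the radial and on the angular past, combined to one event
        of the past of the full path.\<close>
      define A2 where "A2 = ((\<lambda>a. \<lambda>u\<in>{0..s}. Jr (a u)) -` A' \<inter> space (PP s)) \<inter> ((\<lambda>a. \<lambda>u\<in>{0..s}. J2r (a u)) -` A \<inter> space (PP s))"
      have A2: "A2 \<in> sets (PP s)" unfolding A2_def by (simp only: sets.Int[OF measurable_sets[OF jm AC(1)] measurable_sets[OF j2m A]])
      have w_eq: "restrict w {0..s} \<in> A2 \<longleftrightarrow> restrict (rad w) {0..s} \<in> A' \<and> restrict (ang w) {0..s} \<in> A"
        "rad w \<in> rcll_paths T YT" "ang w \<in> rcll_paths T TQ" "restrict (rad w) {s..T} = radial_future s w"
        "ginv (S (ang w s)) \<rhd> ang w t = angle_increment s t w" if w: "w \<in> D" for w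
      proof -
        have X: "w u \<in> Xo" if "u \<in> {0..s}" for u using path_in_Xo[OF w, of u] that st by auto
        have "restrict w {0..s} \<in> space (PP s)" using measurable_space[OF measurable_path_past[OF sT(1)], of w] w path_space.space_path_borel[OF path_spaces(1)] by simp
        moreover have "(\<lambda>u\<in>{0..s}. Jr (restrict w {0..s} u)) = restrict (rad w) {0..s}"
          using X st by (auto simp: path_map_def Jr_def restrict_def fun_eq_iff)
        moreover have "(\<lambda>u\<in>{0..s}. J2r (restrict w {0..s} u)) = restrict (ang w) {0..s}"
          using X st by (auto simp: path_map_def J2r_def restrict_def fun_eq_iff)
        ultimately show "restrict w {0..s} \<in> A2 \<longleftrightarrow> restrict (rad w) {0..s} \<in> A' \<and> restrict (ang w) {0..s} \<in> A"
          by (simp add: A2_def)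
        show "rad w \<in> rcll_paths T YT" by (rule path_map_in_rcll_paths[OF continuous_J_J2(1) w])
        show "ang w \<in> rcll_paths T TQ" by (rule path_map_in_rcll_paths[OF continuous_J_J2(2) w])
        show "restrict (rad w) {s..T} = radial_future s w" by (rule radial_restrict[OF w st(1)])
        show "ginv (S (ang w s)) \<rhd> ang w t = angle_increment s t w" using sT by (simp add: path_map_def angle_increment_def)
      qed
      define V where "V = {w \<in> D. restrict w {0..s} \<in> A2 \<and> radial_future s w \<in> C' \<and> h \<rhd> angle_increment s t w \<in> B}"
      have "V = (rad -` H \<inter> space (Px x)) \<inter> (ang -` F1 \<inter> space (Px x))"
        using w_eq by (auto simp: V_def AC(3) F1_def)
      then have V: "V \<in> sets (Px x)"
        by (simp only: sets.Int[OF measurable_sets[OF measurable_rad_Px Hs] measurable_sets[OF measurable_ang_Px F1]])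
      have "emeasure (density (radial_law x) ?f1) H = (\<integral>\<^sup>+v. ?f1 v * indicator H v \<partial>radial_law x)"
        by (rule emeasure_density[OF f1m]) (use Hs in simp)
      also have "\<dots> = (\<integral>\<^sup>+v. indicator H v * ?f1 v \<partial>radial_law x)" by (simp add: mult.commute)
      also have "\<dots> = (\<integral>\<^sup>+w. indicator H (rad w) * indicator F1 (ang w) \<partial>Px x)"
        by (rule disintegration[OF x _ F1]) (use Hs in simp)
      also have "\<dots> = (\<integral>\<^sup>+w. indicator V w \<partial>Px x)"
        using w_eq by (intro nn_integral_cong) (auto simp: V_def AC(3) F1_def split: split_indicator)
      also have "\<dots> = emeasure (Px x) V" using V by simp
      also have "\<dots> = (\<integral>\<^sup>+w. indicator A2 (restrict w {0..s}) * (indicator C' (radial_future s w) * b0 (radial_future s w)) \<partial>Px x)"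
        unfolding V_def by (rule eq0[OF h A2 AC(2)])
      also have "\<dots> = (\<integral>\<^sup>+w. (indicator H (rad w) * b (rad w)) * indicator F0 (ang w) \<partial>Px x)"
        using w_eq by (intro nn_integral_cong) (auto simp: AC(3) F0_def b_def split: split_indicator)
      also have "\<dots> = (\<integral>\<^sup>+v. (indicator H v * b v) * ?f0 v \<partial>radial_law x)"
        by (rule disintegration[OF x _ F0, symmetric]) (use Hs bm in simp)
      also have "\<dots> = (\<integral>\<^sup>+v. (?f0 v * b v) * indicator H v \<partial>radial_law x)"
        by (rule nn_integral_cong) (simp add: mult_ac)
      also have "\<dots> = emeasure (density (radial_law x) (\<lambda>v. ?f0 v * b v)) H"
        by (rule emeasure_density[OF f2m, symmetric]) (use Hs in simp)
      finally show ?thesis .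
    qed
    have "density (radial_law x) ?f1 = density (radial_law x) (\<lambda>v. ?f0 v * b v)"
    proof (rule measure_eqI_generator_eq[OF \<G>(2), where A="\<lambda>_. rcll_paths T YT"])
      show "\<G> \<subseteq> Pow (rcll_paths T YT)" by (auto simp: \<G>_def)
      have "emeasure (density (radial_law x) ?f1) (rcll_paths T YT) = (\<integral>\<^sup>+v. ?f1 v * indicator (rcll_paths T YT) v \<partial>radial_law x)"
        by (rule emeasure_density[OF f1m]) (use \<G>(3,4) in auto)
      also have "\<dots> \<le> (\<integral>\<^sup>+v. 1 \<partial>radial_law x)"
        using prob_R[OF z] by (intro nn_integral_mono) (auto split: split_indicator intro!: prob_space.emeasure_le_1)
      also have "\<dots> < \<top>" by (simp add: less_top[symmetric] JP.emeasure_finite[unfolded infinity_ennreal_def])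
      finally show "emeasure (density (radial_law x) ?f1) (rcll_paths T YT) \<noteq> \<infinity>" by simp
    qed (use gen \<G> in auto)
    then have "AE v in radial_law x. ?f1 v = ?f0 v * b v" by (rule JP.density_unique[OF f1m f2m])
    then show ?thesis unfolding F0_def F1_def .
  qed
  then show ?thesis by blast
qed

text \<open>Times, sets of positions, elements of \<open>M\<close> and past events are all taken
  from countable families. Outside one null set every identity holds at once, and a single
  conditional law then satisfies the hypotheses for increments at the times in
  \<open>Dn\<close>.\<close>

lemma AE_levy:
  assumes x: "x \<in> Xo"
  shows "AE v in radial_law x. nonhomogeneous_levy_process K M S TQ T (R (J2 x) v) (\<lambda>t \<omega>. \<omega> t)"
proof -
  let ?z = "J2 x"
  have z: "?z \<in> C" using J2_in[OF x] .
  interpret pQ: path_space T TQ by (rule path_spaces(3))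
  let ?DQ = "rcll_paths T TQ"
  define Dn where "Dn = ({0..T} \<inter> \<rat>) \<union> {T}"
  have Dn: "countable Dn" "Dn \<subseteq> {0..T}" "T \<in> Dn" unfolding Dn_def using countable_rational_times T_pos by auto
  have Dn3: "\<exists>q\<in>Dn. s < q \<and> q < t" if st: "0 \<le> s" "s < t" "t \<le> T" for s t
  proof -
    obtain q where "q \<in> \<rat>" "s < q" "q < t" using Rats_dense_in_real[OF st(2)] by blast
    then show ?thesis using st by (intro bexI[of _ q]) (auto simp: Dn_def)
  qed
  obtain \<B> where \<B>: "countable \<B>" "\<B> \<subseteq> Pow C" "Int_stable \<B>" "C \<in> \<B>" "sets (borel_of TQ) = sigma_sets C \<B>"
    by (rule borel_of_countable_generator[OF TQ_second_countable, unfolded topspace_TQ]) (rule that; assumption)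
  have \<B>s: "B \<in> sets (borel_of TQ)" if "B \<in> \<B>" for B using that \<B>(5) by auto
  obtain D1 where D1: "countable D1" "D1 \<subseteq> topspace (subtopology TL M)"
    "\<And>h. h \<in> topspace (subtopology TL M) \<Longrightarrow> \<exists>\<sigma>::nat \<Rightarrow> 'k. range \<sigma> \<subseteq> D1 \<and> limitin (subtopology TL M) \<sigma> h sequentially"
    by (rule countable_dense_sequences[OF metrizable_space_subtopology[OF TL_metrizable] second_countable_subtopology[OF TL_second_countable]])
      (rule that; assumption)
  \<comment> \<open>A countable dense subset of \<open>M\<close> in its own topology, with the unit
    added because every \<open>h\<close> is compared with it.\<close>
  define D0 where "D0 = insert \<one>\<^bsub>K\<^esub> D1"
  have one: "\<one>\<^bsub>K\<^esub> \<in> M" using M_subgroup by (rule subgroup.one_closed)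
  have D0: "countable D0" "D0 \<subseteq> M" "\<one>\<^bsub>K\<^esub> \<in> D0" using D1(1,2) one by (auto simp: D0_def)
  have dense: "\<exists>\<sigma>::nat \<Rightarrow> 'k. range \<sigma> \<subseteq> D0 \<and> limitin TL \<sigma> h sequentially" if h: "h \<in> M" for h
  proof -
    have "h \<in> topspace (subtopology TL M)" using h M_sub by auto
    from D1(3)[OF this] obtain \<sigma> :: "nat \<Rightarrow> 'k" where "range \<sigma> \<subseteq> D1" "limitin (subtopology TL M) \<sigma> h sequentially" by (elim exE conjE)
    then show ?thesis by (intro exI[of _ \<sigma>]) (auto simp: D0_def limitin_subtopology)
  qed
  \<comment> \<open>Basic cylinder events at rational times up to \<open>s\<close>. The pi-system
    \<open>\<G> s\<close> generated from them is again countable.\<close>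
  define \<A> where "\<A> s = (\<lambda>(u, B). {\<omega> \<in> ?DQ. \<omega> u \<in> B}) ` ((Dn \<inter> {..s}) \<times> \<B>)" for s
  have "\<exists>\<G>. countable \<G> \<and> \<G> \<subseteq> Pow ?DQ \<and> Int_stable \<G> \<and> ?DQ \<in> \<G> \<and> sigma_sets ?DQ \<G> = sigma_sets ?DQ (\<A> s) \<and> \<G> \<subseteq> sigma_sets ?DQ (\<A> s)" for s
  proof -
    have "countable (\<A> s)" unfolding \<A>_def using Dn(1) \<B>(1) by auto
    moreover have "\<A> s \<subseteq> Pow ?DQ" by (auto simp: \<A>_def)
    ultimately show ?thesis by (rule countable_Int_stable_generator) blast
  qed
  then obtain \<G> where \<G>: "\<And>s. countable (\<G> s)" "\<And>s. \<G> s \<subseteq> Pow ?DQ" "\<And>s. Int_stable (\<G> s)" "\<And>s. ?DQ \<in> \<G> s"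
    "\<And>s. sigma_sets ?DQ (\<G> s) = sigma_sets ?DQ (\<A> s)" "\<And>s. \<G> s \<subseteq> sigma_sets ?DQ (\<A> s)" by metis
  \<comment> \<open>Writes a generator of the dense past as an event of the path restricted to
    \<open>[0, s]\<close>, the form in which the conditional identity is available.\<close>
  have past: "\<exists>A\<in>sets (PiM {0..s} (\<lambda>_. borel_of TQ)). G = {\<omega> \<in> ?DQ. restrict \<omega> {0..s} \<in> A}"
    if G: "G \<in> \<G> s" and s: "s \<in> Dn" for G s
  proof -
    let ?P = "PiM {0..s} (\<lambda>_. borel_of TQ)"
    let ?V = "vimage_algebra ?DQ (\<lambda>\<omega>. restrict \<omega> {0..s}) ?P"
    have m: "(\<lambda>\<omega>. restrict \<omega> {0..s}) \<in> path_borel T TQ \<rightarrow>\<^sub>M ?P" using Dn(2) s by (intro pQ.measurable_restrict_path) auto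
    then have sp: "(\<lambda>\<omega>. restrict \<omega> {0..s}) \<in> ?DQ \<rightarrow> space ?P" by (auto simp only: measurable_def pQ.space_path_borel)
    have V: "sets ?V = {(\<lambda>\<omega>. restrict \<omega> {0..s}) -` A \<inter> ?DQ | A. A \<in> sets ?P}" by (rule sets_vimage_algebra2[OF sp])
    have "\<A> s \<subseteq> sets ?V"
    proof
      fix U assume "U \<in> \<A> s"
      then obtain u B where uB: "u \<in> Dn" "u \<le> s" "B \<in> \<B>" "U = {\<omega> \<in> ?DQ. \<omega> u \<in> B}" by (auto simp: \<A>_def)
      then have u: "u \<in> {0..s}" using Dn(2) by auto
      have "(\<lambda>f. f u) -` B \<inter> space ?P \<in> sets ?P"
        using measurable_sets[OF measurable_component_singleton[where M="\<lambda>_. borel_of TQ", OF u] \<B>s[OF uB(3)]] .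
      moreover have "U = (\<lambda>\<omega>. restrict \<omega> {0..s}) -` ((\<lambda>f. f u) -` B \<inter> space ?P) \<inter> ?DQ" using uB(4) u sp by auto
      ultimately show "U \<in> sets ?V" unfolding V by blast
    qed
    from sets.sigma_sets_subset[OF this] have "G \<in> sets ?V" using G \<G>(6) by auto
    then obtain A where "A \<in> sets ?P" "G = (\<lambda>\<omega>. restrict \<omega> {0..s}) -` A \<inter> ?DQ" unfolding V by blast
    then show ?thesis by (intro bexI[of _ A]) auto
  qed
  define Good where "Good s t B b \<longleftrightarrow> (\<forall>h\<in>M. \<forall>A\<in>sets (PiM {0..s} (\<lambda>_. borel_of TQ)). AE v in radial_law x.
      emeasure (R ?z v) {\<omega> \<in> ?DQ. restrict \<omega> {0..s} \<in> A \<and> h \<rhd> (ginv (S (\<omega> s)) \<rhd> \<omega> t) \<in> B}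
      = emeasure (R ?z v) {\<omega> \<in> ?DQ. restrict \<omega> {0..s} \<in> A} * b v)" for s t B and b :: "(real \<Rightarrow> 'x) \<Rightarrow> ennreal"
  \<comment> \<open>The factor is chosen before \<open>h\<close> and the past event are, which keeps
    it common to all of them.\<close>
  define b where "b s t B = (SOME b. Good s t B b)" for s t B
  have b: "Good s t B (b s t B)" if "s \<in> Dn" "t \<in> Dn" "s < t" "B \<in> \<B>" for s t B
  proof -
    have "0 \<le> s" "t \<le> T" using that(1,2) Dn(2) by auto
    then have "\<exists>b. Good s t B b" unfolding Good_def by (rule AE_conditional_increment[OF x _ that(3) _ \<B>s[OF that(4)]])
    then show ?thesis unfolding b_def by (rule someI_ex)
  qed
  have "AE v in radial_law x. \<forall>s\<in>Dn. \<forall>t\<in>Dn \<inter> {s<..}. \<forall>B\<in>\<B>. \<forall>h\<in>D0. \<forall>G\<in>\<G> s.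
      emeasure (R ?z v) {\<omega> \<in> G. h \<rhd> (ginv (S (\<omega> s)) \<rhd> \<omega> t) \<in> B} = emeasure (R ?z v) G * b s t B v"
  proof (intro AE_ball_countable[THEN iffD2] ballI)
    fix s t B h G assume a: "s \<in> Dn" "t \<in> Dn \<inter> {s<..}" "B \<in> \<B>" "h \<in> D0" "G \<in> \<G> s"
    obtain A where A: "A \<in> sets (PiM {0..s} (\<lambda>_. borel_of TQ))" "G = {\<omega> \<in> ?DQ. restrict \<omega> {0..s} \<in> A}"
      using past[OF a(5,1)] by (elim bexE)
    have e: "{\<omega> \<in> G. h \<rhd> (ginv (S (\<omega> s)) \<rhd> \<omega> t) \<in> B} = {\<omega> \<in> ?DQ. restrict \<omega> {0..s} \<in> A \<and> h \<rhd> (ginv (S (\<omega> s)) \<rhd> \<omega> t) \<in> B}"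
      unfolding A(2) by auto
    show "AE v in radial_law x. emeasure (R ?z v) {\<omega> \<in> G. h \<rhd> (ginv (S (\<omega> s)) \<rhd> \<omega> t) \<in> B} = emeasure (R ?z v) G * b s t B v"
      unfolding e unfolding A(2) using b[of s t B] a(1-4) D0(2) A(1) unfolding Good_def by auto
  qed (use Dn(1) \<B>(1) D0(1) \<G>(1) in auto)
  moreover have "AE v in radial_law x. v \<in> rcll_paths T YT" using path_space.space_path_borel[OF path_spaces(2)] by (intro AE_I2) simp
  ultimately show ?thesis
  proof eventually_elim
    \<comment> \<open>From here on \<open>v\<close> is fixed: \<open>R (J2 x) v\<close> is one
      probability measure on paths, and no further null sets arise.\<close>
    case (elim v)
    interpret H: homogeneous_path_measure K L M Q S T "R ?z v" Dn
      by (intro homogeneous_path_measure.intro homogeneous_space_axioms homogeneous_path_measure_axioms.intro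
          T_pos prob_R[OF z elim(2)] sets_R[OF z elim(2)] Dn(2,3) Dn3)
    have "homogeneous_independent_increments K L M Q S T (R ?z v) Dn"
    proof (rule H.independent_increments_of_generators[OF \<B>(3,2,4,5) _ _ _ _ dense D0(2,3), where \<G>=\<G> and b="\<lambda>s t B. b s t B v"])
      show "Int_stable (\<G> s)" "space (R ?z v) \<in> \<G> s" for s using \<G> H.space_N by auto
      have "\<A> s \<subseteq> sets (R ?z v)" if s: "s \<in> Dn" for s
      proof
        fix U assume "U \<in> \<A> s"
        then obtain u B where uB: "u \<in> Dn" "B \<in> \<B>" "U = {\<omega> \<in> ?DQ. \<omega> u \<in> B}" by (auto simp: \<A>_def)
        have "U = (\<lambda>\<omega>. \<omega> u) -` B \<inter> space (R ?z v)" using uB(3) H.space_N by auto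
        moreover have "u \<in> {0..T}" using uB(1) Dn(2) by auto
        ultimately show "U \<in> sets (R ?z v)" by (simp only: measurable_sets[OF H.measurable_ev \<B>s[OF uB(2)]])
      qed
      then show "\<G> s \<subseteq> sets (R ?z v)" if "s \<in> Dn" for s
        using sets.sigma_sets_subset[of "\<A> s" "R ?z v"] that \<G>(6)[of s] H.space_N by auto
      show "{\<omega> \<in> space (R ?z v). \<omega> u \<in> B} \<in> sigma_sets (space (R ?z v)) (\<G> s)" if "s \<in> Dn" "u \<in> Dn" "u \<le> s" "B \<in> \<B>" for s u B
        unfolding H.space_N \<G>(5) using that by (intro sigma_sets.Basic) (auto simp: \<A>_def)
      show "emeasure (R ?z v) {\<omega> \<in> A. h \<rhd> H.incr s t \<omega> \<in> B} = emeasure (R ?z v) A * b s t B v"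
        if "s \<in> Dn" "t \<in> Dn" "s < t" "A \<in> \<G> s" "B \<in> \<B>" "h \<in> D0" for s t A B h
        using elim(1) that unfolding H.incr_def by auto
    qed
    then show ?case by (rule homogeneous_independent_increments.levy)
  qed
qed

end

theorem theorem3:
  fixes K :: "('k, 'b) monoid_scheme" and L :: "'k manifold"
    and X :: "'x manifold" and \<alpha> :: "'k \<Rightarrow> 'x \<Rightarrow> 'x"
    and Y :: "'x set" and m :: nat
    and M :: "'k set" and Q :: "'k set manifold" and S :: "'k set \<Rightarrow> 'k"
    and P :: "real \<Rightarrow> 'x \<Rightarrow> 'x measure"
    and N :: "'x \<Rightarrow> 'w measure" and p :: "real \<Rightarrow> 'w \<Rightarrow> 'x" and \<xi> :: "'w \<Rightarrow> ereal"
    and T :: real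
    and R :: "'k set \<Rightarrow> (real \<Rightarrow> 'x) \<Rightarrow> (real \<Rightarrow> 'k set) measure"
  defines "Yo \<equiv> submanifold_interior X Y m"
  defines "Xo \<equiv> (\<Union>y\<in>Yo. orbit K \<alpha> y)"
  defines "J \<equiv> radial_part K \<alpha> Y"
  defines "J2 \<equiv> angular_part K \<alpha> Yo M S"
  defines "XT \<equiv> subtopology (top_of X) Xo"
  defines "YT \<equiv> subtopology (top_of X) Yo"
  defines "\<zeta> \<equiv> \<lambda>\<omega>. exit_time (top_of X) Xo (\<xi> \<omega>) (\<lambda>t. p t \<omega>)"
  defines "Px \<equiv> \<lambda>x. path_law T XT (N x) p \<zeta>"
  assumes "lie_group K L" and "smooth_manifold X" and "smooth_action K L X \<alpha>"
    and "submanifold_with_boundary X Y m" and "transversal K \<alpha> X Y"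
    and "openin (top_of X) Xo" and "top_of X closure_of Xo = topspace (top_of X)"
    and "subgroup M K" and "compactin (top_of L) M"
    and "\<And>y. y \<in> Yo \<Longrightarrow> stabilizer K \<alpha> y = M"
    and "homogeneous_manifold K L M Q" and "coset_section K L M Q S"
    and "diffeomorphism (prod_manifold (interior_manifold X Y m) Q) (open_submanifold X Xo)
           (\<lambda>(y, z). \<alpha> (S z) y)"
    and "transition_semigroup (top_of X) P" and "invariant_semigroup K \<alpha> (top_of X) P"
    and "\<And>x. x \<in> topspace (top_of X) \<Longrightarrow> markov_process (top_of X) P (N x) p \<xi>"
    and "\<And>x. x \<in> topspace (top_of X) \<Longrightarrow> AE \<omega> in N x. 0 < \<xi> \<omega> \<and> p 0 \<omega> = x"
    and "0 < T"
    and "angular_conditional_distribution T XT YT (top_of Q) J J2 Px R"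
  shows "\<forall>y\<in>Yo. \<forall>z\<in>lcosets\<^bsub>K\<^esub> M.
           AE v in distr (Px y) (path_borel T YT) (path_map T J).
             nonhomogeneous_levy_process K M S (top_of Q) T (R z v) (\<lambda>t w. w t)"
proof (intro ballI)
  interpret homogeneous_space K L M Q S by (rule homogeneous_space.intro) fact+
  interpret radial_conditioning K L M Q S X \<alpha> Y m P N p \<xi> T Yo Xo J J2 XT YT \<zeta> Px R
    by unfold_locales
      (fact assms(9-)[unfolded Px_def \<zeta>_def XT_def YT_def J2_def J_def Xo_def Yo_def]
        Yo_def Xo_def J_def J2_def XT_def YT_def \<zeta>_def Px_def)+
  fix y z assume y: "y \<in> Yo" and z: "z \<in> lcosets\<^bsub>K\<^esub> M"
  \<comment> \<open>A starting point in the orbit of \<open>y\<close> with angular part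
    \<open>z\<close>: the conditional laws attached to it are those of \<open>R z\<close>, and its
    radial law is that of \<open>y\<close>.\<close>
  have x: "\<alpha> (S z) y \<in> Xo" "J (\<alpha> (S z) y) = y" "J2 (\<alpha> (S z) y) = z"
    using y z Xo_I J_eq J2_eq by auto
  show "AE v in distr (Px y) (path_borel T YT) (path_map T J).
      nonhomogeneous_levy_process K M S (top_of Q) T (R z v) (\<lambda>t w. w t)"
    using AE_levy[OF x(1)] unfolding radial_law_eq[OF x(1)] x(2,3) .
qed

end
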